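(* Fix a compact semisimple quadratic Lie algebra $(\mathfrak g,[\cdot,\cdot]_{\mathfrak g},\langle\cdot,\cdot\rangle_{\mathfrak g})$ with $\langle\cdot,\cdot\rangle_{\mathfrak g}$ of neutral signature, and consider regular generalized complex structures on transitive Courant algebroids with quadratic Lie algebra bundle of fibre type $\mathfrak g$, near regular points, together with the parameters $(p,q,k,\mathcal D)$ of a normal form to which they are locally equivalent. Then $(q,k)$ together with the orbit $[\mathcal D]$ of $\mathcal D$ under the action of $\mathrm{Aut}(\mathfrak g)$ form a complete set of invariants for local equivalence: if $\mathcal J,\tilde{\mathcal J}$ are two such structures, near regular points $x,\tilde x$, with normal form parameters $(p,q,k,\mathcal D)$ and $(\tilde p,\tilde q,\tilde k,\tilde{\mathcal D})$, then $\mathcal J$ and $\tilde{\mathcal J}$ are equivalent on suitable neighbourhoods of $x$ and $\tilde x$ if and only if $q=\tilde q$, $k=\tilde k$ and $\tilde{\mathcal D}\in[\mathcal D]$. Moreover, the parameter $p=\dim M-2(q+k)$ ($M$ the base manifold) is redundant and coincides with $\dim_{\mathbb C}(\mathcal D\cap\bar{\mathcal D})$.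
   Context: Tensors are extended complex-linearly to complexifications without change of notation. $\mathrm{Aut}(\mathfrak g)$ is the group of automorphisms of the Lie algebra $\mathfrak g$ preserving $\langle\cdot,\cdot\rangle_{\mathfrak g}$, acting complex-linearly on $\mathfrak g^{\mathbb C}$; $\bar{\mathcal D}$ is the conjugate with respect to the real form $\mathfrak g$. Quadratic Lie algebra (bundle): a quadratic Lie algebra is a finite-dimensional real Lie algebra with an $\mathrm{ad}$-invariant non-degenerate symmetric bilinear form ("scalar product"); a quadratic Lie algebra bundle is a vector bundle with smooth fibrewise bracket and scalar product of this kind. Standard Courant algebroid over $M$: $E=TM\oplus T^*M\oplus\mathcal G$, where $(\mathcal G,[\cdot,\cdot]_{\mathcal G},\langle\cdot,\cdot\rangle_{\mathcal G})$ is a quadratic Lie algebra bundle, with defining data $(\nabla,R,H)$: $\nabla$ a connection on $\mathcal G$ preserving bracket and scalar product, $R\in\Omega^2(M,\mathcal G)$, $H\in\Omega^3(M)$ with $R^\nabla(X,Y)r=[R(X,Y),r]_{\mathcal G}$, $d^\nabla R=0$, $dH=\langle R\wedge R\rangle_{\mathcal G}$. The anchor is the projection to $TM$, the scalar product is $\langle X+\xi+r,Y+\eta+s\rangle=\frac12(\xi(Y)+\eta(X))+\langle r,s\rangle_{\mathcal G}$, and the Dorfman bracket is determined by $[X,Y]=\mathcal L_XY+i_Yi_XH+R(X,Y)$, $[X,r]=-2\langle i_XR,r\rangle_{\mathcal G}+\nabla_Xr$, $[r_1,r_2]=2\langle\nabla r_1,r_2\rangle_{\mathcal G}+[r_1,r_2]_{\mathcal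 G}$, $[X,\eta]=\mathcal L_X\eta$, $[\eta_1,\eta_2]=[r,\eta]=0$ and $[u,v]+[v,u]=2d\langle u,v\rangle$. Every transitive Courant algebroid (surjective anchor) is isomorphic to a standard one. The untwisted Courant algebroid $TM\oplus T^*M\oplus(M\times\mathfrak g)$ is the standard one with $\mathcal G=M\times\mathfrak g$ (constant bracket and scalar product), $\nabla$ the canonical flat connection, $R=0$, $H=0$. Equivalence: an isomorphism of Courant algebroids is a vector bundle isomorphism over the identity preserving anchor, scalar product and Dorfman bracket. For a diffeomorphism $f:M\to N$ and standard $E\to N$, $f^!E$ is the standard Courant algebroid over $M$ defined by $f^*\mathcal G$ and $(f^*\nabla,f^*R,f^*H)$, with pullback map $f^!:E\to f^!E$, $X_{f(x)}+\xi_{f(x)}+r_{f(x)}\mapsto (d_xf)^{-1}X_{f(x)}+\xi_{f(x)}\circ d_xf+r_{f(x)}$. An equivalence is a composition of isomorphisms and pullbacks. Generalized complex structures are equivalent if an equivalence intertwines them. Generalized complex structure: a field $\mathcal J$ of endomorphisms of $E$, skew-symmetric for the scalar product, with $\mathcal J^2=-\mathrm{Id}$, such that sections of its $(1,0)$-bundle $L\subset E^{\mathbb C}$ ($\sqrt{-1}$-eigenbundle) are closed under the Dorfman bracket. On a standard Courant algebroid, $L$ can be written pointwise as $L(W,\mathcal D,\sigma,\epsilon):=\{X+\xi+\sigma(X)+r\mid X\in W,\ \xi\in((TM)^{\mathbb C})^*,\ r\in\mathcal D,\ \xi(Y)=2\epsilon(X,Y)-\langle\sigma(Y),\sigma(X)+2r\rangle_{\mathcal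 G}\ \forall Y\in W\}$, where $W=\pi_{(TM)^{\mathbb C}}(L)$, $\mathcal D=\pi_{\mathcal G^{\mathbb C}}(\ker\pi_{(TM)^{\mathbb C}}|_L)$ is maximal isotropic in $\mathcal G^{\mathbb C}$, $\sigma:W\to\mathcal G^{\mathbb C}$ is linear and $\epsilon\in\Lambda^2W^*$. A point $x$ is regular for $\mathcal J$ if $\dim W$ is constant near $x$. $\mathcal J$ is regular if every point has an open neighbourhood $U$ and an isomorphism from $E|_U$ to an untwisted Courant algebroid $TU\oplus T^*U\oplus(U\times\mathfrak g)$ mapping $\mathcal D$ to a trivial bundle $U\times\mathcal D_U$, where $\mathcal D_U\subset\mathfrak g^{\mathbb C}$ is a subalgebra normalised by a Cartan subalgebra of $\mathfrak g$. Normal form: a normal form with parameters $(p,q,k,\mathcal D)$ is a generalized complex structure on the untwisted Courant algebroid $TM\oplus T^*M\oplus(M\times\mathfrak g)$, $M=U_1\times U_2\times V$, with $U_1\subset\mathbb R^p$ (coordinates $x^i$), $U_2\subset\mathbb R^{2q}$ (coordinates $y^i$), $V\subset\mathbb C^k$ (coordinates $z^j$) open neighbourhoods of the origins, with $(1,0)$-bundle $L(W,\mathcal D,\sigma,\epsilon)$ such that: $W=\mathrm{span}_{\mathbb C}\{\partial/\partial x^i,\partial/\partial y^j,\partial/\partial\bar z^l\}$; $\mathcal D\subset\mathfrak g^{\mathbb C}$ is a constant Lagrangian (i.e. maximal isotropic) subalgebra normalised by a Cartan subalgebra $\mathfrak h_{\mathfrak g}$ of $\mathfrak g$, of the form $\mathcal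 D=(\mathcal D\cap\mathfrak h)\oplus\bigoplus_{\alpha\in R^+}\mathfrak g_\alpha$ with $\mathfrak h=\mathfrak h_{\mathfrak g}^{\mathbb C}$, $R^+$ a positive root system, $\mathcal D\cap\mathfrak h$ maximal isotropic in $\mathfrak h$ and $\dim_{\mathbb R}(\mathcal D\cap\mathfrak g)=p$; $\sigma=\sum_{i=1}^pdx^i\otimes(\sqrt{-1}v_i')$ with $(v_i')$ a constant basis of an isotropic subspace of $\mathfrak h_{\mathfrak g}$ paired non-degenerately by $\langle\cdot,\cdot\rangle_{\mathfrak g}$ with $\mathfrak h_{\mathfrak g}\cap\mathcal D$; $\epsilon=\sqrt{-1}\sum_{i=1}^qdy^i\wedge dy^{i+q}$. It is known that every regular generalized complex structure as in the claim is equivalent, near any regular point, to some normal form. *)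

theory Defs
  imports "HOL-Analysis.Analysis" "HOL-Library.Function_Algebras"
begin

section \<open>Real vector space structure on functions\<close>

text \<open>Tangent vectors are functionals on functions, so their span, sums and multiples are
  pointwise ones.\<close>

instantiation "fun" :: (type, real_vector) real_vector
begin

definition scaleR_fun :: "real \<Rightarrow> ('a \<Rightarrow> 'b) \<Rightarrow> 'a \<Rightarrow> 'b"
  where "scaleR_fun c f = (\<lambda>x. c *\<^sub>R f x)"

instance
  by standard (auto simp: scaleR_fun_def fun_eq_iff scaleR_add_right scaleR_add_left)

end


section \<open>Complexification\<close>

text \<open>The complexification of a real vector space is the type of pairs, where \<open>(a, b)\<close> stands
  for a + ib. Real tensors are extended complex-(bi)linearly.\<close>

definition cscale :: "complex \<Rightarrow> 'v \<times> 'v \<Rightarrow> 'v \<times> 'v::real_vector"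
  where "cscale c u = (Re c *\<^sub>R fst u - Im c *\<^sub>R snd u, Re c *\<^sub>R snd u + Im c *\<^sub>R fst u)"

global_interpretation cplx: vector_space "cscale :: complex \<Rightarrow> 'v \<times> 'v \<Rightarrow> 'v \<times> 'v::real_vector"
  defines csubspace = cplx.subspace
    and cspan = cplx.span
    and cdim = cplx.dim
  by standard (auto simp: cscale_def algebra_simps)

definition conj_vec :: "'v \<times> 'v \<Rightarrow> 'v \<times> 'v::real_vector"
  where "conj_vec u = (fst u, - snd u)"

definition cform :: "('v \<Rightarrow> 'w \<Rightarrow> real) \<Rightarrow> 'v \<times> 'v \<Rightarrow> 'w \<times> 'w \<Rightarrow> complex"
  where "cform B u v = Complex (B (fst u) (fst v) - B (snd u) (snd v))
                               (B (fst u) (snd v) + B (snd u) (fst v))"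

definition cbracket :: "('v \<Rightarrow> 'v \<Rightarrow> 'v) \<Rightarrow> 'v \<times> 'v \<Rightarrow> 'v \<times> 'v \<Rightarrow> 'v \<times> 'v::real_vector"
  where "cbracket B u v = (B (fst u) (fst v) - B (snd u) (snd v),
                           B (fst u) (snd v) + B (snd u) (fst v))"

definition linear_over :: "'v::real_vector set \<Rightarrow> ('v \<Rightarrow> 'w::real_vector) \<Rightarrow> bool"
  where "linear_over S f \<longleftrightarrow>
    (\<forall>a\<in>S. \<forall>b\<in>S. f (a + b) = f a + f b) \<and> (\<forall>c. \<forall>a\<in>S. f (c *\<^sub>R a) = c *\<^sub>R f a)"

definition clinear_over :: "('v \<times> 'v::real_vector) set \<Rightarrow> ('v \<times> 'v \<Rightarrow> complex) \<Rightarrow> bool"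
  where "clinear_over S f \<longleftrightarrow>
    (\<forall>a\<in>S. \<forall>b\<in>S. f (a + b) = f a + f b) \<and> (\<forall>c. \<forall>a\<in>S. f (cscale c a) = c * f a)"

text \<open>Functionals on a subspace are represented by functions vanishing outside of it.\<close>

definition dual_space :: "'v::real_vector set \<Rightarrow> ('v \<Rightarrow> real) set"
  where "dual_space S = {\<xi>. linear_over S \<xi> \<and> (\<forall>v. v \<notin> S \<longrightarrow> \<xi> v = 0)}"

definition isotropic :: "('v \<Rightarrow> 'v \<Rightarrow> real) \<Rightarrow> ('v \<times> 'v) set \<Rightarrow> bool"
  where "isotropic B S \<longleftrightarrow> (\<forall>u\<in>S. \<forall>v\<in>S. cform B u v = 0)"

definition maximal_isotropic ::
    "('v \<Rightarrow> 'v \<Rightarrow> real) \<Rightarrow> ('v \<times> 'v::real_vector) set \<Rightarrow> ('v \<times> 'v) set \<Rightarrow> bool"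
  where "maximal_isotropic B V S \<longleftrightarrow>
    csubspace S \<and> S \<subseteq> V \<and> isotropic B S \<and>
    (\<forall>S'. csubspace S' \<and> S' \<subseteq> V \<and> isotropic B S' \<and> S \<subseteq> S' \<longrightarrow> S' = S)"


section \<open>Quadratic Lie algebras\<close>

definition invariant_form :: "('g \<Rightarrow> 'g \<Rightarrow> 'g) \<Rightarrow> ('g::real_vector \<Rightarrow> 'g \<Rightarrow> real) \<Rightarrow> bool"
  where "invariant_form br ip \<longleftrightarrow>
    bilinear ip \<and> (\<forall>a b. ip a b = ip b a) \<and> (\<forall>a b c. ip (br a b) c + ip b (br a c) = 0)"

definition lie_algebra :: "('g::real_vector \<Rightarrow> 'g \<Rightarrow> 'g) \<Rightarrow> bool"
  where "lie_algebra br \<longleftrightarrow>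
    (\<exists>S::'g set. finite S \<and> span S = UNIV) \<and>
    bilinear br \<and> (\<forall>a. br a a = 0) \<and>
    (\<forall>a b c. br a (br b c) = br (br a b) c + br b (br a c))"

definition quadratic_lie_algebra ::
    "('g::real_vector \<Rightarrow> 'g \<Rightarrow> 'g) \<Rightarrow> ('g \<Rightarrow> 'g \<Rightarrow> real) \<Rightarrow> bool"
  where "quadratic_lie_algebra br ip \<longleftrightarrow>
    lie_algebra br \<and> invariant_form br ip \<and> (\<forall>a. (\<forall>b. ip a b = 0) \<longrightarrow> a = 0)"

text \<open>A real Lie algebra is that of a compact Lie group iff it carries an invariant inner product.\<close>

definition compact_lie_algebra :: "('g::real_vector \<Rightarrow> 'g \<Rightarrow> 'g) \<Rightarrow> bool"
  where "compact_lie_algebra br \<longleftrightarrow> (\<exists>K. invariant_form br K \<and> (\<forall>a. a \<noteq> 0 \<longrightarrow> K a a > 0))"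

text \<open>Bourbaki's definition: there is no nonzero abelian ideal.\<close>

definition semisimple_lie_algebra :: "('g::real_vector \<Rightarrow> 'g \<Rightarrow> 'g) \<Rightarrow> bool"
  where "semisimple_lie_algebra br \<longleftrightarrow>
    (\<forall>I. subspace I \<and> (\<forall>a. \<forall>b\<in>I. br a b \<in> I) \<and> (\<forall>a\<in>I. \<forall>b\<in>I. br a b = 0) \<longrightarrow> I = {0})"

definition neutral_signature :: "('g::real_vector \<Rightarrow> 'g \<Rightarrow> real) \<Rightarrow> bool"
  where "neutral_signature ip \<longleftrightarrow>
    (\<exists>P N. subspace P \<and> subspace N \<and> P \<inter> N = {0} \<and> span (P \<union> N) = UNIV \<and> dim P = dim N \<and>
       (\<forall>a\<in>P - {0}. ip a a > 0) \<and> (\<forall>a\<in>N - {0}. ip a a < 0))"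

definition lie_aut :: "('g::real_vector \<Rightarrow> 'g \<Rightarrow> 'g) \<Rightarrow> ('g \<Rightarrow> 'g \<Rightarrow> real) \<Rightarrow> ('g \<Rightarrow> 'g) set"
  where "lie_aut br ip = {\<phi>. linear \<phi> \<and> bij \<phi> \<and>
    (\<forall>a b. \<phi> (br a b) = br (\<phi> a) (\<phi> b)) \<and> (\<forall>a b. ip (\<phi> a) (\<phi> b) = ip a b)}"

definition aut_orbit :: "('g::real_vector \<Rightarrow> 'g \<Rightarrow> 'g) \<Rightarrow> ('g \<Rightarrow> 'g \<Rightarrow> real) \<Rightarrow>
    ('g \<times> 'g) set \<Rightarrow> ('g \<times> 'g) set set"
  where "aut_orbit br ip \<D> = {map_prod \<phi> \<phi> ` \<D> | \<phi>. \<phi> \<in> lie_aut br ip}"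

fun lower_central_series :: "('g::real_vector \<Rightarrow> 'g \<Rightarrow> 'g) \<Rightarrow> 'g set \<Rightarrow> nat \<Rightarrow> 'g set"
  where
    "lower_central_series br S 0 = S"
  | "lower_central_series br S (Suc m) =
       span {br a b | a b. a \<in> S \<and> b \<in> lower_central_series br S m}"

definition cartan_subalgebra :: "('g::real_vector \<Rightarrow> 'g \<Rightarrow> 'g) \<Rightarrow> 'g set \<Rightarrow> bool"
  where "cartan_subalgebra br h \<longleftrightarrow>
    subspace h \<and> (\<forall>a\<in>h. \<forall>b\<in>h. br a b \<in> h) \<and>
    (\<exists>m. lower_central_series br h m = {0}) \<and>
    {a. \<forall>b\<in>h. br a b \<in> h} = h"

definition complex_subalgebra :: "('g::real_vector \<Rightarrow> 'g \<Rightarrow> 'g) \<Rightarrow> ('g \<times> 'g) set \<Rightarrow> bool"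
  where "complex_subalgebra br \<D> \<longleftrightarrow> csubspace \<D> \<and> (\<forall>u\<in>\<D>. \<forall>v\<in>\<D>. cbracket br u v \<in> \<D>)"

definition normalised_by :: "('g::real_vector \<Rightarrow> 'g \<Rightarrow> 'g) \<Rightarrow> 'g set \<Rightarrow> ('g \<times> 'g) set \<Rightarrow> bool"
  where "normalised_by br h \<D> \<longleftrightarrow> (\<forall>a\<in>h. \<forall>u\<in>\<D>. cbracket br (a, 0) u \<in> \<D>)"

definition root_space :: "('g::real_vector \<Rightarrow> 'g \<Rightarrow> 'g) \<Rightarrow> ('g \<times> 'g) set \<Rightarrow>
    ('g \<times> 'g \<Rightarrow> complex) \<Rightarrow> ('g \<times> 'g) set"
  where "root_space br H \<alpha> = {u. \<forall>a\<in>H. cbracket br a u = cscale (\<alpha> a) u}"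

definition lie_roots :: "('g::real_vector \<Rightarrow> 'g \<Rightarrow> 'g) \<Rightarrow> ('g \<times> 'g) set \<Rightarrow> ('g \<times> 'g \<Rightarrow> complex) set"
  where "lie_roots br H = {\<alpha>. clinear_over H \<alpha> \<and> (\<forall>u. u \<notin> H \<longrightarrow> \<alpha> u = 0) \<and>
    (\<exists>a\<in>H. \<alpha> a \<noteq> 0) \<and> root_space br H \<alpha> \<noteq> {0}}"

definition positive_system :: "('g::real_vector \<Rightarrow> 'g \<Rightarrow> 'g) \<Rightarrow> ('g \<times> 'g) set \<Rightarrow>
    ('g \<times> 'g \<Rightarrow> complex) set \<Rightarrow> bool"
  where "positive_system br H P \<longleftrightarrow>
    P \<subseteq> lie_roots br H \<and>
    (\<forall>\<alpha>\<in>lie_roots br H. (\<alpha> \<in> P) \<noteq> (- \<alpha> \<in> P)) \<and>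
    (\<forall>\<alpha>\<in>P. \<forall>\<beta>\<in>P. \<alpha> + \<beta> \<in> lie_roots br H \<longrightarrow> \<alpha> + \<beta> \<in> P)"


section \<open>Smooth manifolds\<close>

definition partial_deriv :: "nat \<Rightarrow> ((nat \<Rightarrow> real) \<Rightarrow> real) \<Rightarrow> (nat \<Rightarrow> real) \<Rightarrow> real"
  where "partial_deriv i f x = deriv (\<lambda>t. f (x(i := t))) (x i)"

fun Ck_Rn :: "nat \<Rightarrow> nat \<Rightarrow> (nat \<Rightarrow> real) set \<Rightarrow> ((nat \<Rightarrow> real) \<Rightarrow> real) \<Rightarrow> bool"
  where
    "Ck_Rn n 0 U f \<longleftrightarrow> continuous_map (subtopology (Euclidean_space n) U) euclideanreal f"
  | "Ck_Rn n (Suc m) U f \<longleftrightarrow>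
       continuous_map (subtopology (Euclidean_space n) U) euclideanreal f \<and>
       (\<forall>i<n. (\<forall>x\<in>U. (\<lambda>t. f (x(i := t))) differentiable (at (x i))) \<and>
              Ck_Rn n m U (partial_deriv i f))"

definition smooth_Rn :: "nat \<Rightarrow> (nat \<Rightarrow> real) set \<Rightarrow> ((nat \<Rightarrow> real) \<Rightarrow> real) \<Rightarrow> bool"
  where "smooth_Rn n U f \<longleftrightarrow> (\<forall>m. Ck_Rn n m U f)"

text \<open>A chart is a pair of its domain and its coordinate map, whose values outside the domain
  are irrelevant.\<close>

record 'a manifold =
  mtop :: "'a topology"
  mdim :: nat
  charts :: "('a set \<times> ('a \<Rightarrow> nat \<Rightarrow> real)) set"

definition smooth_manifold :: "'a manifold \<Rightarrow> bool"
  where "smooth_manifold M \<longleftrightarrow>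
    Hausdorff_space (mtop M) \<and>
    (\<exists>\<B>. countable \<B> \<and> (\<forall>V\<in>\<B>. openin (mtop M) V) \<and>
       (\<forall>U x. openin (mtop M) U \<and> x \<in> U \<longrightarrow> (\<exists>V\<in>\<B>. x \<in> V \<and> V \<subseteq> U))) \<and>
    \<Union> (fst ` charts M) = topspace (mtop M) \<and>
    (\<forall>(U, \<phi>)\<in>charts M.
       openin (mtop M) U \<and> openin (Euclidean_space (mdim M)) (\<phi> ` U) \<and>
       homeomorphic_map (subtopology (mtop M) U)
         (subtopology (Euclidean_space (mdim M)) (\<phi> ` U)) \<phi>) \<and>
    (\<forall>(U, \<phi>)\<in>charts M. \<forall>(V, \<psi>)\<in>charts M. \<forall>i<mdim M.
       smooth_Rn (mdim M) (\<phi> ` (U \<inter> V)) (\<lambda>w. \<psi> (inv_into U \<phi> w) i))"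

definition open_submanifold :: "'a manifold \<Rightarrow> 'a set \<Rightarrow> 'a manifold"
  where "open_submanifold M U =
    \<lparr>mtop = subtopology (mtop M) U, mdim = mdim M, charts = {(V \<inter> U, \<phi>) | V \<phi>. (V, \<phi>) \<in> charts M}\<rparr>"

definition Rn_manifold :: "nat \<Rightarrow> (nat \<Rightarrow> real) manifold"
  where "Rn_manifold n =
    \<lparr>mtop = Euclidean_space n, mdim = n, charts = {(topspace (Euclidean_space n), \<lambda>x. x)}\<rparr>"

definition smooth_on :: "'a manifold \<Rightarrow> 'a set \<Rightarrow> ('a \<Rightarrow> real) \<Rightarrow> bool"
  where "smooth_on M U f \<longleftrightarrow>
    openin (mtop M) U \<and>
    (\<forall>(V, \<phi>)\<in>charts M. smooth_Rn (mdim M) (\<phi> ` (U \<inter> V)) (\<lambda>w. f (inv_into V \<phi> w)))"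

definition smooth_near :: "'a manifold \<Rightarrow> 'a \<Rightarrow> ('a \<Rightarrow> real) \<Rightarrow> bool"
  where "smooth_near M x f \<longleftrightarrow> (\<exists>U. x \<in> U \<and> smooth_on M U f)"

definition diffeomorphism :: "'a manifold \<Rightarrow> 'b manifold \<Rightarrow> ('a \<Rightarrow> 'b) \<Rightarrow> bool"
  where "diffeomorphism M N f \<longleftrightarrow>
    homeomorphic_map (mtop M) (mtop N) f \<and>
    (\<forall>V h. openin (mtop N) V \<longrightarrow>
       (smooth_on N V h \<longleftrightarrow> smooth_on M {x \<in> topspace (mtop M). f x \<in> V} (\<lambda>x. h (f x))))"

text \<open>A tangent vector at \<open>x\<close> is the directional derivative on functions smooth near \<open>x\<close> given
  by a coordinate vector in a chart around \<open>x\<close>; it takes the value 0 on all other functions.\<close>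

type_synonym 'a tvec = "('a \<Rightarrow> real) \<Rightarrow> real"
type_synonym 'a covec = "'a tvec \<Rightarrow> real"

definition chart_vector ::
    "'a manifold \<Rightarrow> 'a set \<Rightarrow> ('a \<Rightarrow> nat \<Rightarrow> real) \<Rightarrow> 'a \<Rightarrow> (nat \<Rightarrow> real) \<Rightarrow> 'a tvec"
  where "chart_vector M V \<phi> x w = (\<lambda>f. if smooth_near M x f
    then \<Sum>i<mdim M. w i * partial_deriv i (\<lambda>y. f (inv_into V \<phi> y)) (\<phi> x) else 0)"

definition tangent_space :: "'a manifold \<Rightarrow> 'a \<Rightarrow> 'a tvec set"
  where "tangent_space M x = {chart_vector M V \<phi> x w | V \<phi> w. (V, \<phi>) \<in> charts M \<and> x \<in> V}"

definition vector_field :: "'a manifold \<Rightarrow> 'a set \<Rightarrow> ('a \<Rightarrow> 'a tvec) \<Rightarrow> bool"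
  where "vector_field M U X \<longleftrightarrow>
    openin (mtop M) U \<and> (\<forall>x\<in>U. X x \<in> tangent_space M x) \<and>
    (\<forall>V f. V \<subseteq> U \<and> smooth_on M V f \<longrightarrow> smooth_on M V (\<lambda>x. X x f))"

definition one_form :: "'a manifold \<Rightarrow> 'a set \<Rightarrow> ('a \<Rightarrow> 'a covec) \<Rightarrow> bool"
  where "one_form M U \<xi> \<longleftrightarrow>
    openin (mtop M) U \<and> (\<forall>x\<in>U. \<xi> x \<in> dual_space (tangent_space M x)) \<and>
    (\<forall>V X. V \<subseteq> U \<and> vector_field M V X \<longrightarrow> smooth_on M V (\<lambda>x. \<xi> x (X x)))"

definition field_bracket :: "'a manifold \<Rightarrow> ('a \<Rightarrow> 'a tvec) \<Rightarrow> ('a \<Rightarrow> 'a tvec) \<Rightarrow> 'a \<Rightarrow> 'a tvec"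
  where "field_bracket M X Y x = (\<lambda>f. if smooth_near M x f
    then X x (\<lambda>y. Y y f) - Y x (\<lambda>y. X y f) else 0)"

text \<open>Some local vector field with a prescribed value at a point. The forms below are evaluated on
  a tangent vector by means of such an extension, on which the result does not depend.\<close>

definition extend_vector :: "'a manifold \<Rightarrow> 'a \<Rightarrow> 'a tvec \<Rightarrow> 'a \<Rightarrow> 'a tvec"
  where "extend_vector M x z = (SOME Z. (\<exists>U. x \<in> U \<and> vector_field M U Z) \<and> Z x = z)"

definition lie_derivative_form ::
    "'a manifold \<Rightarrow> ('a \<Rightarrow> 'a tvec) \<Rightarrow> ('a \<Rightarrow> 'a covec) \<Rightarrow> 'a \<Rightarrow> 'a covec"
  where "lie_derivative_form M X \<eta> x = (\<lambda>z. if z \<in> tangent_space M x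
    then (let Z = extend_vector M x z in
            X x (\<lambda>y. \<eta> y (Z y)) - \<eta> x (field_bracket M X Z x))
    else 0)"

definition contract_exterior_deriv ::
    "'a manifold \<Rightarrow> ('a \<Rightarrow> 'a tvec) \<Rightarrow> ('a \<Rightarrow> 'a covec) \<Rightarrow> 'a \<Rightarrow> 'a covec"
  where "contract_exterior_deriv M Y \<xi> x = (\<lambda>z. if z \<in> tangent_space M x
    then (let Z = extend_vector M x z in
            Y x (\<lambda>y. \<xi> y (Z y)) - z (\<lambda>y. \<xi> y (Y y)) - \<xi> x (field_bracket M Y Z x))
    else 0)"

text \<open>Vector-valued functions are tested on linear functionals; the target is finite-dimensional.\<close>

definition smooth_vec_on :: "'a manifold \<Rightarrow> 'a set \<Rightarrow> ('a \<Rightarrow> 'g::real_vector) \<Rightarrow> bool"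
  where "smooth_vec_on M U r \<longleftrightarrow> (\<forall>l. linear l \<longrightarrow> smooth_on M U (\<lambda>x. l (r x)))"

definition vec_deriv :: "'a tvec \<Rightarrow> ('a \<Rightarrow> 'g::real_vector) \<Rightarrow> 'g"
  where "vec_deriv X r = (THE w. \<forall>l. linear l \<longrightarrow> l w = X (\<lambda>y. l (r y)))"


section \<open>Transitive Courant algebroids\<close>

text \<open>The fibres of a bundle are subspaces of one, possibly infinite-dimensional, vector space;
  every vector bundle has this form up to isomorphism (take the direct sum of its
  fibres). The smooth structure is given by the sheaf of smooth local sections.\<close>

definition vector_bundle ::
    "'a manifold \<Rightarrow> ('a \<Rightarrow> 'e::real_vector set) \<Rightarrow> ('a set \<Rightarrow> ('a \<Rightarrow> 'e) set) \<Rightarrow> bool"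
  where "vector_bundle M F \<Gamma> \<longleftrightarrow>
    (\<forall>x\<in>topspace (mtop M). subspace (F x)) \<and>
    (\<forall>U u. openin (mtop M) U \<longrightarrow>
       (u \<in> \<Gamma> U \<longleftrightarrow> (\<forall>x\<in>U. \<exists>V. openin (mtop M) V \<and> x \<in> V \<and> V \<subseteq> U \<and> u \<in> \<Gamma> V))) \<and>
    (\<forall>x\<in>topspace (mtop M). \<exists>U es. openin (mtop M) U \<and> x \<in> U \<and>
       (\<forall>y\<in>U. distinct (map (\<lambda>e. e y) es) \<and> independent ((\<lambda>e. e y) ` set es) \<and>
              span ((\<lambda>e. e y) ` set es) = F y) \<and>
       (\<forall>V u. openin (mtop M) V \<and> V \<subseteq> U \<longrightarrow>
          (u \<in> \<Gamma> V \<longleftrightarrow>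
            (\<exists>c. (\<forall>i<length es. smooth_on M V (c i)) \<and>
                 (\<forall>y\<in>V. u y = (\<Sum>i<length es. c i y *\<^sub>R (es ! i) y))))))"

text \<open>The Dorfman bracket acts on local sections: its value at a point depends only on
  the arguments near that point.\<close>

record ('a, 'e) courant =
  fibre :: "'a \<Rightarrow> 'e set"
  sections :: "'a set \<Rightarrow> ('a \<Rightarrow> 'e) set"
  anchor :: "'a \<Rightarrow> 'e \<Rightarrow> 'a tvec"
  pairing :: "'a \<Rightarrow> 'e \<Rightarrow> 'e \<Rightarrow> real"
  dorfman :: "('a \<Rightarrow> 'e) \<Rightarrow> ('a \<Rightarrow> 'e) \<Rightarrow> 'a \<Rightarrow> 'e"

definition courant_algebroid :: "'a manifold \<Rightarrow> ('a, 'e::real_vector) courant \<Rightarrow> bool"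
  where "courant_algebroid M E \<longleftrightarrow>
    vector_bundle M (fibre E) (sections E) \<and>
    (\<forall>x\<in>topspace (mtop M).
       linear_over (fibre E x) (anchor E x) \<and>
       anchor E x ` fibre E x \<subseteq> tangent_space M x \<and>
       (\<forall>a\<in>fibre E x. linear_over (fibre E x) (pairing E x a)) \<and>
       (\<forall>a\<in>fibre E x. \<forall>b\<in>fibre E x. pairing E x a b = pairing E x b a) \<and>
       (\<forall>a\<in>fibre E x. (\<forall>b\<in>fibre E x. pairing E x a b = 0) \<longrightarrow> a = 0)) \<and>
    (\<forall>U. openin (mtop M) U \<longrightarrow>
       (\<forall>u\<in>sections E U. vector_field M U (\<lambda>x. anchor E x (u x))) \<and>
       (\<forall>u\<in>sections E U. \<forall>v\<in>sections E U.
          smooth_on M U (\<lambda>x. pairing E x (u x) (v x)) \<and> dorfman E u v \<in> sections E U)) \<and>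
    (\<forall>U. openin (mtop M) U \<longrightarrow>
       (\<forall>u\<in>sections E U. \<forall>v\<in>sections E U. \<forall>u' v'. (\<forall>y\<in>U. u' y = u y \<and> v' y = v y) \<longrightarrow>
          (\<forall>x\<in>U. dorfman E u' v' x = dorfman E u v x)) \<and>
       (\<forall>u\<in>sections E U. \<forall>v\<in>sections E U. \<forall>w\<in>sections E U. \<forall>x\<in>U.
          dorfman E (\<lambda>y. u y + v y) w x = dorfman E u w x + dorfman E v w x \<and>
          dorfman E w (\<lambda>y. u y + v y) x = dorfman E w u x + dorfman E w v x) \<and>
       (\<forall>u\<in>sections E U. \<forall>v\<in>sections E U. \<forall>c. \<forall>x\<in>U.
          dorfman E (\<lambda>y. c *\<^sub>R u y) v x = c *\<^sub>R dorfman E u v x \<and>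
          dorfman E u (\<lambda>y. c *\<^sub>R v y) x = c *\<^sub>R dorfman E u v x) \<and>
       (\<forall>u\<in>sections E U. \<forall>v\<in>sections E U. \<forall>w\<in>sections E U. \<forall>x\<in>U.
          dorfman E u (dorfman E v w) x =
            dorfman E (dorfman E u v) w x + dorfman E v (dorfman E u w) x) \<and>
       (\<forall>u\<in>sections E U. \<forall>v\<in>sections E U. \<forall>x\<in>U.
          anchor E x (dorfman E u v x) =
            field_bracket M (\<lambda>y. anchor E y (u y)) (\<lambda>y. anchor E y (v y)) x) \<and>
       (\<forall>u\<in>sections E U. \<forall>v\<in>sections E U. \<forall>f. smooth_on M U f \<longrightarrow> (\<forall>x\<in>U.
          dorfman E u (\<lambda>y. f y *\<^sub>R v y) x =
            anchor E x (u x) f *\<^sub>R v x + f x *\<^sub>R dorfman E u v x)) \<and>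
       (\<forall>u\<in>sections E U. \<forall>v\<in>sections E U. \<forall>w\<in>sections E U. \<forall>x\<in>U.
          anchor E x (u x) (\<lambda>y. pairing E y (v y) (w y)) =
            pairing E x (dorfman E u v x) (w x) + pairing E x (v x) (dorfman E u w x)) \<and>
       (\<forall>u\<in>sections E U. \<forall>v\<in>sections E U. \<forall>w\<in>sections E U. \<forall>x\<in>U.
          pairing E x (dorfman E u v x + dorfman E v u x) (w x) =
            anchor E x (w x) (\<lambda>y. pairing E y (u y) (v y))))"

text \<open>The last axiom above says that the symmetric part of the bracket is 2d of the pairing of the
  two sections: the embedding of a covector \<open>\<xi>\<close> pairs with \<open>w\<close> to half of \<open>\<xi>\<close> on the anchor
  of \<open>w\<close>.\<close>

definition transitive_courant_algebroid :: "'a manifold \<Rightarrow> ('a, 'e::real_vector) courant \<Rightarrow> bool"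
  where "transitive_courant_algebroid M E \<longleftrightarrow>
    courant_algebroid M E \<and>
    (\<forall>x\<in>topspace (mtop M). anchor E x ` fibre E x = tangent_space M x)"

text \<open>For a transitive Courant algebroid the quadratic Lie algebra bundle is the kernel of the
  anchor modulo its orthogonal complement (which is the image of the cotangent bundle).\<close>

definition anchor_kernel :: "('a, 'e::real_vector) courant \<Rightarrow> 'a \<Rightarrow> 'e set"
  where "anchor_kernel E x = {e \<in> fibre E x. anchor E x e = 0}"

definition anchor_kernel_perp :: "('a, 'e::real_vector) courant \<Rightarrow> 'a \<Rightarrow> 'e set"
  where "anchor_kernel_perp E x = {e \<in> fibre E x. \<forall>k\<in>anchor_kernel E x. pairing E x e k = 0}"

definition fibre_type :: "'a manifold \<Rightarrow> ('a, 'e::real_vector) courant \<Rightarrow>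
    ('g::real_vector \<Rightarrow> 'g \<Rightarrow> 'g) \<Rightarrow> ('g \<Rightarrow> 'g \<Rightarrow> real) \<Rightarrow> bool"
  where "fibre_type M E br ip \<longleftrightarrow> (\<forall>x\<in>topspace (mtop M). \<exists>\<tau>.
    linear \<tau> \<and> range \<tau> \<subseteq> anchor_kernel E x \<and>
    (\<forall>e\<in>anchor_kernel E x. \<exists>!a. e - \<tau> a \<in> anchor_kernel_perp E x) \<and>
    (\<forall>a b. pairing E x (\<tau> a) (\<tau> b) = ip a b) \<and>
    (\<forall>U u v a b. openin (mtop M) U \<and> x \<in> U \<and> u \<in> sections E U \<and> v \<in> sections E U \<and>
       (\<forall>y\<in>U. u y \<in> anchor_kernel E y \<and> v y \<in> anchor_kernel E y) \<and>
       u x - \<tau> a \<in> anchor_kernel_perp E x \<and> v x - \<tau> b \<in> anchor_kernel_perp E x \<longrightarrow>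
       dorfman E u v x - \<tau> (br a b) \<in> anchor_kernel_perp E x))"

text \<open>The standard Courant algebroid with trivial bundle of Lie algebras, canonical flat connection,
  R = 0 and H = 0. Its Dorfman bracket of \<open>X + \<xi> + r\<close> and \<open>Y + \<eta> + s\<close> is obtained from
  the brackets of the components, where \<open>[\<xi>, Y] = 2d\<langle>\<xi>, Y\<rangle> - L\<^sub>Y \<xi> = - i\<^sub>Y d\<xi>\<close> and
  \<open>[r, Y] = - \<nabla>\<^sub>Y r\<close>.\<close>

definition untwisted :: "'a manifold \<Rightarrow> ('g::real_vector \<Rightarrow> 'g \<Rightarrow> 'g) \<Rightarrow> ('g \<Rightarrow> 'g \<Rightarrow> real) \<Rightarrow>
    ('a, 'a tvec \<times> 'a covec \<times> 'g) courant"
  where "untwisted M br ip = \<lparr>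
    fibre = (\<lambda>x. tangent_space M x \<times> dual_space (tangent_space M x) \<times> UNIV),
    sections = (\<lambda>U. {u. vector_field M U (\<lambda>x. fst (u x)) \<and>
                        one_form M U (\<lambda>x. fst (snd (u x))) \<and>
                        smooth_vec_on M U (\<lambda>x. snd (snd (u x)))}),
    anchor = (\<lambda>x. fst),
    pairing = (\<lambda>x (X, \<xi>, r) (Y, \<eta>, s). (\<xi> Y + \<eta> X) / 2 + ip r s),
    dorfman = (\<lambda>u v x.
      let X = (\<lambda>y. fst (u y)); \<xi> = (\<lambda>y. fst (snd (u y))); r = (\<lambda>y. snd (snd (u y)));
          Y = (\<lambda>y. fst (v y)); \<eta> = (\<lambda>y. fst (snd (v y))); s = (\<lambda>y. snd (snd (v y)))
      in (field_bracket M X Y x,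
          (\<lambda>Z. if Z \<in> tangent_space M x
               then lie_derivative_form M X \<eta> x Z - contract_exterior_deriv M Y \<xi> x Z
                      + 2 * ip (vec_deriv Z r) (s x)
               else 0),
          vec_deriv (X x) s - vec_deriv (Y x) r + br (r x) (s x)))\<rparr>"


section \<open>Isomorphisms, pullbacks and equivalences\<close>

definition courant_iso :: "'a manifold \<Rightarrow> ('a, 'e::real_vector) courant \<Rightarrow>
    ('a, 'f::real_vector) courant \<Rightarrow> ('a \<Rightarrow> 'e \<Rightarrow> 'f) \<Rightarrow> bool"
  where "courant_iso M E E' \<Phi> \<longleftrightarrow>
    (\<forall>x\<in>topspace (mtop M).
       linear_over (fibre E x) (\<Phi> x) \<and> bij_betw (\<Phi> x) (fibre E x) (fibre E' x) \<and>
       (\<forall>a\<in>fibre E x. anchor E' x (\<Phi> x a) = anchor E x a) \<and>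
       (\<forall>a\<in>fibre E x. \<forall>b\<in>fibre E x. pairing E' x (\<Phi> x a) (\<Phi> x b) = pairing E x a b)) \<and>
    (\<forall>U u. openin (mtop M) U \<and> (\<forall>x\<in>U. u x \<in> fibre E x) \<longrightarrow>
       (u \<in> sections E U \<longleftrightarrow> (\<lambda>x. \<Phi> x (u x)) \<in> sections E' U)) \<and>
    (\<forall>U. openin (mtop M) U \<longrightarrow> (\<forall>u\<in>sections E U. \<forall>v\<in>sections E U. \<forall>x\<in>U.
       \<Phi> x (dorfman E u v x) = dorfman E' (\<lambda>y. \<Phi> y (u y)) (\<lambda>y. \<Phi> y (v y)) x))"

text \<open>Pullback by a diffeomorphism \<open>f\<close> from \<open>M\<close> to the base of \<open>E\<close>. The fibre at \<open>x\<close> is the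
  fibre of \<open>E\<close> at \<open>f x\<close>, so the pullback map on fibres is the identity, and all structure is
  transported; the anchor is composed with the inverse of the differential of \<open>f\<close>.\<close>

definition courant_pullback :: "'a manifold \<Rightarrow> ('a \<Rightarrow> 'b) \<Rightarrow> ('b, 'e) courant \<Rightarrow> ('a, 'e) courant"
  where "courant_pullback M f E = (let g = inv_into (topspace (mtop M)) f in \<lparr>
    fibre = (\<lambda>x. fibre E (f x)),
    sections = (\<lambda>U. {u. (\<lambda>y. u (g y)) \<in> sections E (f ` U)}),
    anchor = (\<lambda>x e h. anchor E (f x) e (\<lambda>y. h (g y))),
    pairing = (\<lambda>x. pairing E (f x)),
    dorfman = (\<lambda>u v x. dorfman E (\<lambda>y. u (g y)) (\<lambda>y. v (g y)) (f x))\<rparr>)"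


section \<open>Generalized complex structures\<close>

definition holomorphic_bundle :: "('a, 'e::real_vector) courant \<Rightarrow> ('a \<Rightarrow> 'e \<Rightarrow> 'e) \<Rightarrow> 'a \<Rightarrow> ('e \<times> 'e) set"
  where "holomorphic_bundle E J x =
    {u \<in> fibre E x \<times> fibre E x. map_prod (J x) (J x) u = cscale \<i> u}"

definition complex_sections :: "('a, 'e::real_vector) courant \<Rightarrow> 'a set \<Rightarrow> ('a \<Rightarrow> 'e \<times> 'e) set"
  where "complex_sections E U =
    {u. (\<lambda>x. fst (u x)) \<in> sections E U \<and> (\<lambda>x. snd (u x)) \<in> sections E U}"

definition complex_dorfman :: "('a, 'e::real_vector) courant \<Rightarrow>
    ('a \<Rightarrow> 'e \<times> 'e) \<Rightarrow> ('a \<Rightarrow> 'e \<times> 'e) \<Rightarrow> 'a \<Rightarrow> 'e \<times> 'e"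
  where "complex_dorfman E u v x =
    (let u1 = (\<lambda>y. fst (u y)); u2 = (\<lambda>y. snd (u y)); v1 = (\<lambda>y. fst (v y)); v2 = (\<lambda>y. snd (v y))
     in (dorfman E u1 v1 x - dorfman E u2 v2 x, dorfman E u1 v2 x + dorfman E u2 v1 x))"

definition generalized_complex_structure ::
    "'a manifold \<Rightarrow> ('a, 'e::real_vector) courant \<Rightarrow> ('a \<Rightarrow> 'e \<Rightarrow> 'e) \<Rightarrow> bool"
  where "generalized_complex_structure M E J \<longleftrightarrow>
    (\<forall>x\<in>topspace (mtop M).
       linear_over (fibre E x) (J x) \<and> J x ` fibre E x \<subseteq> fibre E x \<and>
       (\<forall>a\<in>fibre E x. J x (J x a) = - a) \<and>
       (\<forall>a\<in>fibre E x. \<forall>b\<in>fibre E x. pairing E x (J x a) b = - pairing E x a (J x b))) \<and>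
    (\<forall>U. openin (mtop M) U \<longrightarrow> (\<forall>u\<in>sections E U. (\<lambda>x. J x (u x)) \<in> sections E U)) \<and>
    (\<forall>U. openin (mtop M) U \<longrightarrow> (\<forall>u\<in>complex_sections E U. \<forall>v\<in>complex_sections E U.
       (\<forall>x\<in>U. u x \<in> holomorphic_bundle E J x \<and> v x \<in> holomorphic_bundle E J x) \<longrightarrow>
       (\<forall>x\<in>U. complex_dorfman E u v x \<in> holomorphic_bundle E J x)))"

text \<open>An equivalence is a composition of isomorphisms and pullbacks. Since isomorphisms can
  be pulled back, it is an isomorphism onto the pullback by some diffeomorphism \<open>f\<close>, followed by
  the (inverse) pullback map by \<open>f\<close>.\<close>

definition gcs_equivalence :: "'a manifold \<Rightarrow> ('a, 'e::real_vector) courant \<Rightarrow> ('a \<Rightarrow> 'e \<Rightarrow> 'e) \<Rightarrow>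
    'b manifold \<Rightarrow> ('b, 'f::real_vector) courant \<Rightarrow> ('b \<Rightarrow> 'f \<Rightarrow> 'f) \<Rightarrow>
    ('a \<Rightarrow> 'b) \<Rightarrow> ('a \<Rightarrow> 'e \<Rightarrow> 'f) \<Rightarrow> bool"
  where "gcs_equivalence M E J N E' J' f \<Phi> \<longleftrightarrow>
    diffeomorphism M N f \<and> courant_iso M E (courant_pullback M f E') \<Phi> \<and>
    (\<forall>x\<in>topspace (mtop M). \<forall>a\<in>fibre E x. \<Phi> x (J x a) = J' (f x) (\<Phi> x a))"

definition locally_equivalent :: "'a manifold \<Rightarrow> ('a, 'e::real_vector) courant \<Rightarrow> ('a \<Rightarrow> 'e \<Rightarrow> 'e) \<Rightarrow> 'a \<Rightarrow>
    'b manifold \<Rightarrow> ('b, 'f::real_vector) courant \<Rightarrow> ('b \<Rightarrow> 'f \<Rightarrow> 'f) \<Rightarrow> 'b \<Rightarrow> bool"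
  where "locally_equivalent M E J x N E' J' x' \<longleftrightarrow>
    (\<exists>U U' f \<Phi>. openin (mtop M) U \<and> x \<in> U \<and> openin (mtop N) U' \<and> x' \<in> U' \<and> f x = x' \<and>
       gcs_equivalence (open_submanifold M U) E J (open_submanifold N U') E' J' f \<Phi>)"

definition W_space :: "('a, 'e::real_vector) courant \<Rightarrow> ('a \<Rightarrow> 'e \<Rightarrow> 'e) \<Rightarrow> 'a \<Rightarrow> ('a tvec \<times> 'a tvec) set"
  where "W_space E J x = map_prod (anchor E x) (anchor E x) ` holomorphic_bundle E J x"

definition regular_point ::
    "'a manifold \<Rightarrow> ('a, 'e::real_vector) courant \<Rightarrow> ('a \<Rightarrow> 'e \<Rightarrow> 'e) \<Rightarrow> 'a \<Rightarrow> bool"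
  where "regular_point M E J x \<longleftrightarrow>
    (\<exists>U d. openin (mtop M) U \<and> x \<in> U \<and> (\<forall>y\<in>U. cdim (W_space E J y) = d))"

text \<open>For a subspace \<open>L\<close> of a complexified fibre of a standard Courant algebroid.\<close>

definition D_space :: "(('a tvec \<times> 'a covec \<times> 'g) \<times> ('a tvec \<times> 'a covec \<times> 'g)) set \<Rightarrow> ('g \<times> 'g) set"
  where "D_space L = {(r1, r2). \<exists>\<xi>1 \<xi>2. ((0, \<xi>1, r1), (0, \<xi>2, r2)) \<in> L}"

definition regular_gcs :: "'a manifold \<Rightarrow> ('a, 'e::real_vector) courant \<Rightarrow> ('a \<Rightarrow> 'e \<Rightarrow> 'e) \<Rightarrow>
    ('g::real_vector \<Rightarrow> 'g \<Rightarrow> 'g) \<Rightarrow> ('g \<Rightarrow> 'g \<Rightarrow> real) \<Rightarrow> bool"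
  where "regular_gcs M E J br ip \<longleftrightarrow>
    generalized_complex_structure M E J \<and>
    (\<forall>x\<in>topspace (mtop M). \<exists>U \<Phi> \<D> h. openin (mtop M) U \<and> x \<in> U \<and>
       courant_iso (open_submanifold M U) E (untwisted (open_submanifold M U) br ip) \<Phi> \<and>
       complex_subalgebra br \<D> \<and> cartan_subalgebra br h \<and> normalised_by br h \<D> \<and>
       (\<forall>y\<in>U. D_space (map_prod (\<Phi> y) (\<Phi> y) ` holomorphic_bundle E J y) = \<D>))"

text \<open>The subspace \<open>L(W, \<D>, \<sigma>, \<epsilon>)\<close>, where \<open>T\<close> is the tangent space.\<close>

definition L_space :: "('g::real_vector \<Rightarrow> 'g \<Rightarrow> real) \<Rightarrow> 'a tvec set \<Rightarrow>
    ('a tvec \<times> 'a tvec) set \<Rightarrow> ('g \<times> 'g) set \<Rightarrow>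
    ('a tvec \<times> 'a tvec \<Rightarrow> 'g \<times> 'g) \<Rightarrow> ('a tvec \<times> 'a tvec \<Rightarrow> 'a tvec \<times> 'a tvec \<Rightarrow> complex) \<Rightarrow>
    (('a tvec \<times> 'a covec \<times> 'g) \<times> ('a tvec \<times> 'a covec \<times> 'g)) set"
  where "L_space ip T W \<D> \<sigma> \<epsilon> =
    {((fst X, fst \<xi>, fst (\<sigma> X + r)), (snd X, snd \<xi>, snd (\<sigma> X + r))) | X \<xi> r.
       X \<in> W \<and> \<xi> \<in> dual_space T \<times> dual_space T \<and> r \<in> \<D> \<and>
       (\<forall>Y\<in>W. cform (\<lambda>\<xi>' Y'. \<xi>' Y') \<xi> Y = 2 * \<epsilon> X Y - cform ip (\<sigma> Y) (\<sigma> X + cscale 2 r))}"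


section \<open>Normal forms\<close>

text \<open>Points of the base are \<open>v\<close> with real coordinates \<open>x\<^sup>i = v i\<close> (\<open>i < p\<close>),
  \<open>y\<^sup>j = v (p + j)\<close> (\<open>j < 2q\<close>) and complex coordinates
  \<open>z\<^sup>l = v (p + 2q + 2l) + \<i> v (p + 2q + 2l + 1)\<close> (\<open>l < k\<close>); indices start from 0.\<close>

definition normal_form_base :: "nat \<Rightarrow> nat \<Rightarrow> nat \<Rightarrow> (nat \<Rightarrow> real) set \<Rightarrow> bool"
  where "normal_form_base p q k B \<longleftrightarrow>
    (\<exists>U1 U2 V. openin (Euclidean_space p) U1 \<and> 0 \<in> U1 \<and>
       openin (Euclidean_space (2 * q)) U2 \<and> 0 \<in> U2 \<and>
       openin (top_of_set {z::nat \<Rightarrow> complex. \<forall>l\<ge>k. z l = 0}) V \<and> 0 \<in> V \<and>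
       B = {v \<in> topspace (Euclidean_space (p + 2 * q + 2 * k)).
              (\<lambda>i. if i < p then v i else 0) \<in> U1 \<and>
              (\<lambda>j. if j < 2 * q then v (p + j) else 0) \<in> U2 \<and>
              (\<lambda>l. if l < k then Complex (v (p + 2 * q + 2 * l)) (v (p + 2 * q + 2 * l + 1)) else 0) \<in> V})"

definition coord_vector :: "(nat \<Rightarrow> real) manifold \<Rightarrow> (nat \<Rightarrow> real) \<Rightarrow> nat \<Rightarrow> (nat \<Rightarrow> real) tvec"
  where "coord_vector N v i = (\<lambda>f. if smooth_near N v f then partial_deriv i f v else 0)"

definition antiholomorphic_vector ::
    "(nat \<Rightarrow> real) manifold \<Rightarrow> (nat \<Rightarrow> real) \<Rightarrow> nat \<Rightarrow> nat \<Rightarrow> (nat \<Rightarrow> real) tvec \<times> (nat \<Rightarrow> real) tvec"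
  where "antiholomorphic_vector N v a b =
    cscale (1 / 2) (coord_vector N v a, coord_vector N v b)"

definition coord_form :: "nat \<Rightarrow> (nat \<Rightarrow> real) tvec \<times> (nat \<Rightarrow> real) tvec \<Rightarrow> complex"
  where "coord_form i X = Complex (fst X (\<lambda>v. v i)) (snd X (\<lambda>v. v i))"

definition normal_form_W :: "(nat \<Rightarrow> real) manifold \<Rightarrow> nat \<Rightarrow> nat \<Rightarrow> nat \<Rightarrow> (nat \<Rightarrow> real) \<Rightarrow>
    ((nat \<Rightarrow> real) tvec \<times> (nat \<Rightarrow> real) tvec) set"
  where "normal_form_W N p q k v = cspan
    ({(coord_vector N v i, 0) | i. i < p} \<union>
     {(coord_vector N v (p + j), 0) | j. j < 2 * q} \<union>
     {antiholomorphic_vector N v (p + 2 * q + 2 * l) (p + 2 * q + 2 * l + 1) | l. l < k})"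

definition normal_form_sigma :: "nat \<Rightarrow> (nat \<Rightarrow> 'g::real_vector) \<Rightarrow>
    (nat \<Rightarrow> real) tvec \<times> (nat \<Rightarrow> real) tvec \<Rightarrow> 'g \<times> 'g"
  where "normal_form_sigma p v' X = (\<Sum>i<p. cscale (coord_form i X) (cscale \<i> (v' i, 0)))"

definition normal_form_eps :: "nat \<Rightarrow> nat \<Rightarrow> (nat \<Rightarrow> real) tvec \<times> (nat \<Rightarrow> real) tvec \<Rightarrow>
    (nat \<Rightarrow> real) tvec \<times> (nat \<Rightarrow> real) tvec \<Rightarrow> complex"
  where "normal_form_eps p q X Y = \<i> * (\<Sum>j<q.
    coord_form (p + j) X * coord_form (p + q + j) Y - coord_form (p + q + j) X * coord_form (p + j) Y)"

definition normal_form_D :: "('g::real_vector \<Rightarrow> 'g \<Rightarrow> 'g) \<Rightarrow> ('g \<Rightarrow> 'g \<Rightarrow> real) \<Rightarrow>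
    nat \<Rightarrow> 'g set \<Rightarrow> ('g \<times> 'g) set \<Rightarrow> bool"
  where "normal_form_D br ip p h \<D> \<longleftrightarrow>
    complex_subalgebra br \<D> \<and> maximal_isotropic ip UNIV \<D> \<and>
    cartan_subalgebra br h \<and> normalised_by br h \<D> \<and>
    (\<exists>P. positive_system br (h \<times> h) P \<and>
       \<D> = cspan ((\<D> \<inter> h \<times> h) \<union> (\<Union>\<alpha>\<in>P. root_space br (h \<times> h) \<alpha>))) \<and>
    maximal_isotropic ip (h \<times> h) (\<D> \<inter> h \<times> h) \<and>
    dim {a. (a, 0) \<in> \<D>} = p"

definition normal_form_basis :: "('g::real_vector \<Rightarrow> 'g \<Rightarrow> real) \<Rightarrow> nat \<Rightarrow> 'g set \<Rightarrow>
    ('g \<times> 'g) set \<Rightarrow> (nat \<Rightarrow> 'g) \<Rightarrow> bool"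
  where "normal_form_basis ip p h \<D> v' \<longleftrightarrow>
    (let S = span (v' ` {..<p}); A = {a \<in> h. (a, 0) \<in> \<D>} in
       inj_on v' {..<p} \<and> independent (v' ` {..<p}) \<and> S \<subseteq> h \<and>
       (\<forall>a\<in>S. \<forall>b\<in>S. ip a b = 0) \<and>
       (\<forall>a\<in>S. (\<forall>b\<in>A. ip a b = 0) \<longrightarrow> a = 0) \<and>
       (\<forall>b\<in>A. (\<forall>a\<in>S. ip a b = 0) \<longrightarrow> b = 0))"

definition normal_form :: "('g::real_vector \<Rightarrow> 'g \<Rightarrow> 'g) \<Rightarrow> ('g \<Rightarrow> 'g \<Rightarrow> real) \<Rightarrow>
    nat \<Rightarrow> nat \<Rightarrow> nat \<Rightarrow> ('g \<times> 'g) set \<Rightarrow> (nat \<Rightarrow> real) set \<Rightarrow>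
    ((nat \<Rightarrow> real) \<Rightarrow> (nat \<Rightarrow> real) tvec \<times> (nat \<Rightarrow> real) covec \<times> 'g \<Rightarrow>
        (nat \<Rightarrow> real) tvec \<times> (nat \<Rightarrow> real) covec \<times> 'g) \<Rightarrow> bool"
  where "normal_form br ip p q k \<D> B J \<longleftrightarrow>
    (let N = open_submanifold (Rn_manifold (p + 2 * q + 2 * k)) B in
       normal_form_base p q k B \<and>
       generalized_complex_structure N (untwisted N br ip) J \<and>
       (\<exists>h v'. normal_form_D br ip p h \<D> \<and> normal_form_basis ip p h \<D> v' \<and>
          (\<forall>v\<in>B. holomorphic_bundle (untwisted N br ip) J v =
             L_space ip (tangent_space N v) (normal_form_W N p q k v) \<D>
               (normal_form_sigma p v') (normal_form_eps p q))))"

definition has_normal_form_near :: "'a manifold \<Rightarrow> ('a, 'e::real_vector) courant \<Rightarrow> ('a \<Rightarrow> 'e \<Rightarrow> 'e) \<Rightarrow> 'a \<Rightarrow>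
    ('g::real_vector \<Rightarrow> 'g \<Rightarrow> 'g) \<Rightarrow> ('g \<Rightarrow> 'g \<Rightarrow> real) \<Rightarrow>
    nat \<Rightarrow> nat \<Rightarrow> nat \<Rightarrow> ('g \<times> 'g) set \<Rightarrow> bool"
  where "has_normal_form_near M E J x br ip p q k \<D> \<longleftrightarrow>
    (\<exists>U B J0 f \<Phi>. openin (mtop M) U \<and> x \<in> U \<and> f x = 0 \<and> normal_form br ip p q k \<D> B J0 \<and>
       (let N = open_submanifold (Rn_manifold (p + 2 * q + 2 * k)) B in
          gcs_equivalence (open_submanifold M U) E J N (untwisted N br ip) J0 f \<Phi>))"

end

theory Submission
  imports Defs "HOL-Homology.Invariance_of_Domain"
begin

text \<open>An equivalence of structures in normal form preserves the kernel of the anchor. The quotient of the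
  kernel by its orthogonal complement is the quadratic Lie algebra, so the equivalence induces an automorphism
  of the latter, which transports \<open>\<D>\<close>. It also preserves the space of real vectors in \<open>W\<close>, whose dimension is
  \<open>p + 2q\<close>, and \<open>p\<close> is the dimension of the real part of \<open>\<D>\<close>. Hence \<open>q\<close>, \<open>k\<close> and the orbit of \<open>\<D>\<close> are invariants.

  Conversely, an automorphism taking \<open>\<D>\<close> to \<open>\<D>'\<close> takes \<open>h\<close> to \<open>h'\<close>, because the Cartan subalgebra is the real
  normaliser of \<open>\<D>\<close>. Together with a linear change of the coordinates \<open>x\<^sup>i\<close> it reduces the claim to the same
  \<open>\<D>\<close> and two isotropic families \<open>v\<close> and \<open>v1\<close> dual to the same basis of the real part of \<open>\<D>\<close>. Then
  \<open>\<i> (v1 i - v i) = w i\<close> modulo \<open>\<D>\<close> for suitable \<open>w i\<close> in the Cartan subalgebra, and the gauge transformation by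
  \<open>exp (- ad (\<Sum> x\<^sup>i w i))\<close>, which stabilises \<open>\<D>\<close>, combined with a constant B-field identifies the two
  normal forms.\<close>

text \<open>Sections, brackets, anchors and inverses take arbitrary values off the open set on which
  they matter, and equivalence is phrased with a particular inverse. So local equivalence is
  replaced by \<open>pointed_iso\<close>, a relation on germs for which transitivity and symmetry
  can be proved. Compactness gives the two facts behind the recovery of the Cartan subalgebra:
  nilpotent becomes abelian, and no positive root vanishes on the part of \<open>D\<close> in the
  complexified Cartan subalgebra. The gauge map is forced. Matching the algebra parts modulo
  \<open>D\<close> dictates a shift by the \<open>w i\<close>. The Dorfman bracket tolerates it only
  together with automorphisms \<open>K\<close> whose derivative is minus the adjoint action of the
  shift times \<open>K\<close>; as the \<open>w i\<close> commute, \<open>K\<close> is an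
  exponential. Orthogonality fixes the covector part up to a two-form, and comparing covectors
  determines this B-field. It is real only if \<open>w\<close> satisfies a symmetry condition, which
  is arranged by adding real elements of \<open>D\<close> to the \<open>w i\<close>.\<close>

abbreviation "Rn n \<equiv> Rn_manifold n"
abbreviation "ER n \<equiv> topspace (Euclidean_space n)"
abbreviation "opn n \<equiv> openin (Euclidean_space n)"
abbreviation "TR n \<equiv> tangent_space (Rn n)"
abbreviation "openM M \<equiv> openin (mtop M)"
abbreviation "cvec n \<equiv> coord_vector (Rn n)"
abbreviation "cov e \<equiv> fst (snd e)"
abbreviation "alg e \<equiv> snd (snd e)"

section \<open>Smooth functions in coordinates\<close>

text \<open>An open set of the product topology constrains only finitely many coordinates near a
  point, and those from \<open>n\<close> on vanish on the whole space; so one radius for the first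
  \<open>n\<close> coordinates is enough.\<close>

lemma Euclidean_box:
  assumes U: "opn n U" and x: "x \<in> U"
  obtains e where "e > 0"
    "\<And>y. y \<in> ER n \<Longrightarrow> (\<And>i. i < n \<Longrightarrow> \<bar>y i - x i\<bar> < e) \<Longrightarrow> y \<in> U"
proof -
  obtain T where T: "openin (powertop_real UNIV) T" "U = T \<inter> {x. \<forall>i\<ge>n. x i = 0}"
    using U unfolding Euclidean_space_def openin_subtopology by auto
  obtain W where W: "finite {i. W i \<noteq> UNIV}" "\<And>i. open (W i)" "x \<in> Pi\<^sub>E UNIV W" "Pi\<^sub>E UNIV W \<subseteq> T"
    using T x unfolding openin_product_topology_alt by (auto simp: topspace_euclidean)
  have "\<exists>e>0. \<forall>t. \<bar>t - x i\<bar> < e \<longrightarrow> t \<in> W i" for i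
    using W(2)[of i] W(3) by (auto simp: open_dist dist_real_def PiE_def Pi_def)
  then obtain e where e: "\<And>i. e i > 0" "\<And>i t. \<bar>t - x i\<bar> < e i \<Longrightarrow> t \<in> W i" by metis
  \<comment> \<open>The extra element 1 keeps the minimum meaningful for \<open>n\<close> =
    0.\<close>
  define d where "d = Min (insert 1 (e ` {..<n}))"
  have d: "d > 0" "\<And>i. i < n \<Longrightarrow> d \<le> e i" using e(1) by (auto simp: d_def)
  have x0: "\<forall>i\<ge>n. x i = 0" using x T by auto
  show thesis
  proof (rule that[OF d(1)])
    fix y assume y: "y \<in> ER n" "\<And>i. i < n \<Longrightarrow> \<bar>y i - x i\<bar> < d"
    have y0: "\<forall>i\<ge>n. y i = 0" using y(1) by (simp add: topspace_Euclidean_space)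
    have "y i \<in> W i" for i
    proof (cases "i < n")
      case True
      thus ?thesis using y(2)[OF True] d(2)[OF True] e(2)[of "y i" i] by linarith
    next
      case False
      thus ?thesis using x0 y0 e(1)[of i] e(2)[of "y i" i] by auto
    qed
    hence "y \<in> T" using W(4) by (auto simp: PiE_def Pi_def)
    thus "y \<in> U" using T(2) y0 by auto
  qed
qed

lemma continuous_map_Euclidean_epsilon:
  assumes U: "opn n U" and x: "x \<in> U"
    and f: "continuous_map (subtopology (Euclidean_space n) U) euclideanreal f" and e: "e > 0"
  obtains d where "d > 0"
    "\<And>y. y \<in> ER n \<Longrightarrow> (\<And>i. i < n \<Longrightarrow> \<bar>y i - x i\<bar> < d) \<Longrightarrow> y \<in> U \<and> \<bar>f y - f x\<bar> < e"
proof -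
  have UE: "U \<subseteq> ER n" using U openin_subset by blast
  have "openin (subtopology (Euclidean_space n) U) {y \<in> U. f y \<in> {t. \<bar>t - f x\<bar> < e}}"
  proof -
    have "open {t. \<bar>t - f x\<bar> < e}"
      using open_ball[of "f x" e] by (simp add: ball_def dist_real_def abs_minus_commute)
    thus ?thesis using openin_continuous_map_preimage[OF f, of "{t. \<bar>t - f x\<bar> < e}"] UE
      by (simp add: topspace_subtopology_subset Int_absorb1)
  qed
  hence "opn n {y \<in> U. f y \<in> {t. \<bar>t - f x\<bar> < e}}" using U openin_trans_full by blast
  moreover have "x \<in> {y \<in> U. f y \<in> {t. \<bar>t - f x\<bar> < e}}" using x e by simp
  ultimately obtain d where d: "d > 0" "\<And>y. y \<in> ER n \<Longrightarrow>
      (\<And>i. i < n \<Longrightarrow> \<bar>y i - x i\<bar> < d) \<Longrightarrow> y \<in> {y \<in> U. f y \<in> {t. \<bar>t - f x\<bar> < e}}" by (rule Euclidean_box) blast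
  show thesis by (rule that[OF d(1)]) (use d(2) in blast)
qed

lemma slice_eventually:
  assumes U: "opn n U" and x: "x \<in> U" and i: "i < n"
  shows "\<forall>\<^sub>F t in nhds (x i). x(i := t) \<in> U"
proof -
  obtain e where e: "e > 0"
    "\<And>y. y \<in> ER n \<Longrightarrow> (\<And>i. i < n \<Longrightarrow> \<bar>y i - x i\<bar> < e) \<Longrightarrow> y \<in> U" using Euclidean_box[OF U x] by blast
  have xE: "x \<in> ER n" using U x openin_subset by blast
  have "\<forall>\<^sub>F t in nhds (x i). \<bar>t - x i\<bar> < e" using e(1) by (auto simp: eventually_nhds_metric dist_real_def)
  thus ?thesis
  proof eventually_elim
    case (elim t)
    show ?case using xE elim i e(1) by (intro e(2)) (auto simp: topspace_Euclidean_space)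
  qed
qed

definition partially_differentiable :: "nat \<Rightarrow> ((nat \<Rightarrow> real) \<Rightarrow> real) \<Rightarrow> (nat \<Rightarrow> real) \<Rightarrow> bool"
  where "partially_differentiable i f x \<longleftrightarrow> (\<lambda>t. f (x(i := t))) differentiable (at (x i))"

lemma partial_deriv_DERIV:
  "partially_differentiable i f x \<Longrightarrow>
    ((\<lambda>t. f (x(i := t))) has_real_derivative partial_deriv i f x) (at (x i))"
  unfolding partially_differentiable_def partial_deriv_def
  using DERIV_deriv_iff_real_differentiable by blast

lemma partial_deriv_eqI:
  assumes "((\<lambda>t. f (x(i := t))) has_real_derivative D) (at (x i))"
  shows "partial_deriv i f x = D" "partially_differentiable i f x" using assms DERIV_imp_deriv
  by (auto simp: partial_deriv_def partially_differentiable_def real_differentiable_def)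

lemma partial_deriv_cong_ev:
  assumes "\<forall>\<^sub>F t in nhds (x i). f (x(i := t)) = g (x(i := t))"
  shows "partial_deriv i f x = partial_deriv i g x"
    "partially_differentiable i f x \<longleftrightarrow> partially_differentiable i g x"
proof -
  have *: "((\<lambda>t. f (x(i := t))) has_real_derivative D) (at (x i)) \<longleftrightarrow>
      ((\<lambda>t. g (x(i := t))) has_real_derivative D) (at (x i))" for D
    by (rule DERIV_cong_ev[OF refl assms refl])
  show "partial_deriv i f x = partial_deriv i g x" unfolding partial_deriv_def deriv_def * ..
  show "partially_differentiable i f x \<longleftrightarrow> partially_differentiable i g x"
    unfolding partially_differentiable_def real_differentiable_def * ..
qed

lemma partial_deriv_cong:
  assumes U: "opn n U" and x: "x \<in> U" and i: "i < n"
    and fg: "\<And>y. y \<in> U \<Longrightarrow> f y = g y"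
  shows "partial_deriv i f x = partial_deriv i g x"
    "partially_differentiable i f x \<longleftrightarrow> partially_differentiable i g x"
proof -
  have "\<forall>\<^sub>F t in nhds (x i). f (x(i := t)) = g (x(i := t))"
    using slice_eventually[OF U x i] by eventually_elim (rule fg)
  from partial_deriv_cong_ev[OF this]
  show "partial_deriv i f x = partial_deriv i g x"
    "partially_differentiable i f x \<longleftrightarrow> partially_differentiable i g x" .
qed

lemma Ck_Rn_cong:
  assumes U: "opn n U" and fg: "\<And>x. x \<in> U \<Longrightarrow> f x = g x"
  shows "Ck_Rn n m U f \<longleftrightarrow> Ck_Rn n m U g"
proof -
  have c: "continuous_map (subtopology (Euclidean_space n) U) euclideanreal f \<longleftrightarrow>
      continuous_map (subtopology (Euclidean_space n) U) euclideanreal g"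
    if "\<And>x. x \<in> U \<Longrightarrow> f x = g x" for f g :: "(nat \<Rightarrow> real) \<Rightarrow> real"
    using that by (intro iffI; elim continuous_map_eq) auto
  show ?thesis using fg
  proof (induction m arbitrary: f g)
    case 0
    thus ?case using c[of f g] by simp
  next
    case (Suc m)
    have "Ck_Rn n m U (partial_deriv i f) \<longleftrightarrow> Ck_Rn n m U (partial_deriv i g)" if "i < n" for i
      by (rule Suc.IH) (use partial_deriv_cong(1)[OF U _ that] Suc.prems in blast)
    moreover have "((\<lambda>t. f (x(i := t))) differentiable (at (x i))) \<longleftrightarrow>
        ((\<lambda>t. g (x(i := t))) differentiable (at (x i)))" if "i < n" "x \<in> U" for i x
      using partial_deriv_cong(2)[OF U that(2,1), of f g] Suc.prems
      by (simp add: partially_differentiable_def)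
    ultimately show ?case using c[OF Suc.prems] by auto
  qed
qed

lemma smooth_Rn_cong:
  assumes "opn n U" "\<And>x. x \<in> U \<Longrightarrow> f x = g x"
  shows "smooth_Rn n U f \<longleftrightarrow> smooth_Rn n U g" using Ck_Rn_cong[OF assms] by (simp add: smooth_Rn_def)

lemma Ck_Rn_subset: "Ck_Rn n m U f \<Longrightarrow> V \<subseteq> U \<Longrightarrow> Ck_Rn n m V f"
proof (induction m arbitrary: f)
  case 0
  thus ?case using continuous_map_from_subtopology_mono by auto
next
  case (Suc m)
  thus ?case using continuous_map_from_subtopology_mono[OF _ Suc.prems(2)] by auto
qed

lemma smooth_Rn_subset: "smooth_Rn n U f \<Longrightarrow> V \<subseteq> U \<Longrightarrow> smooth_Rn n V f"
  unfolding smooth_Rn_def using Ck_Rn_subset by blast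

lemma smooth_RnD:
  assumes "smooth_Rn n U f"
  shows "continuous_map (subtopology (Euclidean_space n) U) euclideanreal f"
    "i < n \<Longrightarrow> x \<in> U \<Longrightarrow> partially_differentiable i f x"
    "i < n \<Longrightarrow> smooth_Rn n U (partial_deriv i f)"
proof -
  have *: "Ck_Rn n m U f" for m using assms by (simp add: smooth_Rn_def)
  show "continuous_map (subtopology (Euclidean_space n) U) euclideanreal f" using *[of 0] by simp
  show "i < n \<Longrightarrow> x \<in> U \<Longrightarrow> partially_differentiable i f x"
    using *[of "Suc 0"] by (simp add: partially_differentiable_def)
  show "i < n \<Longrightarrow> smooth_Rn n U (partial_deriv i f)" using *[of "Suc _"] by (simp add: smooth_Rn_def)
qed

text \<open>The order of differentiability is inducted on for the whole family at once, so it is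
  enough that the family is closed under partial derivatives, up to equality on \<open>U\<close>.
  Smoothness of every newly built class of functions is obtained in this way.\<close>

lemma smooth_Rn_coinduct:
  assumes U: "opn n U"
    and F: "\<And>f. f \<in> F \<Longrightarrow> continuous_map (subtopology (Euclidean_space n) U) euclideanreal f"
      "\<And>f i x. f \<in> F \<Longrightarrow> i < n \<Longrightarrow> x \<in> U \<Longrightarrow> partially_differentiable i f x"
      "\<And>f i. f \<in> F \<Longrightarrow> i < n \<Longrightarrow> \<exists>g\<in>F. \<forall>x\<in>U. partial_deriv i f x = g x"
    and f: "f \<in> F"
  shows "smooth_Rn n U f"
proof -
  have "Ck_Rn n m U f" for m using f
  proof (induction m arbitrary: f)
    case 0
    thus ?case using F(1) by simp
  next
    case (Suc m)
    have "Ck_Rn n m U (partial_deriv i f)" if i: "i < n" for i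
    proof -
      obtain g where g: "g \<in> F" "\<forall>x\<in>U. partial_deriv i f x = g x" using F(3)[OF Suc.prems i] by blast
      show ?thesis using Suc.IH[OF g(1)] Ck_Rn_cong[OF U, of "partial_deriv i f" g m] g(2) by blast
    qed
    thus ?case using F(1,2) Suc.prems by (simp add: partially_differentiable_def)
  qed
  thus ?thesis by (simp add: smooth_Rn_def)
qed

section \<open>Sum and product rules; closure of smooth functions under arithmetic\<close>

lemma partial_deriv_rules:
  assumes "partially_differentiable i f x" "partially_differentiable i g x"
  shows "partial_deriv i (\<lambda>y. f y + g y) x = partial_deriv i f x + partial_deriv i g x"
    "partially_differentiable i (\<lambda>y. f y + g y) x"
    "partial_deriv i (\<lambda>y. f y * g y) x = partial_deriv i f x * g x + f x * partial_deriv i g x"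
    "partially_differentiable i (\<lambda>y. f y * g y) x"
proof -
  note d = partial_deriv_DERIV[OF assms(1)] partial_deriv_DERIV[OF assms(2)]
  have "((\<lambda>t. f (x(i := t)) + g (x(i := t))) has_real_derivative
      partial_deriv i f x + partial_deriv i g x) (at (x i))" by (rule derivative_eq_intros d refl)+
  thus "partial_deriv i (\<lambda>y. f y + g y) x = partial_deriv i f x + partial_deriv i g x"
    "partially_differentiable i (\<lambda>y. f y + g y) x" using partial_deriv_eqI[of "\<lambda>y. f y + g y"] by auto
  have "((\<lambda>t. f (x(i := t)) * g (x(i := t))) has_real_derivative
      partial_deriv i f x * g x + f x * partial_deriv i g x) (at (x i))"
    by (rule derivative_eq_intros d refl)+ auto
  thus "partial_deriv i (\<lambda>y. f y * g y) x = partial_deriv i f x * g x + f x * partial_deriv i g x"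
    "partially_differentiable i (\<lambda>y. f y * g y) x" using partial_deriv_eqI[of "\<lambda>y. f y * g y"] by auto
qed

lemma partial_deriv_const: "partial_deriv i (\<lambda>y. c) x = 0" "partially_differentiable i (\<lambda>y. c) x"
  using partial_deriv_eqI[of "\<lambda>y. c" x i 0] by auto

lemma partial_deriv_coord:
  "partial_deriv i (\<lambda>y. y j) x = (if j = i then 1 else 0)" "partially_differentiable i (\<lambda>y. y j) x"
  using partial_deriv_eqI[of "\<lambda>y. y j" x i "if j = i then 1 else 0"] by (cases "j = i"; auto)+

lemma continuous_map_coord:
  "continuous_map (subtopology (Euclidean_space n) U) euclideanreal (\<lambda>y. y j)"
  by (rule continuous_map_from_subtopology)
    (auto simp: Euclidean_space_def intro!: continuous_map_from_subtopology continuous_map_product_projection)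

text \<open>The derivative of a product is a sum of products, so neither operation can be treated
  alone by \<open>smooth_Rn_coinduct\<close>; this class is closed under both and under partial
  derivatives.\<close>

inductive_set poly_closure :: "nat \<Rightarrow> (nat \<Rightarrow> real) set \<Rightarrow> ((nat \<Rightarrow> real) \<Rightarrow> real) set"
  for n U where
    "smooth_Rn n U f \<Longrightarrow> f \<in> poly_closure n U"
  | "(\<lambda>x. c) \<in> poly_closure n U"
  | "(\<lambda>x. x j) \<in> poly_closure n U"
  | "f \<in> poly_closure n U \<Longrightarrow> g \<in> poly_closure n U \<Longrightarrow> (\<lambda>x. f x + g x) \<in> poly_closure n U"
  | "f \<in> poly_closure n U \<Longrightarrow> g \<in> poly_closure n U \<Longrightarrow> (\<lambda>x. f x * g x) \<in> poly_closure n U"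

lemma poly_closure_smooth:
  assumes U: "opn n U" and f: "f \<in> poly_closure n U"
  shows "smooth_Rn n U f"
proof (rule smooth_Rn_coinduct[OF U _ _ _ f])
  fix f assume "f \<in> poly_closure n U"
  thus "continuous_map (subtopology (Euclidean_space n) U) euclideanreal f"
    by induction (auto intro: smooth_RnD continuous_map_coord continuous_map_add continuous_map_real_mult)
next
  fix f i x assume "f \<in> poly_closure n U" "i < n" "x \<in> U"
  thus "partially_differentiable i f x"
    by induction (auto intro: smooth_RnD partial_deriv_const partial_deriv_coord partial_deriv_rules)
next
  have d: "partially_differentiable i f x" if "f \<in> poly_closure n U" "i < n" "x \<in> U" for i f x using that
    by induction (auto intro: smooth_RnD partial_deriv_const partial_deriv_coord partial_deriv_rules)
  fix f i assume "f \<in> poly_closure n U" "i < n"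
  thus "\<exists>g\<in>poly_closure n U. \<forall>x\<in>U. partial_deriv i f x = g x"
  proof induction
    case (1 f)
    thus ?case using smooth_RnD(3)[of n U f i] poly_closure.intros(1) by blast
  next
    case (2 c)
    show ?case by (rule bexI[of _ "\<lambda>x. 0"]) (simp_all add: partial_deriv_const poly_closure.intros(2))
  next
    case (3 j)
    show ?case by (rule bexI[of _ "\<lambda>x. if j = i then 1 else 0"])
        (simp_all add: partial_deriv_coord(1) poly_closure.intros(2))
  next
    case (4 f g)
    then obtain f' g' where "f' \<in> poly_closure n U" "g' \<in> poly_closure n U"
      "\<forall>x\<in>U. partial_deriv i f x = f' x" "\<forall>x\<in>U. partial_deriv i g x = g' x" by blast
    thus ?case using partial_deriv_rules(1)[OF d[OF 4(1) 4(5)] d[OF 4(2) 4(5)]]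
      by (intro bexI[of _ "\<lambda>x. f' x + g' x"]) (auto intro: poly_closure.intros)
  next
    case (5 f g)
    then obtain f' g' where "f' \<in> poly_closure n U" "g' \<in> poly_closure n U"
      "\<forall>x\<in>U. partial_deriv i f x = f' x" "\<forall>x\<in>U. partial_deriv i g x = g' x" by blast
    thus ?case using partial_deriv_rules(3)[OF d[OF 5(1) 5(5)] d[OF 5(2) 5(5)]] 5(1,2)
      by (intro bexI[of _ "\<lambda>x. f' x * g x + f x * g' x"]) (auto intro: poly_closure.intros)
  qed
qed

lemma smooth_Rn_const: "opn n U \<Longrightarrow> smooth_Rn n U (\<lambda>x. c)"
  by (rule poly_closure_smooth, assumption, rule poly_closure.intros(2))

lemma smooth_Rn_coord: "opn n U \<Longrightarrow> smooth_Rn n U (\<lambda>x. x j)"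
  by (rule poly_closure_smooth, assumption, rule poly_closure.intros(3))

lemma smooth_Rn_add:
  assumes "opn n U" "smooth_Rn n U f" "smooth_Rn n U g"
  shows "smooth_Rn n U (\<lambda>x. f x + g x)"
  by (rule poly_closure_smooth[OF assms(1)], rule poly_closure.intros(4);
      rule poly_closure.intros(1), rule assms)

lemma smooth_Rn_mult:
  assumes "opn n U" "smooth_Rn n U f" "smooth_Rn n U g"
  shows "smooth_Rn n U (\<lambda>x. f x * g x)"
  by (rule poly_closure_smooth[OF assms(1)], rule poly_closure.intros(5);
      rule poly_closure.intros(1), rule assms)

lemma smooth_Rn_minus:
  assumes U: "opn n U" and "smooth_Rn n U f"
  shows "smooth_Rn n U (\<lambda>x. - f x)"
  using smooth_Rn_mult[OF U smooth_Rn_const[OF U, of "-1"] assms(2)] by simp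

lemma smooth_Rn_diff:
  assumes U: "opn n U" and "smooth_Rn n U f" "smooth_Rn n U g"
  shows "smooth_Rn n U (\<lambda>x. f x - g x)"
  using smooth_Rn_add[OF U assms(2) smooth_Rn_minus[OF U assms(3)]] by simp

lemma smooth_Rn_sum:
  assumes U: "opn n U" and "\<And>i. i \<in> I \<Longrightarrow> smooth_Rn n U (f i)"
  shows "smooth_Rn n U (\<lambda>x. \<Sum>i\<in>I. f i x)" using assms(2)
proof (induction I rule: infinite_finite_induct)
  case (insert i I)
  thus ?case by (simp add: smooth_Rn_add[OF U])
qed (simp_all add: smooth_Rn_const[OF U])

section \<open>Directional derivatives and the symmetry of second derivatives\<close>

lemma mean_value_segment:
  fixes g g' :: "real \<Rightarrow> real"
  assumes "\<And>\<theta>. 0 \<le> \<theta> \<Longrightarrow> \<theta> \<le> 1 \<Longrightarrow> (g has_real_derivative g' (a + \<theta> * s)) (at (a + \<theta> * s))"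
  obtains \<theta> where "0 < \<theta>" "\<theta> < 1" "g (a + s) - g a = s * g' (a + \<theta> * s)"
proof -
  have "\<exists>z::real. z > 0 \<and> z < 1 \<and>
      (\<lambda>\<theta>. g (a + \<theta> * s)) 1 - (\<lambda>\<theta>. g (a + \<theta> * s)) 0 = (1 - 0) * (g' (a + z * s) * s)"
  proof (rule MVT2)
    fix z :: real assume z: "0 \<le> z" "z \<le> 1"
    have "((\<lambda>\<theta>. a + \<theta> * s) has_real_derivative s) (at z)" by (auto intro!: derivative_eq_intros)
    from DERIV_chain2[OF assms[OF z] this]
    show "((\<lambda>\<theta>. g (a + \<theta> * s)) has_real_derivative g' (a + z * s) * s) (at z)" .
  qed simp
  thus thesis using that by (auto simp: mult.commute)
qed

text \<open>\<open>Ck_Rn\<close> speaks of partial derivatives only. The increment is split into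
  moves of one coordinate at a time; the mean value theorem turns each move into a partial
  derivative at a nearby point, and continuity of the partial derivatives finishes.\<close>

lemma directional_derivative:
  assumes U: "opn n U" and x: "x \<in> U" and f: "smooth_Rn n U f"
  shows "((\<lambda>s. f (\<lambda>i. if i < n then x i + s * a i else x i)) has_real_derivative
    (\<Sum>i<n. a i * partial_deriv i f x)) (at 0)"
proof -
  have xE: "\<And>i. i \<ge> n \<Longrightarrow> x i = 0" using U x openin_subset by (fastforce simp: topspace_Euclidean_space)
  define y where "y k s = (\<lambda>i. if i < k then x i + s * a i else x i)" for k s
  \<comment> \<open>A strict bound for all components of the direction, positive even if the
    direction vanishes.\<close>
  define C where "C = (\<Sum>i<n. \<bar>a i\<bar>) + 1"
  have C: "C > 0" "\<And>i. i < n \<Longrightarrow> \<bar>a i\<bar> < C"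
  proof -
    have "0 \<le> (\<Sum>i<n. \<bar>a i\<bar>)" by (simp add: sum_nonneg)
    thus "C > 0" unfolding C_def by linarith
    show "\<bar>a i\<bar> < C" if "i < n" for i
      using member_le_sum[of i "{..<n}" "\<lambda>i. \<bar>a i\<bar>"] that by (simp add: C_def)
  qed
  have "((\<lambda>s. f (y k s)) has_real_derivative (\<Sum>i<k. a i * partial_deriv i f x)) (at 0)" if "k \<le> n" for k
    using that
  proof (induction k)
    case 0
    thus ?case by (simp add: y_def)
  next
    case (Suc k)
    hence k: "k < n" by simp
    \<comment> \<open>Telescoping: the step from \<open>k\<close> to \<open>Suc k\<close> moved
      coordinates contributes the summand of coordinate \<open>k\<close>.\<close>
    have "((\<lambda>s. f (y (Suc k) s) - f (y k s)) has_real_derivative a k * partial_deriv k f x) (at 0)"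
      unfolding DERIV_def LIM_def
    proof (intro allI impI)
      fix r :: real assume r: "r > 0"
      define e where "e = r / C"
      have e: "e > 0" using r C by (simp add: e_def)
      obtain d where d: "d > 0"
        "\<And>z. z \<in> ER n \<Longrightarrow> (\<And>i. i < n \<Longrightarrow> \<bar>z i - x i\<bar> < d) \<Longrightarrow>
          z \<in> U \<and> \<bar>partial_deriv k f z - partial_deriv k f x\<bar> < e"
        using continuous_map_Euclidean_epsilon[OF U x smooth_RnD(1)[OF smooth_RnD(3)[OF f k]] e] by blast
      show "\<exists>s>0. \<forall>h. h \<noteq> 0 \<and> dist h 0 < s \<longrightarrow>
        dist ((f (y (Suc k) (0 + h)) - f (y k (0 + h)) - (f (y (Suc k) 0) - f (y k 0))) / h)
          (a k * partial_deriv k f x) < r"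
      proof (intro exI[of _ "d / C"] conjI allI impI)
        show "d / C > 0" using d(1) C(1) by simp
        fix h :: real assume h: "h \<noteq> 0 \<and> dist h 0 < d / C"
        hence hC: "\<bar>h\<bar> * C < d" using C(1) by (simp add: dist_real_def field_simps)
        have small: "\<bar>\<theta> * (h * a i)\<bar> < d" if "0 \<le> \<theta>" "\<theta> \<le> 1" "i < n" for \<theta> i
        proof -
          have "\<bar>\<theta> * (h * a i)\<bar> = \<theta> * (\<bar>h\<bar> * \<bar>a i\<bar>)" using that by (simp add: abs_mult)
          also have "... \<le> 1 * (\<bar>h\<bar> * C)" using that C by (intro mult_mono) (auto simp: less_imp_le)
          finally show ?thesis using hC by linarith
        qed
        \<comment> \<open>The first \<open>k\<close> coordinates are already fully moved, coordinate
          \<open>k\<close> only by the fraction \<theta>.\<close>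
        define z where "z \<theta> = (y k h)(k := x k + \<theta> * (h * a k))" for \<theta>
        have zU: "z \<theta> \<in> U \<and> \<bar>partial_deriv k f (z \<theta>) - partial_deriv k f x\<bar> < e" if "0 \<le> \<theta>" "\<theta> \<le> 1" for \<theta>
        proof (rule d(2))
          show "z \<theta> \<in> ER n" using k xE by (auto simp: topspace_Euclidean_space z_def y_def)
          show "\<bar>z \<theta> i - x i\<bar> < d" if "i < n" for i
            using small[OF \<open>0 \<le> \<theta>\<close> \<open>\<theta> \<le> 1\<close> that] small[of 1 i] that d(1) by (auto simp: z_def y_def)
        qed
        obtain \<theta> where \<theta>: "0 < \<theta>" "\<theta> < 1"
          "f ((y k h)(k := x k + h * a k)) - f ((y k h)(k := x k)) = (h * a k) * partial_deriv k f (z \<theta>)"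
        proof (rule mean_value_segment[of "\<lambda>t. f ((y k h)(k := t))"
              "\<lambda>t. partial_deriv k f ((y k h)(k := t))" "x k" "h * a k"])
          fix \<theta> :: real assume "0 \<le> \<theta>" "\<theta> \<le> 1"
          hence "z \<theta> \<in> U" using zU by blast
          from partial_deriv_DERIV[OF smooth_RnD(2)[OF f k this]]
          show "((\<lambda>t. f ((y k h)(k := t))) has_real_derivative
              partial_deriv k f ((y k h)(k := x k + \<theta> * (h * a k)))) (at (x k + \<theta> * (h * a k)))"
            by (simp add: z_def)
        qed (use that in \<open>auto simp: z_def\<close>)
        have 1: "(y k h)(k := x k + h * a k) = y (Suc k) h" "(y k h)(k := x k) = y k h"
          by (auto simp: y_def fun_eq_iff less_Suc_eq)
        have 2: "y (Suc k) 0 = y k 0" by (auto simp: y_def)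
        have "(f (y (Suc k) (0 + h)) - f (y k (0 + h)) - (f (y (Suc k) 0) - f (y k 0))) / h =
            a k * partial_deriv k f (z \<theta>)" using \<theta>(3) h by (simp add: 1 2)
        hence "dist ((f (y (Suc k) (0 + h)) - f (y k (0 + h)) - (f (y (Suc k) 0) - f (y k 0))) / h)
          (a k * partial_deriv k f x) = \<bar>a k\<bar> * \<bar>partial_deriv k f (z \<theta>) - partial_deriv k f x\<bar>"
          by (simp add: dist_real_def abs_mult flip: right_diff_distrib)
        also have "... \<le> \<bar>a k\<bar> * e" using zU[of \<theta>] \<theta> by (intro mult_left_mono) auto
        also have "... < C * e" using C(2)[OF k] e by (intro mult_strict_right_mono) auto
        also have "C * e = r" using C(1) by (simp add: e_def)
        finally show "dist ((f (y (Suc k) (0 + h)) - f (y k (0 + h)) - (f (y (Suc k) 0) - f (y k 0))) / h)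
          (a k * partial_deriv k f x) < r" .
      qed
    qed
    from DERIV_add[OF Suc.IH this] Suc.prems show ?case by simp
  qed
  from this[of n] show ?thesis by (simp add: y_def)
qed

text \<open>The mixed difference over a square is an increment in direction \<open>i\<close> of an
  increment in direction \<open>j\<close>; one mean value theorem in each direction evaluates it.
  Its left-hand side does not depend on the order of \<open>i\<close> and \<open>j\<close>, which is
  the whole point.\<close>

lemma second_difference:
  assumes U: "opn n U" and f: "smooth_Rn n U f" and ij: "i < n" "j < n" "i \<noteq> j"
    and box: "\<And>a b. 0 \<le> a \<Longrightarrow> a \<le> s \<Longrightarrow> 0 \<le> b \<Longrightarrow> b \<le> s \<Longrightarrow> x(i := x i + a, j := x j + b) \<in> U"
    and s: "s > 0"
  obtains a b where "0 \<le> a" "a \<le> s" "0 \<le> b" "b \<le> s"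
    "f (x(i := x i + s, j := x j + s)) - f (x(i := x i + s)) - f (x(j := x j + s)) + f x =
      s * s * partial_deriv j (partial_deriv i f) (x(i := x i + a, j := x j + b))"
proof -
  let ?p = "\<lambda>a b. x(i := a, j := b)"
  have bs: "0 \<le> \<theta> * s" "\<theta> * s \<le> s" if "0 \<le> \<theta>" "\<theta> \<le> 1" for \<theta> using that s by (auto simp: mult_left_le_one_le)
  obtain \<theta> where \<theta>: "0 < \<theta>" "\<theta> < 1"
    "(f (?p (x i + s) (x j + s)) - f (?p (x i + s) (x j))) - (f (?p (x i) (x j + s)) - f (?p (x i) (x j))) =
      s * (partial_deriv i f (?p (x i + \<theta> * s) (x j + s)) - partial_deriv i f (?p (x i + \<theta> * s) (x j)))"
  proof (rule mean_value_segment[of "\<lambda>t. f (?p t (x j + s)) - f (?p t (x j))"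
      "\<lambda>t. partial_deriv i f (?p t (x j + s)) - partial_deriv i f (?p t (x j))" "x i" s])
    fix \<theta> :: real assume \<theta>: "0 \<le> \<theta>" "\<theta> \<le> 1"
    have "((\<lambda>t. f (?p t (x j + b))) has_real_derivative partial_deriv i f (?p (x i + \<theta> * s) (x j + b)))
        (at (x i + \<theta> * s))" if "0 \<le> b" "b \<le> s" for b
      using partial_deriv_DERIV[OF smooth_RnD(2)[OF f ij(1) box[OF bs[OF \<theta>] that]]] ij(3)
      by (simp add: fun_upd_twist)
    from DERIV_diff[OF this[of s] this[of 0]]
    show "((\<lambda>t. f (?p t (x j + s)) - f (?p t (x j))) has_real_derivative
       partial_deriv i f (?p (x i + \<theta> * s) (x j + s)) - partial_deriv i f (?p (x i + \<theta> * s) (x j)))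
       (at (x i + \<theta> * s))" using s by simp
  qed (use that in blast)
  obtain \<tau> where \<tau>: "0 < \<tau>" "\<tau> < 1"
    "partial_deriv i f (?p (x i + \<theta> * s) (x j + s)) - partial_deriv i f (?p (x i + \<theta> * s) (x j)) =
      s * partial_deriv j (partial_deriv i f) (?p (x i + \<theta> * s) (x j + \<tau> * s))"
  proof (rule mean_value_segment[of "\<lambda>t. partial_deriv i f (?p (x i + \<theta> * s) t)"
      "\<lambda>t. partial_deriv j (partial_deriv i f) (?p (x i + \<theta> * s) t)" "x j" s])
    fix \<tau> :: real assume \<tau>: "0 \<le> \<tau>" "\<tau> \<le> 1"
    have \<theta>': "0 \<le> \<theta>" "\<theta> \<le> 1" using \<theta> by auto
    show "((\<lambda>t. partial_deriv i f (?p (x i + \<theta> * s) t)) has_real_derivative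
        partial_deriv j (partial_deriv i f) (?p (x i + \<theta> * s) (x j + \<tau> * s))) (at (x j + \<tau> * s))"
      using partial_deriv_DERIV[OF smooth_RnD(2)[OF smooth_RnD(3)[OF f ij(1)] ij(2)
        box[OF bs[OF \<theta>'] bs[OF \<tau>]]]] ij(3) by simp
  qed (use that in blast)
  show thesis
  proof (rule that[of "\<theta> * s" "\<tau> * s"])
    show "f (x(i := x i + s, j := x j + s)) - f (x(i := x i + s)) - f (x(j := x j + s)) + f x =
      s * s * partial_deriv j (partial_deriv i f) (x(i := x i + \<theta> * s, j := x j + \<tau> * s))"
      using \<theta>(3) \<tau>(3) ij(3) by (simp add: fun_upd_idem)
  qed (use bs[of \<theta>] bs[of \<tau>] \<theta> \<tau> in auto)
qed

lemma partial_deriv_commute: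
  assumes U: "opn n U" and x: "x \<in> U" and f: "smooth_Rn n U f"
    and ij: "i < n" "j < n"
  shows "partial_deriv i (partial_deriv j f) x = partial_deriv j (partial_deriv i f) x"
proof (cases "i = j")
  case False
  have xE: "\<And>i. i \<ge> n \<Longrightarrow> x i = 0" using U x openin_subset by (fastforce simp: topspace_Euclidean_space)
  let ?P = "partial_deriv j (partial_deriv i f)" and ?Q = "partial_deriv i (partial_deriv j f)"
  have "\<bar>?P x - ?Q x\<bar> < 2 * e" if e: "e > 0" for e
  proof -
    obtain d1 where d1: "d1 > 0"
      "\<And>z. z \<in> ER n \<Longrightarrow> (\<And>i. i < n \<Longrightarrow> \<bar>z i - x i\<bar> < d1) \<Longrightarrow> z \<in> U \<and> \<bar>?P z - ?P x\<bar> < e"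
      using continuous_map_Euclidean_epsilon[OF U x smooth_RnD(1)[OF smooth_RnD(3)[OF smooth_RnD(3)[OF f]]] e] ij
      by metis
    obtain d2 where d2: "d2 > 0"
      "\<And>z. z \<in> ER n \<Longrightarrow> (\<And>i. i < n \<Longrightarrow> \<bar>z i - x i\<bar> < d2) \<Longrightarrow> z \<in> U \<and> \<bar>?Q z - ?Q x\<bar> < e"
      using continuous_map_Euclidean_epsilon[OF U x smooth_RnD(1)[OF smooth_RnD(3)[OF smooth_RnD(3)[OF f]]] e] ij
      by metis
    \<comment> \<open>Half of the smaller radius keeps the closed square of side \<open>s\<close>
      inside both boxes.\<close>
    define s where "s = min d1 d2 / 2"
    have s: "s > 0" "s < d1" "s < d2" using d1(1) d2(1) by (auto simp: s_def)
    have near: "x(i := x i + a, j := x j + b) \<in> U \<and> \<bar>?P (x(i := x i + a, j := x j + b)) - ?P x\<bar> < e \<and>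
        \<bar>?Q (x(i := x i + a, j := x j + b)) - ?Q x\<bar> < e" if "0 \<le> a" "a \<le> s" "0 \<le> b" "b \<le> s" for a b
    proof -
      have "x(i := x i + a, j := x j + b) \<in> ER n" using xE ij by (auto simp: topspace_Euclidean_space)
      thus ?thesis using d1 d2 that s by force
    qed
    obtain a b where ab: "0 \<le> a" "a \<le> s" "0 \<le> b" "b \<le> s"
      "f (x(i := x i + s, j := x j + s)) - f (x(i := x i + s)) - f (x(j := x j + s)) + f x =
      s * s * ?P (x(i := x i + a, j := x j + b))"
      using second_difference[OF U f ij False _ s(1)] near by (metis (no_types, lifting))
    obtain a' b' where ab': "0 \<le> a'" "a' \<le> s" "0 \<le> b'" "b' \<le> s"
      "f (x(j := x j + s, i := x i + s)) - f (x(j := x j + s)) - f (x(i := x i + s)) + f x =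
      s * s * ?Q (x(j := x j + a', i := x i + b'))"
    proof (rule second_difference[OF U f ij(2,1) False[symmetric] _ s(1)])
      show "x(j := x j + a, i := x i + b) \<in> U" if "0 \<le> a" "a \<le> s" "0 \<le> b" "b \<le> s" for a b
        using near[OF that(3,4,1,2)] fun_upd_twist[OF False[symmetric], of x] by simp
    qed blast
    \<comment> \<open>The same second difference has been evaluated in both orders.\<close>
    have "s * s * ?P (x(i := x i + a, j := x j + b)) = s * s * ?Q (x(i := x i + b', j := x j + a'))"
      using ab(5) ab'(5)[unfolded fun_upd_twist[OF False[symmetric], of x]] by linarith
    hence "?P (x(i := x i + a, j := x j + b)) = ?Q (x(i := x i + b', j := x j + a'))" using s(1) by simp
    thus ?thesis using near[OF ab(1-4)] near[OF ab'(3,4,1,2)] by linarith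
  qed
  hence "\<not> \<bar>?P x - ?Q x\<bar> > 0" by (metis field_sum_of_halves less_irrefl mult_2 half_gt_zero)
  thus ?thesis by simp
qed simp

section \<open>Linear substitutions and exponentials of linear forms\<close>

definition lin_map :: "nat \<Rightarrow> (nat \<Rightarrow> nat \<Rightarrow> real) \<Rightarrow> (nat \<Rightarrow> real) \<Rightarrow> nat \<Rightarrow> real"
  where "lin_map n F x = (\<lambda>i. if i < n then \<Sum>j<n. F i j * x j else 0)"

lemma lin_map_Euclidean: "lin_map n F x \<in> ER n" by (simp add: lin_map_def topspace_Euclidean_space)

lemma lin_map_upd:
  assumes "j < n"
  shows "lin_map n F (x(j := t)) =
    (\<lambda>i. if i < n then lin_map n F x i + (t - x j) * F i j else lin_map n F x i)"
proof
  fix i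
  have "(\<Sum>k<n. F i k * (x(j := t)) k) = (\<Sum>k<n. F i k * x k + (if k = j then (t - x j) * F i j else 0))"
    by (intro sum.cong) (auto simp: algebra_simps)
  also have "... = (\<Sum>k<n. F i k * x k) + (t - x j) * F i j" using assms by (simp add: sum.distrib)
  finally show "lin_map n F (x(j := t)) i =
      (if i < n then lin_map n F x i + (t - x j) * F i j else lin_map n F x i)" by (simp add: lin_map_def)
qed

lemma continuous_map_lin_map: "continuous_map (Euclidean_space n) (Euclidean_space n) (lin_map n F)"
proof -
  have "continuous_map (Euclidean_space n) euclideanreal (\<lambda>x. \<Sum>j<n. F i j * x j)" for i
    using continuous_map_coord[of n "ER n"]
    by (intro continuous_map_sum) (auto intro!: continuous_map_real_mult simp: subtopology_topspace)
  thus ?thesis unfolding lin_map_def by (simp add: continuous_map_componentwise_Euclidean_space)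
qed

lemma partial_deriv_lin_map:
  assumes U: "opn n U" and f: "smooth_Rn n U f" and x: "lin_map n F x \<in> U"
    and j: "j < n"
  shows "partial_deriv j (\<lambda>y. f (lin_map n F y)) x = (\<Sum>i<n. F i j * partial_deriv i f (lin_map n F x))"
    "partially_differentiable j (\<lambda>y. f (lin_map n F y)) x"
proof -
  let ?L = "lin_map n F x"
  have "((\<lambda>s. f (\<lambda>i. if i < n then ?L i + s * F i j else ?L i)) has_real_derivative
      (\<Sum>i<n. F i j * partial_deriv i f ?L)) (at (x j - x j))"
    using directional_derivative[OF U x f, of "\<lambda>i. F i j"] by simp
  moreover have "((\<lambda>t. t - x j) has_real_derivative 1) (at (x j))" by (auto intro!: derivative_eq_intros)
  ultimately have "((\<lambda>t. f (\<lambda>i. if i < n then ?L i + (t - x j) * F i j else ?L i)) has_real_derivative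
      (\<Sum>i<n. F i j * partial_deriv i f ?L) * 1) (at (x j))" by (rule DERIV_chain2)
  hence d: "((\<lambda>t. f (lin_map n F (x(j := t)))) has_real_derivative
      (\<Sum>i<n. F i j * partial_deriv i f ?L)) (at (x j))" by (simp add: lin_map_upd[OF j])
  show "partial_deriv j (\<lambda>y. f (lin_map n F y)) x = (\<Sum>i<n. F i j * partial_deriv i f (lin_map n F x))"
    "partially_differentiable j (\<lambda>y. f (lin_map n F y)) x"
    using partial_deriv_eqI[of "\<lambda>y. f (lin_map n F y)", OF d] by auto
qed

text \<open>By the chain rule a partial derivative of a pullback is a combination, with constant
  coefficients, of pullbacks of partial derivatives; hence the closure under sums and scalar
  multiples.\<close>

inductive_set lin_pullbacks :: "nat \<Rightarrow> (nat \<Rightarrow> nat \<Rightarrow> real) \<Rightarrow> (nat \<Rightarrow> real) set \<Rightarrow> ((nat \<Rightarrow> real) \<Rightarrow> real) set"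
  for n F U where
    base: "smooth_Rn n U f \<Longrightarrow> (\<lambda>x. f (lin_map n F x)) \<in> lin_pullbacks n F U"
  | zero: "(\<lambda>x. 0) \<in> lin_pullbacks n F U"
  | add: "f \<in> lin_pullbacks n F U \<Longrightarrow> g \<in> lin_pullbacks n F U \<Longrightarrow> (\<lambda>x. f x + g x) \<in> lin_pullbacks n F U"
  | scale: "f \<in> lin_pullbacks n F U \<Longrightarrow> (\<lambda>x. c * f x) \<in> lin_pullbacks n F U"

lemma lin_pullbacks_sum:
  assumes "\<And>i. i \<in> I \<Longrightarrow> f i \<in> lin_pullbacks n F U"
  shows "(\<lambda>x. \<Sum>i\<in>I. f i x) \<in> lin_pullbacks n F U" using assms
proof (induction I rule: infinite_finite_induct)
  case (insert i I)
  hence "(\<lambda>x. f i x + (\<Sum>i\<in>I. f i x)) \<in> lin_pullbacks n F U" by (intro lin_pullbacks.add) auto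
  thus ?case using insert by simp
qed (simp_all add: lin_pullbacks.zero)

lemma smooth_Rn_lin_map:
  assumes U: "opn n U" and f: "smooth_Rn n U f"
    and V: "opn n V" and VU: "\<And>x. x \<in> V \<Longrightarrow> lin_map n F x \<in> U"
  shows "smooth_Rn n V (\<lambda>x. f (lin_map n F x))"
proof (rule smooth_Rn_coinduct[OF V])
  show "(\<lambda>x. f (lin_map n F x)) \<in> lin_pullbacks n F U" using f by (rule lin_pullbacks.base)
next
  fix f assume "f \<in> lin_pullbacks n F U"
  thus "continuous_map (subtopology (Euclidean_space n) V) euclideanreal f"
  proof induction
    case (base f)
    have "continuous_map (subtopology (Euclidean_space n) V) (subtopology (Euclidean_space n) U) (lin_map n F)"
      using VU continuous_map_from_subtopology[OF continuous_map_lin_map]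
      by (auto simp: continuous_map_in_subtopology)
    from continuous_map_compose[OF this smooth_RnD(1)[OF base]] show ?case by (simp add: o_def)
  next
    case zero
    show ?case by simp
  next
    case (add f g)
    thus ?case by (intro continuous_map_add)
  next
    case (scale f c)
    thus ?case by (intro continuous_map_real_mult) auto
  qed
next
  have d: "partially_differentiable i f x" if "f \<in> lin_pullbacks n F U" "i < n" "x \<in> V" for f i x using that
  proof induction
    case (base f)
    thus ?case using partial_deriv_lin_map(2)[OF U base(1) VU] by blast
  next
    case zero
    show ?case by (rule partial_deriv_const)
  next
    case (add f g)
    thus ?case by (intro partial_deriv_rules) auto
  next
    case (scale f c)
    thus ?case by (intro partial_deriv_rules(4)[OF partial_deriv_const(2)]) auto
  qed
  thus "partially_differentiable i f x" if "f \<in> lin_pullbacks n F U" "i < n" "x \<in> V" for f i x using that .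
  fix f i assume "f \<in> lin_pullbacks n F U" and i: "i < n"
  thus "\<exists>g\<in>lin_pullbacks n F U. \<forall>x\<in>V. partial_deriv i f x = g x"
  proof induction
    case (base f)
    have "(\<lambda>x. \<Sum>k<n. F k i * partial_deriv k f (lin_map n F x)) \<in> lin_pullbacks n F U"
      by (rule lin_pullbacks_sum, rule lin_pullbacks.scale, rule lin_pullbacks.base,
          rule smooth_RnD(3)[OF base(1)]) simp
    thus ?case by (rule bexI[rotated]) (use partial_deriv_lin_map(1)[OF U base(1) VU i] in blast)
  next
    case zero
    show ?case by (rule bexI[OF _ lin_pullbacks.zero]) (simp add: partial_deriv_const)
  next
    case (add f g)
    then obtain f' g' where fg: "f' \<in> lin_pullbacks n F U" "g' \<in> lin_pullbacks n F U"
      "\<forall>x\<in>V. partial_deriv i f x = f' x" "\<forall>x\<in>V. partial_deriv i g x = g' x" by blast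
    show ?case by (rule bexI[OF _ lin_pullbacks.add[OF fg(1,2)]])
        (use fg(3,4) partial_deriv_rules(1)[OF d[OF add(1) i] d[OF add(2) i]] in simp)
  next
    case (scale f c)
    then obtain f' where f': "f' \<in> lin_pullbacks n F U" "\<forall>x\<in>V. partial_deriv i f x = f' x" by blast
    show ?case by (rule bexI[OF _ lin_pullbacks.scale[OF f'(1), of c]])
        (use f'(2) partial_deriv_rules(3)[OF partial_deriv_const(2) d[OF scale(1) i]]
          partial_deriv_const(1) in simp)
  qed
qed

text \<open>These functions are the building blocks of \<open>weight_flow.K\<close>: exponentiating
  commuting semisimple elements only produces exponents that are linear in the coordinates.\<close>

lemma partial_deriv_exp:
  assumes "i < n"
  shows "partial_deriv i (\<lambda>v. Re (c * exp (\<Sum>j<n. of_real (v j) * l j))) x =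
      Re (c * l i * exp (\<Sum>j<n. of_real (x j) * l j))"
    "partially_differentiable i (\<lambda>v. Re (c * exp (\<Sum>j<n. of_real (v j) * l j))) x"
proof -
  have eq: "(\<Sum>j<n. of_real ((x(i := t)) j) * l j) = (\<Sum>j<n. of_real (x j) * l j) + of_real (t - x i) * l i" for t
  proof -
    have "(\<Sum>j<n. of_real ((x(i := t)) j) * l j) =
        (\<Sum>j<n. of_real (x j) * l j + (if j = i then of_real (t - x i) * l i else 0))"
      by (intro sum.cong) (auto simp: algebra_simps)
    thus ?thesis using assms by (simp add: sum.distrib)
  qed
  let ?S = "\<Sum>j<n. of_real (x j) * l j"
  have "((\<lambda>z. c * exp (?S + (z - of_real (x i)) * l i)) has_field_derivative
      c * l i * exp ?S) (at (of_real (x i)))" by (auto intro!: derivative_eq_intros)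
  from has_vector_derivative_real_field[OF this]
  have "((\<lambda>t. c * exp (?S + (of_real t - of_real (x i)) * l i)) has_vector_derivative
      c * l i * exp ?S) (at (x i))" by (simp add: o_def)
  from bounded_linear.has_vector_derivative[OF bounded_linear_Re this]
  have "((\<lambda>t. Re (c * exp (?S + of_real (t - x i) * l i))) has_real_derivative Re (c * l i * exp ?S)) (at (x i))"
    by (simp add: has_real_derivative_iff_has_vector_derivative)
  hence d: "((\<lambda>t. Re (c * exp (\<Sum>j<n. of_real ((x(i := t)) j) * l j))) has_real_derivative
      Re (c * l i * exp ?S)) (at (x i))" by (simp only: eq)
  show "partial_deriv i (\<lambda>v. Re (c * exp (\<Sum>j<n. of_real (v j) * l j))) x =
      Re (c * l i * exp (\<Sum>j<n. of_real (x j) * l j))"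
    "partially_differentiable i (\<lambda>v. Re (c * exp (\<Sum>j<n. of_real (v j) * l j))) x"
    using partial_deriv_eqI[of "\<lambda>v. Re (c * exp (\<Sum>j<n. of_real (v j) * l j))", OF d] by auto
qed

text \<open>A partial derivative multiplies the constant \<open>c\<close> by \<open>l i\<close> and
  changes nothing else, so letting \<open>c\<close> vary gives a closed family.\<close>

lemma smooth_Rn_exp:
  assumes U: "opn n U"
  shows "smooth_Rn n U (\<lambda>v. Re (c * exp (\<Sum>j<n. of_real (v j) * l j)))"
proof (rule smooth_Rn_coinduct[OF U, of "{\<lambda>v. Re (c * exp (\<Sum>j<n. of_real (v j) * l j)) | c. True}"])
  fix f assume "f \<in> {\<lambda>v. Re (c * exp (\<Sum>j<n. of_real (v j) * l j)) | c. True}"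
  then obtain c where f: "f = (\<lambda>v. Re (c * exp (\<Sum>j<n. of_real (v j) * l j)))" by blast
  have "continuous_map (subtopology (Euclidean_space n) U) euclideanreal (\<lambda>v. \<Sum>j<n. v j * Re (l j))"
    "continuous_map (subtopology (Euclidean_space n) U) euclideanreal (\<lambda>v. \<Sum>j<n. v j * Im (l j))"
    by (intro continuous_map_sum continuous_map_real_mult continuous_map_coord; simp)+
  from continuous_map_pairedI[OF this]
  have *: "continuous_map (subtopology (Euclidean_space n) U) euclidean
       (\<lambda>v. (\<Sum>j<n. v j * Re (l j), \<Sum>j<n. v j * Im (l j)))" by (simp only: prod_topology_euclidean)
  have "continuous_on UNIV (\<lambda>p. Re (c * exp (Complex (fst p) (snd p))))"
    by (auto simp: exp_eq_polar Complex_eq intro!: continuous_intros)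
  hence "continuous_map euclidean euclideanreal (\<lambda>p. Re (c * exp (Complex (fst p) (snd p))))" by simp
  from continuous_map_compose[OF * this]
  have c: "continuous_map (subtopology (Euclidean_space n) U) euclidean
      (\<lambda>v. Re (c * exp (Complex (\<Sum>j<n. v j * Re (l j)) (\<Sum>j<n. v j * Im (l j)))))" by (simp add: o_def)
  have "(\<Sum>j<n. of_real (v j) * l j) = Complex (\<Sum>j<n. v j * Re (l j)) (\<Sum>j<n. v j * Im (l j))" for v
    by (simp add: complex_eq_iff Re_sum Im_sum)
  thus "continuous_map (subtopology (Euclidean_space n) U) euclideanreal f" using c by (simp add: f)
  show "partially_differentiable i f x" if "i < n" for i x
    unfolding f by (rule partial_deriv_exp(2)[OF that])
  show "\<exists>g\<in>{\<lambda>v. Re (c * exp (\<Sum>j<n. of_real (v j) * l j)) | c. True}. \<forall>x\<in>U. partial_deriv i f x = g x"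
    if "i < n" for i unfolding f partial_deriv_exp(1)[OF that]
    by (intro bexI[of _ "\<lambda>x. Re (c * l i * exp (\<Sum>j<n. of_real (x j) * l j))"] ballI refl
        CollectI exI[of _ "c * l i"] conjI TrueI)
qed auto

section \<open>Locality of smoothness and restriction to open submanifolds\<close>

definition proper_charts :: "'a manifold \<Rightarrow> bool"
  where "proper_charts M \<longleftrightarrow> (\<forall>V \<phi>. (V, \<phi>) \<in> charts M \<longrightarrow> openM M V \<and> inj_on \<phi> V \<and>
    (\<forall>U. openM M U \<longrightarrow> openin (Euclidean_space (mdim M)) (\<phi> ` (U \<inter> V))))"

lemma proper_chartsD:
  assumes "proper_charts M" "(V, \<phi>) \<in> charts M"
  shows "openM M V" "inj_on \<phi> V"
    "openM M U \<Longrightarrow> openin (Euclidean_space (mdim M)) (\<phi> ` (U \<inter> V))"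
  using assms by (auto simp: proper_charts_def)

lemma smooth_manifold_proper_charts:
  assumes "smooth_manifold M"
  shows "proper_charts M" unfolding proper_charts_def
proof (intro allI impI conjI)
  fix V \<phi> assume c: "(V, \<phi>) \<in> charts M"
  have V: "openM M V" "openin (Euclidean_space (mdim M)) (\<phi> ` V)"
    "homeomorphic_map (subtopology (mtop M) V) (subtopology (Euclidean_space (mdim M)) (\<phi> ` V)) \<phi>"
    using assms c unfolding smooth_manifold_def by blast+
  show "openM M V" by fact
  have t: "topspace (subtopology (mtop M) V) = V" using openin_subset[OF V(1)] by (simp add: Int_absorb1)
  show "inj_on \<phi> V" using V(3) t by (metis homeomorphic_imp_injective_map)
  fix U assume U: "openM M U"
  have "openin (subtopology (mtop M) V) (U \<inter> V)" using U openin_subtopology by blast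
  hence "openin (subtopology (Euclidean_space (mdim M)) (\<phi> ` V)) (\<phi> ` (U \<inter> V))"
    using V(3) homeomorphic_imp_open_map open_map_def by blast
  thus "openin (Euclidean_space (mdim M)) (\<phi> ` (U \<inter> V))" using V(2) openin_trans_full by blast
qed

lemma smooth_on_cong:
  assumes M: "proper_charts M" and fg: "\<And>x. x \<in> U \<Longrightarrow> f x = g x"
  shows "smooth_on M U f \<longleftrightarrow> smooth_on M U g"
proof -
  have "smooth_Rn (mdim M) (\<phi> ` (U \<inter> V)) (\<lambda>w. f (inv_into V \<phi> w)) \<longleftrightarrow>
      smooth_Rn (mdim M) (\<phi> ` (U \<inter> V)) (\<lambda>w. g (inv_into V \<phi> w))" if "(V, \<phi>) \<in> charts M" "openM M U" for V \<phi>
    by (rule smooth_Rn_cong[OF proper_chartsD(3)[OF M that]])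
      (use fg proper_chartsD(2)[OF M that(1)] in auto)
  thus ?thesis unfolding smooth_on_def by fast
qed

lemma smooth_on_subset:
  assumes "smooth_on M U f" "V \<subseteq> U" "openM M V"
  shows "smooth_on M V f"
proof -
  have "smooth_Rn (mdim M) (\<phi> ` (V \<inter> W)) (\<lambda>w. f (inv_into W \<phi> w))" if "(W, \<phi>) \<in> charts M" for W \<phi>
  proof (rule smooth_Rn_subset)
    show "smooth_Rn (mdim M) (\<phi> ` (U \<inter> W)) (\<lambda>w. f (inv_into W \<phi> w))"
      using assms(1) that unfolding smooth_on_def by blast
    show "\<phi> ` (V \<inter> W) \<subseteq> \<phi> ` (U \<inter> W)" using assms(2) by blast
  qed
  thus ?thesis using assms(3) unfolding smooth_on_def by blast
qed

lemma openin_submanifold: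
  "openM M B \<Longrightarrow> openin (mtop (open_submanifold M B)) U \<longleftrightarrow> U \<subseteq> B \<and> openM M U"
  by (auto simp: open_submanifold_def openin_open_subtopology)

lemma topspace_submanifold:
  "openM M B \<Longrightarrow> topspace (mtop (open_submanifold M B)) = B"
  using openin_subset[of "mtop M" B] by (simp add: open_submanifold_def Int_absorb1)

lemma ball_charts_submanifold:
  "(\<forall>(V, \<phi>)\<in>charts (open_submanifold M B). P V \<phi>) \<longleftrightarrow> (\<forall>V \<phi>. (V, \<phi>) \<in> charts M \<longrightarrow> P (V \<inter> B) \<phi>)"
  unfolding open_submanifold_def by auto

lemma inv_into_Int:
  assumes "inj_on f A" "x \<in> A \<inter> B"
  shows "inv_into (A \<inter> B) f (f x) = x" "inv_into A f (f x) = x"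
  using assms inj_on_subset[OF assms(1), of "A \<inter> B"] by (simp_all add: inv_into_f_f)

lemma smooth_on_submanifold:
  assumes M: "proper_charts M" and B: "openM M B"
  shows "smooth_on (open_submanifold M B) U f \<longleftrightarrow> U \<subseteq> B \<and> smooth_on M U f"
proof (cases "U \<subseteq> B \<and> openM M U")
  case True
  have eq: "smooth_Rn (mdim M) (\<phi> ` (U \<inter> (V \<inter> B))) (\<lambda>w. f (inv_into (V \<inter> B) \<phi> w)) \<longleftrightarrow>
      smooth_Rn (mdim M) (\<phi> ` (U \<inter> V)) (\<lambda>w. f (inv_into V \<phi> w))" if c: "(V, \<phi>) \<in> charts M" for V \<phi>
  proof -
    have "U \<inter> (V \<inter> B) = U \<inter> V" using True by blast
    moreover have "smooth_Rn (mdim M) (\<phi> ` (U \<inter> V)) (\<lambda>w. f (inv_into (V \<inter> B) \<phi> w)) \<longleftrightarrow>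
        smooth_Rn (mdim M) (\<phi> ` (U \<inter> V)) (\<lambda>w. f (inv_into V \<phi> w))"
    proof (rule smooth_Rn_cong[OF proper_chartsD(3)[OF M c]])
      fix w assume "w \<in> \<phi> ` (U \<inter> V)"
      then obtain x where "w = \<phi> x" "x \<in> V \<inter> B" using True by blast
      thus "f (inv_into (V \<inter> B) \<phi> w) = f (inv_into V \<phi> w)"
        using inv_into_Int[OF proper_chartsD(2)[OF M c], of x B] by simp
    qed (use True in blast)
    ultimately show ?thesis by simp
  qed
  have "smooth_on (open_submanifold M B) U f \<longleftrightarrow> (\<forall>V \<phi>. (V, \<phi>) \<in> charts M \<longrightarrow>
        smooth_Rn (mdim M) (\<phi> ` (U \<inter> (V \<inter> B))) (\<lambda>w. f (inv_into (V \<inter> B) \<phi> w)))"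
    using True openin_submanifold[OF B, of U] unfolding smooth_on_def ball_charts_submanifold
    by (simp add: open_submanifold_def)
  also have "... \<longleftrightarrow> (\<forall>V \<phi>. (V, \<phi>) \<in> charts M \<longrightarrow> smooth_Rn (mdim M) (\<phi> ` (U \<inter> V)) (\<lambda>w. f (inv_into V \<phi> w)))"
    using eq by blast
  also have "... \<longleftrightarrow> smooth_on M U f" using True by (auto simp: smooth_on_def)
  finally show ?thesis using True by blast
next
  case False
  thus ?thesis using openin_submanifold[OF B, of U] by (auto simp: smooth_on_def)
qed

lemma smooth_near_local:
  assumes M: "proper_charts M" and Q: "openM M Q" "x \<in> Q" "\<And>y. y \<in> Q \<Longrightarrow> f y = g y"
    and f: "smooth_near M x f"
  shows "smooth_near M x g"
proof -
  obtain U where U: "x \<in> U" "smooth_on M U f" using f by (auto simp: smooth_near_def)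
  have "openM M (U \<inter> Q)" using U Q by (auto simp: smooth_on_def intro: openin_Int)
  hence "smooth_on M (U \<inter> Q) f" using smooth_on_subset[OF U(2)] by blast
  hence "smooth_on M (U \<inter> Q) g" using smooth_on_cong[OF M, of "U \<inter> Q" f g] Q(3) by blast
  thus ?thesis unfolding smooth_near_def using U(1) Q(2) by blast
qed

text \<open>The default value 0 on functions that are not smooth near \<open>x\<close> is harmless:
  functions that agree near \<open>x\<close> are smooth there together, and partial derivatives are
  local.\<close>

lemma chart_vector_local:
  assumes M: "proper_charts M" and c: "(V, \<phi>) \<in> charts M" "x \<in> V"
    and Q: "openM M Q" "x \<in> Q" "\<And>y. y \<in> Q \<Longrightarrow> f y = g y"
  shows "chart_vector M V \<phi> x w f = chart_vector M V \<phi> x w g"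
proof -
  have "smooth_near M x f \<longleftrightarrow> smooth_near M x g"
  proof
    show "smooth_near M x f" if "smooth_near M x g"
      by (rule smooth_near_local[OF M Q(1,2) _ that]) (simp add: Q(3))
    show "smooth_near M x g" if "smooth_near M x f"
      by (rule smooth_near_local[OF M Q(1,2) _ that]) (simp add: Q(3))
  qed
  moreover have "partial_deriv i (\<lambda>y. f (inv_into V \<phi> y)) (\<phi> x) = partial_deriv i (\<lambda>y. g (inv_into V \<phi> y)) (\<phi> x)"
    if "i < mdim M" for i by (rule partial_deriv_cong(1)[OF proper_chartsD(3)[OF M c(1) Q(1)] _ that])
      (use c Q proper_chartsD(2)[OF M c(1)] in auto)
  hence "(\<Sum>i<mdim M. w i * partial_deriv i (\<lambda>y. f (inv_into V \<phi> y)) (\<phi> x)) =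
      (\<Sum>i<mdim M. w i * partial_deriv i (\<lambda>y. g (inv_into V \<phi> y)) (\<phi> x))" by (intro sum.cong) simp_all
  ultimately show ?thesis unfolding chart_vector_def by simp
qed

lemma tangent_local:
  assumes "proper_charts M" "X \<in> tangent_space M x"
    "openM M Q" "x \<in> Q" "\<And>y. y \<in> Q \<Longrightarrow> f y = g y"
  shows "X f = X g"
proof -
  obtain V \<phi> w where X: "X = chart_vector M V \<phi> x w" "(V, \<phi>) \<in> charts M" "x \<in> V"
    using assms(2) unfolding tangent_space_def by blast
  show ?thesis unfolding X(1) by (rule chart_vector_local[OF assms(1) X(2,3) assms(3,4)]) (rule assms(5))
qed

lemma smooth_near_submanifold:
  assumes M: "proper_charts M" and B: "openM M B" and x: "x \<in> B"
  shows "smooth_near (open_submanifold M B) x f \<longleftrightarrow> smooth_near M x f"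
proof
  assume "smooth_near M x f"
  then obtain U where U: "x \<in> U" "smooth_on M U f" by (auto simp: smooth_near_def)
  hence "smooth_on M (U \<inter> B) f"
    using B by (intro smooth_on_subset[OF U(2)]) (auto simp: smooth_on_def intro: openin_Int)
  thus "smooth_near (open_submanifold M B) x f"
    unfolding smooth_near_def smooth_on_submanifold[OF M B] using U(1) x by blast
next
  assume "smooth_near (open_submanifold M B) x f"
  thus "smooth_near M x f" unfolding smooth_near_def smooth_on_submanifold[OF M B] by blast
qed

text \<open>Shrinking the domain of a chart changes its \<open>inv_into\<close>, but by injectivity
  only outside the image of the smaller domain.\<close>

lemma chart_vector_submanifold:
  assumes M: "proper_charts M" and B: "openM M B" and x: "x \<in> B"
    and c: "(V, \<phi>) \<in> charts M" "x \<in> V"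
  shows "chart_vector (open_submanifold M B) (V \<inter> B) \<phi> x w = chart_vector M V \<phi> x w"
proof
  fix f
  have "partial_deriv i (\<lambda>y. f (inv_into (V \<inter> B) \<phi> y)) (\<phi> x) = partial_deriv i (\<lambda>y. f (inv_into V \<phi> y)) (\<phi> x)"
    if "i < mdim M" for i
  proof (rule partial_deriv_cong(1)[OF proper_chartsD(3)[OF M c(1) B] _ that])
    show "\<phi> x \<in> \<phi> ` (B \<inter> V)" using x c by blast
    fix y assume "y \<in> \<phi> ` (B \<inter> V)"
    then obtain z where "y = \<phi> z" "z \<in> V \<inter> B" by blast
    thus "f (inv_into (V \<inter> B) \<phi> y) = f (inv_into V \<phi> y)"
      using inv_into_Int[OF proper_chartsD(2)[OF M c(1)], of z B] by simp
  qed
  moreover have "mdim (open_submanifold M B) = mdim M" by (simp add: open_submanifold_def)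
  ultimately show "chart_vector (open_submanifold M B) (V \<inter> B) \<phi> x w f = chart_vector M V \<phi> x w f"
    unfolding chart_vector_def smooth_near_submanifold[OF M B x] by (auto intro!: sum.cong)
qed

lemma tangent_space_submanifold:
  assumes M: "proper_charts M" and B: "openM M B" and x: "x \<in> B"
  shows "tangent_space (open_submanifold M B) x = tangent_space M x"
proof
  show "tangent_space (open_submanifold M B) x \<subseteq> tangent_space M x"
  proof
    fix X assume "X \<in> tangent_space (open_submanifold M B) x"
    then obtain V \<phi> w where X: "X = chart_vector (open_submanifold M B) V \<phi> x w"
      "(V, \<phi>) \<in> charts (open_submanifold M B)" "x \<in> V" by (auto simp: tangent_space_def)
    then obtain V' where V': "V = V' \<inter> B" "(V', \<phi>) \<in> charts M" by (auto simp: open_submanifold_def)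
    hence "X = chart_vector M V' \<phi> x w" using chart_vector_submanifold[OF M B x V'(2)] X by auto
    thus "X \<in> tangent_space M x" using V' X by (auto simp: tangent_space_def)
  qed
  show "tangent_space M x \<subseteq> tangent_space (open_submanifold M B) x"
  proof
    fix X assume "X \<in> tangent_space M x"
    then obtain V \<phi> w where X: "X = chart_vector M V \<phi> x w" "(V, \<phi>) \<in> charts M" "x \<in> V"
      by (auto simp: tangent_space_def)
    hence "X = chart_vector (open_submanifold M B) (V \<inter> B) \<phi> x w"
      using chart_vector_submanifold[OF M B x X(2,3)] by simp
    moreover have "(V \<inter> B, \<phi>) \<in> charts (open_submanifold M B)"
      using X(2) by (auto simp: open_submanifold_def)
    ultimately show "X \<in> tangent_space (open_submanifold M B) x"
      using X(3) x unfolding tangent_space_def by blast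
  qed
qed

lemma vector_field_submanifold:
  assumes M: "proper_charts M" and B: "openM M B"
  shows "vector_field (open_submanifold M B) U X \<longleftrightarrow> U \<subseteq> B \<and> vector_field M U X"
proof (cases "U \<subseteq> B")
  case True
  hence "tangent_space (open_submanifold M B) x = tangent_space M x" if "x \<in> U" for x
    using tangent_space_submanifold[OF M B] that by blast
  thus ?thesis using True
    unfolding vector_field_def openin_submanifold[OF B] smooth_on_submanifold[OF M B] by auto
qed (auto simp: vector_field_def openin_submanifold[OF B])

lemma one_form_submanifold:
  assumes M: "proper_charts M" and B: "openM M B"
  shows "one_form (open_submanifold M B) U X \<longleftrightarrow> U \<subseteq> B \<and> one_form M U X"
proof (cases "U \<subseteq> B")
  case True
  hence "tangent_space (open_submanifold M B) x = tangent_space M x" if "x \<in> U" for x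
    using tangent_space_submanifold[OF M B] that by blast
  thus ?thesis using True unfolding one_form_def openin_submanifold[OF B] smooth_on_submanifold[OF M B]
      vector_field_submanifold[OF M B] by auto
qed (auto simp: one_form_def openin_submanifold[OF B])

lemma smooth_vec_on_submanifold:
  assumes M: "proper_charts M" and B: "openM M B" and U: "U \<subseteq> B"
  shows "smooth_vec_on (open_submanifold M B) U r \<longleftrightarrow> smooth_vec_on M U r"
  using U by (simp add: smooth_vec_on_def smooth_on_submanifold[OF M B])

lemma vector_field_subset:
  assumes "vector_field M U X" "V \<subseteq> U" "openM M V"
  shows "vector_field M V X" using assms unfolding vector_field_def by (meson order_trans subsetD)

text \<open>The choice operator is applied to equivalent predicates, so even the chosen extension is
  the same.\<close>

lemma extend_vector_submanifold:
  assumes M: "proper_charts M" and B: "openM M B" and x: "x \<in> B"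
  shows "extend_vector (open_submanifold M B) x z = extend_vector M x z"
proof -
  have "(\<exists>U. x \<in> U \<and> vector_field (open_submanifold M B) U Z) \<longleftrightarrow> (\<exists>U. x \<in> U \<and> vector_field M U Z)" for Z
  proof
    assume "\<exists>U. x \<in> U \<and> vector_field M U Z"
    then obtain U where U: "x \<in> U" "vector_field M U Z" by blast
    hence "vector_field M (U \<inter> B) Z"
      using B by (intro vector_field_subset[OF U(2)]) (auto simp: vector_field_def intro: openin_Int)
    thus "\<exists>U. x \<in> U \<and> vector_field (open_submanifold M B) U Z"
      using U x vector_field_submanifold[OF M B, of "U \<inter> B" Z] by blast
  qed (use vector_field_submanifold[OF M B] in blast)
  thus ?thesis by (simp add: extend_vector_def)
qed

lemma field_bracket_submanifold:
  assumes M: "proper_charts M" and B: "openM M B" and x: "x \<in> B"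
  shows "field_bracket (open_submanifold M B) X Y x = field_bracket M X Y x"
  by (simp add: field_bracket_def smooth_near_submanifold[OF assms])

text \<open>Normal forms live over an open set of coordinate space. Since every ingredient is local,
  their algebroid can be exchanged for the one over the whole space, where tangent spaces and
  smoothness have a coordinate description.\<close>

lemma untwisted_submanifold:
  assumes M: "proper_charts M" and B: "openM M B"
  shows "x \<in> B \<Longrightarrow> fibre (untwisted (open_submanifold M B) br ip) x = fibre (untwisted M br ip) x"
    "U \<subseteq> B \<Longrightarrow> sections (untwisted (open_submanifold M B) br ip) U = sections (untwisted M br ip) U"
    "anchor (untwisted (open_submanifold M B) br ip) = anchor (untwisted M br ip)"
    "pairing (untwisted (open_submanifold M B) br ip) = pairing (untwisted M br ip)"
    "x \<in> B \<Longrightarrow> dorfman (untwisted (open_submanifold M B) br ip) u v x = dorfman (untwisted M br ip) u v x"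
  by (simp_all add: untwisted_def tangent_space_submanifold[OF M B] vector_field_submanifold[OF M B]
      one_form_submanifold[OF M B] smooth_vec_on_submanifold[OF M B] Let_def
      lie_derivative_form_def contract_exterior_deriv_def extend_vector_submanifold[OF M B]
      field_bracket_submanifold[OF M B] cong: conj_cong if_cong)

lemma Rn_manifold_simps [simp]:
  "mtop (Rn n) = Euclidean_space n" "mdim (Rn n) = n"
  "charts (Rn n) = {(ER n, \<lambda>x. x)}" by (simp_all add: Rn_manifold_def)

text \<open>All locality results ask just for \<open>proper_charts\<close>, so coordinate space
  qualifies by inspection of its single chart.\<close>

lemma proper_charts_Rn: "proper_charts (Rn n)" by (auto simp: proper_charts_def inj_on_def)

lemma smooth_on_Rn: "smooth_on (Rn n) U f \<longleftrightarrow> opn n U \<and> smooth_Rn n U f"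
proof (cases "opn n U")
  case True
  hence "U \<inter> ER n = U" using openin_subset by blast
  moreover have "smooth_Rn n U (\<lambda>w. f (inv_into (ER n) (\<lambda>x. x) w)) \<longleftrightarrow> smooth_Rn n U f"
    by (rule smooth_Rn_cong[OF True])
      (use openin_subset[OF True] inv_into_f_f[of "\<lambda>x. x" "ER n"] in \<open>auto simp: inj_on_def\<close>)
  ultimately show ?thesis using True by (simp add: smooth_on_def)
qed (simp add: smooth_on_def)

section \<open>Local isomorphisms of Courant algebroids\<close>

text \<open>Transported sections and functions are composed with inverses that are arbitrary off the
  open set. The last three properties say that sections, brackets and anchors see their arguments
  only through the values on the set, so the arbitrary values do no harm; the first one lets
  fibrewise maps be applied to sections.\<close>

locale tame_on =
  fixes M :: "'a manifold" and E :: "('a, 'e::real_vector) courant" and U :: "'a set"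
  assumes section_fibre: "V \<subseteq> U \<Longrightarrow> openM M V \<Longrightarrow> u \<in> sections E V \<Longrightarrow> x \<in> V \<Longrightarrow> u x \<in> fibre E x"
    and section_cong: "V \<subseteq> U \<Longrightarrow> openM M V \<Longrightarrow> u \<in> sections E V \<Longrightarrow> (\<And>x. x \<in> V \<Longrightarrow> u' x = u x) \<Longrightarrow> u' \<in> sections E V"
    and dorfman_local: "V \<subseteq> U \<Longrightarrow> openM M V \<Longrightarrow> u \<in> sections E V \<Longrightarrow> v \<in> sections E V \<Longrightarrow>
       (\<And>x. x \<in> V \<Longrightarrow> u' x = u x) \<Longrightarrow> (\<And>x. x \<in> V \<Longrightarrow> v' x = v x) \<Longrightarrow> x \<in> V \<Longrightarrow> dorfman E u' v' x = dorfman E u v x"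
    and anchor_local: "V \<subseteq> U \<Longrightarrow> openM M V \<Longrightarrow> x \<in> V \<Longrightarrow> a \<in> fibre E x \<Longrightarrow>
       (\<And>y. y \<in> V \<Longrightarrow> h y = h' y) \<Longrightarrow> anchor E x a h = anchor E x a h'"

lemmas tame_onD = tame_on.section_fibre tame_on.section_cong tame_on.dorfman_local tame_on.anchor_local

lemma tame_on_subset:
  assumes "tame_on M E U" "V \<subseteq> U"
  shows "tame_on M E V"
proof (rule tame_on.intro)
  note d = tame_onD[OF assms(1) order_trans[OF _ assms(2)]]
  show "u x \<in> fibre E x" if "W \<subseteq> V" "openM M W" "u \<in> sections E W" "x \<in> W" for W u x by (rule d(1)[OF that])
  show "u' \<in> sections E W" if "W \<subseteq> V" "openM M W" "u \<in> sections E W" "\<And>x. x \<in> W \<Longrightarrow> u' x = u x" for W u u'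
    by (rule d(2)[OF that(1-3)]) (rule that(4))
  show "dorfman E u' v' x = dorfman E u v x" if "W \<subseteq> V" "openM M W" "u \<in> sections E W" "v \<in> sections E W"
      "\<And>x. x \<in> W \<Longrightarrow> u' x = u x" "\<And>x. x \<in> W \<Longrightarrow> v' x = v x" "x \<in> W" for W u v u' v' x
    by (rule d(3)[OF that(1-4) _ _ that(7)]) (rule that(5,6); assumption)+
  show "anchor E x a h = anchor E x a h'"
    if "W \<subseteq> V" "openM M W" "x \<in> W" "a \<in> fibre E x" "\<And>y. y \<in> W \<Longrightarrow> h y = h' y" for W x a h h'
    by (rule d(4)[OF that(1-4)]) (rule that(5))
qed

lemma tame_on_sections_cong:
  assumes "tame_on M E U" "V \<subseteq> U" "openM M V" "\<And>x. x \<in> V \<Longrightarrow> u' x = u x"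
  shows "u' \<in> sections E V \<longleftrightarrow> u \<in> sections E V"
  by (rule iffI; erule tame_onD(2)[OF assms(1-3)]; simp add: assms(4))

text \<open>Kept apart from \<open>tame_on\<close> because it serves inversion alone: the inverse
  undoes \<Phi> on the fibres only and has to be applied to a bracket.\<close>

definition dorfman_closed :: "'a manifold \<Rightarrow> ('a, 'e::real_vector) courant \<Rightarrow> 'a set \<Rightarrow> bool"
  where "dorfman_closed M E U \<longleftrightarrow> (\<forall>V u v x. V \<subseteq> U \<and> openM M V \<and> u \<in> sections E V \<and>
    v \<in> sections E V \<and> x \<in> V \<longrightarrow> dorfman E u v x \<in> fibre E x)"

text \<open>The axioms of a Courant algebroid do not say that sections restrict to sections, are
  determined locally or take values in the fibres; they do over the domain of a frame.\<close>

lemma courant_algebroid_tame: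
  assumes M: "proper_charts M" and E: "courant_algebroid M E" and x: "x \<in> topspace (mtop M)"
  obtains U where "openM M U" "x \<in> U" "tame_on M E U" "dorfman_closed M E U"
proof -
  have vb: "vector_bundle M (fibre E) (sections E)" using E by (simp add: courant_algebroid_def)
  from this[unfolded vector_bundle_def, THEN conjunct2, THEN conjunct2, rule_format, OF x]
  obtain U es where "openM M U \<and> x \<in> U \<and>
      (\<forall>y\<in>U. distinct (map (\<lambda>e. e y) es) \<and> independent ((\<lambda>e. e y) ` set es) \<and>
              span ((\<lambda>e. e y) ` set es) = fibre E y) \<and> (\<forall>V u. openM M V \<and> V \<subseteq> U \<longrightarrow> (u \<in> sections E V \<longleftrightarrow>
            (\<exists>c. (\<forall>i<length es. smooth_on M V (c i)) \<and>
                 (\<forall>y\<in>V. u y = (\<Sum>i<length es. c i y *\<^sub>R (es ! i) y)))))" by (elim exE)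
  hence U: "openM M U" "x \<in> U"
    "\<And>y. y \<in> U \<Longrightarrow> span ((\<lambda>e. e y) ` set es) = fibre E y"
    "\<And>V u. openM M V \<Longrightarrow> V \<subseteq> U \<Longrightarrow> u \<in> sections E V \<longleftrightarrow>
      (\<exists>c. (\<forall>i<length es. smooth_on M V (c i)) \<and> (\<forall>y\<in>V. u y = (\<Sum>i<length es. c i y *\<^sub>R (es ! i) y)))"
    by simp_all
  have fib: "u y \<in> fibre E y" if V: "openM M V" "V \<subseteq> U" "u \<in> sections E V" "y \<in> V" for V u y
  proof -
    obtain c where "u y = (\<Sum>i<length es. c i y *\<^sub>R (es ! i) y)" using U(4)[OF V(1,2)] V(3,4) by blast
    moreover have "(\<Sum>i<length es. c i y *\<^sub>R (es ! i) y) \<in> span ((\<lambda>e. e y) ` set es)"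
      by (intro span_sum span_scale span_base) auto
    ultimately show ?thesis using U(3) V by auto
  qed
  have dorf: "dorfman E u' v' y = dorfman E u v y"
    if "openM M V" "u \<in> sections E V" "v \<in> sections E V" "\<forall>x\<in>V. u' x = u x \<and> v' x = v x" "y \<in> V"
    for V u v u' v' y
    using E[unfolded courant_algebroid_def, THEN conjunct2, THEN conjunct2, THEN conjunct2, rule_format,
      OF that(1), THEN conjunct1, rule_format, OF that(2,3) _ that(5)] that(4) by blast
  have clo: "dorfman E u v \<in> sections E V" if "openM M V" "u \<in> sections E V" "v \<in> sections E V" for V u v
    using E[unfolded courant_algebroid_def, THEN conjunct2, THEN conjunct2, THEN conjunct1, rule_format,
      OF that(1), THEN conjunct2, rule_format, OF that(2,3)] by blast
  have anc: "anchor E y a \<in> tangent_space M y" if "y \<in> U" "a \<in> fibre E y" for y a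
  proof -
    have "y \<in> topspace (mtop M)" using that(1) openin_subset[OF U(1)] by blast
    from E[unfolded courant_algebroid_def, THEN conjunct2, THEN conjunct1, THEN bspec, OF this,
        THEN conjunct2, THEN conjunct1]
    have "anchor E y ` fibre E y \<subseteq> tangent_space M y" .
    thus ?thesis using that(2) by blast
  qed
  have "tame_on M E U"
  proof (rule tame_on.intro)
    fix V u y assume "V \<subseteq> U" "openM M V" "u \<in> sections E V" "y \<in> V"
    thus "u y \<in> fibre E y" using fib by blast
  next
    fix V u u' assume V: "V \<subseteq> U" "openM M V" "u \<in> sections E V" "\<And>x. x \<in> V \<Longrightarrow> u' x = u x"
    then obtain c where "\<forall>i<length es. smooth_on M V (c i)"
      "\<forall>y\<in>V. u y = (\<Sum>i<length es. c i y *\<^sub>R (es ! i) y)" using U(4) by blast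
    hence "\<exists>c. (\<forall>i<length es. smooth_on M V (c i)) \<and> (\<forall>y\<in>V. u' y = (\<Sum>i<length es. c i y *\<^sub>R (es ! i) y))"
      using V(4) by (intro exI[of _ c]) simp
    thus "u' \<in> sections E V" using U(4)[OF V(2,1)] by blast
  next
    fix V u v u' v' y
    assume "V \<subseteq> U" "openM M V" "u \<in> sections E V" "v \<in> sections E V"
      "\<And>x. x \<in> V \<Longrightarrow> u' x = u x" "\<And>x. x \<in> V \<Longrightarrow> v' x = v x" "y \<in> V"
    thus "dorfman E u' v' y = dorfman E u v y" by (intro dorf[of V]) blast+
  next
    fix V y a and h h' :: "'a \<Rightarrow> real"
    assume a: "V \<subseteq> U" "openM M V" "y \<in> V" "a \<in> fibre E y" "\<And>y. y \<in> V \<Longrightarrow> h y = h' y"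
    hence "anchor E y a \<in> tangent_space M y" using anc by blast
    thus "anchor E y a h = anchor E y a h'" by (rule tangent_local[OF M _ a(2,3)]) (rule a(5))
  qed
  moreover have "dorfman_closed M E U" unfolding dorfman_closed_def using clo fib by blast
  ultimately show thesis using U(1,2) that by blast
qed

text \<open>The inverse \<open>g\<close> is a separate argument, meaningful only on
  \<open>U'\<close>. Composites then simply compose inverses, and neither submanifolds nor pullback
  algebroids have to be formed.\<close>

definition local_iso :: "'a manifold \<Rightarrow> 'a set \<Rightarrow> ('a, 'e::real_vector) courant \<Rightarrow>
    'b manifold \<Rightarrow> 'b set \<Rightarrow> ('b, 'f::real_vector) courant \<Rightarrow> ('a \<Rightarrow> 'b) \<Rightarrow> ('b \<Rightarrow> 'a) \<Rightarrow> ('a \<Rightarrow> 'e \<Rightarrow> 'f) \<Rightarrow> bool"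
  where "local_iso M U E N U' E' f g \<Phi> \<longleftrightarrow> openM M U \<and> openM N U' \<and> f ` U = U' \<and> (\<forall>x\<in>U. g (f x) = x) \<and>
    (\<forall>V\<subseteq>U. openM M V \<longleftrightarrow> openM N (f ` V)) \<and>
    (\<forall>V h. V \<subseteq> U \<and> openM M V \<longrightarrow> (smooth_on N (f ` V) h \<longleftrightarrow> smooth_on M V (\<lambda>x. h (f x)))) \<and>
    (\<forall>x\<in>U. linear_over (fibre E x) (\<Phi> x) \<and> bij_betw (\<Phi> x) (fibre E x) (fibre E' (f x))) \<and>
    (\<forall>x\<in>U. \<forall>a\<in>fibre E x. \<forall>h. anchor E' (f x) (\<Phi> x a) (\<lambda>y. h (g y)) = anchor E x a h) \<and>
    (\<forall>x\<in>U. \<forall>a\<in>fibre E x. \<forall>b\<in>fibre E x. pairing E' (f x) (\<Phi> x a) (\<Phi> x b) = pairing E x a b) \<and>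
    (\<forall>V u. V \<subseteq> U \<and> openM M V \<and> (\<forall>x\<in>V. u x \<in> fibre E x) \<longrightarrow>
       (u \<in> sections E V \<longleftrightarrow> (\<lambda>y. \<Phi> (g y) (u (g y))) \<in> sections E' (f ` V))) \<and>
    (\<forall>V u v x. V \<subseteq> U \<and> openM M V \<and> u \<in> sections E V \<and> v \<in> sections E V \<and> x \<in> V \<longrightarrow> \<Phi> x (dorfman E u v x) =
         dorfman E' (\<lambda>y. \<Phi> (g y) (u (g y))) (\<lambda>y. \<Phi> (g y) (v (g y))) (f x))"

lemma local_isoD:
  assumes "local_iso M U E N U' E' f g \<Phi>"
  shows "openM M U" "openM N U'" "f ` U = U'"
    "x \<in> U \<Longrightarrow> g (f x) = x"
    "V \<subseteq> U \<Longrightarrow> openM M V \<longleftrightarrow> openM N (f ` V)"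
    "V \<subseteq> U \<Longrightarrow> openM M V \<Longrightarrow> smooth_on N (f ` V) h \<longleftrightarrow> smooth_on M V (\<lambda>x. h (f x))"
    "x \<in> U \<Longrightarrow> linear_over (fibre E x) (\<Phi> x)"
    "x \<in> U \<Longrightarrow> bij_betw (\<Phi> x) (fibre E x) (fibre E' (f x))"
    "x \<in> U \<Longrightarrow> a \<in> fibre E x \<Longrightarrow> anchor E' (f x) (\<Phi> x a) (\<lambda>y. k (g y)) = anchor E x a k"
    "x \<in> U \<Longrightarrow> a \<in> fibre E x \<Longrightarrow> b \<in> fibre E x \<Longrightarrow> pairing E' (f x) (\<Phi> x a) (\<Phi> x b) = pairing E x a b"
    "V \<subseteq> U \<Longrightarrow> openM M V \<Longrightarrow> (\<And>x. x \<in> V \<Longrightarrow> u x \<in> fibre E x) \<Longrightarrow>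
       u \<in> sections E V \<longleftrightarrow> (\<lambda>y. \<Phi> (g y) (u (g y))) \<in> sections E' (f ` V)"
    "V \<subseteq> U \<Longrightarrow> openM M V \<Longrightarrow> u \<in> sections E V \<Longrightarrow> v \<in> sections E V \<Longrightarrow> x \<in> V \<Longrightarrow>
       \<Phi> x (dorfman E u v x) = dorfman E' (\<lambda>y. \<Phi> (g y) (u (g y))) (\<lambda>y. \<Phi> (g y) (v (g y))) (f x)"
proof -
  note s0 = assms[unfolded local_iso_def]
  note s1 = s0[THEN conjunct2]
  note s2 = s1[THEN conjunct2]
  note s3 = s2[THEN conjunct2]
  note s4 = s3[THEN conjunct2]
  note s5 = s4[THEN conjunct2]
  note s6 = s5[THEN conjunct2]
  note s7 = s6[THEN conjunct2]
  note s8 = s7[THEN conjunct2]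
  note s9 = s8[THEN conjunct2]
  note s10 = s9[THEN conjunct2]
  show "openM M U" "openM N U'" "f ` U = U'" by (fact s0[THEN conjunct1] s1[THEN conjunct1] s2[THEN conjunct1])+
  show "g (f x) = x" if "x \<in> U" using s3[THEN conjunct1] that by blast
  show "openM M V \<longleftrightarrow> openM N (f ` V)" if "V \<subseteq> U" using s4[THEN conjunct1] that by blast
  show "smooth_on N (f ` V) h \<longleftrightarrow> smooth_on M V (\<lambda>x. h (f x))" if "V \<subseteq> U" "openM M V"
    using s5[THEN conjunct1, rule_format, of V h] that by blast
  show "linear_over (fibre E x) (\<Phi> x)" "bij_betw (\<Phi> x) (fibre E x) (fibre E' (f x))" if "x \<in> U"
    using s6[THEN conjunct1] that by blast+
  show "anchor E' (f x) (\<Phi> x a) (\<lambda>y. k (g y)) = anchor E x a k" if "x \<in> U" "a \<in> fibre E x"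
    by (rule s7[THEN conjunct1, rule_format, OF that])
  show "pairing E' (f x) (\<Phi> x a) (\<Phi> x b) = pairing E x a b" if "x \<in> U" "a \<in> fibre E x" "b \<in> fibre E x"
    by (rule s8[THEN conjunct1, rule_format, OF that])
  show "u \<in> sections E V \<longleftrightarrow> (\<lambda>y. \<Phi> (g y) (u (g y))) \<in> sections E' (f ` V)"
    if "V \<subseteq> U" "openM M V" "\<And>x. x \<in> V \<Longrightarrow> u x \<in> fibre E x"
    by (rule s9[THEN conjunct1, rule_format]) (use that in blast)
  show "\<Phi> x (dorfman E u v x) = dorfman E' (\<lambda>y. \<Phi> (g y) (u (g y))) (\<lambda>y. \<Phi> (g y) (v (g y))) (f x)"
    if "V \<subseteq> U" "openM M V" "u \<in> sections E V" "v \<in> sections E V" "x \<in> V"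
    by (rule s10[rule_format, of V]) (use that in blast)
qed

lemma local_iso_restrict:
  assumes i: "local_iso M U E N U' E' f g \<Phi>" and V: "V \<subseteq> U" "openM M V"
  shows "local_iso M V E N (f ` V) E' f g \<Phi>"
proof -
  note d = local_isoD[OF i]
  have s: "W \<subseteq> U" if "W \<subseteq> V" for W using V(1) that by blast
  have m: "x \<in> U" if "x \<in> V" for x using V(1) that by blast
  show ?thesis unfolding local_iso_def
  proof (intro conjI allI impI ballI; (elim conjE)?)
    show "openM M V" "openM N (f ` V)" "f ` V = f ` V" using V d(5)[OF V(1)] by simp_all
    show "g (f x) = x" "linear_over (fibre E x) (\<Phi> x)" "bij_betw (\<Phi> x) (fibre E x) (fibre E' (f x))"
      if "x \<in> V" for x using d(4,7,8)[OF m[OF that]] by simp_all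
    show "openM M W \<longleftrightarrow> openM N (f ` W)" if "W \<subseteq> V" for W by (rule d(5)[OF s[OF that]])
    show "smooth_on N (f ` W) h \<longleftrightarrow> smooth_on M W (\<lambda>x. h (f x))" if "W \<subseteq> V" "openM M W" for W h
      by (rule d(6)[OF s[OF that(1)] that(2)])
    show "anchor E' (f x) (\<Phi> x a) (\<lambda>y. k (g y)) = anchor E x a k" if "x \<in> V" "a \<in> fibre E x" for x a k
      by (rule d(9)[OF m[OF that(1)] that(2)])
    show "pairing E' (f x) (\<Phi> x a) (\<Phi> x b) = pairing E x a b"
      if "x \<in> V" "a \<in> fibre E x" "b \<in> fibre E x" for x a b by (rule d(10)[OF m[OF that(1)] that(2,3)])
    show "u \<in> sections E W \<longleftrightarrow> (\<lambda>y. \<Phi> (g y) (u (g y))) \<in> sections E' (f ` W)"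
      if "W \<subseteq> V" "openM M W" "\<forall>x\<in>W. u x \<in> fibre E x" for W u
      by (rule d(11)[OF s[OF that(1)] that(2)]) (use that(3) in blast)
    show "\<Phi> x (dorfman E u v x) = dorfman E' (\<lambda>y. \<Phi> (g y) (u (g y))) (\<lambda>y. \<Phi> (g y) (v (g y))) (f x)"
      if "W \<subseteq> V" "openM M W" "u \<in> sections E W" "v \<in> sections E W" "x \<in> W" for W u v x
      by (rule d(12)[OF s[OF that(1)] that(2-5)])
  qed
qed

text \<open>The definition of equivalence uses \<open>inv_into\<close>, while composites produce
  other inverses; tameness makes the choice immaterial as long as it inverts \<open>f\<close> on
  \<open>U\<close>.\<close>

lemma local_iso_change_inverse:
  assumes i: "local_iso M U E N U' E' f g \<Phi>" and t: "tame_on M E U" "tame_on N E' U'"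
    and g': "\<And>x. x \<in> U \<Longrightarrow> g' (f x) = x"
  shows "local_iso M U E N U' E' f g' \<Phi>"
proof -
  note d = local_isoD[OF i]
  have gg: "g' y = g y" if "y \<in> f ` V" "V \<subseteq> U" for V y using that d(4) g' by auto
  have sec: "(\<lambda>y. \<Phi> (g' y) (u (g' y))) \<in> sections E' (f ` V) \<longleftrightarrow>
      (\<lambda>y. \<Phi> (g y) (u (g y))) \<in> sections E' (f ` V)" if V: "V \<subseteq> U" "openM M V" for V u
    by (rule tame_on_sections_cong[OF t(2)]) (use d(3) d(5)[OF V(1)] V gg in auto)
  show ?thesis unfolding local_iso_def
  proof (intro conjI allI impI ballI; (elim conjE)?)
    fix x a h assume x: "x \<in> U" "a \<in> fibre E x"
    have "anchor E' (f x) (\<Phi> x a) (\<lambda>y. h (g' y)) = anchor E' (f x) (\<Phi> x a) (\<lambda>y. h (g y))"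
    proof (rule tame_onD(4)[OF t(2) order_refl d(2)])
      show "f x \<in> U'" using x d(3) by blast
      show "\<Phi> x a \<in> fibre E' (f x)" using d(8)[OF x(1)] x(2) bij_betwE by blast
      show "h (g' y) = h (g y)" if "y \<in> U'" for y using gg[of y U] that d(3) by auto
    qed
    thus "anchor E' (f x) (\<Phi> x a) (\<lambda>y. h (g' y)) = anchor E x a h" using d(9)[OF x] by simp
  next
    fix V u assume "V \<subseteq> U" "openM M V" "\<forall>x\<in>V. u x \<in> fibre E x"
    thus "u \<in> sections E V \<longleftrightarrow> (\<lambda>y. \<Phi> (g' y) (u (g' y))) \<in> sections E' (f ` V)" using d(11) sec by simp
  next
    fix V u v x assume V: "V \<subseteq> U" "openM M V" "u \<in> sections E V" "v \<in> sections E V" "x \<in> V"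
    have s: "(\<lambda>y. \<Phi> (g y) (w (g y))) \<in> sections E' (f ` V)" if "w \<in> sections E V" for w
      using d(11)[OF V(1,2), of w] tame_onD(1)[OF t(1) V(1,2)] that by blast
    have "dorfman E' (\<lambda>y. \<Phi> (g' y) (u (g' y))) (\<lambda>y. \<Phi> (g' y) (v (g' y))) (f x) =
        dorfman E' (\<lambda>y. \<Phi> (g y) (u (g y))) (\<lambda>y. \<Phi> (g y) (v (g y))) (f x)"
      by (rule tame_onD(3)[OF t(2) _ _ s[OF V(3)] s[OF V(4)]])
        (use d(3) d(5)[OF V(1)] V gg in auto)
    thus "\<Phi> x (dorfman E u v x) = dorfman E' (\<lambda>y. \<Phi> (g' y) (u (g' y))) (\<lambda>y. \<Phi> (g' y) (v (g' y))) (f x)"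
      using d(12)[OF V] by simp
  next
    show "openM M U" "openM N U'" "f ` U = U'" by (fact d(1-3))+
    show "g' (f x) = x" if "x \<in> U" for x by (rule g'[OF that])
    show "openM M V \<longleftrightarrow> openM N (f ` V)" if "V \<subseteq> U" for V by (rule d(5)[OF that])
    show "smooth_on N (f ` V) h \<longleftrightarrow> smooth_on M V (\<lambda>x. h (f x))" if "V \<subseteq> U" "openM M V" for V h
      by (rule d(6)[OF that])
    show "linear_over (fibre E x) (\<Phi> x)" "bij_betw (\<Phi> x) (fibre E x) (fibre E' (f x))" if "x \<in> U" for x
      using d(7,8)[OF that] by simp_all
    show "pairing E' (f x) (\<Phi> x a) (\<Phi> x b) = pairing E x a b"
      if "x \<in> U" "a \<in> fibre E x" "b \<in> fibre E x" for x a b by (rule d(10)[OF that])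
  qed
qed

lemma local_iso_compose:
  assumes i: "local_iso M U E N U' E' f g \<Phi>" and i': "local_iso N U' E' P U'' E'' f' g' \<Phi>'"
    and t: "tame_on M E U" "tame_on P E'' U''"
  shows "local_iso M U E P U'' E'' (\<lambda>x. f' (f x)) (\<lambda>z. g (g' z)) (\<lambda>x a. \<Phi>' (f x) (\<Phi> x a))"
proof -
  note d = local_isoD[OF i] and e = local_isoD[OF i']
  have fU: "f x \<in> U'" if "x \<in> U" for x using d(3) that by blast
  have \<Phi>m: "\<Phi> x a \<in> fibre E' (f x)" if "x \<in> U" "a \<in> fibre E x" for x a
    using d(8)[OF that(1)] that(2) bij_betwE by blast
  have im: "(\<lambda>x. f' (f x)) ` V = f' ` (f ` V)" for V by (simp add: image_image)
  have fV: "f ` V \<subseteq> U'" if "V \<subseteq> U" for V using that d(3) by blast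
  have s1: "(\<lambda>y. \<Phi> (g y) (u (g y))) \<in> sections E' (f ` V)" if "V \<subseteq> U" "openM M V" "u \<in> sections E V" for V u
    using d(11)[OF that(1,2), of u] tame_onD(1)[OF t(1) that(1,2)] that(3) by blast
  have f1: "\<Phi> (g y) (u (g y)) \<in> fibre E' y" if "V \<subseteq> U" "\<And>x. x \<in> V \<Longrightarrow> u x \<in> fibre E x" "y \<in> f ` V" for V u y
    using that \<Phi>m d(4) by auto
  have o: "openM N (f ` V)" if "V \<subseteq> U" "openM M V" for V using d(5) that by blast
  have o2: "openin (mtop P) (f' ` f ` V)" "f' ` f ` V \<subseteq> U''" if "V \<subseteq> U" "openM M V" for V
    using e(5)[OF fV[OF that(1)]] o[OF that] e(3) fV[OF that(1)] by auto
  \<comment> \<open>The composite hands the base point \<open>f (g (g' z))\<close> to \<Phi>'. It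
    equals \<open>g' z\<close> only over the image of \<open>V\<close>, so the two transported
    sections agree only there.\<close>
  have eq: "\<Phi>' (f (g (g' z))) (\<Phi> (g (g' z)) (u (g (g' z)))) = \<Phi>' (g' z) (\<Phi> (g (g' z)) (u (g (g' z))))"
    if "z \<in> f' ` f ` V" "V \<subseteq> U" for z V u using that d(4) e(4) fU by auto
  show ?thesis unfolding local_iso_def im
  proof (intro conjI allI impI ballI; (elim conjE)?)
    show "openM M U" "openin (mtop P) U''" "f' ` f ` U = U''" using d e by auto
    fix x assume x: "x \<in> U"
    show "g (g' (f' (f x))) = x" using x d(4) e(4) fU by simp
    show "linear_over (fibre E x) (\<lambda>a. \<Phi>' (f x) (\<Phi> x a))"
      using d(7)[OF x] e(7)[OF fU[OF x]] \<Phi>m[OF x] unfolding linear_over_def by simp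
    show "bij_betw (\<lambda>a. \<Phi>' (f x) (\<Phi> x a)) (fibre E x) (fibre E'' (f' (f x)))"
      using bij_betw_trans[OF d(8)[OF x] e(8)[OF fU[OF x]]] by (simp add: o_def)
    fix a h assume a: "a \<in> fibre E x"
    show "anchor E'' (f' (f x)) (\<Phi>' (f x) (\<Phi> x a)) (\<lambda>y. h (g (g' y))) = anchor E x a h"
      using e(9)[OF fU[OF x] \<Phi>m[OF x a], of "\<lambda>y. h (g y)"] d(9)[OF x a] by simp
  next
    fix x a b assume "x \<in> U" "a \<in> fibre E x" "b \<in> fibre E x"
    thus "pairing E'' (f' (f x)) (\<Phi>' (f x) (\<Phi> x a)) (\<Phi>' (f x) (\<Phi> x b)) = pairing E x a b"
      using d(10) e(10) fU \<Phi>m by simp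
  next
    fix V assume V: "V \<subseteq> U"
    show "openM M V = openin (mtop P) (f' ` f ` V)" using d(5)[OF V] e(5)[OF fV[OF V]] by simp
  next
    fix V h assume V: "V \<subseteq> U" "openM M V"
    show "smooth_on P (f' ` f ` V) h = smooth_on M V (\<lambda>x. h (f' (f x)))"
      using d(6)[OF V] e(6)[OF fV[OF V(1)] o[OF V]] by simp
  next
    fix V u assume V: "V \<subseteq> U" "openM M V" "\<forall>x\<in>V. u x \<in> fibre E x"
    have "u \<in> sections E V \<longleftrightarrow> (\<lambda>z. \<Phi>' (g' z) (\<Phi> (g (g' z)) (u (g (g' z))))) \<in> sections E'' (f' ` f ` V)"
      using d(11)[OF V(1,2), of u] e(11)[OF fV[OF V(1)] o[OF V(1,2)] f1[OF V(1), of u]] V(3) by simp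
    also have "... \<longleftrightarrow> (\<lambda>z. \<Phi>' (f (g (g' z))) (\<Phi> (g (g' z)) (u (g (g' z))))) \<in> sections E'' (f' ` f ` V)"
      by (rule tame_on_sections_cong[OF t(2) o2(2,1)[OF V(1,2)]]) (rule eq[OF _ V(1), symmetric])
    finally show "u \<in> sections E V \<longleftrightarrow>
        (\<lambda>z. \<Phi>' (f (g (g' z))) (\<Phi> (g (g' z)) (u (g (g' z))))) \<in> sections E'' (f' ` f ` V)" .
  next
    fix V u v x assume V: "V \<subseteq> U" "openM M V" "u \<in> sections E V" "v \<in> sections E V" "x \<in> V"
    have s2: "(\<lambda>z. \<Phi>' (g' z) (\<Phi> (g (g' z)) (w (g (g' z))))) \<in> sections E'' (f' ` f ` V)"
      if "w \<in> sections E V" for w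
      using e(11)[OF fV[OF V(1)] o[OF V(1,2)] f1[OF V(1), of w]] s1[OF V(1,2) that]
        tame_onD(1)[OF t(1) V(1,2) that] by simp
    have "\<Phi>' (f x) (\<Phi> x (dorfman E u v x)) = dorfman E'' (\<lambda>z. \<Phi>' (g' z) (\<Phi> (g (g' z)) (u (g (g' z)))))
          (\<lambda>z. \<Phi>' (g' z) (\<Phi> (g (g' z)) (v (g (g' z))))) (f' (f x))"
      using d(12)[OF V] e(12)[OF fV[OF V(1)] o[OF V(1,2)] s1[OF V(1,2,3)] s1[OF V(1,2,4)]] V(5) by simp
    also have "... = dorfman E'' (\<lambda>z. \<Phi>' (f (g (g' z))) (\<Phi> (g (g' z)) (u (g (g' z)))))
          (\<lambda>z. \<Phi>' (f (g (g' z))) (\<Phi> (g (g' z)) (v (g (g' z))))) (f' (f x))"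
    proof (rule sym, rule tame_onD(3)[OF t(2) o2(2,1)[OF V(1,2)] s2[OF V(3)] s2[OF V(4)]])
      show "f' (f x) \<in> f' ` f ` V" using V(5) by blast
    qed (rule eq[OF _ V(1)], assumption)+
    finally show "\<Phi>' (f x) (\<Phi> x (dorfman E u v x)) =
        dorfman E'' (\<lambda>z. \<Phi>' (f (g (g' z))) (\<Phi> (g (g' z)) (u (g (g' z)))))
          (\<lambda>z. \<Phi>' (f (g (g' z))) (\<Phi> (g (g' z)) (v (g (g' z))))) (f' (f x))" .
  qed
qed

lemma linear_over_inv_into:
  assumes l: "linear_over S f" and b: "bij_betw f S T" and S: "subspace S"
  shows "linear_over T (inv_into S f)" unfolding linear_over_def
proof (intro conjI ballI allI)
  have f: "\<And>a b. a \<in> S \<Longrightarrow> b \<in> S \<Longrightarrow> f (a + b) = f a + f b" "\<And>c a. a \<in> S \<Longrightarrow> f (c *\<^sub>R a) = c *\<^sub>R f a"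
    using l by (auto simp: linear_over_def)
  have i: "\<And>a. a \<in> S \<Longrightarrow> inv_into S f (f a) = a" "\<And>y. y \<in> T \<Longrightarrow> \<exists>a\<in>S. y = f a"
    using b by (auto simp: bij_betw_def inv_into_f_f)
  fix x y assume "x \<in> T" "y \<in> T"
  then obtain a b where ab: "a \<in> S" "x = f a" "b \<in> S" "y = f b" using i(2) by metis
  thus "inv_into S f (x + y) = inv_into S f x + inv_into S f y"
    using i(1)[OF subspace_add[OF S ab(1,3)]] f(1)[OF ab(1,3)] i(1) by simp
next
  have f: "\<And>c a. a \<in> S \<Longrightarrow> f (c *\<^sub>R a) = c *\<^sub>R f a" using l by (auto simp: linear_over_def)
  have i: "\<And>a. a \<in> S \<Longrightarrow> inv_into S f (f a) = a" "\<And>y. y \<in> T \<Longrightarrow> \<exists>a\<in>S. y = f a"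
    using b by (auto simp: bij_betw_def inv_into_f_f)
  fix c :: real and x assume "x \<in> T"
  then obtain a where a: "a \<in> S" "x = f a" using i(2) by metis
  thus "inv_into S f (c *\<^sub>R x) = c *\<^sub>R inv_into S f x"
    using i(1)[OF subspace_scale[OF S a(1)], of c] f[OF a(1)] i(1) by simp
qed

text \<open>The conditions on sections and on smooth functions are equivalences, so they can be read
  backwards. For the bracket, the given identity is applied to the sections brought back to
  \<open>U\<close> (by \<open>T\<close> below) and then inverted fibrewise.\<close>

lemma local_iso_inverse:
  assumes i: "local_iso M U E N U' E' f g \<Phi>" and M: "proper_charts M"
    and t: "tame_on M E U" "tame_on N E' U'" and c: "dorfman_closed M E U"
    and S: "\<And>x. x \<in> U \<Longrightarrow> subspace (fibre E x)"
  shows "local_iso N U' E' M U E g f (\<lambda>y. inv_into (fibre E (g y)) (\<Phi> (g y)))"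
proof -
  note d = local_isoD[OF i]
  let ?\<Psi> = "\<lambda>y. inv_into (fibre E (g y)) (\<Phi> (g y))"
  have fg: "f (g y) = y" "g y \<in> U" if "y \<in> U'" for y using that d(3,4) by auto
  have sub: "g ` V \<subseteq> U" "f ` g ` V = V" if "V \<subseteq> U'" for V
  proof -
    show "g ` V \<subseteq> U" using fg(2) that by blast
    have "(\<lambda>y. f (g y)) ` V = (\<lambda>y. y) ` V" using fg(1) that by (intro image_cong) auto
    thus "f ` g ` V = V" by (simp add: image_image)
  qed
  have bij: "bij_betw (\<Phi> (g y)) (fibre E (g y)) (fibre E' y)" if "y \<in> U'" for y
    using d(8)[OF fg(2)[OF that]] fg(1)[OF that] by simp
  have \<Psi>: "?\<Psi> y (\<Phi> (g y) a) = a" if "y \<in> U'" "a \<in> fibre E (g y)" for y a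
    using bij[OF that(1)] that(2) by (simp add: bij_betw_def inv_into_f_f)
  have \<Psi>': "\<Phi> (g y) (?\<Psi> y b) = b" "?\<Psi> y b \<in> fibre E (g y)" if "y \<in> U'" "b \<in> fibre E' y" for y b
    using bij[OF that(1)] that(2) by (auto simp: bij_betw_def f_inv_into_f inv_into_into)
  have o: "openM M (g ` V) \<longleftrightarrow> openM N V" if "V \<subseteq> U'" for V
    using d(5)[OF sub(1)[OF that]] sub(2)[OF that] by simp
  have xx: "?\<Psi> (f x) = inv_into (fibre E x) (\<Phi> x)" if "x \<in> U" for x using d(4)[OF that] by simp
  define T where "T u = (\<lambda>x. inv_into (fibre E (g (f x))) (\<Phi> (g (f x))) (u (f x)))" for u
  have Tfib: "T u x \<in> fibre E x" if "V \<subseteq> U'" "\<And>y. y \<in> V \<Longrightarrow> u y \<in> fibre E' y" "x \<in> g ` V" for V u x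
  proof -
    note h = that
    obtain y where y: "y \<in> V" "x = g y" "y \<in> U'" using h(1,3) by blast
    have "f x = y" using y fg by simp
    thus ?thesis using \<Psi>'(2)[OF y(3) h(2)[OF y(1)]] y(2) by (simp add: T_def)
  qed
  have T\<Phi>: "\<Phi> (g y) (T u (g y)) = u y" if "V \<subseteq> U'" "\<And>y. y \<in> V \<Longrightarrow> u y \<in> fibre E' y" "y \<in> V" for V u y
  proof -
    have y: "y \<in> U'" using that by blast
    have "T u (g y) = ?\<Psi> y (u y)" using fg[OF y] by (simp add: T_def)
    thus ?thesis using \<Psi>'(1)[OF y that(2)[OF that(3)]] by simp
  qed
  have sec: "u \<in> sections E' V \<longleftrightarrow> T u \<in> sections E (g ` V)"
    if V: "V \<subseteq> U'" "openM N V" "\<And>y. y \<in> V \<Longrightarrow> u y \<in> fibre E' y" for V u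
  proof -
    have "T u \<in> sections E (g ` V) \<longleftrightarrow> (\<lambda>y. \<Phi> (g y) (T u (g y))) \<in> sections E' (f ` g ` V)"
      using d(11)[OF sub(1)[OF V(1)], of "T u"] o[OF V(1)] V(2) Tfib[OF V(1,3)] by blast
    also have "... \<longleftrightarrow> u \<in> sections E' V" unfolding sub(2)[OF V(1)]
      by (rule tame_on_sections_cong[OF t(2) V(1,2)]) (rule T\<Phi>[OF V(1,3)])
    finally show ?thesis by blast
  qed
  have i0: "openM N U' \<and> openM M U \<and> g ` U' = U \<and> (\<forall>x\<in>U'. f (g x) = x)" using d(1-4) fg by force
  have i1: "\<forall>V\<subseteq>U'. openM N V \<longleftrightarrow> openM M (g ` V)" using o by blast
  have i2: "smooth_on M (g ` V) h \<longleftrightarrow> smooth_on N V (\<lambda>x. h (g x))" if V: "V \<subseteq> U'" "openM N V" for V h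
  proof -
    have "smooth_on N V (\<lambda>x. h (g x)) \<longleftrightarrow> smooth_on M (g ` V) (\<lambda>x. h (g (f x)))"
      using d(6)[OF sub(1)[OF V(1)], of "\<lambda>x. h (g x)"] sub(2)[OF V(1)] o[OF V(1)] V(2) by simp
    also have "... \<longleftrightarrow> smooth_on M (g ` V) h"
      by (rule smooth_on_cong[OF M]) (use d(4) sub(1)[OF V(1)] in auto)
    finally show ?thesis by simp
  qed
  have i3: "linear_over (fibre E' y) (?\<Psi> y) \<and> bij_betw (?\<Psi> y) (fibre E' y) (fibre E (g y))"
    if y: "y \<in> U'" for y using linear_over_inv_into[OF d(7)[OF fg(2)[OF y]] bij[OF y] S[OF fg(2)[OF y]]]
      bij_betw_inv_into[OF bij[OF y]] by simp
  have i4: "anchor E (g y) (?\<Psi> y b) (\<lambda>x. h (f x)) = anchor E' y b h"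
    if y: "y \<in> U'" "b \<in> fibre E' y" for y b h
  proof -
    have "anchor E (g y) (?\<Psi> y b) (\<lambda>x. h (f x)) = anchor E' y b (\<lambda>z. h (f (g z)))"
      using d(9)[OF fg(2)[OF y(1)] \<Psi>'(2)[OF y], of "\<lambda>x. h (f x)"] \<Psi>'(1)[OF y] fg(1)[OF y(1)] by simp
    also have "... = anchor E' y b h" by (rule tame_onD(4)[OF t(2) order_refl d(2) y]) (simp add: fg)
    finally show ?thesis .
  qed
  have i5: "pairing E (g y) (?\<Psi> y a) (?\<Psi> y b) = pairing E' y a b"
    if y: "y \<in> U'" "a \<in> fibre E' y" "b \<in> fibre E' y" for y a b
    using d(10)[OF fg(2)[OF y(1)] \<Psi>'(2)[OF y(1,2)] \<Psi>'(2)[OF y(1,3)]] \<Psi>'(1)[OF y(1,2)] \<Psi>'(1)[OF y(1,3)]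
      fg(1)[OF y(1)] by simp
  have i6: "?\<Psi> y (dorfman E' u v y) = dorfman E (T u) (T v) (g y)"
    if V: "V \<subseteq> U'" "openM N V" "u \<in> sections E' V" "v \<in> sections E' V" "y \<in> V" for V u v y
  proof -
    have y: "y \<in> U'" using V by blast
    note fib = tame_onD(1)[OF t(2) V(1,2)]
    have Ts: "T u \<in> sections E (g ` V)" "T v \<in> sections E (g ` V)" using sec[OF V(1,2)] fib V(3,4) by auto
    have og: "openM M (g ` V)" using o V by blast
    have gy: "g y \<in> g ` V" using V by blast
    have "\<Phi> (g y) (dorfman E (T u) (T v) (g y)) =
        dorfman E' (\<lambda>y. \<Phi> (g y) (T u (g y))) (\<lambda>y. \<Phi> (g y) (T v (g y))) y"
      using d(12)[OF sub(1)[OF V(1)] og Ts gy] fg(1)[OF y] by simp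
    also have "... = dorfman E' u v y"
      by (rule tame_onD(3)[OF t(2) V(1-4) _ _ V(5)]) (rule T\<Phi>[OF V(1)]; use fib V(3,4) in blast)+
    finally have "?\<Psi> y (dorfman E' u v y) = ?\<Psi> y (\<Phi> (g y) (dorfman E (T u) (T v) (g y)))" by simp
    also have "... = dorfman E (T u) (T v) (g y)"
      using c sub(1)[OF V(1)] og Ts gy unfolding dorfman_closed_def by (intro \<Psi>[OF y]) blast
    finally show ?thesis .
  qed
  show ?thesis unfolding local_iso_def
  proof (intro conjI allI impI ballI; (elim conjE)?)
    show "openM N U'" "openM M U" "g ` U' = U" using i0 by auto
    show "f (g y) = y" if "y \<in> U'" for y by (rule fg(1)[OF that])
    show "openM N V \<longleftrightarrow> openM M (g ` V)" if "V \<subseteq> U'" for V using i1 that by blast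
    show "smooth_on M (g ` V) h \<longleftrightarrow> smooth_on N V (\<lambda>x. h (g x))" if "V \<subseteq> U'" "openM N V" for V h
      by (rule i2[OF that])
    show "linear_over (fibre E' y) (?\<Psi> y)" "bij_betw (?\<Psi> y) (fibre E' y) (fibre E (g y))" if "y \<in> U'" for y
      using i3[OF that] by simp_all
    show "anchor E (g y) (?\<Psi> y b) (\<lambda>x. h (f x)) = anchor E' y b h" if "y \<in> U'" "b \<in> fibre E' y" for y b h
      by (rule i4[OF that])
    show "pairing E (g y) (?\<Psi> y a) (?\<Psi> y b) = pairing E' y a b"
      if "y \<in> U'" "a \<in> fibre E' y" "b \<in> fibre E' y" for y a b by (rule i5[OF that])
    show "u \<in> sections E' V \<longleftrightarrow> (\<lambda>x. inv_into (fibre E (g (f x))) (\<Phi> (g (f x))) (u (f x))) \<in> sections E (g ` V)"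
      if "V \<subseteq> U'" "openM N V" "\<forall>y\<in>V. u y \<in> fibre E' y" for V u
      by (rule sec[unfolded T_def, OF that(1,2)]) (use that(3) in blast)
    show "?\<Psi> y (dorfman E' u v y) = dorfman E (\<lambda>x. inv_into (fibre E (g (f x))) (\<Phi> (g (f x))) (u (f x)))
          (\<lambda>x. inv_into (fibre E (g (f x))) (\<Phi> (g (f x))) (v (f x))) (g y)"
      if "V \<subseteq> U'" "openM N V" "u \<in> sections E' V" "v \<in> sections E' V" "y \<in> V" for V u v y
      by (rule i6[unfolded T_def, OF that])
  qed
qed

section \<open>Germs of equivalences\<close>

definition intertwines :: "'a set \<Rightarrow> ('a, 'e::real_vector) courant \<Rightarrow> ('a \<Rightarrow> 'e \<Rightarrow> 'e) \<Rightarrow> ('b \<Rightarrow> 'f \<Rightarrow> 'f) \<Rightarrow>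
    ('a \<Rightarrow> 'b) \<Rightarrow> ('a \<Rightarrow> 'e \<Rightarrow> 'f) \<Rightarrow> bool"
  where "intertwines U E J J' f \<Phi> \<longleftrightarrow>
    (\<forall>x\<in>U. \<forall>a\<in>fibre E x. J x a \<in> fibre E x \<and> \<Phi> x (J x a) = J' (f x) (\<Phi> x a))"

lemma inverse_of_homeomorphic_map_preimage:
  "inj_on f U \<Longrightarrow> V \<subseteq> U \<Longrightarrow> {x \<in> U. f x \<in> f ` V} = V" by (auto simp: inj_on_def)

text \<open>Open subsets of the two submanifolds correspond under \<open>f\<close>, so conditions on
  open sets of the target and their preimages become conditions on open subsets of \<open>U\<close>
  and their images. The topological part of the diffeomorphism is settled first, because the smooth
  part is translated with its help.\<close>

lemma gcs_equivalence_iff: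
  assumes M: "proper_charts M" and N: "proper_charts N"
    and U: "openM M U" and U': "openM N U'"
    and J: "\<And>x a. x \<in> U \<Longrightarrow> a \<in> fibre E x \<Longrightarrow> J x a \<in> fibre E x"
  shows "gcs_equivalence (open_submanifold M U) E J (open_submanifold N U') E' J' f \<Phi> \<longleftrightarrow>
    local_iso M U E N U' E' f (inv_into U f) \<Phi> \<and> intertwines U E J J' f \<Phi>"
proof -
  note tU = topspace_submanifold[OF U] topspace_submanifold[OF U']
  have sub: "mtop (open_submanifold M U) = subtopology (mtop M) U"
    "mtop (open_submanifold N U') = subtopology (mtop N) U'" by (simp_all add: open_submanifold_def)
  have h: "homeomorphic_map (mtop (open_submanifold M U)) (mtop (open_submanifold N U')) f \<longleftrightarrow>
      f ` U = U' \<and> inj_on f U \<and> (\<forall>V\<subseteq>U. openM M V \<longleftrightarrow> openM N (f ` V))" (is "?l = ?r")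
  proof
    assume l: ?l
    have 1: "f ` U = U'" "inj_on f U"
      using homeomorphic_imp_surjective_map[OF l] homeomorphic_imp_injective_map[OF l] tU by auto
    have "openM M V \<longleftrightarrow> openM N (f ` V)" if V: "V \<subseteq> U" for V
    proof -
      have "openin (mtop (open_submanifold N U')) (f ` V) \<longleftrightarrow> openin (mtop (open_submanifold M U)) V"
        using homeomorphic_map_openness[OF l] V tU by blast
      moreover have "f ` V \<subseteq> U'" using V 1 by blast
      ultimately show ?thesis using openin_submanifold[OF U] openin_submanifold[OF U'] V by simp
    qed
    thus ?r using 1 by blast
  next
    assume r: ?r
    hence r1: "f ` U = U'" "inj_on f U" by simp_all
    have r3: "openM M V \<longleftrightarrow> openM N (f ` V)" if "V \<subseteq> U" for V using r that by simp
    show ?l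
    proof (rule bijective_open_imp_homeomorphic_map)
      show "continuous_map (mtop (open_submanifold M U)) (mtop (open_submanifold N U')) f"
        unfolding continuous_map tU
      proof (intro conjI allI impI)
        show "f ` U \<subseteq> U'" using r1 by blast
        fix W assume W: "openin (mtop (open_submanifold N U')) W"
        hence W': "W \<subseteq> U'" "openM N W" using openin_submanifold[OF U'] by auto
        let ?V = "{x \<in> U. f x \<in> W}"
        have "f ` ?V = W" using W' r1 by blast
        moreover have "openM M ?V \<longleftrightarrow> openM N (f ` ?V)" by (rule r3) blast
        ultimately have "openM M ?V" using W' by simp
        thus "openin (mtop (open_submanifold M U)) ?V" using openin_submanifold[OF U] by blast
      qed
      show "open_map (mtop (open_submanifold M U)) (mtop (open_submanifold N U')) f"
        unfolding open_map_def openin_submanifold[OF U] openin_submanifold[OF U']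
      proof (intro allI impI conjI; elim conjE)
        fix V assume V: "V \<subseteq> U" "openM M V"
        show "f ` V \<subseteq> U'" using V(1) r1(1) by blast
        show "openM N (f ` V)" using V r3[OF V(1)] by blast
      qed
    qed (use r1 tU in auto)
  qed
  have sm: "(\<forall>V h. openin (mtop (open_submanifold N U')) V \<longrightarrow> (smooth_on (open_submanifold N U') V h \<longleftrightarrow>
       smooth_on (open_submanifold M U) {x \<in> topspace (mtop (open_submanifold M U)). f x \<in> V} (\<lambda>x. h (f x)))) \<longleftrightarrow>
     (\<forall>V h. V \<subseteq> U \<and> openM M V \<longrightarrow> (smooth_on N (f ` V) h \<longleftrightarrow> smooth_on M V (\<lambda>x. h (f x))))"
    (is "?l = ?r") if r: "f ` U = U'" "inj_on f U" "\<And>V. V \<subseteq> U \<Longrightarrow> openM M V \<longleftrightarrow> openM N (f ` V)"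
  proof
    assume l: ?l
    show ?r
    proof (intro allI impI)
      fix V h assume V: "V \<subseteq> U \<and> openM M V"
      have fV: "f ` V \<subseteq> U'" using V r(1) by blast
      have "openin (mtop (open_submanifold N U')) (f ` V)"
        using V r(3)[of V] fV openin_submanifold[OF U'] by blast
      with l have "smooth_on (open_submanifold N U') (f ` V) h \<longleftrightarrow>
          smooth_on (open_submanifold M U) {x \<in> U. f x \<in> f ` V} (\<lambda>x. h (f x))" unfolding tU by blast
      thus "smooth_on N (f ` V) h \<longleftrightarrow> smooth_on M V (\<lambda>x. h (f x))"
        using inverse_of_homeomorphic_map_preimage[OF r(2), of V] V fV
        by (simp add: smooth_on_submanifold[OF M U] smooth_on_submanifold[OF N U'])
    qed
  next
    assume l: ?r
    show ?l
    proof (intro allI impI)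
      fix W h assume "openin (mtop (open_submanifold N U')) W"
      hence W: "W \<subseteq> U'" "openM N W" using openin_submanifold[OF U'] by auto
      let ?V = "{x \<in> U. f x \<in> W}"
      have fV: "f ` ?V = W" using W r(1) by blast
      have "openM M ?V" using r(3)[of ?V] fV W(2) by auto
      hence "smooth_on N W h \<longleftrightarrow> smooth_on M ?V (\<lambda>x. h (f x))" using l[rule_format, of ?V h] fV by simp
      thus "smooth_on (open_submanifold N U') W h \<longleftrightarrow>
       smooth_on (open_submanifold M U) {x \<in> topspace (mtop (open_submanifold M U)). f x \<in> W} (\<lambda>x. h (f x))"
        unfolding tU using W by (simp add: smooth_on_submanifold[OF M U] smooth_on_submanifold[OF N U'])
    qed
  qed
  have inj: "inj_on f U" if "\<forall>x\<in>U. inv_into U f (f x) = x" using that by (metis inj_on_inverseI)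
  have dif: "diffeomorphism (open_submanifold M U) (open_submanifold N U') f \<longleftrightarrow>
      f ` U = U' \<and> (\<forall>x\<in>U. inv_into U f (f x) = x) \<and> (\<forall>V\<subseteq>U. openM M V \<longleftrightarrow> openM N (f ` V)) \<and>
      (\<forall>V h. V \<subseteq> U \<and> openM M V \<longrightarrow> (smooth_on N (f ` V) h \<longleftrightarrow> smooth_on M V (\<lambda>x. h (f x))))"
    (is "?d = ?r")
  proof (cases "f ` U = U' \<and> inj_on f U \<and> (\<forall>V\<subseteq>U. openM M V \<longleftrightarrow> openM N (f ` V))")
    case True
    hence "?d \<longleftrightarrow> (\<forall>V h. V \<subseteq> U \<and> openM M V \<longrightarrow> (smooth_on N (f ` V) h \<longleftrightarrow> smooth_on M V (\<lambda>x. h (f x))))"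
      unfolding diffeomorphism_def using h sm by simp
    moreover have "\<forall>x\<in>U. inv_into U f (f x) = x" using True by (simp add: inv_into_f_f)
    ultimately show ?thesis using True by simp
  next
    case False
    hence "\<not> ?d" unfolding diffeomorphism_def using h by blast
    moreover have "\<not> ?r" using False inj by blast
    ultimately show ?thesis by simp
  qed
  have iso: "courant_iso (open_submanifold M U) E (courant_pullback (open_submanifold M U) f E') \<Phi> \<longleftrightarrow>
    (\<forall>x\<in>U. linear_over (fibre E x) (\<Phi> x) \<and> bij_betw (\<Phi> x) (fibre E x) (fibre E' (f x))) \<and>
    (\<forall>x\<in>U. \<forall>a\<in>fibre E x. \<forall>h. anchor E' (f x) (\<Phi> x a) (\<lambda>y. h (inv_into U f y)) = anchor E x a h) \<and>
    (\<forall>x\<in>U. \<forall>a\<in>fibre E x. \<forall>b\<in>fibre E x. pairing E' (f x) (\<Phi> x a) (\<Phi> x b) = pairing E x a b) \<and>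
    (\<forall>V u. V \<subseteq> U \<and> openM M V \<and> (\<forall>x\<in>V. u x \<in> fibre E x) \<longrightarrow>
       (u \<in> sections E V \<longleftrightarrow> (\<lambda>y. \<Phi> (inv_into U f y) (u (inv_into U f y))) \<in> sections E' (f ` V))) \<and>
    (\<forall>V u v x. V \<subseteq> U \<and> openM M V \<and> u \<in> sections E V \<and> v \<in> sections E V \<and> x \<in> V \<longrightarrow> \<Phi> x (dorfman E u v x) =
         dorfman E' (\<lambda>y. \<Phi> (inv_into U f y) (u (inv_into U f y)))
           (\<lambda>y. \<Phi> (inv_into U f y) (v (inv_into U f y))) (f x))"
    unfolding courant_iso_def courant_pullback_def tU openin_submanifold[OF U] Let_def
    by (simp add: fun_eq_iff) (safe; blast)
  have int: "intertwines U E J J' f \<Phi> \<longleftrightarrow> (\<forall>x\<in>U. \<forall>a\<in>fibre E x. \<Phi> x (J x a) = J' (f x) (\<Phi> x a))"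
    using J unfolding intertwines_def by blast
  show ?thesis unfolding gcs_equivalence_def dif iso local_iso_def int tU
    by (rule iffI; elim conjE; intro conjI; (assumption | rule U U'))
qed

text \<open>The germ of an equivalence at a point. Tameness on both sides is part of it, so that
  germs can be composed and compared without returning to the axioms.\<close>

definition pointed_iso :: "'a manifold \<Rightarrow> ('a, 'e::real_vector) courant \<Rightarrow> ('a \<Rightarrow> 'e \<Rightarrow> 'e) \<Rightarrow> 'a \<Rightarrow>
    'b manifold \<Rightarrow> ('b, 'f::real_vector) courant \<Rightarrow> ('b \<Rightarrow> 'f \<Rightarrow> 'f) \<Rightarrow> 'b \<Rightarrow> bool"
  where "pointed_iso M E J x N E' J' x' \<longleftrightarrow>
    (\<exists>U U' f g \<Phi>. local_iso M U E N U' E' f g \<Phi> \<and> x \<in> U \<and> f x = x' \<and> intertwines U E J J' f \<Phi> \<and>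
       tame_on M E U \<and> tame_on N E' U')"

lemma intertwines_subset: "intertwines U E J J' f \<Phi> \<Longrightarrow> V \<subseteq> U \<Longrightarrow> intertwines V E J J' f \<Phi>"
  by (auto simp: intertwines_def)

lemma pointed_iso_trans:
  assumes "pointed_iso M E J x N E' J' y" "pointed_iso N E' J' y P E'' J'' z"
  shows "pointed_iso M E J x P E'' J'' z"
proof -
  obtain U U' f g \<Phi> where 1: "local_iso M U E N U' E' f g \<Phi>" "x \<in> U" "f x = y"
    "intertwines U E J J' f \<Phi>" "tame_on M E U" "tame_on N E' U'"
    using assms(1) unfolding pointed_iso_def by blast
  obtain W W' f' g' \<Phi>' where 2: "local_iso N W E' P W' E'' f' g' \<Phi>'" "y \<in> W" "f' y = z"
    "intertwines W E' J' J'' f' \<Phi>'" "tame_on N E' W" "tame_on P E'' W'"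
    using assms(2) unfolding pointed_iso_def by blast
  note d = local_isoD[OF 1(1)] and e = local_isoD[OF 2(1)]
  define V where "V = {x \<in> U. f x \<in> W}"
  have V: "V \<subseteq> U" "f ` V = U' \<inter> W" using d(3) by (auto simp: V_def)
  have oV: "openM N (U' \<inter> W)" using d(2) e(1) by (rule openin_Int)
  hence V': "openM M V" using d(5)[OF V(1)] V(2) by simp
  have oW: "f' ` (U' \<inter> W) \<subseteq> W'" using e(3) by blast
  have i1: "local_iso M V E N (U' \<inter> W) E' f g \<Phi>" using local_iso_restrict[OF 1(1) V(1) V'] V(2) by simp
  have i2: "local_iso N (U' \<inter> W) E' P (f' ` (U' \<inter> W)) E'' f' g' \<Phi>'"
    by (rule local_iso_restrict[OF 2(1) _ oV]) blast
  have t: "tame_on M E V" "tame_on P E'' (f' ` (U' \<inter> W))"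
    using tame_on_subset[OF 1(5) V(1)] tame_on_subset[OF 2(6) oW] by auto
  have "\<Phi> w a \<in> fibre E' (f w)" if "w \<in> V" "a \<in> fibre E w" for w a
    using d(8)[of w] that V(1) bij_betwE by blast
  hence "intertwines V E J J'' (\<lambda>x. f' (f x)) (\<lambda>x a. \<Phi>' (f x) (\<Phi> x a))"
    using 1(4) 2(4) unfolding intertwines_def V_def by simp
  moreover have "x \<in> V" "f' (f x) = z" using 1(2,3) 2(2,3) by (simp_all add: V_def)
  ultimately show ?thesis unfolding pointed_iso_def using local_iso_compose[OF i1 i2 t] t by blast
qed

text \<open>The source must be a Courant algebroid because its bracket has to take values in the
  fibres near the point; accordingly, inverses are taken only of germs that start at one of the two
  given structures.\<close>

lemma pointed_iso_sym:
  assumes i: "pointed_iso M E J x N E' J' y" and M: "proper_charts M" and E: "courant_algebroid M E"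
  shows "pointed_iso N E' J' y M E J x"
proof -
  obtain U U' f g \<Phi> where 1: "local_iso M U E N U' E' f g \<Phi>" "x \<in> U" "f x = y"
    "intertwines U E J J' f \<Phi>" "tame_on M E U" "tame_on N E' U'" using i unfolding pointed_iso_def by blast
  note d = local_isoD[OF 1(1)]
  have "x \<in> topspace (mtop M)" using d(1) 1(2) openin_subset by blast
  then obtain T where T: "openM M T" "x \<in> T" "tame_on M E T" "dorfman_closed M E T"
    using courant_algebroid_tame[OF M E] by metis
  let ?V = "U \<inter> T"
  have V: "openM M ?V" "?V \<subseteq> U" "f ` ?V \<subseteq> U'" using d(1,3) T(1) by (auto intro: openin_Int)
  have S: "subspace (fibre E w)" if "w \<in> ?V" for w
  proof -
    have "w \<in> topspace (mtop M)" using that V(1) openin_subset by blast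
    from E[unfolded courant_algebroid_def, THEN conjunct1, unfolded vector_bundle_def, THEN conjunct1,
        THEN bspec, OF this]
    show ?thesis .
  qed
  have c: "dorfman_closed M E ?V" using T(4) unfolding dorfman_closed_def Int_subset_iff by blast
  have t: "tame_on M E ?V" "tame_on N E' (f ` ?V)"
    using tame_on_subset[OF 1(5) V(2)] tame_on_subset[OF 1(6) V(3)] by auto
  let ?\<Psi> = "\<lambda>y. inv_into (fibre E (g y)) (\<Phi> (g y))"
  have i': "local_iso N (f ` ?V) E' M ?V E g f ?\<Psi>"
    by (rule local_iso_inverse[OF local_iso_restrict[OF 1(1) V(2,1)] M t c S])
  have "intertwines (f ` ?V) E' J' J g ?\<Psi>" unfolding intertwines_def
  proof (intro ballI)
    fix w b assume w: "w \<in> f ` ?V" "b \<in> fibre E' w"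
    then obtain v where v: "v \<in> U" "w = f v" by blast
    obtain a where a: "a \<in> fibre E v" "b = \<Phi> v a"
      using d(8)[OF v(1)] w(2) v(2) unfolding bij_betw_def by blast
    have J: "J v a \<in> fibre E v" "\<Phi> v (J v a) = J' w b" using 1(4) v a unfolding intertwines_def by auto
    have inj: "inj_on (\<Phi> v) (fibre E v)" using d(8)[OF v(1)] by (simp add: bij_betw_def)
    have "\<Phi> v (J v a) \<in> fibre E' (f v)" using J(1) bij_betwE[OF d(8)[OF v(1)]] by blast
    hence "J' w b \<in> fibre E' w" unfolding J(2) v(2) .
    moreover have "?\<Psi> w (J' w b) = J (g w) (?\<Psi> w b)"
      using J(1) a d(4)[OF v(1)] v(2) inv_into_f_f[OF inj] unfolding J(2)[symmetric] by simp
    ultimately show "J' w b \<in> fibre E' w \<and> ?\<Psi> w (J' w b) = J (g w) (?\<Psi> w b)" ..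
  qed
  moreover have "y \<in> f ` ?V" "g y = x" using 1(2,3) T(2) d(4) by auto
  ultimately show ?thesis unfolding pointed_iso_def using i' t by blast
qed

lemma pointed_iso_locally_equivalent:
  assumes i: "pointed_iso M E J x N E' J' y" and M: "proper_charts M" and N: "proper_charts N"
  shows "locally_equivalent M E J x N E' J' y"
proof -
  obtain U U' f g \<Phi> where 1: "local_iso M U E N U' E' f g \<Phi>" "x \<in> U" "f x = y"
    "intertwines U E J J' f \<Phi>" "tame_on M E U" "tame_on N E' U'" using i unfolding pointed_iso_def by blast
  note d = local_isoD[OF 1(1)]
  have inj: "inj_on f U" using d(4) by (metis inj_on_inverseI)
  have "local_iso M U E N U' E' f (inv_into U f) \<Phi>"
    by (rule local_iso_change_inverse[OF 1(1,5,6)]) (simp add: inj)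
  moreover have "J w a \<in> fibre E w" if "w \<in> U" "a \<in> fibre E w" for w a
    using 1(4) that by (simp add: intertwines_def)
  ultimately have "gcs_equivalence (open_submanifold M U) E J (open_submanifold N U') E' J' f \<Phi>"
    using gcs_equivalence_iff[OF M N d(1,2)] 1(4) by blast
  moreover have "y \<in> U'" using 1(2,3) d(3) by blast
  ultimately show ?thesis unfolding locally_equivalent_def using d(1,2) 1(2,3) by blast
qed

lemma gcs_equivalence_pointed_iso:
  assumes e: "gcs_equivalence (open_submanifold M U) E J (open_submanifold N U') E' J' f \<Phi>"
    and M: "proper_charts M" and N: "proper_charts N"
    and U: "openM M U" and U': "openM N U'" and x: "x \<in> U"
    and J: "\<And>x a. x \<in> U \<Longrightarrow> a \<in> fibre E x \<Longrightarrow> J x a \<in> fibre E x"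
    and T: "openM M T" "x \<in> T" "tame_on M E T"
    and T': "openM N T'" "f x \<in> T'" "tame_on N E' T'"
  shows "pointed_iso M E J x N E' J' (f x)"
proof -
  have 1: "local_iso M U E N U' E' f (inv_into U f) \<Phi>" "intertwines U E J J' f \<Phi>"
    using e gcs_equivalence_iff[OF M N U U', of E J E' J' f \<Phi>] J by simp_all
  note d = local_isoD[OF 1(1)]
  define S where "S = {x \<in> U. f x \<in> T'}"
  have "f ` S = U' \<inter> T'" using d(3) by (auto simp: S_def)
  hence S: "openM M S" using d(5)[of S] openin_Int[OF d(2) T'(1)] by (simp add: S_def)
  let ?V = "S \<inter> T"
  have V: "openM M ?V" "?V \<subseteq> U" "?V \<subseteq> T" "f ` ?V \<subseteq> T'" using openin_Int[OF S T(1)] by (auto simp: S_def)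
  have "x \<in> ?V" using x T(2) T'(2) by (simp add: S_def)
  thus ?thesis unfolding pointed_iso_def
    using local_iso_restrict[OF 1(1) V(2,1)] intertwines_subset[OF 1(2) V(2)]
      tame_on_subset[OF T(3) V(3)] tame_on_subset[OF T'(3) V(4)] by blast
qed

lemma locally_equivalent_pointed_iso:
  assumes e: "locally_equivalent M E J x N E' J' y"
    and M: "proper_charts M" and N: "proper_charts N"
    and E: "courant_algebroid M E" and E': "courant_algebroid N E'"
    and J: "\<And>x a. x \<in> topspace (mtop M) \<Longrightarrow> a \<in> fibre E x \<Longrightarrow> J x a \<in> fibre E x"
  shows "pointed_iso M E J x N E' J' y"
proof -
  obtain U U' f \<Phi> where 1: "openM M U" "x \<in> U" "openM N U'" "y \<in> U'" "f x = y"
    "gcs_equivalence (open_submanifold M U) E J (open_submanifold N U') E' J' f \<Phi>"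
    using e unfolding locally_equivalent_def by blast
  have xy: "x \<in> topspace (mtop M)" "y \<in> topspace (mtop N)" using 1 openin_subset by blast+
  obtain T where T: "openM M T" "x \<in> T" "tame_on M E T" using courant_algebroid_tame[OF M E xy(1)] by metis
  obtain T' where T': "openM N T'" "y \<in> T'" "tame_on N E' T'"
    using courant_algebroid_tame[OF N E' xy(2)] by metis
  have "w \<in> topspace (mtop M)" if "w \<in> U" for w using openin_subset[OF 1(1)] that by blast
  thus ?thesis using gcs_equivalence_pointed_iso[OF 1(6) M N 1(1,3,2) J T T'(1) _ T'(3)] T'(2) 1(5) by simp
qed

section \<open>The untwisted Courant algebroid over a coordinate space\<close>

text \<open>The \<open>chart_vector\<close> of the identity chart, freed from the inverse of the
  chart.\<close>

definition tvec :: "nat \<Rightarrow> (nat \<Rightarrow> real) \<Rightarrow> (nat \<Rightarrow> real) \<Rightarrow> (nat \<Rightarrow> real) tvec"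
  where "tvec n v w = (\<lambda>f. if smooth_near (Rn n) v f then \<Sum>i<n. w i * partial_deriv i f v else 0)"

lemma smooth_near_Rn:
  "smooth_near (Rn n) v f \<longleftrightarrow> (\<exists>U. opn n U \<and> v \<in> U \<and> smooth_Rn n U f)"
  unfolding smooth_near_def smooth_on_Rn by blast

lemma smooth_nearI:
  "opn n U \<Longrightarrow> v \<in> U \<Longrightarrow> smooth_Rn n U f \<Longrightarrow> smooth_near (Rn n) v f" unfolding smooth_near_Rn by blast

lemma openin_Euclidean [simp]: "opn n (ER n)" by (rule openin_topspace)

lemma smooth_near_coord: "v \<in> ER n \<Longrightarrow> smooth_near (Rn n) v (\<lambda>y. y i)"
  by (rule smooth_nearI[OF openin_Euclidean _ smooth_Rn_coord[OF openin_Euclidean]])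

lemma tangent_space_Rn:
  assumes v: "v \<in> ER n"
  shows "TR n v = range (tvec n v)"
proof -
  have "chart_vector (Rn n) (ER n) (\<lambda>x. x) v w = tvec n v w" for w
  proof
    fix f
    have "partial_deriv i (\<lambda>y. f (inv_into (ER n) (\<lambda>x. x) y)) v = partial_deriv i f v" if "i < n" for i
    proof (rule partial_deriv_cong(1)[OF openin_Euclidean v that])
      fix y assume "y \<in> ER n"
      thus "f (inv_into (ER n) (\<lambda>x. x) y) = f y"
        using inv_into_f_f[of "\<lambda>x. x" "ER n" y] by (simp add: inj_on_def)
    qed
    hence "(\<Sum>i<n. w i * partial_deriv i (\<lambda>y. f (inv_into (ER n) (\<lambda>x. x) y)) v) =
        (\<Sum>i<n. w i * partial_deriv i f v)" by (intro sum.cong) simp_all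
    thus "chart_vector (Rn n) (ER n) (\<lambda>x. x) v w f = tvec n v w f" by (simp add: chart_vector_def tvec_def)
  qed
  thus ?thesis using v by (auto simp: tangent_space_def)
qed

lemma tvec_coord:
  assumes v: "v \<in> ER n" and i: "i < n"
  shows "tvec n v w (\<lambda>y. y i) = w i"
proof -
  have "(\<Sum>j<n. w j * (if i = j then 1 else 0)) = w i" using i by (simp add: if_distrib cong: if_cong)
  thus ?thesis by (simp add: tvec_def smooth_near_coord[OF v] partial_deriv_coord)
qed

lemma tvec_cong: "(\<And>i. i < n \<Longrightarrow> w i = w' i) \<Longrightarrow> tvec n v w = tvec n v w'"
  unfolding tvec_def by (intro ext if_cong refl sum.cong) simp_all

lemma tangent_eq_tvec:
  assumes v: "v \<in> ER n" and X: "X \<in> TR n v"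
  shows "X = tvec n v (\<lambda>i. X (\<lambda>y. y i))"
proof -
  obtain w where w: "X = tvec n v w" using X tangent_space_Rn[OF v] by blast
  show ?thesis unfolding w by (rule tvec_cong) (simp add: tvec_coord[OF v])
qed

lemma tvec_in_tangent: "v \<in> ER n \<Longrightarrow> tvec n v w \<in> TR n v" by (simp add: tangent_space_Rn)

text \<open>The coordinate functions determine the components of a tangent vector; every identity of
  vector parts below is reduced to them.\<close>

lemma tangent_eqI:
  assumes "v \<in> ER n" "X \<in> TR n v"
    "Y \<in> TR n v" "\<And>i. i < n \<Longrightarrow> X (\<lambda>y. y i) = Y (\<lambda>y. y i)"
  shows "X = Y"
proof -
  have "X = tvec n v (\<lambda>i. X (\<lambda>y. y i))" by (rule tangent_eq_tvec[OF assms(1,2)])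
  also have "... = tvec n v (\<lambda>i. Y (\<lambda>y. y i))" by (rule tvec_cong) (rule assms(4))
  also have "... = Y" by (rule tangent_eq_tvec[OF assms(1,3), symmetric])
  finally show ?thesis .
qed

lemma tvec_add: "tvec n v w + tvec n v w' = tvec n v (\<lambda>i. w i + w' i)"
  by (auto simp: tvec_def fun_eq_iff algebra_simps sum.distrib)

lemma tvec_scaleR: "c *\<^sub>R tvec n v w = tvec n v (\<lambda>i. c * w i)"
  by (auto simp: tvec_def fun_eq_iff scaleR_fun_def sum_distrib_left mult.assoc)

lemma tvec_zero: "tvec n v (\<lambda>i. 0) = 0" by (auto simp: tvec_def fun_eq_iff)

lemma subspace_tangent_Rn:
  assumes v: "v \<in> ER n"
  shows "subspace (TR n v)" unfolding tangent_space_Rn[OF v]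
proof (rule subspaceI)
  show "0 \<in> range (tvec n v)" by (rule range_eqI) (rule tvec_zero[symmetric])
  fix X Y assume "X \<in> range (tvec n v)" "Y \<in> range (tvec n v)"
  then obtain w w' where "X = tvec n v w" "Y = tvec n v w'" by blast
  thus "X + Y \<in> range (tvec n v)" by (simp only: tvec_add rangeI)
next
  fix c X assume "X \<in> range (tvec n v)"
  then obtain w where "X = tvec n v w" by blast
  thus "c *\<^sub>R X \<in> range (tvec n v)" by (simp only: tvec_scaleR rangeI)
qed

lemma coord_vector_tvec:
  assumes "i < n"
  shows "cvec n v i = tvec n v (\<lambda>j. if j = i then 1 else 0)"
proof -
  have "(\<Sum>j<n. (if j = i then 1 else 0) * partial_deriv j f v) = partial_deriv i f v" for f
    using assms by (simp add: if_distrib[of "\<lambda>x. x * _"] cong: if_cong)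
  thus ?thesis by (simp add: coord_vector_def tvec_def fun_eq_iff)
qed

lemma coord_vector_tangent:
  "v \<in> ER n \<Longrightarrow> i < n \<Longrightarrow> cvec n v i \<in> TR n v" by (simp add: coord_vector_tvec tvec_in_tangent)

lemma coord_vector_coord:
  "v \<in> ER n \<Longrightarrow> i < n \<Longrightarrow> j < n \<Longrightarrow> cvec n v i (\<lambda>y. y j) = (if j = i then 1 else 0)"
  by (simp add: coord_vector_tvec tvec_coord)

lemma tangent_eq_sum:
  assumes v: "v \<in> ER n" and X: "X \<in> TR n v"
  shows "X = (\<Sum>i<n. X (\<lambda>y. y i) *\<^sub>R cvec n v i)"
proof (rule tangent_eqI[OF v X])
  note s = subspace_tangent_Rn[OF v]
  show "(\<Sum>i<n. X (\<lambda>y. y i) *\<^sub>R cvec n v i) \<in> TR n v"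
    by (intro subspace_sum[OF s] subspace_scale[OF s] coord_vector_tangent[OF v]) simp
  fix j assume j: "j < n"
  have "(\<Sum>i<n. X (\<lambda>y. y i) *\<^sub>R cvec n v i) (\<lambda>y. y j) = (\<Sum>i<n. X (\<lambda>y. y i) * cvec n v i (\<lambda>y. y j))"
  proof -
    have "(\<Sum>i\<in>I. F i) f = (\<Sum>i\<in>I. F i f)" if "finite I" for I and F :: "nat \<Rightarrow> (nat \<Rightarrow> real) tvec" and f
      using that by induction (simp_all add: plus_fun_def)
    thus ?thesis by (simp add: scaleR_fun_def)
  qed
  also have "... = (\<Sum>i<n. if i = j then X (\<lambda>y. y i) else 0)"
    by (intro sum.cong) (simp_all add: coord_vector_coord[OF v _ j])
  also have "... = X (\<lambda>y. y j)" using j by simp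
  finally show "X (\<lambda>y. y j) = (\<Sum>i<n. X (\<lambda>y. y i) *\<^sub>R cvec n v i) (\<lambda>y. y j)" by simp
qed

lemma linear_over_sum:
  assumes l: "linear_over S f" and S: "subspace S" and I: "\<And>i. i \<in> I \<Longrightarrow> a i \<in> S"
  shows "f (\<Sum>i\<in>I. a i) = (\<Sum>i\<in>I. f (a i))"
proof -
  have f: "\<And>a b. a \<in> S \<Longrightarrow> b \<in> S \<Longrightarrow> f (a + b) = f a + f b" "\<And>c a. a \<in> S \<Longrightarrow> f (c *\<^sub>R a) = c *\<^sub>R f a"
    using l by (auto simp: linear_over_def)
  have f0: "f 0 = 0" using f(2)[of 0 0] subspace_0[OF S] by simp
  show ?thesis using I
  proof (induction I rule: infinite_finite_induct)
    case (insert i I)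
    thus ?case using f(1)[of "a i" "\<Sum>i\<in>I. a i"] subspace_sum[OF S, of I a] by simp
  qed (simp_all add: f0)
qed

lemma covector_eq_sum:
  assumes v: "v \<in> ER n" and X: "X \<in> TR n v"
    and \<xi>: "\<xi> \<in> dual_space (TR n v)"
  shows "\<xi> X = (\<Sum>i<n. X (\<lambda>y. y i) * \<xi> (cvec n v i))"
proof -
  note s = subspace_tangent_Rn[OF v]
  have l: "linear_over (TR n v) \<xi>" using \<xi> by (simp add: dual_space_def)
  have "\<xi> X = \<xi> (\<Sum>i<n. X (\<lambda>y. y i) *\<^sub>R cvec n v i)" by (subst tangent_eq_sum[OF v X]) (rule refl)
  also have "... = (\<Sum>i<n. \<xi> (X (\<lambda>y. y i) *\<^sub>R cvec n v i))"
    by (intro linear_over_sum[OF l s] subspace_scale[OF s] coord_vector_tangent[OF v]) simp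
  also have "... = (\<Sum>i<n. X (\<lambda>y. y i) * \<xi> (cvec n v i))"
    using l coord_vector_tangent[OF v] by (intro sum.cong) (simp_all add: linear_over_def)
  finally show ?thesis .
qed

section \<open>Covectors in coordinates\<close>

definition covec :: "nat \<Rightarrow> (nat \<Rightarrow> real) \<Rightarrow> (nat \<Rightarrow> real) \<Rightarrow> (nat \<Rightarrow> real) covec"
  where "covec n v c = (\<lambda>X. if X \<in> TR n v then \<Sum>i<n. X (\<lambda>y. y i) * c i else 0)"

lemma covec_dual:
  assumes v: "v \<in> ER n"
  shows "covec n v c \<in> dual_space (TR n v)"
proof -
  note s = subspace_tangent_Rn[OF v]
  have "covec n v c (X + Y) = covec n v c X + covec n v c Y" if "X \<in> TR n v" "Y \<in> TR n v" for X Y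
    using that subspace_add[OF s that]
    by (simp add: covec_def plus_fun_def sum.distrib[symmetric] distrib_right)
  moreover have "covec n v c (a *\<^sub>R X) = a * covec n v c X" if "X \<in> TR n v" for a X
    using that subspace_scale[OF s that, of a]
    by (simp add: covec_def scaleR_fun_def sum_distrib_left mult.assoc)
  moreover have "covec n v c X = 0" if "X \<notin> TR n v" for X using that by (simp add: covec_def)
  ultimately show ?thesis unfolding dual_space_def linear_over_def by simp
qed

lemma covec_coord:
  assumes v: "v \<in> ER n" and i: "i < n"
  shows "covec n v c (cvec n v i) = c i"
proof -
  have "(\<Sum>j<n. cvec n v i (\<lambda>y. y j) * c j) = (\<Sum>j<n. if j = i then c j else 0)"
    by (intro sum.cong) (simp_all add: coord_vector_coord[OF v i])
  thus ?thesis using i by (simp add: covec_def coord_vector_tangent[OF v i])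
qed

section \<open>Tangent vectors as derivations\<close>

context
  fixes n :: nat and U :: "(nat \<Rightarrow> real) set" and v :: "nat \<Rightarrow> real" and X :: "(nat \<Rightarrow> real) tvec"
  assumes U: "opn n U" and v: "v \<in> U"
    and X: "X \<in> TR n v"
begin

lemma U_Euclidean: "v \<in> ER n" using U v openin_subset by blast

lemma tder_eq:
  assumes "smooth_Rn n U f"
  shows "X f = (\<Sum>i<n. X (\<lambda>y. y i) * partial_deriv i f v)" by (subst tangent_eq_tvec[OF U_Euclidean X])
    (simp add: tvec_def smooth_nearI[OF U v assms])

lemma tder_add:
  assumes "smooth_Rn n U f" "smooth_Rn n U g"
  shows "X (\<lambda>y. f y + g y) = X f + X g"
  unfolding tder_eq[OF smooth_Rn_add[OF U assms]] tder_eq[OF assms(1)] tder_eq[OF assms(2)]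
  unfolding sum.distrib[symmetric] by (intro sum.cong refl)
    (simp add: partial_deriv_rules(1)[OF smooth_RnD(2)[OF assms(1) _ v] smooth_RnD(2)[OF assms(2) _ v]]
      distrib_left)

lemma tder_mult:
  assumes "smooth_Rn n U f" "smooth_Rn n U g"
  shows "X (\<lambda>y. f y * g y) = X f * g v + f v * X g"
  unfolding tder_eq[OF smooth_Rn_mult[OF U assms]] tder_eq[OF assms(1)] tder_eq[OF assms(2)]
  unfolding sum_distrib_left sum_distrib_right sum.distrib[symmetric] by (intro sum.cong refl)
    (simp add: partial_deriv_rules(3)[OF smooth_RnD(2)[OF assms(1) _ v] smooth_RnD(2)[OF assms(2) _ v]]
      algebra_simps)

lemma tder_const: "X (\<lambda>y. c) = 0"
  unfolding tder_eq[OF smooth_Rn_const[OF U]] by (simp add: partial_deriv_const)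

lemma tder_cmult:
  assumes "smooth_Rn n U f"
  shows "X (\<lambda>y. c * f y) = c * X f"
  using tder_mult[OF smooth_Rn_const[OF U] assms, of c] tder_const[of c] by simp

lemma tder_multc:
  assumes "smooth_Rn n U f"
  shows "X (\<lambda>y. f y * c) = X f * c" using tder_cmult[OF assms, of c] by (simp add: mult.commute)

lemma tder_minus:
  assumes "smooth_Rn n U f"
  shows "X (\<lambda>y. - f y) = - X f" using tder_cmult[OF assms, of "-1"] by simp

lemma tder_diff:
  assumes "smooth_Rn n U f" "smooth_Rn n U g"
  shows "X (\<lambda>y. f y - g y) = X f - X g"
  using tder_add[OF assms(1) smooth_Rn_minus[OF U assms(2)]] tder_minus[OF assms(2)] by simp

lemma tder_sum:
  assumes "\<And>i. i \<in> I \<Longrightarrow> smooth_Rn n U (f i)"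
  shows "X (\<lambda>y. \<Sum>i\<in>I. f i y) = (\<Sum>i\<in>I. X (f i))" using assms
proof (induction I rule: infinite_finite_induct)
  case (insert i I)
  thus ?case using tder_add[of "f i" "\<lambda>y. \<Sum>i\<in>I. f i y"] smooth_Rn_sum[OF U, of I f] by simp
qed (simp_all add: tder_const)

lemma tder_local:
  assumes "\<And>y. y \<in> U \<Longrightarrow> f y = g y"
  shows "X f = X g" using tangent_local[OF proper_charts_Rn X, of U f g] U v assms by simp

end

text \<open>By \<open>tder_eq\<close> the action on any smooth function is expressed through the
  coordinate functions, so smoothness has to be tested on these alone.\<close>

lemma vector_field_Rn:
  "vector_field (Rn n) U X \<longleftrightarrow> opn n U \<and> (\<forall>x\<in>U. X x \<in> TR n x) \<and> (\<forall>i<n. smooth_Rn n U (\<lambda>x. X x (\<lambda>y. y i)))"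
  (is "?l \<longleftrightarrow> ?r")
proof
  assume l: ?l
  hence U: "opn n U" by (simp add: vector_field_def)
  have "smooth_Rn n U (\<lambda>x. X x (\<lambda>y. y i))" for i
    using l smooth_Rn_coord[OF U, of i] U unfolding vector_field_def smooth_on_Rn by blast
  thus ?r using l by (simp add: vector_field_def)
next
  assume r: ?r
  have "smooth_Rn n V (\<lambda>x. X x f)" if V: "V \<subseteq> U" "opn n V" "smooth_Rn n V f" for V f
  proof -
    have "smooth_Rn n V (\<lambda>x. X x (\<lambda>y. y i))" if "i < n" for i
      by (rule smooth_Rn_subset[OF _ V(1)]) (use r that in blast)
    hence "smooth_Rn n V (\<lambda>x. \<Sum>i<n. X x (\<lambda>y. y i) * partial_deriv i f x)"
      by (intro smooth_Rn_sum[OF V(2)] smooth_Rn_mult[OF V(2)] smooth_RnD(3)[OF V(3)]) simp_all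
    moreover have "X x f = (\<Sum>i<n. X x (\<lambda>y. y i) * partial_deriv i f x)" if "x \<in> V" for x
      by (rule tder_eq[OF V(2) that _ V(3)]) (use r V(1) that in blast)
    ultimately show ?thesis
      using smooth_Rn_cong[OF V(2), of "\<lambda>x. X x f" "\<lambda>x. \<Sum>i<n. X x (\<lambda>y. y i) * partial_deriv i f x"] by simp
  qed
  thus ?l using r unfolding vector_field_def smooth_on_Rn by simp
qed

lemma vector_field_RnD:
  assumes "vector_field (Rn n) U X"
  shows "opn n U" "x \<in> U \<Longrightarrow> X x \<in> TR n x"
    "i < n \<Longrightarrow> smooth_Rn n U (\<lambda>x. X x (\<lambda>y. y i))" "smooth_Rn n U f \<Longrightarrow> smooth_Rn n U (\<lambda>x. X x f)"
proof -
  show *: "opn n U" "x \<in> U \<Longrightarrow> X x \<in> TR n x"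
    "i < n \<Longrightarrow> smooth_Rn n U (\<lambda>x. X x (\<lambda>y. y i))" using assms unfolding vector_field_Rn by simp_all
  show "smooth_Rn n U (\<lambda>x. X x f)" if "smooth_Rn n U f"
    using assms that * unfolding vector_field_def smooth_on_Rn by blast
qed

lemma vector_field_const: "vector_field (Rn n) (ER n) (\<lambda>x. tvec n x w)" unfolding vector_field_Rn
proof (intro conjI ballI allI impI)
  fix i assume "i < n"
  thus "smooth_Rn n (ER n) (\<lambda>x. tvec n x w (\<lambda>y. y i))"
    using smooth_Rn_cong[OF openin_Euclidean, of n "\<lambda>x. tvec n x w (\<lambda>y. y i)" "\<lambda>x. w i"]
      smooth_Rn_const[OF openin_Euclidean, of n "w i"] tvec_coord by simp
qed (simp_all add: tvec_in_tangent)

lemma vector_field_coord: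
  assumes U: "opn n U" and i: "i < n"
  shows "vector_field (Rn n) U (\<lambda>x. cvec n x i)" unfolding coord_vector_tvec[OF i]
  by (rule vector_field_subset[OF vector_field_const]) (use U openin_subset in auto)

lemma one_form_Rn:
  "one_form (Rn n) U \<xi> \<longleftrightarrow> opn n U \<and> (\<forall>x\<in>U. \<xi> x \<in> dual_space (TR n x)) \<and>
    (\<forall>i<n. smooth_Rn n U (\<lambda>x. \<xi> x (cvec n x i)))"
  (is "?l \<longleftrightarrow> ?r")
proof
  assume l: ?l
  hence U: "opn n U" by (simp add: one_form_def)
  have "smooth_Rn n U (\<lambda>x. \<xi> x (cvec n x i))" if "i < n" for i
    using l vector_field_coord[OF U that] unfolding one_form_def smooth_on_Rn by blast
  thus ?r using l by (simp add: one_form_def)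
next
  assume r: ?r
  have "smooth_Rn n V (\<lambda>x. \<xi> x (X x))" if V: "V \<subseteq> U" "vector_field (Rn n) V X" for V X
  proof -
    note X = vector_field_RnD[OF V(2)]
    have "smooth_Rn n V (\<lambda>x. \<xi> x (cvec n x i))" if "i < n" for i
      by (rule smooth_Rn_subset[OF _ V(1)]) (use r that in blast)
    hence "smooth_Rn n V (\<lambda>x. \<Sum>i<n. X x (\<lambda>y. y i) * \<xi> x (cvec n x i))"
      by (intro smooth_Rn_sum[OF X(1)] smooth_Rn_mult[OF X(1)] X(3)) simp_all
    moreover have "\<xi> x (X x) = (\<Sum>i<n. X x (\<lambda>y. y i) * \<xi> x (cvec n x i))" if "x \<in> V" for x
      by (rule covector_eq_sum[OF U_Euclidean[OF X(1) that X(2)[OF that]] X(2)[OF that]])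
        (use r V(1) that in blast)
    ultimately show ?thesis using smooth_Rn_cong[OF X(1), of "\<lambda>x. \<xi> x (X x)"
          "\<lambda>x. \<Sum>i<n. X x (\<lambda>y. y i) * \<xi> x (cvec n x i)"] by simp
  qed
  moreover have "opn n V" if "vector_field (Rn n) V X" for V X using that by (simp add: vector_field_def)
  ultimately show ?l using r unfolding one_form_def smooth_on_Rn Rn_manifold_simps by blast
qed

lemma one_form_RnD:
  assumes "one_form (Rn n) U \<xi>"
  shows "opn n U" "x \<in> U \<Longrightarrow> \<xi> x \<in> dual_space (TR n x)"
    "i < n \<Longrightarrow> smooth_Rn n U (\<lambda>x. \<xi> x (cvec n x i))" using assms unfolding one_form_Rn by simp_all

text \<open>Both iterated derivatives carry second-order terms in \<open>f\<close>; by the symmetry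
  of second derivatives they agree and cancel in the commutator.\<close>

lemma field_bracket_Rn:
  assumes X: "vector_field (Rn n) U X" and Y: "vector_field (Rn n) U Y" and v: "v \<in> U"
  shows "field_bracket (Rn n) X Y v \<in> TR n v"
    "field_bracket (Rn n) X Y v (\<lambda>y. y i) = X v (\<lambda>y. Y y (\<lambda>z. z i)) - Y v (\<lambda>y. X y (\<lambda>z. z i))"
proof -
  note X' = vector_field_RnD[OF X] and Y' = vector_field_RnD[OF Y]
  have vE: "v \<in> ER n" by (rule U_Euclidean[OF X'(1) v X'(2)[OF v]])
  \<comment> \<open>One half of the commutator for arbitrary fields, to be used in both
    orders.\<close>
  have half: "Z v (\<lambda>y. W y f) = (\<Sum>i<n. Z v (\<lambda>y. W y (\<lambda>z. z i)) * partial_deriv i f v) +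
      (\<Sum>i<n. \<Sum>j<n. W v (\<lambda>z. z i) * (Z v (\<lambda>z. z j) * partial_deriv j (partial_deriv i f) v))"
    if Z: "vector_field (Rn n) T Z" and W: "vector_field (Rn n) T W"
      and vT: "v \<in> T" and f: "smooth_Rn n T f" for Z W T f
  proof -
    note Z' = vector_field_RnD[OF Z] and W' = vector_field_RnD[OF W]
    have s: "smooth_Rn n T (\<lambda>y. W y (\<lambda>z. z i))" "smooth_Rn n T (partial_deriv i f)" if "i < n" for i
      using W'(3)[OF that] smooth_RnD(3)[OF f that] by auto
    note Zv = Z'(1) vT Z'(2)[OF vT]
    have "Z v (\<lambda>y. W y f) = Z v (\<lambda>y. \<Sum>i<n. W y (\<lambda>z. z i) * partial_deriv i f y)"
      by (rule tder_local[OF Zv]) (rule tder_eq[OF W'(1) _ W'(2) f]; assumption)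
    also have "... = (\<Sum>i<n. Z v (\<lambda>y. W y (\<lambda>z. z i) * partial_deriv i f y))"
      by (rule tder_sum[OF Zv]) (use s smooth_Rn_mult[OF W'(1)] in blast)
    also have "... = (\<Sum>i<n. Z v (\<lambda>y. W y (\<lambda>z. z i)) * partial_deriv i f v +
        (\<Sum>j<n. W v (\<lambda>z. z i) * (Z v (\<lambda>z. z j) * partial_deriv j (partial_deriv i f) v)))"
      by (intro sum.cong refl)
        (simp add: tder_mult[OF Zv s] tder_eq[OF Zv s(2)] sum_distrib_left)
    finally show ?thesis by (simp add: sum.distrib)
  qed
  have "field_bracket (Rn n) X Y v =
      tvec n v (\<lambda>i. X v (\<lambda>y. Y y (\<lambda>z. z i)) - Y v (\<lambda>y. X y (\<lambda>z. z i)))" (is "_ = tvec n v ?w")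
  proof
    fix f
    show "field_bracket (Rn n) X Y v f = tvec n v ?w f"
    proof (cases "smooth_near (Rn n) v f")
      case True
      then obtain V where V: "opn n V" "v \<in> V" "smooth_Rn n V f" unfolding smooth_near_Rn by blast
      let ?T = "U \<inter> V"
      have T: "opn n ?T" using X'(1) V(1) by (rule openin_Int)
      have XT: "vector_field (Rn n) ?T X" "vector_field (Rn n) ?T Y"
        using vector_field_subset[OF X, of ?T] vector_field_subset[OF Y, of ?T] T by auto
      have fT: "smooth_Rn n ?T f" by (rule smooth_Rn_subset[OF V(3)]) blast
      have vT: "v \<in> ?T" using v V(2) by blast
      have "(\<Sum>i<n. \<Sum>j<n. Y v (\<lambda>z. z i) * (X v (\<lambda>z. z j) * partial_deriv j (partial_deriv i f) v)) =
          (\<Sum>j<n. \<Sum>i<n. Y v (\<lambda>z. z i) * (X v (\<lambda>z. z j) * partial_deriv j (partial_deriv i f) v))"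
        by (rule sum.swap)
      also have "... = (\<Sum>j<n. \<Sum>i<n. X v (\<lambda>z. z j) * (Y v (\<lambda>z. z i) * partial_deriv i (partial_deriv j f) v))"
        by (intro sum.cong refl) (simp add: partial_deriv_commute[OF T vT fT])
      finally have "X v (\<lambda>y. Y y f) - Y v (\<lambda>y. X y f) = (\<Sum>i<n. ?w i * partial_deriv i f v)"
        unfolding half[OF XT vT fT] half[OF XT(2,1) vT fT] by (simp add: sum_subtractf left_diff_distrib)
      thus ?thesis using True by (simp add: field_bracket_def tvec_def)
    qed (simp add: field_bracket_def tvec_def)
  qed
  thus "field_bracket (Rn n) X Y v \<in> TR n v" using tvec_in_tangent[OF vE] by simp
  show "field_bracket (Rn n) X Y v (\<lambda>y. y i) = X v (\<lambda>y. Y y (\<lambda>z. z i)) - Y v (\<lambda>y. X y (\<lambda>z. z i))"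
    by (simp add: field_bracket_def smooth_near_coord[OF vE])
qed

text \<open>The field with constant components is an extension, so the choice in
  \<open>extend_vector\<close> has a witness.\<close>

lemma extend_vector_Rn:
  assumes v: "v \<in> ER n" and z: "z \<in> TR n v"
  obtains U where "v \<in> U" "vector_field (Rn n) U (extend_vector (Rn n) v z)"
    "extend_vector (Rn n) v z v = z"
proof -
  let ?P = "\<lambda>Z. (\<exists>U. v \<in> U \<and> vector_field (Rn n) U Z) \<and> Z v = z"
  have "?P (\<lambda>x. tvec n x (\<lambda>i. z (\<lambda>y. y i)))"
    by (intro conjI exI[of _ "ER n"] v vector_field_const tangent_eq_tvec[OF v z, symmetric])
  from someI[of ?P, OF this] have "?P (extend_vector (Rn n) v z)" unfolding extend_vector_def .
  thus thesis using that by blast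
qed

lemma covector_field_smooth:
  assumes \<xi>: "one_form (Rn n) U \<xi>" and Z: "vector_field (Rn n) U Z"
    and v: "v \<in> U" and X: "X \<in> TR n v"
  shows "X (\<lambda>y. \<xi> y (Z y)) = (\<Sum>i<n. X (\<lambda>y. Z y (\<lambda>z. z i)) * \<xi> v (cvec n v i) +
      Z v (\<lambda>z. z i) * X (\<lambda>y. \<xi> y (cvec n y i)))"
proof -
  note \<xi>' = one_form_RnD[OF \<xi>] and Z' = vector_field_RnD[OF Z]
  note Xv = \<xi>'(1) v X
  have "X (\<lambda>y. \<xi> y (Z y)) = X (\<lambda>y. \<Sum>i<n. Z y (\<lambda>z. z i) * \<xi> y (cvec n y i))" by (rule tder_local[OF Xv])
      (rule covector_eq_sum[OF U_Euclidean[OF Z'(1) _ Z'(2)] Z'(2) \<xi>'(2)]; assumption)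
  also have "... = (\<Sum>i<n. X (\<lambda>y. Z y (\<lambda>z. z i) * \<xi> y (cvec n y i)))"
    by (rule tder_sum[OF Xv]) (use Z'(3) \<xi>'(3) smooth_Rn_mult[OF Z'(1)] in blast)
  also have "... = (\<Sum>i<n. X (\<lambda>y. Z y (\<lambda>z. z i)) * \<xi> v (cvec n v i) +
      Z v (\<lambda>z. z i) * X (\<lambda>y. \<xi> y (cvec n y i)))"
    by (intro sum.cong refl tder_mult[OF Xv]) (use Z'(3) \<xi>'(3) in auto)
  finally show ?thesis .
qed

lemma one_form_subset:
  assumes "one_form M U \<xi>" "V \<subseteq> U" "openM M V"
  shows "one_form M V \<xi>" unfolding one_form_def
proof (intro conjI ballI allI impI)
  show "openM M V" by fact
  show "\<xi> x \<in> dual_space (tangent_space M x)" if "x \<in> V" for x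
    using assms(1,2) that unfolding one_form_def by blast
  show "smooth_on M W (\<lambda>x. \<xi> x (X x))" if "W \<subseteq> V \<and> vector_field M W X" for W X
    using assms(1,2) that unfolding one_form_def by blast
qed

text \<open>The derivatives of the chosen extension \<open>Z\<close> enter once through the value of
  \<eta> on \<open>Z\<close> and once, with the opposite sign, through the bracket of
  \<open>X\<close> with \<open>Z\<close>. Their cancellation is the independence of the
  extension.\<close>

lemma
  assumes X: "vector_field (Rn n) U X" and \<eta>: "one_form (Rn n) U \<eta>"
    and v: "v \<in> U" and z: "z \<in> TR n v"
  shows lie_derivative_Rn: "lie_derivative_form (Rn n) X \<eta> v z =
      (\<Sum>i<n. X v (\<lambda>y. \<eta> y (cvec n y i)) * z (\<lambda>y. y i) + \<eta> v (cvec n v i) * z (\<lambda>y. X y (\<lambda>z. z i)))"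
    and contract_exterior_deriv_Rn: "contract_exterior_deriv (Rn n) X \<eta> v z =
      (\<Sum>i<n. X v (\<lambda>y. \<eta> y (cvec n y i)) * z (\<lambda>y. y i) - z (\<lambda>y. \<eta> y (cvec n y i)) * X v (\<lambda>y. y i))"
proof -
  note X' = vector_field_RnD[OF X]
  have vE: "v \<in> ER n" by (rule U_Euclidean[OF X'(1) v X'(2)[OF v]])
  define Z where "Z = extend_vector (Rn n) v z"
  obtain V where V: "v \<in> V" "vector_field (Rn n) V Z" "Z v = z"
    using extend_vector_Rn[OF vE z] unfolding Z_def by blast
  let ?T = "U \<inter> V"
  have T: "opn n ?T" using X'(1) vector_field_RnD(1)[OF V(2)] by (rule openin_Int)
  have f: "vector_field (Rn n) ?T X" "vector_field (Rn n) ?T Z"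
      "one_form (Rn n) ?T \<eta>"
    using vector_field_subset[OF X, of ?T] vector_field_subset[OF V(2), of ?T] one_form_subset[OF \<eta>, of ?T] T
    by auto
  have vT: "v \<in> ?T" using v V(1) by blast
  have br: "\<eta> v (field_bracket (Rn n) X Z v) =
      (\<Sum>i<n. (X v (\<lambda>y. Z y (\<lambda>z. z i)) - z (\<lambda>y. X y (\<lambda>z. z i))) * \<eta> v (cvec n v i))"
    using covector_eq_sum[OF vE field_bracket_Rn(1)[OF f(1,2) vT] one_form_RnD(2)[OF \<eta> v]]
    by (simp add: field_bracket_Rn(2)[OF f(1,2) vT] V(3))
  have a: "X v (\<lambda>y. \<eta> y (Z y)) = (\<Sum>i<n. X v (\<lambda>y. Z y (\<lambda>z. z i)) * \<eta> v (cvec n v i) +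
      z (\<lambda>z. z i) * X v (\<lambda>y. \<eta> y (cvec n y i)))"
    using covector_field_smooth[OF f(3,2) vT X'(2)[OF v]] V(3) by simp
  have b: "z (\<lambda>y. \<eta> y (X y)) = (\<Sum>i<n. z (\<lambda>y. X y (\<lambda>z. z i)) * \<eta> v (cvec n v i) +
      X v (\<lambda>z. z i) * z (\<lambda>y. \<eta> y (cvec n y i)))" by (rule covector_field_smooth[OF f(3,1) vT z])
  show "lie_derivative_form (Rn n) X \<eta> v z = (\<Sum>i<n. X v (\<lambda>y. \<eta> y (cvec n y i)) * z (\<lambda>y. y i) +
        \<eta> v (cvec n v i) * z (\<lambda>y. X y (\<lambda>z. z i)))"
    using z by (simp add: lie_derivative_form_def Let_def Z_def[symmetric] a br sum.distrib sum_subtractf algebra_simps)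
  show "contract_exterior_deriv (Rn n) X \<eta> v z = (\<Sum>i<n. X v (\<lambda>y. \<eta> y (cvec n y i)) * z (\<lambda>y. y i) -
        z (\<lambda>y. \<eta> y (cvec n y i)) * X v (\<lambda>y. y i))"
    using z by (simp add: contract_exterior_deriv_def Let_def Z_def[symmetric] a b br sum.distrib sum_subtractf algebra_simps)
qed

section \<open>Functions with values in the Lie algebra\<close>

lemma linear_functionals_separate:
  fixes a b :: "'g::real_vector"
  assumes "\<And>l :: 'g \<Rightarrow> real. linear l \<Longrightarrow> l a = l b"
  shows "a = b"
proof (rule ccontr)
  assume "a \<noteq> b"
  hence "independent {a - b}" by simp
  then obtain l :: "'g \<Rightarrow> real" where l: "linear l" "\<forall>x\<in>{a - b}. l x = 1"
    using linear_independent_extend[of "{a - b}" "\<lambda>_. 1"] by blast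
  thus False using assms[OF l(1)] linear_diff[OF l(1), of a b] by simp
qed

lemma finite_basis_exists:
  fixes S :: "'g::real_vector set"
  assumes "finite S" "span S = UNIV"
  obtains Bs where "finite Bs" "independent Bs" "span Bs = (UNIV :: 'g set)"
proof -
  obtain B where B: "B \<subseteq> S" "independent B" "S \<subseteq> span B" using maximal_independent_subset by blast
  have "span B = UNIV" using span_mono[OF B(3)] assms(2) by (simp add: span_span top.extremum_unique)
  thus thesis using that[OF finite_subset[OF B(1) assms(1)] B(2)] by blast
qed

text \<open>Linear functionals separate points, so the description in \<open>vec_deriv\<close> has
  at most one solution and exhibiting one suffices.\<close>

lemma vec_deriv_eqI:
  fixes r :: "'a \<Rightarrow> 'g::real_vector"
  assumes "\<And>l. linear l \<Longrightarrow> l w = X (\<lambda>y. l (r y))"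
  shows "vec_deriv X r = w" unfolding vec_deriv_def
proof (rule the_equality)
  show "\<forall>l. linear l \<longrightarrow> l w = X (\<lambda>y. l (r y))" using assms by blast
  fix w' assume w': "\<forall>l. linear l \<longrightarrow> l w' = X (\<lambda>y. l (r y))"
  show "w' = w" by (rule linear_functionals_separate) (use w' assms in simp)
qed

lemma vec_deriv_cong:
  assumes "\<And>l. linear l \<Longrightarrow> X (\<lambda>y. l (r y)) = X (\<lambda>y. l (s y))"
  shows "vec_deriv X r = vec_deriv X s"
proof -
  have "(\<forall>l. linear l \<longrightarrow> l w = X (\<lambda>y. l (r y))) \<longleftrightarrow> (\<forall>l. linear l \<longrightarrow> l w = X (\<lambda>y. l (s y)))" for w
    using assms by auto
  thus ?thesis unfolding vec_deriv_def by (rule arg_cong[OF ext])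
qed

text \<open>The Lie algebra is a bare \<open>real_vector\<close> type; a fixed basis turns smooth
  functions into it into finitely many real ones.\<close>

locale finite_basis =
  fixes Bs :: "'g::real_vector set"
  assumes basis: "finite Bs" "independent Bs" "span Bs = UNIV"
begin

lemma linear_representation_Bs: "linear (\<lambda>x. representation Bs x b)"
  by (rule linearI) (simp_all add: representation_add representation_scale basis)

lemma sum_representation_Bs: "(\<Sum>b\<in>Bs. representation Bs x b *\<^sub>R b) = x"
  by (rule sum_representation_eq) (simp_all add: basis)

lemma linear_expand:
  assumes "linear (l :: 'g \<Rightarrow> 'h::real_vector)"
  shows "l x = (\<Sum>b\<in>Bs. representation Bs x b *\<^sub>R l b)"
proof -
  have "l x = l (\<Sum>b\<in>Bs. representation Bs x b *\<^sub>R b)" by (simp add: sum_representation_Bs)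
  thus ?thesis by (simp add: linear_sum[OF assms] linear_scale[OF assms])
qed

lemma vec_deriv_sum:
  assumes U: "opn n U" "v \<in> U" "X \<in> TR n v"
    and r: "smooth_vec_on (Rn n) U (r :: (nat \<Rightarrow> real) \<Rightarrow> 'g)"
  shows "vec_deriv X r = (\<Sum>b\<in>Bs. X (\<lambda>y. representation Bs (r y) b) *\<^sub>R b)"
proof (rule vec_deriv_eqI)
  fix l :: "'g \<Rightarrow> real" assume l: "linear l"
  have s: "smooth_Rn n U (\<lambda>y. representation Bs (r y) b)" for b
    using r linear_representation_Bs[of b] unfolding smooth_vec_on_def smooth_on_Rn by blast
  have "X (\<lambda>y. l (r y)) = X (\<lambda>y. \<Sum>b\<in>Bs. representation Bs (r y) b * l b)"
    by (subst linear_expand[OF l]) simp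
  also have "... = (\<Sum>b\<in>Bs. X (\<lambda>y. representation Bs (r y) b * l b))"
    by (rule tder_sum[OF U]) (rule smooth_Rn_mult[OF U(1) s smooth_Rn_const[OF U(1)]])
  also have "... = (\<Sum>b\<in>Bs. X (\<lambda>y. representation Bs (r y) b) * l b)"
    by (intro sum.cong refl tder_multc[OF U] s)
  finally show "l (\<Sum>b\<in>Bs. X (\<lambda>y. representation Bs (r y) b) *\<^sub>R b) = X (\<lambda>y. l (r y))"
    by (simp add: linear_sum[OF l] linear_scale[OF l])
qed

lemma linear_vec_deriv:
  assumes U: "opn n U" "v \<in> U" "X \<in> TR n v"
    and r: "smooth_vec_on (Rn n) U (r :: (nat \<Rightarrow> real) \<Rightarrow> 'g)" and l: "linear (l :: 'g \<Rightarrow> real)"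
  shows "X (\<lambda>y. l (r y)) = l (vec_deriv X r)"
proof -
  have s: "smooth_Rn n U (\<lambda>y. representation Bs (r y) b)" for b
    using r linear_representation_Bs[of b] unfolding smooth_vec_on_def smooth_on_Rn by blast
  have "X (\<lambda>y. l (r y)) = X (\<lambda>y. \<Sum>b\<in>Bs. representation Bs (r y) b * l b)"
    by (subst linear_expand[OF l]) simp
  also have "... = (\<Sum>b\<in>Bs. X (\<lambda>y. representation Bs (r y) b * l b))"
    by (rule tder_sum[OF U]) (rule smooth_Rn_mult[OF U(1) s smooth_Rn_const[OF U(1)]])
  also have "... = (\<Sum>b\<in>Bs. X (\<lambda>y. representation Bs (r y) b) * l b)"
    by (intro sum.cong refl tder_multc[OF U] s)
  finally show ?thesis by (simp add: vec_deriv_sum[OF U r] linear_sum[OF l] linear_scale[OF l])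
qed

end

lemma vector_field_cong:
  assumes "vector_field (Rn n) U X" "\<And>x. x \<in> U \<Longrightarrow> X' x = X x"
  shows "vector_field (Rn n) U X'"
proof -
  note X = vector_field_RnD[OF assms(1)]
  have "smooth_Rn n U (\<lambda>x. X' x (\<lambda>y. y i))" if "i < n" for i
    using X(3)[OF that] smooth_Rn_cong[OF X(1), of "\<lambda>x. X' x (\<lambda>y. y i)" "\<lambda>x. X x (\<lambda>y. y i)"] assms(2)
    by simp
  thus ?thesis unfolding vector_field_Rn using X(1,2) assms(2) by simp
qed

lemma one_form_cong:
  assumes "one_form (Rn n) U \<xi>" "\<And>x. x \<in> U \<Longrightarrow> \<xi>' x = \<xi> x"
  shows "one_form (Rn n) U \<xi>'"
proof -
  note X = one_form_RnD[OF assms(1)]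
  have "smooth_Rn n U (\<lambda>x. \<xi>' x (cvec n x i))" if "i < n" for i
    using X(3)[OF that] smooth_Rn_cong[OF X(1), of "\<lambda>x. \<xi>' x (cvec n x i)"
      "\<lambda>x. \<xi> x (cvec n x i)"] assms(2) by simp
  thus ?thesis unfolding one_form_Rn using X(1,2) assms(2) by simp
qed

lemma smooth_vec_on_cong:
  assumes "smooth_vec_on (Rn n) U r" "\<And>x. x \<in> U \<Longrightarrow> r' x = r x"
  shows "smooth_vec_on (Rn n) U r'" unfolding smooth_vec_on_def
proof (intro allI impI)
  fix l :: "'a \<Rightarrow> real" assume "linear l"
  hence "smooth_on (Rn n) U (\<lambda>x. l (r x))" using assms(1) by (simp add: smooth_vec_on_def)
  thus "smooth_on (Rn n) U (\<lambda>x. l (r' x))"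
    using smooth_on_cong[OF proper_charts_Rn, of U "\<lambda>x. l (r' x)" "\<lambda>x. l (r x)"] assms(2) by simp
qed

abbreviation "untw n br ip \<equiv> untwisted (Rn n) br ip"

lemma untw_simps:
  "fibre (untw n br ip) x = TR n x \<times> dual_space (TR n x) \<times> UNIV"
  "anchor (untw n br ip) x = fst"
  "pairing (untw n br ip) x (X, \<xi>, r) (Y, \<eta>, s) = (\<xi> Y + \<eta> X) / 2 + ip r s"
  "u \<in> sections (untw n br ip) U \<longleftrightarrow> vector_field (Rn n) U (\<lambda>x. fst (u x)) \<and>
     one_form (Rn n) U (\<lambda>x. cov (u x)) \<and> smooth_vec_on (Rn n) U (\<lambda>x. alg (u x))"
  by (simp_all add: untwisted_def)

lemma dual_space_zero: "\<xi> \<in> dual_space T \<Longrightarrow> z \<notin> T \<Longrightarrow> \<xi> z = 0" by (simp add: dual_space_def)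

text \<open>With the coordinate formulas for the Lie derivative and the contraction the chosen
  extensions disappear from the bracket; all later computations with it start from this
  form.\<close>

lemma dorfman_untw:
  assumes u: "u \<in> sections (untw n br ip) U" and v: "v \<in> sections (untw n br ip) U" and x: "x \<in> U"
  shows "fst (dorfman (untw n br ip) u v x) = field_bracket (Rn n) (\<lambda>y. fst (u y)) (\<lambda>y. fst (v y)) x"
    "cov (dorfman (untw n br ip) u v x) z = (if z \<in> TR n x then
      (\<Sum>i<n. fst (u x) (\<lambda>y. cov (v y) (cvec n y i)) * z (\<lambda>y. y i) +
        cov (v x) (cvec n x i) * z (\<lambda>y. fst (u y) (\<lambda>z. z i))) -
      (\<Sum>i<n. fst (v x) (\<lambda>y. cov (u y) (cvec n y i)) * z (\<lambda>y. y i) -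
        z (\<lambda>y. cov (u y) (cvec n y i)) * fst (v x) (\<lambda>y. y i)) +
      2 * ip (vec_deriv z (\<lambda>y. alg (u y))) (alg (v x)) else 0)"
    "alg (dorfman (untw n br ip) u v x) = vec_deriv (fst (u x)) (\<lambda>y. alg (v y)) -
      vec_deriv (fst (v x)) (\<lambda>y. alg (u y)) + br (alg (u x)) (alg (v x))"
proof -
  note u' = u[unfolded untw_simps] and v' = v[unfolded untw_simps]
  show "cov (dorfman (untw n br ip) u v x) z = (if z \<in> TR n x then
      (\<Sum>i<n. fst (u x) (\<lambda>y. cov (v y) (cvec n y i)) * z (\<lambda>y. y i) +
        cov (v x) (cvec n x i) * z (\<lambda>y. fst (u y) (\<lambda>z. z i))) -
      (\<Sum>i<n. fst (v x) (\<lambda>y. cov (u y) (cvec n y i)) * z (\<lambda>y. y i) -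
        z (\<lambda>y. cov (u y) (cvec n y i)) * fst (v x) (\<lambda>y. y i)) +
      2 * ip (vec_deriv z (\<lambda>y. alg (u y))) (alg (v x)) else 0)"
  proof (cases "z \<in> TR n x")
    case True
    have "lie_derivative_form (Rn n) (\<lambda>y. fst (u y)) (\<lambda>y. cov (v y)) x z =
      (\<Sum>i<n. fst (u x) (\<lambda>y. cov (v y) (cvec n y i)) * z (\<lambda>y. y i) +
        cov (v x) (cvec n x i) * z (\<lambda>y. fst (u y) (\<lambda>z. z i)))"
      using lie_derivative_Rn[of n U "\<lambda>y. fst (u y)" "\<lambda>y. cov (v y)" x z] u' v' x True by simp
    moreover have "contract_exterior_deriv (Rn n) (\<lambda>y. fst (v y)) (\<lambda>y. cov (u y)) x z =
      (\<Sum>i<n. fst (v x) (\<lambda>y. cov (u y) (cvec n y i)) * z (\<lambda>y. y i) -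
        z (\<lambda>y. cov (u y) (cvec n y i)) * fst (v x) (\<lambda>y. y i))"
      using contract_exterior_deriv_Rn[of n U "\<lambda>y. fst (v y)" "\<lambda>y. cov (u y)" x z] u' v' x True by simp
    ultimately show ?thesis using True by (simp add: untwisted_def Let_def)
  qed (simp add: untwisted_def Let_def)
qed (simp_all add: untwisted_def Let_def)

lemma tame_untw:
  fixes br :: "'g::real_vector \<Rightarrow> 'g \<Rightarrow> 'g"
  shows "tame_on (Rn n) (untw n br ip) (ER n)"
proof (rule tame_on.intro)
  fix V u x
  assume "openin (mtop (Rn n)) V" "u \<in> sections (untw n br ip) V" "x \<in> V"
  thus "u x \<in> fibre (untw n br ip) x"
    using vector_field_RnD(2)[of n V "\<lambda>x. fst (u x)" x] one_form_RnD(2)[of n V "\<lambda>x. cov (u x)" x]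
    by (simp add: untw_simps mem_Times_iff)
next
  fix V u u'
  assume u: "u \<in> sections (untw n br ip) V" and eq: "\<And>x. x \<in> V \<Longrightarrow> u' x = u x"
  show "u' \<in> sections (untw n br ip) V" unfolding untw_simps
    using vector_field_cong[of n V "\<lambda>x. fst (u x)" "\<lambda>x. fst (u' x)"]
      one_form_cong[of n V "\<lambda>x. cov (u x)" "\<lambda>x. cov (u' x)"]
      smooth_vec_on_cong[of n V "\<lambda>x. alg (u x)" "\<lambda>x. alg (u' x)"] eq u[unfolded untw_simps] by simp
next
  fix V x a and h h' :: "(nat \<Rightarrow> real) \<Rightarrow> real"
  assume "openin (mtop (Rn n)) V" "x \<in> V" "a \<in> fibre (untw n br ip) x" "\<And>y. y \<in> V \<Longrightarrow> h y = h' y"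
  thus "anchor (untw n br ip) x a h = anchor (untw n br ip) x a h'"
    using tangent_local[OF proper_charts_Rn, of "fst a" n x V h h'] by (simp add: untw_simps mem_Times_iff)
next
  fix V u v u' v' x
  assume V: "openin (mtop (Rn n)) V" and u: "u \<in> sections (untw n br ip) V"
    and v: "v \<in> sections (untw n br ip) V" and eu: "\<And>x. x \<in> V \<Longrightarrow> u' x = u x"
    and ev: "\<And>x. x \<in> V \<Longrightarrow> v' x = v x" and x: "x \<in> V"
  have s: "w' \<in> sections (untw n br ip) V" if "w \<in> sections (untw n br ip) V" "\<And>x. x \<in> V \<Longrightarrow> w' x = w x" for w w'
    unfolding untw_simps using vector_field_cong[of n V "\<lambda>x. fst (w x)" "\<lambda>x. fst (w' x)"]
      one_form_cong[of n V "\<lambda>x. cov (w x)" "\<lambda>x. cov (w' x)"]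
      smooth_vec_on_cong[of n V "\<lambda>x. alg (w x)" "\<lambda>x. alg (w' x)"] that(2) that(1)[unfolded untw_simps]
    by simp
  \<comment> \<open>The coordinate form of the bracket holds for sections only, so the altered
    arguments must first be recognised as sections.\<close>
  have u'': "u' \<in> sections (untw n br ip) V" and v'': "v' \<in> sections (untw n br ip) V"
    using s[OF u eu] s[OF v ev] by blast+
  have V': "opn n V" using V by simp
  have loc: "z f = z g" if "z \<in> TR n x" "\<And>y. y \<in> V \<Longrightarrow> f y = g y" for z f g
    by (rule tder_local[OF V' x that(1)]) (rule that(2))
  have T: "fst (u x) \<in> TR n x" "fst (v x) \<in> TR n x"
    using vector_field_RnD(2)[of n V "\<lambda>x. fst (u x)" x] vector_field_RnD(2)[of n V "\<lambda>x. fst (v x)" x]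
      u[unfolded untw_simps] v[unfolded untw_simps] x by simp_all
  have "fst (dorfman (untw n br ip) u' v' x) = fst (dorfman (untw n br ip) u v x)"
    unfolding dorfman_untw(1)[OF u v x] dorfman_untw(1)[OF u'' v'' x]
  proof (rule tangent_eqI[OF U_Euclidean[OF V' x T(1)]])
    note a = field_bracket_Rn[of n V "\<lambda>y. fst (u y)" "\<lambda>y. fst (v y)" x]
    note b = field_bracket_Rn[of n V "\<lambda>y. fst (u' y)" "\<lambda>y. fst (v' y)" x]
    note h = u[unfolded untw_simps] v[unfolded untw_simps] u''[unfolded untw_simps] v''[unfolded untw_simps]
    show "field_bracket (Rn n) (\<lambda>y. fst (u' y)) (\<lambda>y. fst (v' y)) x \<in> TR n x"
      "field_bracket (Rn n) (\<lambda>y. fst (u y)) (\<lambda>y. fst (v y)) x \<in> TR n x" using a(1) b(1) h x by simp_all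
    fix i
    have "fst (u x) (\<lambda>y. fst (v' y) (\<lambda>z. z i)) = fst (u x) (\<lambda>y. fst (v y) (\<lambda>z. z i))"
      "fst (v x) (\<lambda>y. fst (u' y) (\<lambda>z. z i)) = fst (v x) (\<lambda>y. fst (u y) (\<lambda>z. z i))"
      by (rule loc[OF T(1)], simp add: ev) (rule loc[OF T(2)], simp add: eu)
    thus "field_bracket (Rn n) (\<lambda>y. fst (u' y)) (\<lambda>y. fst (v' y)) x (\<lambda>y. y i) =
        field_bracket (Rn n) (\<lambda>y. fst (u y)) (\<lambda>y. fst (v y)) x (\<lambda>y. y i)"
      using a(2) b(2) h x by (simp add: eu[OF x] ev[OF x])
  qed
  moreover have "cov (dorfman (untw n br ip) u' v' x) = cov (dorfman (untw n br ip) u v x)"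
  proof
    fix z
    show "cov (dorfman (untw n br ip) u' v' x) z = cov (dorfman (untw n br ip) u v x) z"
    proof (cases "z \<in> TR n x")
      case z: True
      have 1: "fst (u x) (\<lambda>y. cov (v' y) (cvec n y i)) = fst (u x) (\<lambda>y. cov (v y) (cvec n y i))" for i
        by (rule loc[OF T(1)]) (simp add: ev)
      have 2: "fst (v x) (\<lambda>y. cov (u' y) (cvec n y i)) = fst (v x) (\<lambda>y. cov (u y) (cvec n y i))" for i
        by (rule loc[OF T(2)]) (simp add: eu)
      have 3: "z (\<lambda>y. fst (u' y) (\<lambda>z. z i)) = z (\<lambda>y. fst (u y) (\<lambda>z. z i))" for i
        by (rule loc[OF z]) (simp add: eu)
      have 4: "z (\<lambda>y. cov (u' y) (cvec n y i)) = z (\<lambda>y. cov (u y) (cvec n y i))" for i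
        by (rule loc[OF z]) (simp add: eu)
      have 5: "vec_deriv z (\<lambda>y. alg (u' y)) = vec_deriv z (\<lambda>y. alg (u y))"
        by (rule vec_deriv_cong, rule loc[OF z]) (simp add: eu)
      show ?thesis
        unfolding dorfman_untw(2)[OF u v x] dorfman_untw(2)[OF u'' v'' x] eu[OF x] ev[OF x] 1 2 3 4 5 ..
    qed (simp add: dorfman_untw(2)[OF u v x] dorfman_untw(2)[OF u'' v'' x])
  qed
  moreover have "alg (dorfman (untw n br ip) u' v' x) = alg (dorfman (untw n br ip) u v x)"
  proof -
    have 1: "vec_deriv (fst (u x)) (\<lambda>y. alg (v' y)) = vec_deriv (fst (u x)) (\<lambda>y. alg (v y))"
      by (rule vec_deriv_cong, rule loc[OF T(1)]) (simp add: ev)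
    have 2: "vec_deriv (fst (v x)) (\<lambda>y. alg (u' y)) = vec_deriv (fst (v x)) (\<lambda>y. alg (u y))"
      by (rule vec_deriv_cong, rule loc[OF T(2)]) (simp add: eu)
    show ?thesis unfolding dorfman_untw(3)[OF u v x] dorfman_untw(3)[OF u'' v'' x] eu[OF x] ev[OF x] 1 2 ..
  qed
  ultimately show "dorfman (untw n br ip) u' v' x = dorfman (untw n br ip) u v x" by (simp add: prod_eq_iff)
qed

section \<open>Gauge transformations\<close>

definition coords :: "(nat \<Rightarrow> real) tvec \<Rightarrow> nat \<Rightarrow> real"
  where "coords X = (\<lambda>i. X (\<lambda>y. y i))"

lemma fun_add_apply: "(X + Y) f = X f + Y f" by (simp add: plus_fun_def)

lemma fun_scaleR_apply: "(c *\<^sub>R X) f = c *\<^sub>R X f" by (simp add: scaleR_fun_def)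

lemma coords_add: "coords (X + Y) i = coords X i + coords Y i" by (simp add: coords_def plus_fun_def)

lemma coords_scaleR: "coords (c *\<^sub>R X) i = c * coords X i" by (simp add: coords_def scaleR_fun_def)

lemma untw_sectionsD:
  assumes "u \<in> sections (untw n br ip) U"
  shows "opn n U"
    "x \<in> U \<Longrightarrow> x \<in> ER n"
    "x \<in> U \<Longrightarrow> fst (u x) \<in> TR n x"
    "i < n \<Longrightarrow> smooth_Rn n U (\<lambda>x. coords (fst (u x)) i)"
    "x \<in> U \<Longrightarrow> cov (u x) \<in> dual_space (TR n x)"
    "i < n \<Longrightarrow> smooth_Rn n U (\<lambda>x. cov (u x) (cvec n x i))"
    "smooth_vec_on (Rn n) U (\<lambda>x. alg (u x))"
proof -
  note u = assms[unfolded untw_simps]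
  note X = vector_field_RnD[OF u[THEN conjunct1]] and \<xi> = one_form_RnD[OF u[THEN conjunct2, THEN conjunct1]]
  show *: "opn n U"
    "x \<in> U \<Longrightarrow> fst (u x) \<in> TR n x"
    "i < n \<Longrightarrow> smooth_Rn n U (\<lambda>x. coords (fst (u x)) i)"
    "x \<in> U \<Longrightarrow> cov (u x) \<in> dual_space (TR n x)"
    "i < n \<Longrightarrow> smooth_Rn n U (\<lambda>x. cov (u x) (cvec n x i))"
    "smooth_vec_on (Rn n) U (\<lambda>x. alg (u x))" using X \<xi> u unfolding coords_def by simp_all
  show "x \<in> U \<Longrightarrow> x \<in> ER n" using openin_subset[OF *(1)] by blast
qed

lemma untw_sectionsI:
  assumes "opn n U"
    "\<And>x. x \<in> U \<Longrightarrow> fst (u x) \<in> TR n x"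
    "\<And>i. i < n \<Longrightarrow> smooth_Rn n U (\<lambda>x. coords (fst (u x)) i)"
    "\<And>x. x \<in> U \<Longrightarrow> cov (u x) \<in> dual_space (TR n x)"
    "\<And>i. i < n \<Longrightarrow> smooth_Rn n U (\<lambda>x. cov (u x) (cvec n x i))"
    "\<And>l. linear l \<Longrightarrow> smooth_Rn n U (\<lambda>x. l (alg (u x)))"
  shows "u \<in> sections (untw n br ip) U"
  unfolding untw_simps vector_field_Rn one_form_Rn smooth_vec_on_def smooth_on_Rn
  using assms unfolding coords_def by simp

lemma field_bracket_untw:
  assumes u: "u \<in> sections (untw n br ip) U" and v: "v \<in> sections (untw n br ip) U" and x: "x \<in> U"
  shows "fst (dorfman (untw n br ip) u v x) \<in> TR n x"
    "coords (fst (dorfman (untw n br ip) u v x)) i =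
      fst (u x) (\<lambda>y. coords (fst (v y)) i) - fst (v x) (\<lambda>y. coords (fst (u y)) i)"
  unfolding dorfman_untw(1)[OF u v x] coords_def
  using field_bracket_Rn[of n U "\<lambda>y. fst (u y)" "\<lambda>y. fst (v y)" x] u[unfolded untw_simps] v[unfolded untw_simps] x
  by simp_all

text \<open>Linearity in the test vector is read off the coordinate form. It makes the covector of a
  bracket recoverable from its values on coordinate vectors.\<close>

lemma (in finite_basis) dorfman_untw_dual:
  fixes br :: "'g \<Rightarrow> 'g \<Rightarrow> 'g"
  assumes ip: "bilinear ip"
    and u: "u \<in> sections (untw n br ip) U" and v: "v \<in> sections (untw n br ip) U" and x: "x \<in> U"
  shows "cov (dorfman (untw n br ip) u v x) \<in> dual_space (TR n x)"
proof -
  note u' = untw_sectionsD[OF u] and v' = untw_sectionsD[OF v]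
  note s = subspace_tangent_Rn[OF u'(2)[OF x]]
  let ?D = "cov (dorfman (untw n br ip) u v x)"
  note d = dorfman_untw(2)[OF u v x]
  have vd: "vec_deriv (z + z') (\<lambda>y. alg (u y)) = vec_deriv z (\<lambda>y. alg (u y)) + vec_deriv z' (\<lambda>y. alg (u y))"
    "vec_deriv (c *\<^sub>R z) (\<lambda>y. alg (u y)) = c *\<^sub>R vec_deriv z (\<lambda>y. alg (u y))"
    if "z \<in> TR n x" "z' \<in> TR n x" for z z' c
    using vec_deriv_sum[OF u'(1) x that(1) u'(7)] vec_deriv_sum[OF u'(1) x that(2) u'(7)]
      vec_deriv_sum[OF u'(1) x subspace_add[OF s that] u'(7)]
      vec_deriv_sum[OF u'(1) x subspace_scale[OF s that(1), of c] u'(7)]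
    by (simp_all add: fun_add_apply fun_scaleR_apply scaleR_add_left sum.distrib scaleR_sum_right)
  have "?D (z + z') = ?D z + ?D z'" if z: "z \<in> TR n x" "z' \<in> TR n x" for z z' using z subspace_add[OF s z]
    by (simp add: d vd(1)[OF z] bilinear_ladd[OF ip] fun_add_apply sum.distrib sum_subtractf distrib_left distrib_right;
        linarith)
  moreover have "?D (c *\<^sub>R z) = c * ?D z" if z: "z \<in> TR n x" for z c using z subspace_scale[OF s z, of c]
    by (simp add: d vd(2)[OF z z] bilinear_lmul[OF ip] fun_scaleR_apply sum.distrib sum_subtractf
        sum_distrib_left algebra_simps)
  moreover have "?D z = 0" if "z \<notin> TR n x" for z using that by (simp add: d)
  ultimately show ?thesis unfolding dual_space_def linear_over_def by simp
qed

text \<open>Abstract data of a gauge transformation: the last condition is the flow equation of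
  \<open>exp (- ad (\<Sum> v j w j))\<close>, and \<beta> is a B-field with constant coefficients.
  Since \<open>K\<close> is abstract, the inverse transformation, with all signs reversed, can be a
  second instance.\<close>

locale gauge = finite_basis Bs for Bs :: "'g::real_vector set" +
  fixes n :: nat and br :: "'g \<Rightarrow> 'g \<Rightarrow> 'g" and ip :: "'g \<Rightarrow> 'g \<Rightarrow> real"
    and w :: "nat \<Rightarrow> 'g" and \<beta> :: "nat \<Rightarrow> nat \<Rightarrow> real" and K :: "(nat \<Rightarrow> real) \<Rightarrow> 'g \<Rightarrow> 'g"
  assumes br: "bilinear br" "\<And>a b. br a b = - br b a"
    and ip: "bilinear ip" "\<And>a b. ip a b = ip b a" "\<And>a b c. ip (br a b) c = - ip b (br a c)"
    and w: "\<And>i j. br (w i) (w j) = 0"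
    and \<beta>: "\<And>i j. \<beta> i j = - \<beta> j i"
    and K: "\<And>v. linear (K v)" "\<And>v a b. K v (br a b) = br (K v a) (K v b)"
      "\<And>v a b. ip (K v a) (K v b) = ip a b" "\<And>v i. K v (w i) = w i"
      "\<And>a l. linear l \<Longrightarrow> smooth_Rn n (ER n) (\<lambda>v. l (K v a))"
      "\<And>a l i v. linear l \<Longrightarrow> i < n \<Longrightarrow> v \<in> ER n \<Longrightarrow> partial_deriv i (\<lambda>v. l (K v a)) v = - l (br (w i) (K v a))"
begin

abbreviation "UA \<equiv> untw n br ip"

lemmas ip_simps = bilinear_ladd[OF ip(1)] bilinear_radd[OF ip(1)] bilinear_lmul[OF ip(1)] bilinear_rmul[OF ip(1)]
  bilinear_lneg[OF ip(1)] bilinear_rneg[OF ip(1)] bilinear_lsub[OF ip(1)] bilinear_rsub[OF ip(1)]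
  bilinear_lzero[OF ip(1)] bilinear_rzero[OF ip(1)]

lemmas br_simps = bilinear_ladd[OF br(1)] bilinear_radd[OF br(1)] bilinear_lmul[OF br(1)] bilinear_rmul[OF br(1)]
  bilinear_lneg[OF br(1)] bilinear_rneg[OF br(1)] bilinear_lsub[OF br(1)] bilinear_rsub[OF br(1)]
  bilinear_lzero[OF br(1)] bilinear_rzero[OF br(1)]

lemmas K_simps = linear_add[OF K(1)] linear_diff[OF K(1)] linear_neg[OF K(1)] linear_scale[OF K(1)] linear_0[OF K(1)]

lemma ip_linear: "linear (\<lambda>b. ip a b)" using ip(1) by (simp add: bilinear_def)

definition W :: "(nat \<Rightarrow> real) \<Rightarrow> 'g"
  where "W a = (\<Sum>i<n. a i *\<^sub>R w i)"

definition Bt :: "(nat \<Rightarrow> real) \<Rightarrow> (nat \<Rightarrow> real) \<Rightarrow> real"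
  where "Bt a c = (\<Sum>i<n. (\<Sum>j<n. \<beta> j i * a j) * c i)"

text \<open>Components of the covector added to an element with vector coordinates \<open>a\<close>
  and algebra part \<open>r\<close>. Once \<open>W a\<close> is added to \<open>r\<close>,
  orthogonality dictates the last two terms: one against the old algebra part, one against the
  second shift. The term with \<beta> is the antisymmetric freedom that remains.\<close>

definition delta :: "(nat \<Rightarrow> real) \<Rightarrow> 'g \<Rightarrow> nat \<Rightarrow> real"
  where "delta a r i = (\<Sum>j<n. \<beta> j i * a j) - ip (W a) (w i) - 2 * ip (w i) r"

lemma br_sum_right: "br a (\<Sum>i\<in>I. f i) = (\<Sum>i\<in>I. br a (f i))"
  using br(1) by (simp add: bilinear_def linear_sum)

lemma br_sum_left: "br (\<Sum>i\<in>I. f i) a = (\<Sum>i\<in>I. br (f i) a)"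
  using br(1) linear_sum[of "\<lambda>x. br x a"] by (simp add: bilinear_def)

lemma ip_sum_right: "ip a (\<Sum>i\<in>I. f i) = (\<Sum>i\<in>I. ip a (f i))" by (rule linear_sum[OF ip_linear])

lemma br_W: "br (W a) (W c) = 0" by (simp add: W_def br_sum_left br_sum_right br_simps w)

lemma K_W: "K v (W a) = W a" by (simp add: W_def linear_sum[OF K(1)] K_simps K(4))

lemma ip_W_right: "(\<Sum>i<n. c i * ip a (w i)) = ip a (W c)" by (simp add: W_def ip_sum_right ip_simps)

lemma ip_W_left: "(\<Sum>i<n. c i * ip (w i) a) = ip (W c) a"
proof -
  have "(\<Sum>i<n. c i * ip (w i) a) = (\<Sum>i<n. c i * ip a (w i))"
    by (intro sum.cong refl arg_cong2[where f = "(*)"] ip(2))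
  also have "... = ip (W c) a" unfolding ip_W_right by (rule ip(2))
  finally show ?thesis .
qed

lemma delta_sum: "(\<Sum>i<n. delta a r i * c i) = Bt a c - ip (W a) (W c) - 2 * ip (W c) r"
proof -
  have "(\<Sum>i<n. delta a r i * c i) = Bt a c - (\<Sum>i<n. c i * ip (W a) (w i)) - 2 * (\<Sum>i<n. c i * ip (w i) r)"
    by (simp add: delta_def Bt_def left_diff_distrib sum_subtractf sum_distrib_left sum.distrib algebra_simps)
  thus ?thesis by (simp add: ip_W_right ip_W_left)
qed

lemma Bt_antisym: "Bt a c = - Bt c a"
proof -
  have "Bt a c = (\<Sum>i<n. \<Sum>j<n. \<beta> j i * a j * c i)" by (simp add: Bt_def sum_distrib_right)
  also have "... = (\<Sum>j<n. \<Sum>i<n. \<beta> j i * a j * c i)" by (rule sum.swap)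
  also have "... = (\<Sum>j<n. \<Sum>i<n. - (\<beta> i j * c i * a j))" by (intro sum.cong refl) (subst \<beta>, simp)
  finally show ?thesis by (simp add: Bt_def sum_distrib_right sum_negf)
qed

text \<open>\<open>K v\<close> fixes \<open>W\<close>, so shifting before or after it makes no
  difference.\<close>

definition gmap :: "(nat \<Rightarrow> real) \<Rightarrow> (nat \<Rightarrow> real) tvec \<times> (nat \<Rightarrow> real) covec \<times> 'g \<Rightarrow>
    (nat \<Rightarrow> real) tvec \<times> (nat \<Rightarrow> real) covec \<times> 'g"
  where "gmap v e = (fst e, \<lambda>X. cov e X + covec n v (delta (coords (fst e)) (alg e)) X,
    K v (alg e + W (coords (fst e))))"

lemma covec_delta:
  "covec n v (delta a r) X =
    (if X \<in> TR n v then Bt a (coords X) - ip (W a) (W (coords X)) - 2 * ip (W (coords X)) r else 0)"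
  using delta_sum[of a r "coords X"] by (simp add: covec_def coords_def mult.commute)

lemma W_coords_add: "W (coords (X + Y)) = W (coords X) + W (coords Y)"
  by (simp add: W_def coords_add scaleR_add_left sum.distrib)

lemma W_coords_scaleR: "W (coords (c *\<^sub>R X)) = c *\<^sub>R W (coords X)"
  by (simp add: W_def coords_scaleR scaleR_sum_right)

lemma Bt_coords_add: "Bt (coords (X + Y)) c = Bt (coords X) c + Bt (coords Y) c"
  by (simp add: Bt_def coords_add distrib_left distrib_right sum.distrib)

lemma Bt_coords_scaleR: "Bt (coords (k *\<^sub>R X)) c = k * Bt (coords X) c"
  by (simp add: Bt_def coords_scaleR sum_distrib_left sum_distrib_right algebra_simps)

lemma gmap_fibre:
  assumes v: "v \<in> ER n" and e: "e \<in> fibre UA v"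
  shows "gmap v e \<in> fibre UA v"
proof -
  have "covec n v (delta (coords (fst e)) (alg e)) \<in> dual_space (TR n v)" by (rule covec_dual[OF v])
  moreover have "cov e \<in> dual_space (TR n v)" using e by (simp add: untw_simps mem_Times_iff)
  ultimately have "(\<lambda>X. cov e X + covec n v (delta (coords (fst e)) (alg e)) X) \<in> dual_space (TR n v)"
    by (simp add: dual_space_def linear_over_def distrib_left)
  thus ?thesis using e by (simp add: gmap_def untw_simps mem_Times_iff)
qed

lemma gmap_linear: "linear_over S (gmap v)"
proof -
  have "gmap v (a + b) = gmap v a + gmap v b" for a b
    by (simp add: gmap_def prod_eq_iff fun_eq_iff covec_delta W_coords_add Bt_coords_add ip_simps K_simps)
  moreover have "gmap v (c *\<^sub>R a) = c *\<^sub>R gmap v a" for c a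
    by (simp add: gmap_def prod_eq_iff fun_eq_iff covec_delta W_coords_scaleR Bt_coords_scaleR ip_simps K_simps
        fun_scaleR_apply algebra_simps)
  ultimately show ?thesis by (simp add: linear_over_def)
qed

text \<open>The two copies of \<open>Bt\<close> cancel by antisymmetry. The product of the two
  shifts is cancelled by the quadratic term of \<open>delta\<close>, which occurs twice and is
  halved, and the mixed products by the linear terms.\<close>

lemma gmap_pairing:
  assumes "a \<in> fibre UA v" "b \<in> fibre UA v"
  shows "pairing UA v (gmap v a) (gmap v b) = pairing UA v a b"
proof -
  obtain X \<xi> r Y \<eta> s where ab: "a = (X, \<xi>, r)" "b = (Y, \<eta>, s)" by (metis prod_cases3)
  have T: "X \<in> TR n v" "Y \<in> TR n v" using assms by (simp_all add: ab untw_simps)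
  show ?thesis
    using T Bt_antisym[of "coords X" "coords Y"] ip(2)[of "W (coords Y)" "W (coords X)"] ip(2)[of "W (coords Y)" r]
    by (simp add: ab gmap_def untw_simps covec_delta K(3) ip_simps field_simps)
qed

text \<open>\<open>K\<close> is known to be smooth on fixed vectors; expanding the section in the
  basis reduces to that.\<close>

lemma smooth_l_K:
  assumes U: "opn n U" and r: "smooth_vec_on (Rn n) U r" and l: "linear l"
  shows "smooth_Rn n U (\<lambda>x. l (K x (r x)))"
proof -
  have "l (K x (r x)) = (\<Sum>b\<in>Bs. representation Bs (r x) b * l (K x b))" for x
    using linear_expand[OF linear_compose[OF K(1) l, unfolded o_def], of x "r x"] by simp
  moreover have "smooth_Rn n U (\<lambda>x. \<Sum>b\<in>Bs. representation Bs (r x) b * l (K x b))"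
  proof (intro smooth_Rn_sum[OF U] smooth_Rn_mult[OF U])
    show "smooth_Rn n U (\<lambda>x. representation Bs (r x) b)" for b
      using r linear_representation_Bs[of b] unfolding smooth_vec_on_def smooth_on_Rn by blast
    show "smooth_Rn n U (\<lambda>x. l (K x b))" for b
      by (rule smooth_Rn_subset[OF K(5)[OF l]]) (use U openin_subset in blast)
  qed
  ultimately show ?thesis by simp
qed

text \<open>Product rule in the basis: by the flow equation, differentiating \<open>K\<close>
  contributes the bracket with \<open>W\<close>.\<close>

lemma vec_deriv_K:
  assumes U: "opn n U" "v \<in> U" "X \<in> TR n v"
    and r: "smooth_vec_on (Rn n) U r"
  shows "vec_deriv X (\<lambda>x. K x (r x)) = K v (vec_deriv X r) - br (W (coords X)) (K v (r v))"
proof (rule vec_deriv_eqI)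
  fix l :: "'g \<Rightarrow> real" assume l: "linear l"
  have v: "v \<in> ER n" using U openin_subset by blast
  have s1: "smooth_Rn n U (\<lambda>x. representation Bs (r x) b)" for b
    using r linear_representation_Bs[of b] unfolding smooth_vec_on_def smooth_on_Rn by blast
  have s2: "smooth_Rn n U (\<lambda>x. l (K x b))" for b
    by (rule smooth_Rn_subset[OF K(5)[OF l]]) (use U openin_subset in blast)
  have XK: "X (\<lambda>x. l (K x b)) = - l (br (W (coords X)) (K v b))" for b
  proof -
    have "X (\<lambda>x. l (K x b)) = (\<Sum>i<n. coords X i * - l (br (w i) (K v b)))"
      unfolding tder_eq[OF U s2] coords_def by (intro sum.cong refl) (simp add: K(6)[OF l _ v])
    thus ?thesis by (simp add: W_def br_sum_left br_simps linear_sum[OF l] linear_scale[OF l] sum_negf)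
  qed
  have lK: "linear (\<lambda>b. l (br (W (coords X)) (K v b)))"
    by (rule linearI) (simp_all add: K_simps br_simps linear_add[OF l] linear_scale[OF l])
  have lKr: "l (K x (r x)) = (\<Sum>b\<in>Bs. representation Bs (r x) b * l (K x b))" for x
    using linear_expand[OF linear_compose[OF K(1) l, unfolded o_def], of x "r x"] by simp
  have "X (\<lambda>x. l (K x (r x))) = X (\<lambda>x. \<Sum>b\<in>Bs. representation Bs (r x) b * l (K x b))" by (simp only: lKr)
  also have "... = (\<Sum>b\<in>Bs. X (\<lambda>x. representation Bs (r x) b * l (K x b)))"
    by (rule tder_sum[OF U]) (rule smooth_Rn_mult[OF U(1) s1 s2])
  also have "... = (\<Sum>b\<in>Bs. X (\<lambda>x. representation Bs (r x) b) * l (K v b) +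
      representation Bs (r v) b * - l (br (W (coords X)) (K v b)))"
    by (intro sum.cong refl) (simp add: tder_mult[OF U s1 s2] XK)
  also have "... = (\<Sum>b\<in>Bs. X (\<lambda>x. representation Bs (r x) b) * l (K v b)) -
      (\<Sum>b\<in>Bs. representation Bs (r v) b *\<^sub>R l (br (W (coords X)) (K v b)))" by (simp add: sum_subtractf)
  also have "(\<Sum>b\<in>Bs. representation Bs (r v) b *\<^sub>R l (br (W (coords X)) (K v b))) = l (br (W (coords X)) (K v (r v)))"
    by (rule linear_expand[OF lK, symmetric])
  also have "(\<Sum>b\<in>Bs. X (\<lambda>x. representation Bs (r x) b) * l (K v b)) = l (K v (vec_deriv X r))"
    by (simp add: vec_deriv_sum[OF U r] linear_sum[OF K(1)] linear_sum[OF l] linear_scale[OF l] K_simps)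
  finally show "l (K v (vec_deriv X r) - br (W (coords X)) (K v (r v))) = X (\<lambda>x. l (K x (r x)))"
    by (simp add: linear_diff[OF l])
qed

lemma smooth_vec_W:
  assumes u: "u \<in> sections UA U"
  shows "smooth_vec_on (Rn n) U (\<lambda>x. W (coords (fst (u x))))"
    "smooth_vec_on (Rn n) U (\<lambda>x. alg (u x) + W (coords (fst (u x))))"
proof -
  note d = untw_sectionsD[OF u]
  have 1: "smooth_Rn n U (\<lambda>x. l (W (coords (fst (u x)))))" if l: "linear l" for l
  proof -
    have "smooth_Rn n U (\<lambda>x. \<Sum>i<n. coords (fst (u x)) i * l (w i))"
      by (intro smooth_Rn_sum[OF d(1)] smooth_Rn_mult[OF d(1)] smooth_Rn_const[OF d(1)] d(4)) simp
    thus ?thesis by (simp add: W_def linear_sum[OF l] linear_scale[OF l])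
  qed
  thus "smooth_vec_on (Rn n) U (\<lambda>x. W (coords (fst (u x))))"
    unfolding smooth_vec_on_def smooth_on_Rn using d(1) by simp
  have "smooth_Rn n U (\<lambda>x. l (alg (u x) + W (coords (fst (u x)))))" if l: "linear l" for l
  proof -
    have "smooth_Rn n U (\<lambda>x. l (alg (u x)))" using d(7) l unfolding smooth_vec_on_def smooth_on_Rn by simp
    from smooth_Rn_add[OF d(1) this 1[OF l]] show ?thesis by (simp add: linear_add[OF l])
  qed
  thus "smooth_vec_on (Rn n) U (\<lambda>x. alg (u x) + W (coords (fst (u x))))"
    unfolding smooth_vec_on_def smooth_on_Rn using d(1) by simp
qed

lemma vec_deriv_W:
  assumes u: "u \<in> sections UA U" and x: "x \<in> U" and X: "X \<in> TR n x"
  shows "vec_deriv X (\<lambda>y. alg (u y) + W (coords (fst (u y)))) =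
    vec_deriv X (\<lambda>y. alg (u y)) + W (\<lambda>i. X (\<lambda>y. coords (fst (u y)) i))"
proof (rule vec_deriv_eqI)
  note d = untw_sectionsD[OF u]
  note t = d(1) x X
  fix l :: "'g \<Rightarrow> real" assume l: "linear l"
  have s: "smooth_Rn n U (\<lambda>x. l (alg (u x)))" using d(7) l unfolding smooth_vec_on_def smooth_on_Rn by simp
  have sW: "smooth_Rn n U (\<lambda>x. l (W (coords (fst (u x)))))"
    using smooth_vec_W(1)[OF u] l unfolding smooth_vec_on_def smooth_on_Rn by simp
  have "X (\<lambda>y. l (W (coords (fst (u y))))) = X (\<lambda>y. \<Sum>i<n. coords (fst (u y)) i * l (w i))"
    by (simp add: W_def linear_sum[OF l] linear_scale[OF l])
  also have "... = (\<Sum>i<n. X (\<lambda>y. coords (fst (u y)) i * l (w i)))"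
    by (rule tder_sum[OF t]) (rule smooth_Rn_mult[OF d(1) d(4) smooth_Rn_const[OF d(1)]], simp)
  also have "... = (\<Sum>i<n. X (\<lambda>y. coords (fst (u y)) i) * l (w i))"
    by (intro sum.cong refl tder_multc[OF t] d(4)) simp
  also have "... = l (W (\<lambda>i. X (\<lambda>y. coords (fst (u y)) i)))"
    by (simp add: W_def linear_sum[OF l] linear_scale[OF l])
  finally have W: "X (\<lambda>y. l (W (coords (fst (u y))))) = l (W (\<lambda>i. X (\<lambda>y. coords (fst (u y)) i)))" .
  show "l (vec_deriv X (\<lambda>y. alg (u y)) + W (\<lambda>i. X (\<lambda>y. coords (fst (u y)) i))) =
      X (\<lambda>y. l (alg (u y) + W (coords (fst (u y)))))"
    using tder_add[OF t s sW] linear_vec_deriv[OF t d(7) l] by (simp add: linear_add[OF l] W)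
qed

lemma smooth_delta:
  assumes u: "u \<in> sections UA U"
  shows "smooth_Rn n U (\<lambda>x. delta (coords (fst (u x))) (alg (u x)) i)"
proof -
  note d = untw_sectionsD[OF u]
  have 1: "smooth_Rn n U (\<lambda>x. \<Sum>j<n. \<beta> j i * coords (fst (u x)) j)"
    by (intro smooth_Rn_sum[OF d(1)] smooth_Rn_mult[OF d(1) smooth_Rn_const[OF d(1)]] d(4)) simp
  have 2: "smooth_Rn n U (\<lambda>x. ip (w i) (alg (u x)))"
    using d(7) ip_linear unfolding smooth_vec_on_def smooth_on_Rn by simp
  have 3: "smooth_Rn n U (\<lambda>x. ip (w i) (W (coords (fst (u x)))))"
    using smooth_vec_W(1)[OF u] ip_linear unfolding smooth_vec_on_def smooth_on_Rn by simp
  show ?thesis unfolding delta_def ip(2)[of "W _"]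
    by (intro smooth_Rn_diff[OF d(1)] 1 3 smooth_Rn_mult[OF d(1) smooth_Rn_const[OF d(1)] 2])
qed

lemma gmap_sections:
  assumes u: "u \<in> sections UA U"
  shows "(\<lambda>x. gmap x (u x)) \<in> sections UA U"
proof (rule untw_sectionsI)
  note d = untw_sectionsD[OF u]
  show "opn n U" by (rule d(1))
  show "fst (gmap x (u x)) \<in> TR n x" if "x \<in> U" for x using d(3)[OF that] by (simp add: gmap_def)
  show "smooth_Rn n U (\<lambda>x. coords (fst (gmap x (u x))) i)" if "i < n" for i
    using d(4)[OF that] by (simp add: gmap_def)
  show "cov (gmap x (u x)) \<in> dual_space (TR n x)" if "x \<in> U" for x
    using gmap_fibre[OF d(2)[OF that], of "u x"] d(3,5)[OF that] by (simp add: untw_simps mem_Times_iff)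
  show "smooth_Rn n U (\<lambda>x. cov (gmap x (u x)) (cvec n x i))" if i: "i < n" for i
  proof -
    have "smooth_Rn n U (\<lambda>x. cov (u x) (cvec n x i) + delta (coords (fst (u x))) (alg (u x)) i)"
      by (rule smooth_Rn_add[OF d(1) d(6)[OF i] smooth_delta[OF u]])
    thus ?thesis using smooth_Rn_cong[OF d(1), of "\<lambda>x. cov (gmap x (u x)) (cvec n x i)"
        "\<lambda>x. cov (u x) (cvec n x i) + delta (coords (fst (u x))) (alg (u x)) i"]
      by (simp add: gmap_def covec_coord[OF d(2) i])
  qed
  show "smooth_Rn n U (\<lambda>x. l (alg (gmap x (u x))))" if "linear l" for l
    using smooth_l_K[OF d(1) smooth_vec_W(2)[OF u] that] by (simp add: gmap_def)
qed

text \<open>\<open>delta\<close> is jointly linear in \<open>a\<close> and \<open>r\<close> with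
  constant coefficients, so a derivative passes inside.\<close>

lemma tder_delta:
  assumes u: "u \<in> sections UA U" and x: "x \<in> U" and X: "X \<in> TR n x"
  shows "X (\<lambda>y. delta (coords (fst (u y))) (alg (u y)) i) =
    delta (\<lambda>j. X (\<lambda>y. coords (fst (u y)) j)) (vec_deriv X (\<lambda>y. alg (u y))) i"
proof -
  note d = untw_sectionsD[OF u]
  note t = d(1) x X
  have s1: "smooth_Rn n U (\<lambda>x. \<Sum>j<n. \<beta> j i * coords (fst (u x)) j)"
    by (intro smooth_Rn_sum[OF d(1)] smooth_Rn_mult[OF d(1) smooth_Rn_const[OF d(1)]] d(4)) simp
  have s2: "smooth_Rn n U (\<lambda>x. ip (w i) (alg (u x)))"
    using d(7) ip_linear unfolding smooth_vec_on_def smooth_on_Rn by simp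
  have s3: "smooth_Rn n U (\<lambda>x. ip (w i) (W (coords (fst (u x)))))"
    using smooth_vec_W(1)[OF u] ip_linear unfolding smooth_vec_on_def smooth_on_Rn by simp
  have 1: "X (\<lambda>y. \<Sum>j<n. \<beta> j i * coords (fst (u y)) j) = (\<Sum>j<n. \<beta> j i * X (\<lambda>y. coords (fst (u y)) j))"
  proof -
    have "X (\<lambda>y. \<Sum>j<n. \<beta> j i * coords (fst (u y)) j) = (\<Sum>j<n. X (\<lambda>y. \<beta> j i * coords (fst (u y)) j))"
      by (rule tder_sum[OF t]) (rule smooth_Rn_mult[OF d(1) smooth_Rn_const[OF d(1)] d(4)], simp)
    also have "... = (\<Sum>j<n. \<beta> j i * X (\<lambda>y. coords (fst (u y)) j))"
      by (intro sum.cong refl tder_cmult[OF t] d(4)) simp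
    finally show ?thesis .
  qed
  have 3: "X (\<lambda>y. ip (w i) (W (coords (fst (u y))))) = ip (w i) (W (\<lambda>j. X (\<lambda>y. coords (fst (u y)) j)))"
  proof -
    have "X (\<lambda>y. ip (w i) (W (coords (fst (u y))))) = X (\<lambda>y. \<Sum>j<n. coords (fst (u y)) j * ip (w i) (w j))"
      by (simp add: ip_W_right)
    also have "... = (\<Sum>j<n. X (\<lambda>y. coords (fst (u y)) j * ip (w i) (w j)))"
      by (rule tder_sum[OF t]) (rule smooth_Rn_mult[OF d(1) d(4) smooth_Rn_const[OF d(1)]], simp)
    also have "... = (\<Sum>j<n. X (\<lambda>y. coords (fst (u y)) j) * ip (w i) (w j))"
      by (intro sum.cong refl tder_multc[OF t] d(4)) simp
    finally show ?thesis by (simp add: ip_W_right)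
  qed
  have "X (\<lambda>y. delta (coords (fst (u y))) (alg (u y)) i) =
      X (\<lambda>y. (\<Sum>j<n. \<beta> j i * coords (fst (u y)) j) - ip (w i) (W (coords (fst (u y)))) - 2 * ip (w i) (alg (u y)))"
    by (simp add: delta_def ip(2)[of "W _"])
  also have "... = X (\<lambda>y. (\<Sum>j<n. \<beta> j i * coords (fst (u y)) j) - ip (w i) (W (coords (fst (u y))))) -
      X (\<lambda>y. 2 * ip (w i) (alg (u y)))"
    by (rule tder_diff[OF t smooth_Rn_diff[OF d(1) s1 s3] smooth_Rn_mult[OF d(1) smooth_Rn_const[OF d(1)] s2]])
  also have "... = X (\<lambda>y. \<Sum>j<n. \<beta> j i * coords (fst (u y)) j) - X (\<lambda>y. ip (w i) (W (coords (fst (u y))))) -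
      2 * X (\<lambda>y. ip (w i) (alg (u y)))" by (simp only: tder_diff[OF t s1 s3] tder_cmult[OF t s2])
  also have "... = delta (\<lambda>j. X (\<lambda>y. coords (fst (u y)) j)) (vec_deriv X (\<lambda>y. alg (u y))) i"
    by (simp add: 1 3 linear_vec_deriv[OF t d(7) ip_linear] delta_def ip(2)[of "W _"])
  finally show ?thesis .
qed

text \<open>Differentiating \<open>K\<close> along \<open>X\<close> and \<open>Y\<close> produces
  brackets with \<open>W\<close>. They cancel the mixed terms in the bracket of the shifted algebra
  parts, and the term with two shifts vanishes because the \<open>w i\<close> commute.\<close>

lemma gmap_dorfman_vec:
  assumes u: "u \<in> sections UA U" and v: "v \<in> sections UA U" and x: "x \<in> U"
  shows "alg (gmap x (dorfman UA u v x)) = alg (dorfman UA (\<lambda>y. gmap y (u y)) (\<lambda>y. gmap y (v y)) x)"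
proof -
  note du = untw_sectionsD[OF u] and dv = untw_sectionsD[OF v]
  define X Y r s where "X = fst (u x)" "Y = fst (v x)" "r = alg (u x)" "s = alg (v x)"
  define XY YX where "XY = (\<lambda>i. X (\<lambda>y. coords (fst (v y)) i))" "YX = (\<lambda>i. Y (\<lambda>y. coords (fst (u y)) i))"
  define Xs Yr where "Xs = vec_deriv X (\<lambda>y. alg (v y))" "Yr = vec_deriv Y (\<lambda>y. alg (u y))"
  note defs = X_Y_r_s_def XY_YX_def Xs_Yr_def
  have T: "X \<in> TR n x" "Y \<in> TR n x" using du(3) dv(3) x by (simp_all add: defs)
  have "W (coords (fst (dorfman UA u v x))) = W XY - W YX"
    by (simp add: W_def field_bracket_untw(2)[OF u v x] defs scaleR_diff_left sum_subtractf)
  hence l: "alg (gmap x (dorfman UA u v x)) = K x (Xs - Yr + br r s + (W XY - W YX))"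
    by (simp add: gmap_def dorfman_untw(3)[OF u v x] defs)
  have 1: "vec_deriv X (\<lambda>y. K y (alg (v y) + W (coords (fst (v y))))) =
      K x (Xs + W XY) - br (W (coords X)) (K x (s + W (coords Y)))"
    using vec_deriv_K[OF dv(1) x T(1) smooth_vec_W(2)[OF v]] vec_deriv_W[OF v x T(1)] by (simp add: defs)
  have 2: "vec_deriv Y (\<lambda>y. K y (alg (u y) + W (coords (fst (u y))))) =
      K x (Yr + W YX) - br (W (coords Y)) (K x (r + W (coords X)))"
    using vec_deriv_K[OF du(1) x T(2) smooth_vec_W(2)[OF u]] vec_deriv_W[OF u x T(2)] by (simp add: defs)
  \<comment> \<open>\<open>K\<close> is an automorphism fixing \<open>W a\<close>, so it commutes
    with the adjoint action of \<open>W a\<close>.\<close>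
  have Kb: "br (W a) (K x b) = K x (br (W a) b)" for a b by (simp add: K(2) K_W)
  have "alg (dorfman UA (\<lambda>y. gmap y (u y)) (\<lambda>y. gmap y (v y)) x) =
      K x (Xs + W XY) - K x (br (W (coords X)) (s + W (coords Y))) -
      (K x (Yr + W YX) - K x (br (W (coords Y)) (r + W (coords X)))) +
      K x (br (r + W (coords X)) (s + W (coords Y)))"
    using 1 2 unfolding dorfman_untw(3)[OF gmap_sections[OF u] gmap_sections[OF v] x]
    by (simp add: gmap_def Kb K(2)[symmetric] X_Y_r_s_def)
  also have "... = K x (Xs - Yr + br r s + (W XY - W YX))" using br(2)[of r "W (coords Y)"]
    by (simp add: K_simps br_simps br_W K(2)[symmetric])
  finally show ?thesis using l by simp
qed

text \<open>A B-field with constant coefficients is closed, so its terms only reproduce the B-field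
  on the bracket of the vector fields. The other new terms cancel in pairs, and what remains of the
  derivative of \<open>K\<close> is rewritten by the invariance of \<open>ip\<close>.\<close>

lemma gmap_dorfman_covec:
  assumes u: "u \<in> sections UA U" and v: "v \<in> sections UA U" and x: "x \<in> U"
    and z: "z \<in> TR n x"
  shows "cov (gmap x (dorfman UA u v x)) z = cov (dorfman UA (\<lambda>y. gmap y (u y)) (\<lambda>y. gmap y (v y)) x) z"
proof -
  note du = untw_sectionsD[OF u] and dv = untw_sectionsD[OF v]
  define X Y r s where "X = fst (u x)" "Y = fst (v x)" "r = alg (u x)" "s = alg (v x)"
  define XY YX zX where "XY = (\<lambda>i. X (\<lambda>y. coords (fst (v y)) i))" "YX = (\<lambda>i. Y (\<lambda>y. coords (fst (u y)) i))"
    "zX = (\<lambda>i. z (\<lambda>y. coords (fst (u y)) i))"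
  define Xs Yr zr where "Xs = vec_deriv X (\<lambda>y. alg (v y))" "Yr = vec_deriv Y (\<lambda>y. alg (u y))"
    "zr = vec_deriv z (\<lambda>y. alg (u y))"
  note defs = X_Y_r_s_def XY_YX_zX_def Xs_Yr_zr_def
  have T: "X \<in> TR n x" "Y \<in> TR n x" using du(3) dv(3) x by (simp_all add: defs)
  define \<xi> \<eta> where "\<xi> = (\<lambda>i y. cov (u y) (cvec n y i))"
    "\<eta> = (\<lambda>i y. cov (v y) (cvec n y i))"
  have W0: "W (coords (fst (dorfman UA u v x))) = W XY - W YX"
    by (simp add: W_def field_bracket_untw(2)[OF u v x] defs scaleR_diff_left sum_subtractf)
  have B0: "Bt (coords (fst (dorfman UA u v x))) c = Bt XY c - Bt YX c" for c
    by (simp add: Bt_def field_bracket_untw(2)[OF u v x] defs right_diff_distrib left_diff_distrib sum_subtractf)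
  define D where "D = cov (dorfman UA u v x) z"
  \<comment> \<open>The target of the computation: the old covector plus \<open>delta\<close> of the
    bracket.\<close>
  have l: "cov (gmap x (dorfman UA u v x)) z = D +
      (Bt XY (coords z) - Bt YX (coords z) - ip (W XY - W YX) (W (coords z)) -
        2 * ip (W (coords z)) (Xs - Yr + br r s))"
    using z by (simp add: gmap_def covec_delta W0 B0 dorfman_untw(3)[OF u v x] defs D_def)
  have D: "D = (\<Sum>i<n. X (\<eta> i) * coords z i + \<eta> i x * zX i) - (\<Sum>i<n. Y (\<xi> i) * coords z i - z (\<xi> i) * coords Y i)
      + 2 * ip zr s" using z by (simp add: D_def dorfman_untw(2)[OF u v x] defs \<xi>_\<eta>_def coords_def)
  have comp: "cov (gmap y (u y)) (cvec n y i) = \<xi> i y + delta (coords (fst (u y))) (alg (u y)) i"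
    "cov (gmap y (v y)) (cvec n y i) = \<eta> i y + delta (coords (fst (v y))) (alg (v y)) i"
    if "y \<in> U" "i < n" for y i using that by (simp_all add: gmap_def \<xi>_\<eta>_def covec_coord[OF du(2)])
  have s\<xi>: "smooth_Rn n U (\<xi> i)" "smooth_Rn n U (\<eta> i)" if "i < n" for i
    using du(6)[OF that] dv(6)[OF that] by (simp_all add: \<xi>_\<eta>_def)
  have dv1: "Z (\<lambda>y. cov (gmap y (v y)) (cvec n y i)) =
      Z (\<eta> i) + delta (\<lambda>j. Z (\<lambda>y. coords (fst (v y)) j)) (vec_deriv Z (\<lambda>y. alg (v y))) i"
    if Z: "Z \<in> TR n x" and i: "i < n" for Z i
  proof -
    have "Z (\<lambda>y. cov (gmap y (v y)) (cvec n y i)) =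
        Z (\<lambda>y. \<eta> i y + delta (coords (fst (v y))) (alg (v y)) i)"
      by (rule tder_local[OF du(1) x Z]) (rule comp(2)[OF _ i])
    also have "... = Z (\<eta> i) + Z (\<lambda>y. delta (coords (fst (v y))) (alg (v y)) i)"
      by (rule tder_add[OF du(1) x Z s\<xi>(2)[OF i] smooth_delta[OF v]])
    finally show ?thesis using tder_delta[OF v x Z] by simp
  qed
  have du1: "Z (\<lambda>y. cov (gmap y (u y)) (cvec n y i)) =
      Z (\<xi> i) + delta (\<lambda>j. Z (\<lambda>y. coords (fst (u y)) j)) (vec_deriv Z (\<lambda>y. alg (u y))) i"
    if Z: "Z \<in> TR n x" and i: "i < n" for Z i
  proof -
    have "Z (\<lambda>y. cov (gmap y (u y)) (cvec n y i)) =
        Z (\<lambda>y. \<xi> i y + delta (coords (fst (u y))) (alg (u y)) i)"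
      by (rule tder_local[OF du(1) x Z]) (rule comp(1)[OF _ i])
    also have "... = Z (\<xi> i) + Z (\<lambda>y. delta (coords (fst (u y))) (alg (u y)) i)"
      by (rule tder_add[OF du(1) x Z s\<xi>(1)[OF i] smooth_delta[OF u]])
    finally show ?thesis using tder_delta[OF u x Z] by simp
  qed
  have dX: "X (\<lambda>y. cov (gmap y (v y)) (cvec n y i)) = X (\<eta> i) + delta XY Xs i"
    "Y (\<lambda>y. cov (gmap y (u y)) (cvec n y i)) = Y (\<xi> i) + delta YX Yr i"
    "z (\<lambda>y. cov (gmap y (u y)) (cvec n y i)) = z (\<xi> i) + delta zX zr i"
    "cov (gmap x (v x)) (cvec n x i) = \<eta> i x + delta (coords Y) s i" if "i < n" for i
    using dv1[OF T(1) that] du1[OF T(2) that] du1[OF z that] comp(2)[OF x that] by (simp_all add: defs)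
  have zK: "vec_deriv z (\<lambda>y. alg (gmap y (u y))) = K x (zr + W zX - br (W (coords z)) (r + W (coords X)))"
    using vec_deriv_K[OF du(1) x z smooth_vec_W(2)[OF u]] vec_deriv_W[OF u x z]
    by (simp add: gmap_def defs K_simps K(2) K_W)
  have S1: "(\<Sum>i<n. X (\<lambda>y. cov (gmap y (v y)) (cvec n y i)) * coords z i +
        cov (gmap x (v x)) (cvec n x i) * zX i) =
      (\<Sum>i<n. X (\<eta> i) * coords z i + \<eta> i x * zX i) + (\<Sum>i<n. delta XY Xs i * coords z i) +
      (\<Sum>i<n. delta (coords Y) s i * zX i)" unfolding sum.distrib[symmetric]
    by (intro sum.cong refl) (simp add: dX algebra_simps)
  have S2: "(\<Sum>i<n. Y (\<lambda>y. cov (gmap y (u y)) (cvec n y i)) * coords z i -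
        z (\<lambda>y. cov (gmap y (u y)) (cvec n y i)) * coords Y i) =
      (\<Sum>i<n. Y (\<xi> i) * coords z i - z (\<xi> i) * coords Y i) + (\<Sum>i<n. delta YX Yr i * coords z i) -
      (\<Sum>i<n. delta zX zr i * coords Y i)" unfolding sum.distrib[symmetric] sum_subtractf[symmetric]
    by (intro sum.cong refl) (simp add: dX algebra_simps)
  have "cov (dorfman UA (\<lambda>y. gmap y (u y)) (\<lambda>y. gmap y (v y)) x) z =
      (\<Sum>i<n. X (\<lambda>y. cov (gmap y (v y)) (cvec n y i)) * coords z i +
        cov (gmap x (v x)) (cvec n x i) * zX i) -
      (\<Sum>i<n. Y (\<lambda>y. cov (gmap y (u y)) (cvec n y i)) * coords z i -
        z (\<lambda>y. cov (gmap y (u y)) (cvec n y i)) * coords Y i) +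
      2 * ip (vec_deriv z (\<lambda>y. alg (gmap y (u y)))) (K x (s + W (coords Y)))"
    unfolding dorfman_untw(2)[OF gmap_sections[OF u] gmap_sections[OF v] x] using z
    by (simp add: gmap_def defs coords_def)
  \<comment> \<open>The old term \<open>2 * ip zr s\<close> is taken out of \<open>D\<close>, as its
    shifted version reappears in the last summand.\<close>
  also have "... = D - 2 * ip zr s + (\<Sum>i<n. delta XY Xs i * coords z i) + (\<Sum>i<n. delta (coords Y) s i * zX i)
      - (\<Sum>i<n. delta YX Yr i * coords z i) + (\<Sum>i<n. delta zX zr i * coords Y i)
      + 2 * ip (zr + W zX - br (W (coords z)) (r + W (coords X))) (s + W (coords Y))"
    unfolding S1 S2 zK K(3) D by simp
  also have "... = D + (Bt XY (coords z) - Bt YX (coords z) - ip (W XY - W YX) (W (coords z)) -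
        2 * ip (W (coords z)) (Xs - Yr + br r s))"
  proof -
    \<comment> \<open>Invariance moves the bracket off \<open>W\<close>; in \<open>b\<close> it then
      meets two shifts, which commute.\<close>
    have a: "ip (br (W (coords z)) r) s = ip (W (coords z)) (br r s)"
      using ip(3)[of r "W (coords z)" s] br(2)[of "W (coords z)" r] by (simp add: ip_simps)
    have b: "ip (br (W (coords z)) r) (W (coords Y)) = 0"
      using ip(3)[of "W (coords z)" r "W (coords Y)"] by (simp add: br_W ip_simps)
    show ?thesis unfolding delta_sum using Bt_antisym[of zX "coords Y"]
      by (simp add: ip_simps br_simps br_W a b ip(2)[of zr] ip(2)[of "W zX"])
  qed
  finally show ?thesis using l by simp
qed

lemma gmap_dorfman:
  assumes u: "u \<in> sections UA U" and v: "v \<in> sections UA U" and x: "x \<in> U"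
  shows "gmap x (dorfman UA u v x) = dorfman UA (\<lambda>y. gmap y (u y)) (\<lambda>y. gmap y (v y)) x"
proof -
  have "cov (gmap x (dorfman UA u v x)) = cov (dorfman UA (\<lambda>y. gmap y (u y)) (\<lambda>y. gmap y (v y)) x)"
  proof
    fix z
    show "cov (gmap x (dorfman UA u v x)) z = cov (dorfman UA (\<lambda>y. gmap y (u y)) (\<lambda>y. gmap y (v y)) x) z"
    proof (cases "z \<in> TR n x")
      case True
      thus ?thesis by (rule gmap_dorfman_covec[OF u v x])
    next
      case False
      have "cov (dorfman UA (\<lambda>y. gmap y (u y)) (\<lambda>y. gmap y (v y)) x) z = 0"
        unfolding dorfman_untw(2)[OF gmap_sections[OF u] gmap_sections[OF v] x, of z] using False
        by (rule if_not_P)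
      moreover have "cov (dorfman UA u v x) z = 0"
        unfolding dorfman_untw(2)[OF u v x, of z] using False by (rule if_not_P)
      ultimately show ?thesis using False by (simp add: gmap_def covec_def)
    qed
  qed
  moreover have "fst (gmap x (dorfman UA u v x)) = fst (dorfman UA (\<lambda>y. gmap y (u y)) (\<lambda>y. gmap y (v y)) x)"
    unfolding dorfman_untw(1)[OF gmap_sections[OF u] gmap_sections[OF v] x]
    by (simp add: gmap_def dorfman_untw(1)[OF u v x])
  ultimately show ?thesis using gmap_dorfman_vec[OF u v x] by (simp add: prod_eq_iff)
qed

end

text \<open>The inverse of a gauge map is the gauge map of the negated data, so bijectivity and the
  reverse transfer of sections follow from the lemmas already proved.\<close>

locale gauge_pair = gauge Bs n br ip w \<beta> K + inv: gauge Bs n br ip "\<lambda>i. - w i" "\<lambda>i j. - \<beta> i j" K'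
  for Bs :: "'g::real_vector set" and n br ip w \<beta> K K' +
  assumes KK': "K' v (K v a) = a" "K v (K' v a) = a"
begin

lemma inv_W: "inv.W a = - W a" by (simp add: inv.W_def W_def sum_negf)

lemma inv_Bt: "inv.Bt a c = - Bt a c" by (simp add: inv.Bt_def Bt_def sum_negf)

lemma gmap_inverse:
  shows "inv.gmap v (gmap v e) = e" "gmap v (inv.gmap v e) = e"
proof -
  have K'W: "K' v (W a) = W a" for a using KK'(1)[of v "W a"] by (simp add: K_W)
  have ipK: "ip (W a) (K v b) = ip (W a) b" "ip (W a) (K' v b) = ip (W a) b" for a b
    using K(3)[of v "W a" b] inv.K(3)[of v "W a" b] by (simp_all add: K_W K'W)
  show "inv.gmap v (gmap v e) = e"
    by (simp add: inv.gmap_def gmap_def prod_eq_iff fun_eq_iff covec_delta inv.covec_delta inv_W inv_Bt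
        K_simps inv.K_simps KK' K_W K'W ip_simps ipK ip(2)[of "W (coords (fst e))"])
  show "gmap v (inv.gmap v e) = e"
    by (simp add: inv.gmap_def gmap_def prod_eq_iff fun_eq_iff covec_delta inv.covec_delta inv_W inv_Bt
        K_simps inv.K_simps KK' K_W K'W ip_simps ipK ip(2)[of "W (coords (fst e))"])
qed

lemma local_iso_gauge:
  assumes U: "opn n U"
  shows "local_iso (Rn n) U UA (Rn n) U UA (\<lambda>x. x) (\<lambda>x. x) gmap" unfolding local_iso_def image_ident
proof (intro conjI allI impI ballI; (elim conjE)?)
  have E: "x \<in> ER n" if "x \<in> U" for x using U openin_subset that by blast
  show "linear_over (fibre UA x) (gmap x)" for x by (rule gmap_linear)
  show "bij_betw (gmap x) (fibre UA x) (fibre UA x)" if "x \<in> U" for x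
    by (rule bij_betw_byWitness[of _ "inv.gmap x"])
      (use gmap_inverse gmap_fibre[OF E[OF that]] inv.gmap_fibre[OF E[OF that]] in auto)
  show "anchor UA x (gmap x a) (\<lambda>y. h y) = anchor UA x a h" for x a h by (simp add: untw_simps gmap_def)
  show "pairing UA x (gmap x a) (gmap x b) = pairing UA x a b"
    if "a \<in> fibre UA x" "b \<in> fibre UA x" for x a b by (rule gmap_pairing[OF that])
  show "u \<in> sections UA V \<longleftrightarrow> (\<lambda>y. gmap y (u y)) \<in> sections UA V" for V u
    using gmap_sections[of u V] inv.gmap_sections[of "\<lambda>y. gmap y (u y)" V] by (auto simp: gmap_inverse)
  show "gmap x (dorfman UA u v x) = dorfman UA (\<lambda>y. gmap y (u y)) (\<lambda>y. gmap y (v y)) x"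
    if "u \<in> sections UA V" "v \<in> sections UA V" "x \<in> V" for V u v x by (rule gmap_dorfman[OF that])
qed (use U in simp_all)

end

section \<open>Linear changes of coordinates\<close>

lemma covec_eq:
  assumes v: "v \<in> ER n" and \<xi>: "\<xi> \<in> dual_space (TR n v)"
  shows "\<xi> = covec n v (\<lambda>i. \<xi> (cvec n v i))"
proof
  fix X
  show "\<xi> X = covec n v (\<lambda>i. \<xi> (cvec n v i)) X"
    using covector_eq_sum[OF v _ \<xi>, of X] dual_space_zero[OF \<xi>, of X] by (simp add: covec_def)
qed

lemma covec_cong: "(\<And>i. i < n \<Longrightarrow> c i = c' i) \<Longrightarrow> covec n v c = covec n v c'"
  by (auto simp: covec_def fun_eq_iff intro!: sum.cong)

lemma lin_map_cong: "(\<And>i. i < n \<Longrightarrow> a i = b i) \<Longrightarrow> lin_map n F a = lin_map n F b"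
  unfolding lin_map_def by (intro ext if_cong refl sum.cong) simp_all

lemma coords_tvec: "v \<in> ER n \<Longrightarrow> i < n \<Longrightarrow> coords (tvec n v a) i = a i" by (simp add: coords_def tvec_coord)

text \<open>A linear substitution of the base coordinates by \<open>F\<close> combined with an
  automorphism \<phi> of the fibre algebra. The inverse relations are stated for indices below
  \<open>n\<close>, because points vanish beyond.\<close>

locale linear_change = finite_basis Bs for Bs :: "'g::real_vector set" +
  fixes n :: nat and br :: "'g \<Rightarrow> 'g \<Rightarrow> 'g" and ip :: "'g \<Rightarrow> 'g \<Rightarrow> real"
    and F G :: "nat \<Rightarrow> nat \<Rightarrow> real" and \<phi> \<psi> :: "'g \<Rightarrow> 'g"
  assumes FG: "\<And>j k. j < n \<Longrightarrow> k < n \<Longrightarrow> (\<Sum>i<n. F j i * G i k) = (if j = k then 1 else 0)"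
    and GF: "\<And>j k. j < n \<Longrightarrow> k < n \<Longrightarrow> (\<Sum>i<n. G j i * F i k) = (if j = k then 1 else 0)"
    and ip_bil: "bilinear ip"
    and \<phi>: "linear \<phi>" "\<And>a b. \<phi> (br a b) = br (\<phi> a) (\<phi> b)" "\<And>a b. ip (\<phi> a) (\<phi> b) = ip a b"
    and \<psi>: "linear \<psi>" "\<And>a b. \<psi> (br a b) = br (\<psi> a) (\<psi> b)" "\<And>a b. ip (\<psi> a) (\<psi> b) = ip a b"
    and \<phi>\<psi>: "\<And>a. \<phi> (\<psi> a) = a" "\<And>a. \<psi> (\<phi> a) = a"
begin

abbreviation "UA \<equiv> untw n br ip"
abbreviation "LF \<equiv> lin_map n F"
abbreviation "LG \<equiv> lin_map n G"

text \<open>Covectors move by the transpose of \<open>G\<close> and vectors by \<open>F\<close>, so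
  their pairing is unchanged. This one identity carries all invariance arguments for covectors
  below.\<close>

lemma contraction: "(\<Sum>i<n. (\<Sum>j<n. G j i * a j) * LF b i) = (\<Sum>j<n. a j * b j)"
proof -
  have "(\<Sum>i<n. (\<Sum>j<n. G j i * a j) * LF b i) = (\<Sum>i<n. \<Sum>j<n. \<Sum>k<n. G j i * F i k * (a j * b k))"
    by (intro sum.cong refl) (simp add: lin_map_def sum_product algebra_simps)
  also have "... = (\<Sum>j<n. \<Sum>i<n. \<Sum>k<n. G j i * F i k * (a j * b k))" by (rule sum.swap)
  also have "... = (\<Sum>j<n. \<Sum>k<n. \<Sum>i<n. G j i * F i k * (a j * b k))" by (intro sum.cong refl sum.swap)
  also have "... = (\<Sum>j<n. \<Sum>k<n. if j = k then a j * b k else 0)"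
    by (intro sum.cong refl) (simp add: GF sum_distrib_right[symmetric])
  also have "... = (\<Sum>j<n. a j * b j)" by simp
  finally show ?thesis .
qed

lemma lin_map_FG: "i < n \<Longrightarrow> LF (LG a) i = a i"
proof -
  assume i: "i < n"
  have "LF (LG a) i = (\<Sum>j<n. \<Sum>k<n. F i j * G j k * a k)"
    using i by (simp add: lin_map_def sum_distrib_left mult.assoc)
  also have "... = (\<Sum>k<n. \<Sum>j<n. F i j * G j k * a k)" by (rule sum.swap)
  also have "... = (\<Sum>k<n. if i = k then a k else 0)"
    using i by (intro sum.cong refl) (simp add: FG sum_distrib_right[symmetric])
  finally show ?thesis using i by simp
qed

lemma lin_map_GF: "i < n \<Longrightarrow> LG (LF a) i = a i"
proof -
  assume i: "i < n"
  have "LG (LF a) i = (\<Sum>j<n. \<Sum>k<n. G i j * F j k * a k)"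
    using i by (simp add: lin_map_def sum_distrib_left mult.assoc)
  also have "... = (\<Sum>k<n. \<Sum>j<n. G i j * F j k * a k)" by (rule sum.swap)
  also have "... = (\<Sum>k<n. if i = k then a k else 0)"
    using i by (intro sum.cong refl) (simp add: GF sum_distrib_right[symmetric])
  finally show ?thesis using i by simp
qed

lemma GF_point: "x \<in> ER n \<Longrightarrow> LG (LF x) = x"
proof
  fix i assume "x \<in> ER n"
  thus "LG (LF x) i = x i"
    using lin_map_GF[of i x] by (cases "i < n") (simp_all add: lin_map_def topspace_Euclidean_space)
qed

lemma FG_point: "x \<in> ER n \<Longrightarrow> LF (LG x) = x"
proof
  fix i assume "x \<in> ER n"
  thus "LF (LG x) i = x i"
    using lin_map_FG[of i x] by (cases "i < n") (simp_all add: lin_map_def topspace_Euclidean_space)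
qed

lemma image_F:
  assumes "U \<subseteq> ER n"
  shows "LF ` U = {y \<in> ER n. LG y \<in> U}"
proof
  show "LF ` U \<subseteq> {y \<in> ER n. LG y \<in> U}" using assms GF_point lin_map_Euclidean by auto
  show "{y \<in> ER n. LG y \<in> U} \<subseteq> LF ` U"
  proof
    fix y assume "y \<in> {y \<in> ER n. LG y \<in> U}"
    hence "y = LF (LG y)" "LG y \<in> U" using FG_point by simp_all
    thus "y \<in> LF ` U" by (rule image_eqI)
  qed
qed

lemma open_image_F:
  assumes U: "opn n U"
  shows "opn n (LF ` U)" unfolding image_F[OF openin_subset[OF U]]
  by (rule openin_continuous_map_preimage[OF continuous_map_lin_map U])

lemma smooth_G:
  assumes U: "opn n U" and f: "smooth_Rn n U f"
  shows "smooth_Rn n (LF ` U) (\<lambda>y. f (LG y))" by (rule smooth_Rn_lin_map[OF U f open_image_F[OF U]])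
    (use image_F[OF openin_subset[OF U]] in blast)

lemma smooth_near_F:
  assumes x: "x \<in> ER n"
  shows "smooth_near (Rn n) (LF x) h \<longleftrightarrow> smooth_near (Rn n) x (\<lambda>y. h (LF y))"
proof
  assume "smooth_near (Rn n) (LF x) h"
  then obtain U where U: "opn n U" "LF x \<in> U" "smooth_Rn n U h" unfolding smooth_near_Rn by blast
  let ?V = "{y \<in> ER n. LF y \<in> U}"
  have V: "opn n ?V" by (rule openin_continuous_map_preimage[OF continuous_map_lin_map U(1)])
  have "smooth_Rn n ?V (\<lambda>y. h (LF y))" by (rule smooth_Rn_lin_map[OF U(1,3) V]) blast
  thus "smooth_near (Rn n) x (\<lambda>y. h (LF y))" by (rule smooth_nearI[OF V, rotated]) (use x U(2) in blast)
next
  assume "smooth_near (Rn n) x (\<lambda>y. h (LF y))"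
  then obtain U where U: "opn n U" "x \<in> U" "smooth_Rn n U (\<lambda>y. h (LF y))" unfolding smooth_near_Rn by blast
  have s: "smooth_Rn n (LF ` U) (\<lambda>y. h (LF (LG y)))" by (rule smooth_G[OF U(1,3)])
  have "smooth_Rn n (LF ` U) h" using s smooth_Rn_cong[OF open_image_F[OF U(1)], of h "\<lambda>y. h (LF (LG y))"]
      FG_point openin_subset[OF open_image_F[OF U(1)]] by (simp add: subset_iff)
  thus "smooth_near (Rn n) (LF x) h"
    by (rule smooth_nearI[OF open_image_F[OF U(1)], rotated]) (use U(2) in blast)
qed

definition push :: "(nat \<Rightarrow> real) \<Rightarrow> (nat \<Rightarrow> real) tvec \<Rightarrow> (nat \<Rightarrow> real) tvec"
  where "push x X = tvec n (LF x) (LF (coords X))"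

text \<open>\<open>push\<close> is the differential of the substitution: the chain rule applies
  where \<open>h\<close> is smooth, and elsewhere \<open>smooth_near_F\<close> gives both sides the
  default value 0.\<close>

lemma push_apply:
  assumes x: "x \<in> ER n" and X: "X \<in> TR n x"
  shows "push x X h = X (\<lambda>y. h (LF y))"
proof (cases "smooth_near (Rn n) (LF x) h")
  case True
  then obtain U where U: "opn n U" "LF x \<in> U" "smooth_Rn n U h" unfolding smooth_near_Rn by blast
  let ?d = "\<lambda>i. partial_deriv i h (LF x)"
  have "X (\<lambda>y. h (LF y)) = (\<Sum>j<n. coords X j * partial_deriv j (\<lambda>y. h (LF y)) x)"
    using True smooth_near_F[OF x] by (subst tangent_eq_tvec[OF x X]) (simp add: tvec_def coords_def)
  also have "... = (\<Sum>j<n. \<Sum>i<n. coords X j * (F i j * ?d i))"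
    by (intro sum.cong refl) (simp add: partial_deriv_lin_map(1)[OF U(1,3,2)] sum_distrib_left)
  also have "... = (\<Sum>i<n. \<Sum>j<n. coords X j * (F i j * ?d i))" by (rule sum.swap)
  also have "... = (\<Sum>i<n. LF (coords X) i * ?d i)"
    by (intro sum.cong refl) (simp add: lin_map_def sum_distrib_right algebra_simps)
  finally show ?thesis using True by (simp add: push_def tvec_def)
next
  case False
  hence "X (\<lambda>y. h (LF y)) = 0"
    using smooth_near_F[OF x] by (subst tangent_eq_tvec[OF x X]) (simp add: tvec_def)
  thus ?thesis using False by (simp add: push_def tvec_def)
qed

lemma coords_push: "i < n \<Longrightarrow> coords (push x X) i = LF (coords X) i"
  unfolding push_def by (rule coords_tvec[OF lin_map_Euclidean])

lemma push_tangent: "push x X \<in> TR n (LF x)"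
  unfolding push_def by (rule tvec_in_tangent[OF lin_map_Euclidean])

definition lmap :: "(nat \<Rightarrow> real) \<Rightarrow> (nat \<Rightarrow> real) tvec \<times> (nat \<Rightarrow> real) covec \<times> 'g \<Rightarrow>
    (nat \<Rightarrow> real) tvec \<times> (nat \<Rightarrow> real) covec \<times> 'g"
  where "lmap x e = (push x (fst e), covec n (LF x) (\<lambda>i. \<Sum>j<n. G j i * cov e (cvec n x j)), \<phi> (alg e))"

lemma lmap_covec:
  "cov (lmap x e) (push x Z) = (\<Sum>j<n. coords Z j * cov e (cvec n x j))"
proof -
  have p: "push x Z (\<lambda>y. y i) = LF (coords Z) i" if "i < n" for i
    using coords_push[OF that, of x Z] by (simp add: coords_def)
  have "cov (lmap x e) (push x Z) = (\<Sum>i<n. push x Z (\<lambda>y. y i) * (\<Sum>j<n. G j i * cov e (cvec n x j)))"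
    by (simp add: lmap_def covec_def push_tangent)
  also have "... = (\<Sum>i<n. (\<Sum>j<n. G j i * cov e (cvec n x j)) * LF (coords Z) i)"
    by (intro sum.cong refl) (simp add: p mult.commute)
  finally show ?thesis unfolding contraction by (simp add: mult.commute)
qed

lemma lmap_fibre: "lmap x e \<in> fibre UA (LF x)"
  by (simp add: lmap_def untw_simps push_tangent covec_dual[OF lin_map_Euclidean])

lemma lmap_linear: "linear_over S (lmap x)"
proof -
  have c1: "push x (X + Y) = push x X + push x Y" for X Y unfolding push_def tvec_add
    by (rule tvec_cong) (simp add: lin_map_def coords_add distrib_left sum.distrib)
  have c2: "push x (c *\<^sub>R X) = c *\<^sub>R push x X" for c X unfolding push_def tvec_scaleR
    by (rule tvec_cong) (simp add: lin_map_def coords_scaleR sum_distrib_left algebra_simps)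
  have d1: "covec n y (\<lambda>i. \<Sum>j<n. G j i * (\<xi> j + \<eta> j)) = covec n y (\<lambda>i. \<Sum>j<n. G j i * \<xi> j) + covec n y (\<lambda>i. \<Sum>j<n. G j i * \<eta> j)"
    for y \<xi> \<eta> by (auto simp: covec_def fun_eq_iff distrib_left sum.distrib)
  have d2: "covec n y (\<lambda>i. \<Sum>j<n. G j i * (c * \<xi> j)) = c *\<^sub>R covec n y (\<lambda>i. \<Sum>j<n. G j i * \<xi> j)"
    for y \<xi> c by (auto simp: covec_def fun_eq_iff sum_distrib_left fun_scaleR_apply algebra_simps)
  have "lmap x (a + b) = lmap x a + lmap x b" for a b
    by (simp add: lmap_def prod_eq_iff c1 d1 fun_add_apply linear_add[OF \<phi>(1)])
  moreover have "lmap x (c *\<^sub>R a) = c *\<^sub>R lmap x a" for c a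
    by (simp add: lmap_def prod_eq_iff c2 d2 fun_scaleR_apply linear_scale[OF \<phi>(1)])
  ultimately show ?thesis by (simp add: linear_over_def)
qed

lemma lmap_pairing:
  assumes x: "x \<in> ER n"
    and ab: "a \<in> fibre UA x" "b \<in> fibre UA x"
  shows "pairing UA (LF x) (lmap x a) (lmap x b) = pairing UA x a b"
proof -
  obtain X \<xi> r Y \<eta> s where e: "a = (X, \<xi>, r)" "b = (Y, \<eta>, s)" by (metis prod_cases3)
  have T: "X \<in> TR n x" "Y \<in> TR n x"
    "\<xi> \<in> dual_space (TR n x)" "\<eta> \<in> dual_space (TR n x)" using ab by (simp_all add: e untw_simps)
  have "cov (lmap x a) (push x Y) = \<xi> Y" "cov (lmap x b) (push x X) = \<eta> X"
    using lmap_covec[of x a Y] lmap_covec[of x b X]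
      covector_eq_sum[OF x T(2,3)] covector_eq_sum[OF x T(1,4)] by (simp_all add: e coords_def)
  thus ?thesis by (simp add: e lmap_def untw_simps \<phi>(3))
qed

end

text \<open>The inverse is again of this kind, with \<open>F\<close>, \<open>G\<close> and \<phi>,
  \<psi> exchanged.\<close>

locale linear_change_pair = linear_change Bs n br ip F G \<phi> \<psi> + inv: linear_change Bs n br ip G F \<psi> \<phi>
  for Bs :: "'g::real_vector set" and n br ip F G \<phi> \<psi>
begin

lemma lmap_inverse:
  assumes x: "x \<in> ER n" and e: "e \<in> fibre UA x"
  shows "inv.lmap (LF x) (lmap x e) = e"
proof -
  have T: "fst e \<in> TR n x" "cov e \<in> dual_space (TR n x)" using e by (simp_all add: untw_simps mem_Times_iff)
  have "inv.push (LF x) (push x (fst e)) = fst e"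
  proof (rule tangent_eqI[OF x _ T(1)])
    show "inv.push (LF x) (push x (fst e)) \<in> TR n x"
      using inv.push_tangent[of "LF x"] GF_point[OF x] by simp
    fix i assume i: "i < n"
    have "coords (inv.push (LF x) (push x (fst e))) i = LG (coords (push x (fst e))) i"
      by (rule inv.coords_push[OF i])
    also have "LG (coords (push x (fst e))) = LG (LF (coords (fst e)))"
      by (rule lin_map_cong) (rule coords_push)
    finally show "inv.push (LF x) (push x (fst e)) (\<lambda>y. y i) = fst e (\<lambda>y. y i)"
      using lin_map_GF[OF i, of "coords (fst e)"] by (simp add: coords_def)
  qed
  moreover have "cov (inv.lmap (LF x) (lmap x e)) = cov e"
  proof -
    have "(\<Sum>j<n. F j i * (\<Sum>k<n. G k j * cov e (cvec n x k))) = cov e (cvec n x i)" if i: "i < n" for i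
    proof -
      have "(\<Sum>j<n. F j i * (\<Sum>k<n. G k j * cov e (cvec n x k))) = (\<Sum>j<n. (\<Sum>k<n. G k j * cov e (cvec n x k)) *
            LF (\<lambda>l. if l = i then 1 else 0) j)"
        using i by (intro sum.cong refl) (simp add: lin_map_def if_distrib cong: if_cong)
      also have "... = cov e (cvec n x i)"
        unfolding contraction using i by (simp add: if_distrib cong: if_cong)
      finally show ?thesis .
    qed
    hence "cov (inv.lmap (LF x) (lmap x e)) = covec n x (\<lambda>i. cov e (cvec n x i))"
      unfolding inv.lmap_def lmap_def GF_point[OF x] fst_conv snd_conv
      by (intro covec_cong) (simp add: covec_coord[OF lin_map_Euclidean])
    thus ?thesis using covec_eq[OF x T(2)] by simp
  qed
  ultimately show ?thesis by (simp add: inv.lmap_def lmap_def prod_eq_iff \<phi>\<psi>)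
qed

end

section \<open>Naturality of the bracket under the substitution\<close>

context linear_change
begin

context
  fixes u U
  assumes u: "u \<in> sections UA U"
begin

lemma pushed:
  assumes z: "z \<in> U"
  shows "lmap (LG (LF z)) (u (LG (LF z))) = lmap z (u z)"
  using GF_point[OF untw_sectionsD(2)[OF u z]] by simp

lemma lmap_sections: "(\<lambda>y. lmap (LG y) (u (LG y))) \<in> sections UA (LF ` U)"
proof (rule untw_sectionsI)
  note d = untw_sectionsD[OF u]
  have pt: "LF (LG y) = y" "LG y \<in> U" "y \<in> ER n" if "y \<in> LF ` U" for y
    using that GF_point d(2) lin_map_Euclidean by auto
  show o: "opn n (LF ` U)" by (rule open_image_F[OF d(1)])
  show "fst (lmap (LG y) (u (LG y))) \<in> TR n y" if "y \<in> LF ` U" for y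
    using push_tangent[of "LG y"] pt(1)[OF that] by (simp add: lmap_def)
  show "cov (lmap (LG y) (u (LG y))) \<in> dual_space (TR n y)" if "y \<in> LF ` U" for y
    using covec_dual[OF pt(3)[OF that]] pt(1)[OF that] by (simp add: lmap_def)
  show "smooth_Rn n (LF ` U) (\<lambda>y. coords (fst (lmap (LG y) (u (LG y)))) i)" if i: "i < n" for i
  proof -
    have "smooth_Rn n U (\<lambda>x. \<Sum>j<n. F i j * coords (fst (u x)) j)"
      by (intro smooth_Rn_sum[OF d(1)] smooth_Rn_mult[OF d(1) smooth_Rn_const[OF d(1)]] d(4)) simp
    from smooth_G[OF d(1) this] show ?thesis using i by (simp add: lmap_def coords_push lin_map_def)
  qed
  show "smooth_Rn n (LF ` U) (\<lambda>y. cov (lmap (LG y) (u (LG y))) (cvec n y i))" if i: "i < n" for i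
  proof -
    have "smooth_Rn n U (\<lambda>x. \<Sum>j<n. G j i * cov (u x) (cvec n x j))"
      by (intro smooth_Rn_sum[OF d(1)] smooth_Rn_mult[OF d(1) smooth_Rn_const[OF d(1)]] d(6)) simp
    from smooth_G[OF d(1) this] show ?thesis
      using smooth_Rn_cong[OF o, of "\<lambda>y. cov (lmap (LG y) (u (LG y))) (cvec n y i)"
          "\<lambda>y. \<Sum>j<n. G j i * cov (u (LG y)) (cvec n (LG y) j)"]
        pt covec_coord[OF _ i] by (simp add: lmap_def)
  qed
  show "smooth_Rn n (LF ` U) (\<lambda>y. l (alg (lmap (LG y) (u (LG y)))))" if l: "linear l" for l :: "'g \<Rightarrow> real"
  proof -
    have "smooth_Rn n U (\<lambda>x. l (\<phi> (alg (u x))))"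
      by (rule d(7)[unfolded smooth_vec_on_def smooth_on_Rn, rule_format,
          OF linear_compose[OF \<phi>(1) l, unfolded o_def], THEN conjunct2])
    from smooth_G[OF d(1) this] show ?thesis by (simp add: lmap_def)
  qed
qed

text \<open>Differentiating a transported section along a pushed vector brings \<open>LG\<close> and
  \<open>LF\<close> together; they cancel near \<open>x\<close>, and a derivative of the fibrewise
  image at the original point remains.\<close>

lemma push_pushed:
  assumes x: "x \<in> U" and X: "X \<in> TR n x"
  shows "push x X (\<lambda>y. h (lmap (LG y) (u (LG y))) y) = X (\<lambda>z. h (lmap z (u z)) (LF z))"
proof -
  note d = untw_sectionsD[OF u]
  have "push x X (\<lambda>y. h (lmap (LG y) (u (LG y))) y) = X (\<lambda>z. h (lmap (LG (LF z)) (u (LG (LF z)))) (LF z))"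
    by (rule push_apply[OF d(2)[OF x] X])
  also have "... = X (\<lambda>z. h (lmap z (u z)) (LF z))" by (rule tder_local[OF d(1) x X]) (simp only: pushed)
  finally show ?thesis .
qed

lemma push_coords:
  assumes x: "x \<in> U" and X: "X \<in> TR n x" and i: "i < n"
  shows "push x X (\<lambda>y. coords (fst (lmap (LG y) (u (LG y)))) i) = LF (\<lambda>j. X (\<lambda>y. coords (fst (u y)) j)) i"
proof -
  note d = untw_sectionsD[OF u]
  note t = d(1) x X
  have "push x X (\<lambda>y. coords (fst (lmap (LG y) (u (LG y)))) i) = X (\<lambda>z. coords (fst (lmap z (u z))) i)"
    by (rule push_pushed[OF x X])
  also have "... = X (\<lambda>z. \<Sum>j<n. F i j * coords (fst (u z)) j)"
    using i by (simp add: lmap_def coords_push lin_map_def)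
  also have "... = (\<Sum>j<n. X (\<lambda>z. F i j * coords (fst (u z)) j))"
    by (rule tder_sum[OF t]) (rule smooth_Rn_mult[OF d(1) smooth_Rn_const[OF d(1)] d(4)], simp)
  also have "... = (\<Sum>j<n. F i j * X (\<lambda>z. coords (fst (u z)) j))"
    by (intro sum.cong refl tder_cmult[OF t] d(4)) simp
  finally show ?thesis using i by (simp add: lin_map_def)
qed

lemma push_covec:
  assumes x: "x \<in> U" and X: "X \<in> TR n x" and i: "i < n"
  shows "push x X (\<lambda>y. cov (lmap (LG y) (u (LG y))) (cvec n y i)) =
    (\<Sum>j<n. G j i * X (\<lambda>y. cov (u y) (cvec n y j)))"
proof -
  note d = untw_sectionsD[OF u]
  note t = d(1) x X
  have "push x X (\<lambda>y. cov (lmap (LG y) (u (LG y))) (cvec n y i)) =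
      X (\<lambda>z. cov (lmap z (u z)) (cvec n (LF z) i))"
    by (rule push_pushed[OF x X, of "\<lambda>e y. cov e (cvec n y i)"])
  also have "... = X (\<lambda>z. \<Sum>j<n. G j i * cov (u z) (cvec n z j))"
    by (simp add: lmap_def covec_coord[OF lin_map_Euclidean i])
  also have "... = (\<Sum>j<n. X (\<lambda>z. G j i * cov (u z) (cvec n z j)))"
    by (rule tder_sum[OF t]) (rule smooth_Rn_mult[OF d(1) smooth_Rn_const[OF d(1)] d(6)], simp)
  also have "... = (\<Sum>j<n. G j i * X (\<lambda>z. cov (u z) (cvec n z j)))"
    by (intro sum.cong refl tder_cmult[OF t] d(6)) simp
  finally show ?thesis .
qed

lemma push_vec:
  assumes x: "x \<in> U" and X: "X \<in> TR n x"
  shows "vec_deriv (push x X) (\<lambda>y. alg (lmap (LG y) (u (LG y)))) = \<phi> (vec_deriv X (\<lambda>y. alg (u y)))"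
proof (rule vec_deriv_eqI)
  note d = untw_sectionsD[OF u]
  fix l :: "'g \<Rightarrow> real" assume l: "linear l"
  have "push x X (\<lambda>y. l (alg (lmap (LG y) (u (LG y))))) = X (\<lambda>z. l (alg (lmap z (u z))))"
    by (rule push_pushed[OF x X])
  also have "... = l (\<phi> (vec_deriv X (\<lambda>y. alg (u y))))"
    using linear_vec_deriv[OF d(1) x X d(7) linear_compose[OF \<phi>(1) l, unfolded o_def]]
    by (simp add: lmap_def)
  finally show "l (\<phi> (vec_deriv X (\<lambda>y. alg (u y)))) =
      push x X (\<lambda>y. l (alg (lmap (LG y) (u (LG y)))))" by simp
qed

end

text \<open>The covector part of the bracket consists of sums over coordinates of a derivative times
  a component, and \<open>contraction\<close> shows each of them to be the same in old and new
  coordinates. The other parts are natural by linearity of \<open>F\<close> and since \<phi> is an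
  automorphism.\<close>

lemma lmap_dorfman:
  assumes u: "u \<in> sections UA U" and v: "v \<in> sections UA U" and x: "x \<in> U"
  shows "lmap x (dorfman UA u v x) = dorfman UA
    (\<lambda>y. lmap (LG y) (u (LG y))) (\<lambda>y. lmap (LG y) (v (LG y))) (LF x)"
    (is "_ = dorfman _ ?u ?v _")
proof -
  note du = untw_sectionsD[OF u] and dv = untw_sectionsD[OF v]
  note su = lmap_sections[OF u] and sv = lmap_sections[OF v]
  have Fx: "LF x \<in> LF ` U" using x by blast
  have xE: "x \<in> ER n" by (rule du(2)[OF x])
  let ?y = "LF x"
  define X Y where "X = fst (u x)" "Y = fst (v x)"
  have T: "X \<in> TR n x" "Y \<in> TR n x" using du(3)[OF x] dv(3)[OF x] by (simp_all add: X_Y_def)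
  have at: "?u ?y = lmap x (u x)" "?v ?y = lmap x (v x)" using pushed[OF u x] pushed[OF v x] by auto
  have f: "fst (?u ?y) = push x X" "fst (?v ?y) = push x Y" unfolding at by (simp_all add: lmap_def X_Y_def)
  have "fst (lmap x (dorfman UA u v x)) = fst (dorfman UA ?u ?v ?y)"
  proof (rule tangent_eqI[OF lin_map_Euclidean])
    show "fst (lmap x (dorfman UA u v x)) \<in> TR n ?y" by (simp add: lmap_def push_tangent)
    show "fst (dorfman UA ?u ?v ?y) \<in> TR n ?y" by (rule field_bracket_untw(1)[OF su sv Fx])
    fix i assume i: "i < n"
    have "coords (fst (dorfman UA ?u ?v ?y)) i =
        LF (\<lambda>j. X (\<lambda>y. coords (fst (v y)) j)) i - LF (\<lambda>j. Y (\<lambda>y. coords (fst (u y)) j)) i"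
      unfolding field_bracket_untw(2)[OF su sv Fx] f push_coords[OF v x T(1) i] push_coords[OF u x T(2) i] ..
    also have "... = LF (coords (fst (dorfman UA u v x))) i"
      using i by (simp add: lin_map_def field_bracket_untw(2)[OF u v x] X_Y_def right_diff_distrib sum_subtractf)
    also have "... = coords (fst (lmap x (dorfman UA u v x))) i" using i by (simp add: lmap_def coords_push)
    finally show "fst (lmap x (dorfman UA u v x)) (\<lambda>y. y i) =
        fst (dorfman UA ?u ?v ?y) (\<lambda>y. y i)" by (simp add: coords_def)
  qed
  moreover have "cov (lmap x (dorfman UA u v x)) = cov (dorfman UA ?u ?v ?y)"
  proof
    fix z'
    show "cov (lmap x (dorfman UA u v x)) z' = cov (dorfman UA ?u ?v ?y) z'"
    proof (cases "z' \<in> TR n ?y")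
      case z': True
      \<comment> \<open>Every tangent vector at the image point is the push of such a vector, so
        covectors need to be compared on pushed vectors only.\<close>
      define z where "z = tvec n x (LG (coords z'))"
      have z: "z \<in> TR n x" unfolding z_def by (rule tvec_in_tangent[OF xE])
      have zz: "z' = push x z"
      proof (rule tangent_eqI[OF lin_map_Euclidean z' push_tangent])
        fix i assume i: "i < n"
        have "LF (coords z) = LF (LG (coords z'))"
          unfolding z_def by (rule lin_map_cong) (rule coords_tvec[OF xE])
        thus "z' (\<lambda>y. y i) = push x z (\<lambda>y. y i)"
          using coords_push[OF i, of x z] lin_map_FG[OF i, of "coords z'"] by (simp add: coords_def)
      qed
      define \<xi> \<eta> where "\<xi> = (\<lambda>i y. cov (u y) (cvec n y i))"
        "\<eta> = (\<lambda>i y. cov (v y) (cvec n y i))"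
      define D where "D = cov (dorfman UA u v x)"
      \<comment> \<open>\<open>lmap\<close> evaluates a covector on coordinate vectors only;
        linearity of the covector of the bracket turns the sum back into its value at
        \<open>z\<close>.\<close>
      have "cov (lmap x (dorfman UA u v x)) z' = (\<Sum>j<n. coords z j * D (cvec n x j))"
        unfolding zz D_def by (rule lmap_covec)
      also have "... = D z"
        unfolding D_def using covector_eq_sum[OF xE z dorfman_untw_dual[OF ip_bil u v x]] by (simp add: coords_def)
      also have "D z = (\<Sum>i<n. X (\<eta> i) * coords z i + \<eta> i x * z (\<lambda>y. coords (fst (u y)) i)) -
          (\<Sum>i<n. Y (\<xi> i) * coords z i - z (\<xi> i) * coords Y i) +
          2 * ip (vec_deriv z (\<lambda>y. alg (u y))) (alg (v x))"
        unfolding D_def dorfman_untw(2)[OF u v x] using z by (simp add: \<xi>_\<eta>_def X_Y_def coords_def)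
      finally have l: "cov (lmap x (dorfman UA u v x)) z' =
          (\<Sum>i<n. X (\<eta> i) * coords z i + \<eta> i x * z (\<lambda>y. coords (fst (u y)) i)) -
          (\<Sum>i<n. Y (\<xi> i) * coords z i - z (\<xi> i) * coords Y i) +
          2 * ip (vec_deriv z (\<lambda>y. alg (u y))) (alg (v x))" .
      have S1: "(\<Sum>i<n. push x X (\<lambda>y. cov (?v y) (cvec n y i)) * z' (\<lambda>y. y i) +
          cov (?v ?y) (cvec n ?y i) * z' (\<lambda>y. fst (?u y) (\<lambda>z. z i))) =
          (\<Sum>i<n. (\<Sum>j<n. G j i * X (\<eta> j)) * LF (coords z) i) +
          (\<Sum>i<n. (\<Sum>j<n. G j i * \<eta> j x) * LF (\<lambda>j. z (\<lambda>y. coords (fst (u y)) j)) i)"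
        unfolding sum.distrib[symmetric]
      proof (intro sum.cong refl)
        fix i assume "i \<in> {..<n}"
        hence i: "i < n" by simp
        have a: "z' (\<lambda>y. y i) = LF (coords z) i"
          unfolding zz using coords_push[OF i, of x z] by (simp add: coords_def)
        have b: "z' (\<lambda>y. fst (?u y) (\<lambda>z. z i)) = LF (\<lambda>j. z (\<lambda>y. coords (fst (u y)) j)) i"
          unfolding zz using push_coords[OF u x z i] by (simp add: coords_def)
        have c: "cov (?v ?y) (cvec n ?y i) = (\<Sum>j<n. G j i * \<eta> j x)"
          unfolding at by (simp add: lmap_def covec_coord[OF lin_map_Euclidean i] \<xi>_\<eta>_def)
        show "push x X (\<lambda>y. cov (?v y) (cvec n y i)) * z' (\<lambda>y. y i) +
          cov (?v ?y) (cvec n ?y i) * z' (\<lambda>y. fst (?u y) (\<lambda>z. z i)) =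
          (\<Sum>j<n. G j i * X (\<eta> j)) * LF (coords z) i +
          (\<Sum>j<n. G j i * \<eta> j x) * LF (\<lambda>j. z (\<lambda>y. coords (fst (u y)) j)) i"
          unfolding a b c push_covec[OF v x T(1) i] by (simp add: \<xi>_\<eta>_def)
      qed
      have S2: "(\<Sum>i<n. push x Y (\<lambda>y. cov (?u y) (cvec n y i)) * z' (\<lambda>y. y i) -
          z' (\<lambda>y. cov (?u y) (cvec n y i)) * push x Y (\<lambda>y. y i)) =
          (\<Sum>i<n. (\<Sum>j<n. G j i * Y (\<xi> j)) * LF (coords z) i) -
          (\<Sum>i<n. (\<Sum>j<n. G j i * z (\<xi> j)) * LF (coords Y) i)" unfolding sum_subtractf[symmetric]
      proof (intro sum.cong refl)
        fix i assume "i \<in> {..<n}"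
        hence i: "i < n" by simp
        have a: "z' (\<lambda>y. y i) = LF (coords z) i" "push x Y (\<lambda>y. y i) = LF (coords Y) i"
          unfolding zz using coords_push[OF i, of x] by (simp_all add: coords_def)
        have b: "z' (\<lambda>y. cov (?u y) (cvec n y i)) = (\<Sum>j<n. G j i * z (\<xi> j))"
          unfolding zz push_covec[OF u x z i] by (simp add: \<xi>_\<eta>_def)
        show "push x Y (\<lambda>y. cov (?u y) (cvec n y i)) * z' (\<lambda>y. y i) -
          z' (\<lambda>y. cov (?u y) (cvec n y i)) * push x Y (\<lambda>y. y i) =
          (\<Sum>j<n. G j i * Y (\<xi> j)) * LF (coords z) i - (\<Sum>j<n. G j i * z (\<xi> j)) * LF (coords Y) i"
          unfolding a b push_covec[OF u x T(2) i] by (simp add: \<xi>_\<eta>_def)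
      qed
      have V: "ip (vec_deriv z' (\<lambda>y. alg (?u y))) (alg (?v ?y)) =
          ip (vec_deriv z (\<lambda>y. alg (u y))) (alg (v x))"
        unfolding zz at push_vec[OF u x z] by (simp add: lmap_def \<phi>(3))
      show ?thesis unfolding l dorfman_untw(2)[OF su sv Fx] f S1 S2 V contraction if_P[OF z']
        by (simp add: sum.distrib sum_subtractf)
    next
      case False
      thus ?thesis unfolding dorfman_untw(2)[OF su sv Fx] by (simp add: lmap_def covec_def)
    qed
  qed
  moreover have "alg (lmap x (dorfman UA u v x)) = alg (dorfman UA ?u ?v ?y)"
  proof -
    have "alg (?u ?y) = \<phi> (alg (u x))" "alg (?v ?y) = \<phi> (alg (v x))"
      unfolding at by (simp_all add: lmap_def)
    thus ?thesis unfolding dorfman_untw(3)[OF su sv Fx] f push_vec[OF v x T(1)] push_vec[OF u x T(2)]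
      by (simp add: lmap_def dorfman_untw(3)[OF u v x] X_Y_def linear_add[OF \<phi>(1)] linear_diff[OF \<phi>(1)] \<phi>(2))
  qed
  ultimately show ?thesis by (simp add: prod_eq_iff)
qed

end

context linear_change_pair
begin

lemma local_iso_linear:
  assumes U: "opn n U"
  shows "local_iso (Rn n) U UA (Rn n) (LF ` U) UA LF LG lmap" unfolding local_iso_def
proof (intro conjI allI impI ballI; (elim conjE)?)
  have E: "x \<in> ER n" if "x \<in> U" for x using U openin_subset that by blast
  have GFV: "LG ` LF ` V = V" if "V \<subseteq> U" for V
  proof -
    have "(\<lambda>x. LG (LF x)) ` V = (\<lambda>x. x) ` V" using that E GF_point by (intro image_cong) auto
    thus ?thesis by (simp add: image_image)
  qed
  show "openin (mtop (Rn n)) U" "openin (mtop (Rn n)) (LF ` U)" using U open_image_F[OF U] by simp_all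
  show "LF ` U = LF ` U" ..
  show "LG (LF x) = x" if "x \<in> U" for x by (rule GF_point[OF E[OF that]])
  show o: "openin (mtop (Rn n)) V \<longleftrightarrow> openin (mtop (Rn n)) (LF ` V)" if "V \<subseteq> U" for V
    using open_image_F[of V] inv.open_image_F[of "LF ` V"] GFV[OF that] by auto
  show "smooth_on (Rn n) (LF ` V) h \<longleftrightarrow> smooth_on (Rn n) V (\<lambda>x. h (LF x))"
    if V: "V \<subseteq> U" "openin (mtop (Rn n)) V" for V h
  proof
    assume "smooth_on (Rn n) (LF ` V) h"
    hence h: "opn n (LF ` V)" "smooth_Rn n (LF ` V) h" by (simp_all add: smooth_on_Rn)
    show "smooth_on (Rn n) V (\<lambda>x. h (LF x))"
      using inv.smooth_G[OF h] GFV[OF V(1)] V(2) by (simp add: smooth_on_Rn)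
  next
    assume "smooth_on (Rn n) V (\<lambda>x. h (LF x))"
    hence h: "opn n V" "smooth_Rn n V (\<lambda>x. h (LF x))" by (simp_all add: smooth_on_Rn)
    have "smooth_Rn n (LF ` V) (\<lambda>y. h (LF (LG y)))" by (rule smooth_G[OF h])
    hence "smooth_Rn n (LF ` V) h" using smooth_Rn_cong[OF open_image_F[OF h(1)], of h "\<lambda>y. h (LF (LG y))"]
        FG_point openin_subset[OF open_image_F[OF h(1)]] by (simp add: subset_iff)
    thus "smooth_on (Rn n) (LF ` V) h" using open_image_F[OF h(1)] by (simp add: smooth_on_Rn)
  qed
  show "linear_over (fibre UA x) (lmap x)" for x by (rule lmap_linear)
  show "bij_betw (lmap x) (fibre UA x) (fibre UA (LF x))" if "x \<in> U" for x
  proof (rule bij_betw_byWitness[of _ "inv.lmap (LF x)"])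
    note xE = E[OF that]
    show "\<forall>a\<in>fibre UA x. inv.lmap (LF x) (lmap x a) = a" using lmap_inverse[OF xE] by blast
    show "\<forall>a\<in>fibre UA (LF x). lmap x (inv.lmap (LF x) a) = a"
    proof
      \<comment> \<open>The same locale with both pairs exchanged supplies the inverse on the other
        side.\<close>
      interpret swap: linear_change_pair Bs n br ip G F \<psi> \<phi> ..
      fix a assume "a \<in> fibre UA (LF x)"
      from swap.lmap_inverse[OF lin_map_Euclidean this] GF_point[OF xE]
      show "lmap x (inv.lmap (LF x) a) = a" by simp
    qed
    show "lmap x ` fibre UA x \<subseteq> fibre UA (LF x)" using lmap_fibre by blast
    show "inv.lmap (LF x) ` fibre UA (LF x) \<subseteq> fibre UA x"
      using inv.lmap_fibre[of "LF x"] GF_point[OF xE] by auto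
  qed
  show "anchor UA (LF x) (lmap x a) (\<lambda>y. h (LG y)) = anchor UA x a h"
    if x: "x \<in> U" and a: "a \<in> fibre UA x" for x a h
  proof -
    have T: "fst a \<in> TR n x" using a by (simp add: untw_simps mem_Times_iff)
    have "push x (fst a) (\<lambda>y. h (LG y)) = fst a (\<lambda>y. h (LG (LF y)))" by (rule push_apply[OF E[OF x] T])
    also have "... = fst a h" by (rule tder_local[OF U x T]) (simp add: GF_point E)
    finally show ?thesis by (simp add: untw_simps lmap_def)
  qed
  show "pairing UA (LF x) (lmap x a) (lmap x b) = pairing UA x a b"
    if "x \<in> U" "a \<in> fibre UA x" "b \<in> fibre UA x" for x a b
    by (rule lmap_pairing[OF E[OF that(1)] that(2,3)])
  show "u \<in> sections UA V \<longleftrightarrow> (\<lambda>y. lmap (LG y) (u (LG y))) \<in> sections UA (LF ` V)"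
    if V: "V \<subseteq> U" "openin (mtop (Rn n)) V" "\<forall>x\<in>V. u x \<in> fibre UA x" for V u
  proof
    assume "(\<lambda>y. lmap (LG y) (u (LG y))) \<in> sections UA (LF ` V)"
    from inv.lmap_sections[OF this] GFV[OF V(1)]
    have s: "(\<lambda>x. inv.lmap (LF x) (lmap (LG (LF x)) (u (LG (LF x))))) \<in> sections UA V" by simp
    show "u \<in> sections UA V"
    proof (rule tame_onD(2)[OF tame_untw _ V(2) s])
      show "V \<subseteq> ER n" using V(1) E by blast
      fix x assume "x \<in> V"
      hence "x \<in> ER n" "u x \<in> fibre UA x" using V E by auto
      thus "u x = inv.lmap (LF x) (lmap (LG (LF x)) (u (LG (LF x))))" using lmap_inverse GF_point by simp
    qed
  qed (rule lmap_sections)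
  show "lmap x (dorfman UA u v x) = dorfman UA
    (\<lambda>y. lmap (LG y) (u (LG y))) (\<lambda>y. lmap (LG y) (v (LG y))) (LF x)"
    if "u \<in> sections UA V" "v \<in> sections UA V" "x \<in> V" for V u v x by (rule lmap_dorfman[OF that])
qed

end

section \<open>The flow of commuting semisimple elements\<close>

lemma cscale_simps [simp]:
  "fst (cscale c u) = Re c *\<^sub>R fst u - Im c *\<^sub>R snd u"
  "snd (cscale c u) = Re c *\<^sub>R snd u + Im c *\<^sub>R fst u" by (simp_all add: cscale_def)

lemma conj_vec_simps [simp]: "fst (conj_vec u) = fst u" "snd (conj_vec u) = - snd u"
  by (simp_all add: conj_vec_def)

lemma conj_vec_conj [simp]: "conj_vec (conj_vec u) = u" by (simp add: prod_eq_iff)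

lemma conj_vec_add: "conj_vec (u + v) = conj_vec u + conj_vec v" by (simp add: prod_eq_iff)

lemma conj_vec_cscale: "conj_vec (cscale c u) = cscale (cnj c) (conj_vec u)"
  by (simp add: prod_eq_iff algebra_simps)

lemma csubspace_conj:
  assumes "csubspace S"
  shows "csubspace {u. conj_vec u \<in> S}" unfolding cplx.subspace_def
  using assms cplx.subspace_0[OF assms] cplx.subspace_add[OF assms] cplx.subspace_scale[OF assms]
  by (simp add: conj_vec_add conj_vec_cscale) (simp add: conj_vec_def zero_prod_def)

lemma csubspace_pair:
  assumes S: "csubspace S" and u: "(a, b) \<in> S"
  shows "(- b, a) \<in> S" "(- a, - b) \<in> S" "(b, - a) \<in> S"
proof -
  have "cscale \<i> (a, b) \<in> S" "cscale (-1) (a, b) \<in> S" "cscale (- \<i>) (a, b) \<in> S"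
    using cplx.subspace_scale[OF S u] by blast+
  thus "(- b, a) \<in> S" "(- a, - b) \<in> S" "(b, - a) \<in> S" by (simp_all add: cscale_def)
qed

lemma csubspace_real: "csubspace S \<Longrightarrow> subspace S"
proof (rule subspaceI)
  assume S: "csubspace S"
  show "0 \<in> S" by (rule cplx.subspace_0[OF S])
  show "x + y \<in> S" if "x \<in> S" "y \<in> S" for x y by (rule cplx.subspace_add[OF S that])
  show "c *\<^sub>R x \<in> S" if "x \<in> S" for c x
  proof -
    have "cscale (of_real c) x = c *\<^sub>R x" by (simp add: prod_eq_iff)
    thus ?thesis using cplx.subspace_scale[OF S that, of "of_real c"] by simp
  qed
qed

lemma cspan_induct_zero:
  assumes "u \<in> cspan Z" "\<And>z. z \<in> Z \<Longrightarrow> f z = 0" "\<And>a b. f (a + b) = f a + f b"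
    "\<And>c a. f (cscale c a) = c * f a"
  shows "f u = (0 :: complex)"
proof -
  have "csubspace {u. f u = 0}" unfolding cplx.subspace_def using assms(3,4) assms(4)[of 0 0] by simp
  hence "cspan Z \<subseteq> {u. f u = 0}" by (intro cplx.span_minimal) (use assms(2) in auto)
  thus ?thesis using assms(1) by blast
qed

text \<open>The form is only asked to be invariant, so that one calculus serves both the indefinite
  \<open>ip\<close> and the definite \<open>Kf\<close>.\<close>

locale lie_form =
  fixes br :: "'g::real_vector \<Rightarrow> 'g \<Rightarrow> 'g" and ip :: "'g \<Rightarrow> 'g \<Rightarrow> real"
  assumes br_bil: "bilinear br" and br_self: "br a a = 0"
    and jacobi: "br a (br b c) = br (br a b) c + br b (br a c)"
    and ip_inv: "invariant_form br ip"
begin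

lemma ip_bil: "bilinear ip" using ip_inv unfolding invariant_form_def by blast

lemma ip_sym: "ip a b = ip b a" using ip_inv unfolding invariant_form_def by blast

lemma ip_br: "ip (br a b) c = - ip b (br a c)"
proof -
  have "ip (br a b) c + ip b (br a c) = 0" using ip_inv unfolding invariant_form_def by blast
  thus ?thesis by linarith
qed

lemma br_antisym: "br a b = - br b a"
proof -
  have "0 = br (a + b) (a + b)" by (rule br_self[symmetric])
  also have "... = br a b + br b a"
    unfolding bilinear_ladd[OF br_bil] bilinear_radd[OF br_bil] by (simp add: br_self add.commute)
  finally have "br a b + br b a = 0" by (rule sym)
  thus ?thesis by (rule eq_neg_iff_add_eq_0[THEN iffD2])
qed

lemmas br_simps = bilinear_ladd[OF br_bil] bilinear_radd[OF br_bil] bilinear_lmul[OF br_bil] bilinear_rmul[OF br_bil]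
  bilinear_lneg[OF br_bil] bilinear_rneg[OF br_bil] bilinear_lsub[OF br_bil] bilinear_rsub[OF br_bil]
  bilinear_lzero[OF br_bil] bilinear_rzero[OF br_bil]

lemmas ip_simps = bilinear_ladd[OF ip_bil] bilinear_radd[OF ip_bil] bilinear_lmul[OF ip_bil] bilinear_rmul[OF ip_bil]
  bilinear_lneg[OF ip_bil] bilinear_rneg[OF ip_bil] bilinear_lsub[OF ip_bil] bilinear_rsub[OF ip_bil]
  bilinear_lzero[OF ip_bil] bilinear_rzero[OF ip_bil]

lemma cbr_add: "cbracket br (u + v) w = cbracket br u w + cbracket br v w"
    "cbracket br w (u + v) = cbracket br w u + cbracket br w v"
  by (simp_all add: cbracket_def prod_eq_iff br_simps)

lemma cbr_scale: "cbracket br (cscale c u) w = cscale c (cbracket br u w)"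
    "cbracket br w (cscale c u) = cscale c (cbracket br w u)"
  by (simp_all add: cbracket_def prod_eq_iff br_simps algebra_simps)

lemma cbr_antisym: "cbracket br u v = - cbracket br v u"
  using br_antisym[of "fst u" "fst v"] br_antisym[of "snd u" "snd v"] br_antisym[of "fst u" "snd v"]
    br_antisym[of "snd u" "fst v"] by (simp add: cbracket_def prod_eq_iff)

lemma cbr_jacobi:
  "cbracket br u (cbracket br v w) = cbracket br (cbracket br u v) w + cbracket br v (cbracket br u w)"
  using jacobi[of "fst u" "fst v" "fst w"] jacobi[of "fst u" "snd v" "snd w"] jacobi[of "snd u" "fst v" "snd w"]
    jacobi[of "snd u" "snd v" "fst w"] jacobi[of "fst u" "fst v" "snd w"] jacobi[of "fst u" "snd v" "fst w"]
    jacobi[of "snd u" "fst v" "fst w"] jacobi[of "snd u" "snd v" "snd w"]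
  by (simp add: cbracket_def prod_eq_iff br_simps algebra_simps)

lemma cbr_conj: "cbracket br (conj_vec u) (conj_vec v) = conj_vec (cbracket br u v)"
  by (simp add: cbracket_def prod_eq_iff br_simps)

lemma cip_add: "cform ip (u + v) w = cform ip u w + cform ip v w"
    "cform ip w (u + v) = cform ip w u + cform ip w v" by (simp_all add: cform_def complex_eq_iff ip_simps)

lemma cip_scale: "cform ip (cscale c u) w = c * cform ip u w"
    "cform ip w (cscale c u) = c * cform ip w u"
  by (simp_all add: cform_def complex_eq_iff ip_simps algebra_simps)

lemma cip_minus: "cform ip (- u) w = - cform ip u w" "cform ip w (- u) = - cform ip w u"
  by (simp_all add: cform_def complex_eq_iff ip_simps)

lemma cip_sym: "cform ip u v = cform ip v u"
  using ip_sym[of "fst u" "fst v"] ip_sym[of "snd u" "snd v"] ip_sym[of "fst u" "snd v"] ip_sym[of "snd u" "fst v"]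
  by (simp add: cform_def complex_eq_iff)

lemma cip_br: "cform ip (cbracket br u v) w = - cform ip v (cbracket br u w)"
  by (simp add: cform_def cbracket_def complex_eq_iff ip_simps ip_br)

lemma cip_conj: "cform ip (conj_vec u) (conj_vec v) = cnj (cform ip u v)"
  by (simp add: cform_def complex_eq_iff ip_simps)

end

text \<open>The adjoint action of commuting semisimple elements \<open>w j\<close> is exponentiated on a basis of
  common eigenvectors; \<open>K v\<close> is \<open>exp(- ad(\<Sum> v j w j))\<close>.\<close>

locale weight_flow = lie_form br ip + finite_basis Bs
  for br :: "'g::real_vector \<Rightarrow> 'g \<Rightarrow> 'g" and ip and Bs :: "'g set" +
  fixes n :: nat and w :: "nat \<Rightarrow> 'g" and Z :: "('g \<times> 'g) set"
  assumes Zspan: "cspan Z = UNIV"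
    and Zweight: "\<And>z. z \<in> Z \<Longrightarrow> \<exists>l. \<forall>j<n. cbracket br (w j, 0) z = cscale (l j) z"
    and w_comm: "\<And>i j. br (w i) (w j) = 0"
begin

definition weight :: "(nat \<Rightarrow> complex) \<Rightarrow> 'g \<times> 'g \<Rightarrow> bool"
  where "weight l z \<longleftrightarrow> (\<forall>j<n. cbracket br (w j, 0) z = cscale (l j) z)"

text \<open>The weight vectors in \<open>Z\<close> span but may be dependent; the exponential is
  defined on a basis chosen among them.\<close>

definition Bz :: "('g \<times> 'g) set"
  where "Bz = (SOME B. B \<subseteq> Z \<and> cplx.independent B \<and> cspan B = UNIV)"

lemma Bz: "Bz \<subseteq> Z" "cplx.independent Bz" "cspan Bz = UNIV"
proof -
  obtain B where B: "B \<subseteq> Z" "cplx.independent B" "Z \<subseteq> cspan B"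
    using cplx.maximal_independent_subset by blast
  have "cspan B = UNIV" using cplx.span_mono[OF B(3)] Zspan by (auto simp: cplx.span_span)
  hence "\<exists>B. B \<subseteq> Z \<and> cplx.independent B \<and> cspan B = UNIV" using B by blast
  from someI_ex[OF this] show "Bz \<subseteq> Z" "cplx.independent Bz" "cspan Bz = UNIV" unfolding Bz_def by blast+
qed

lemma finite_Bz: "finite Bz"
proof -
  let ?S = "(\<lambda>b. (b, 0 :: 'g)) ` Bs"
  have "(a, 0) \<in> cspan ?S" for a
  proof -
    have "(a, 0) = (\<Sum>b\<in>Bs. cscale (of_real (representation Bs a b)) (b, 0))"
      using sum_representation_Bs[of a] by (simp add: prod_eq_iff fst_sum snd_sum)
    also have "... \<in> cspan ?S" by (intro cplx.span_sum cplx.span_scale cplx.span_base) auto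
    finally show ?thesis .
  qed
  hence "u \<in> cspan ?S" for u
  proof -
    have "u = (fst u, 0) + cscale \<i> (snd u, 0)" by (simp add: prod_eq_iff)
    thus ?thesis using \<open>\<And>a. (a, 0) \<in> cspan ?S\<close> cplx.span_add cplx.span_scale by metis
  qed
  thus ?thesis
    using cplx.independent_span_bound[OF finite_imageI[OF basis(1)] Bz(2), of "\<lambda>b. (b, 0)"] by blast
qed

abbreviation "crep \<equiv> cplx.representation Bz"

lemma crep_sum: "(\<Sum>b\<in>Bz. cscale (crep u b) b) = u"
  by (rule cplx.sum_representation_eq[OF Bz(2)]) (simp_all add: Bz finite_Bz)

lemma crep_add: "crep (u + v) b = crep u b + crep v b" by (simp add: cplx.representation_add Bz)

lemma crep_scale: "crep (cscale c u) b = c * crep u b" by (simp add: cplx.representation_scale Bz)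

text \<open>Weights are pinned down only at indices below \<open>n\<close>; \<open>ex\<close> reads
  no others.\<close>

definition lam :: "'g \<times> 'g \<Rightarrow> nat \<Rightarrow> complex"
  where "lam z = (SOME l. weight l z)"

lemma weight_lam: "b \<in> Bz \<Longrightarrow> weight (lam b) b"
proof -
  assume "b \<in> Bz"
  hence "\<exists>l. weight l b" unfolding weight_def using Zweight Bz(1) by blast
  thus ?thesis unfolding lam_def by (rule someI_ex)
qed

definition ex :: "(nat \<Rightarrow> real) \<Rightarrow> (nat \<Rightarrow> complex) \<Rightarrow> complex"
  where "ex v l = exp (\<Sum>j<n. of_real (v j) * - l j)"

lemma ex_add: "ex v (\<lambda>j. l j + m j) = ex v l * ex v m"
  by (simp add: ex_def exp_add[symmetric] sum.distrib[symmetric] algebra_simps)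

lemma ex_zero: "ex v (\<lambda>j. 0) = 1" by (simp add: ex_def)

lemma ex_cnj: "ex v (\<lambda>j. cnj (l j)) = cnj (ex v l)" by (simp add: ex_def exp_cnj cnj_sum)

lemma ex_cong: "(\<And>j. j < n \<Longrightarrow> l j = m j) \<Longrightarrow> ex v l = ex v m"
  unfolding ex_def by (intro arg_cong[where f = exp] sum.cong) auto

lemma ex_neg: "ex (\<lambda>j. - v j) l * ex v l = 1"
  by (simp add: ex_def exp_add[symmetric] sum.distrib[symmetric])

text \<open>The eigenvectors are complex, so the exponential is built on the complexification and
  shown to preserve the real form afterwards.\<close>

definition Ex :: "(nat \<Rightarrow> real) \<Rightarrow> 'g \<times> 'g \<Rightarrow> 'g \<times> 'g"
  where "Ex v u = (\<Sum>b\<in>Bz. cscale (crep u b * ex v (lam b)) b)"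

lemma Ex_add: "Ex v (u + u') = Ex v u + Ex v u'"
  by (simp add: Ex_def crep_add distrib_right cplx.scale_left_distrib sum.distrib)

lemma Ex_scale: "Ex v (cscale c u) = cscale c (Ex v u)"
  by (simp add: Ex_def crep_scale mult.assoc cplx.scale_scale[symmetric] cplx.scale_sum_right del: cplx.scale_scale)

lemma Ex_zero: "Ex v 0 = 0" using Ex_scale[of v 0 0] by simp

lemma Ex_sum: "Ex v (\<Sum>i\<in>I. f i) = (\<Sum>i\<in>I. Ex v (f i))"
  by (induction I rule: infinite_finite_induct) (simp_all add: Ex_add Ex_zero)

lemma cbr_sum: "cbracket br u (\<Sum>i\<in>I. f i) = (\<Sum>i\<in>I. cbracket br u (f i))"
  "cbracket br (\<Sum>i\<in>I. f i) u = (\<Sum>i\<in>I. cbracket br (f i) u)"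
proof -
  have "cbracket br u 0 = 0" "cbracket br 0 u = 0" by (simp_all add: cbracket_def br_simps zero_prod_def)
  thus "cbracket br u (\<Sum>i\<in>I. f i) = (\<Sum>i\<in>I. cbracket br u (f i))"
    "cbracket br (\<Sum>i\<in>I. f i) u = (\<Sum>i\<in>I. cbracket br (f i) u)"
    by (induction I rule: infinite_finite_induct) (simp_all add: cbr_add)
qed

lemma cip_sum: "cform ip u (\<Sum>i\<in>I. f i) = (\<Sum>i\<in>I. cform ip u (f i))"
  "cform ip (\<Sum>i\<in>I. f i) u = (\<Sum>i\<in>I. cform ip (f i) u)"
proof -
  have "cform ip u 0 = 0" "cform ip 0 u = 0" by (simp_all add: cform_def ip_simps complex_eq_iff)
  thus "cform ip u (\<Sum>i\<in>I. f i) = (\<Sum>i\<in>I. cform ip u (f i))"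
    "cform ip (\<Sum>i\<in>I. f i) u = (\<Sum>i\<in>I. cform ip (f i) u)"
    by (induction I rule: infinite_finite_induct) (simp_all add: cip_add)
qed

text \<open>Comparing coefficients in the bracket of \<open>w j\<close> with \<open>z\<close> shows
  that only basis vectors with the weights of \<open>z\<close> occur in \<open>z\<close>. Hence the
  exponential does not depend on the chosen basis.\<close>

lemma Ex_weight:
  assumes z: "weight l z"
  shows "Ex v z = cscale (ex v l) z"
proof -
  have eq: "crep z b * ex v (lam b) = ex v l * crep z b" if b: "b \<in> Bz" for b
  proof (cases "crep z b = 0")
    case False
    have "lam b j = l j" if j: "j < n" for j
    proof -
      have "cscale (l j) z = cbracket br (w j, 0) (\<Sum>b\<in>Bz. cscale (crep z b) b)"
        using z j by (simp add: weight_def crep_sum)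
      also have "... = (\<Sum>b\<in>Bz. cscale (crep z b * lam b j) b)" unfolding cbr_sum cbr_scale
        by (intro sum.cong refl) (use weight_lam j in \<open>simp add: weight_def\<close>)
      finally have "crep (cscale (l j) z) b = crep (\<Sum>b\<in>Bz. cscale (crep z b * lam b j) b) b" by simp
      also have "... = (\<Sum>c\<in>Bz. crep z c * lam c j * crep c b)"
      proof -
        have "crep (\<Sum>i\<in>I. f i) b = (\<Sum>i\<in>I. crep (f i) b)" if "finite I" for I and f :: "'g \<times> 'g \<Rightarrow> 'g \<times> 'g"
          using that by induction (simp_all add: crep_add cplx.representation_zero)
        thus ?thesis using finite_Bz by (simp add: crep_scale)
      qed
      also have "... = (\<Sum>c\<in>Bz. if c = b then crep z c * lam c j else 0)"
        by (intro sum.cong refl) (simp add: cplx.representation_basis[OF Bz(2)])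
      also have "... = crep z b * lam b j" using b finite_Bz by simp
      finally show ?thesis using False by (simp add: crep_scale)
    qed
    hence "ex v (lam b) = ex v l" by (rule ex_cong)
    thus ?thesis by simp
  qed simp
  have "Ex v z = (\<Sum>b\<in>Bz. cscale (ex v l * crep z b) b)"
    unfolding Ex_def by (intro sum.cong refl arg_cong2[where f = cscale] eq)
  also have "... = cscale (ex v l) (\<Sum>b\<in>Bz. cscale (crep z b) b)" by (simp add: cplx.scale_sum_right)
  finally show ?thesis by (simp add: crep_sum)
qed

lemma Ex_basis: "b \<in> Bz \<Longrightarrow> Ex v b = cscale (ex v (lam b)) b" by (rule Ex_weight[OF weight_lam])

lemma weight_bracket:
  assumes "weight l x" "weight m y"
  shows "weight (\<lambda>j. l j + m j) (cbracket br x y)"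
  using assms by (simp add: weight_def cbr_jacobi cbr_scale cplx.scale_left_distrib)

lemma weight_conj:
  assumes "weight l x"
  shows "weight (\<lambda>j. cnj (l j)) (conj_vec x)"
proof -
  have "cbracket br (w j, 0) (conj_vec x) = conj_vec (cbracket br (w j, 0) x)" for j
    using cbr_conj[of "(w j, 0)" x] by (simp add: conj_vec_def)
  thus ?thesis using assms by (simp add: weight_def conj_vec_cscale)
qed

text \<open>Weights add under the bracket by the Jacobi identity, and exponentials of sums
  multiply.\<close>

lemma Ex_bracket: "Ex v (cbracket br x y) = cbracket br (Ex v x) (Ex v y)"
proof -
  have b: "Ex v (cbracket br b c) = cbracket br (Ex v b) (Ex v c)" if "b \<in> Bz" "c \<in> Bz" for b c
    using Ex_weight[OF weight_bracket[OF weight_lam[OF that(1)] weight_lam[OF that(2)]]]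
    by (simp add: Ex_basis that ex_add cbr_scale mult.commute)
  have "cbracket br x y = cbracket br (\<Sum>b\<in>Bz. cscale (crep x b) b) (\<Sum>c\<in>Bz. cscale (crep y c) c)"
    by (simp only: crep_sum)
  also have "... = (\<Sum>b\<in>Bz. \<Sum>c\<in>Bz. cscale (crep x b) (cscale (crep y c) (cbracket br b c)))"
    unfolding cbr_sum(2) by (intro sum.cong refl) (simp only: cbr_sum(1) cbr_scale cplx.scale_sum_right,
      intro sum.cong refl cplx.scale_left_commute)
  finally have "Ex v (cbracket br x y) =
      (\<Sum>b\<in>Bz. \<Sum>c\<in>Bz. cscale (crep x b) (cscale (crep y c) (cbracket br (Ex v b) (Ex v c))))"
    by (simp only: Ex_sum Ex_scale) (intro sum.cong refl, simp only: b)
  also have "... = cbracket br (\<Sum>b\<in>Bz. cscale (crep x b) (Ex v b)) (\<Sum>c\<in>Bz. cscale (crep y c) (Ex v c))"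
    unfolding cbr_sum(2) by (intro sum.cong refl) (simp only: cbr_sum(1) cbr_scale cplx.scale_sum_right,
      intro sum.cong refl cplx.scale_left_commute)
  also have "... = cbracket br (Ex v (\<Sum>b\<in>Bz. cscale (crep x b) b)) (Ex v (\<Sum>c\<in>Bz. cscale (crep y c) c))"
    by (simp only: Ex_sum Ex_scale)
  finally show ?thesis by (simp only: crep_sum)
qed

text \<open>By invariance of \<open>ip\<close>, two weight vectors pair nontrivially only if their
  weights cancel, and then the two exponential factors cancel as well.\<close>

lemma Ex_ip: "cform ip (Ex v x) (Ex v y) = cform ip x y"
proof -
  have b: "cform ip (Ex v b) (Ex v c) = cform ip b c" if bc: "b \<in> Bz" "c \<in> Bz" for b c
  proof (cases "cform ip b c = 0")
    case True
    thus ?thesis by (simp add: Ex_basis bc cip_scale)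
  next
    case False
    have "lam b j + lam c j = 0" if j: "j < n" for j
    proof -
      have "lam b j * cform ip b c = - (lam c j * cform ip b c)"
        using cip_br[of "(w j, 0)" b c] weight_lam[OF bc(1)] weight_lam[OF bc(2)] j
        by (simp add: weight_def cip_scale)
      hence "(lam b j + lam c j) * cform ip b c = 0" by (simp add: distrib_right)
      thus ?thesis using False by simp
    qed
    hence "ex v (\<lambda>j. lam b j + lam c j) = ex v (\<lambda>j. 0)" by (rule ex_cong)
    hence "ex v (lam b) * ex v (lam c) = 1" by (simp add: ex_add ex_zero)
    hence "ex v (lam b) * (ex v (lam c) * cform ip b c) = cform ip b c"
      by (simp only: mult.assoc[symmetric] mult_1)
    thus ?thesis by (simp only: Ex_basis bc cip_scale mult.left_commute)
  qed
  have "cform ip x y = cform ip (\<Sum>b\<in>Bz. cscale (crep x b) b) (\<Sum>c\<in>Bz. cscale (crep y c) c)"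
    by (simp add: crep_sum)
  also have "... = cform ip (\<Sum>b\<in>Bz. cscale (crep x b) (Ex v b)) (\<Sum>c\<in>Bz. cscale (crep y c) (Ex v c))"
    unfolding cip_sum(2) by (intro sum.cong refl) (simp add: cip_sum(1) cip_scale b)
  also have "... = cform ip (Ex v (\<Sum>b\<in>Bz. cscale (crep x b) b)) (Ex v (\<Sum>c\<in>Bz. cscale (crep y c) c))"
    by (simp only: Ex_sum Ex_scale)
  finally show ?thesis by (simp add: crep_sum)
qed

text \<open>The \<open>w j\<close> are real, so conjugating a weight vector conjugates its weights
  and therefore its exponential factor.\<close>

lemma Ex_conj: "Ex v (conj_vec x) = conj_vec (Ex v x)"
proof -
  have conj_sum: "conj_vec (\<Sum>i\<in>I. f i) = (\<Sum>i\<in>I. conj_vec (f i))" for I and f :: "'g \<times> 'g \<Rightarrow> 'g \<times> 'g"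
    by (induction I rule: infinite_finite_induct) (simp_all add: conj_vec_add, simp_all add: conj_vec_def zero_prod_def)
  have b: "Ex v (conj_vec b) = conj_vec (Ex v b)" if "b \<in> Bz" for b
    using Ex_weight[OF weight_conj[OF weight_lam[OF that]]] by (simp add: Ex_basis that ex_cnj conj_vec_cscale)
  have "Ex v (conj_vec (\<Sum>b\<in>Bz. cscale (crep x b) b)) = conj_vec (Ex v (\<Sum>b\<in>Bz. cscale (crep x b) b))"
    by (simp add: conj_sum conj_vec_cscale Ex_sum Ex_scale b)
  thus ?thesis by (simp add: crep_sum)
qed

lemma Ex_neg: "Ex (\<lambda>j. - v j) (Ex v x) = x"
proof -
  have "Ex (\<lambda>j. - v j) (Ex v x) = Ex (\<lambda>j. - v j) (\<Sum>b\<in>Bz. cscale (crep x b * ex v (lam b)) b)"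
    by (simp add: Ex_def[of v])
  also have "... = (\<Sum>b\<in>Bz. cscale (crep x b) b)" unfolding Ex_sum Ex_scale
    using ex_neg[of v] by (intro sum.cong refl) (simp add: Ex_basis mult.assoc mult.commute[of "ex v _"])
  finally show ?thesis by (simp add: crep_sum)
qed

definition K :: "(nat \<Rightarrow> real) \<Rightarrow> 'g \<Rightarrow> 'g"
  where "K v a = fst (Ex v (a, 0))"

lemma Ex_real: "Ex v (a, 0) = (K v a, 0)"
proof -
  have "snd (Ex v (a, 0)) = - snd (Ex v (a, 0))"
    using arg_cong[OF Ex_conj[of v "(a, 0)"], of snd] by (simp add: conj_vec_def)
  hence "snd (Ex v (a, 0)) = 0" by (metis scaleR_half_double scaleR_zero_right add.right_inverse)
  thus ?thesis by (simp add: K_def prod_eq_iff)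
qed

lemma Ex_K: "Ex v (a, b) = (K v a, K v b)"
proof -
  have "Ex v (a, b) = Ex v ((a, 0) + cscale \<i> (b, 0))" by (simp add: cscale_def)
  also have "... = (K v a, K v b)" by (simp only: Ex_add Ex_scale Ex_real) (simp add: cscale_def)
  finally show ?thesis .
qed

lemma K_linear: "linear (K v)"
proof (rule linearI)
  show "K v (a + b) = K v a + K v b" for a b
    using arg_cong[OF Ex_add[of v "(a, 0)" "(b, 0)"], of fst] by (simp add: K_def)
  show "K v (c *\<^sub>R a) = c *\<^sub>R K v a" for c a
    using arg_cong[OF Ex_scale[of v "of_real c" "(a, 0)"], of fst] by (simp add: K_def cscale_def)
qed

lemma K_bracket: "K v (br a b) = br (K v a) (K v b)"
  using arg_cong[OF Ex_bracket[of v "(a, 0)" "(b, 0)"], of fst] by (simp add: Ex_real cbracket_def br_simps)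

lemma K_ip: "ip (K v a) (K v b) = ip a b"
  using arg_cong[OF Ex_ip[of v "(a, 0)" "(b, 0)"], of Re] by (simp add: Ex_real cform_def ip_simps)

lemma K_neg: "K (\<lambda>j. - v j) (K v a) = a"
  using arg_cong[OF Ex_neg[of v "(a, 0)"], of fst] by (simp add: Ex_real)

lemma K_fixed:
  assumes "\<And>j. j < n \<Longrightarrow> br (w j) a = 0"
  shows "K v a = a"
proof -
  have "weight (\<lambda>j. 0) (a, 0)" using assms by (simp add: weight_def cbracket_def br_simps zero_prod_def)
  from Ex_weight[OF this, of v] show ?thesis by (simp add: K_def ex_zero)
qed

lemma K_expand:
  assumes l: "linear (l :: 'g \<Rightarrow> real)"
  shows "l (fst (\<Sum>b\<in>Bz. cscale (c b) b)) = (\<Sum>b\<in>Bz. Re (c b * Complex (l (fst b)) (l (snd b))))"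
  by (simp add: fst_sum linear_sum[OF l] linear_diff[OF l] linear_scale[OF l])

text \<open>The factor \<open>s\<close> will be 1 for the flow and -1 for its inverse, so that one
  computation serves both.\<close>

lemma K_smooth:
  assumes l: "linear (l :: 'g \<Rightarrow> real)"
  shows "smooth_Rn n (ER n) (\<lambda>v. l (K (\<lambda>j. s * v j) a))"
    "i < n \<Longrightarrow> partial_deriv i (\<lambda>v. l (K (\<lambda>j. s * v j) a)) v = - s * l (br (w i) (K (\<lambda>j. s * v j) a))"
proof -
  let ?E = "ER n"
  let ?c = "\<lambda>b. crep (a, 0) b * Complex (l (fst b)) (l (snd b))"
  let ?m = "\<lambda>b j. - (of_real s * lam b j)"
  let ?f = "\<lambda>b v. Re (?c b * exp (\<Sum>j<n. of_real (v j) * ?m b j))"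
  have ex: "ex (\<lambda>j. s * v j) (lam b) = exp (\<Sum>j<n. of_real (v j) * ?m b j)" for v b
    unfolding ex_def by (intro arg_cong[where f = exp] sum.cong refl) (simp add: mult_ac)
  have e: "(\<lambda>v. l (K (\<lambda>j. s * v j) a)) = (\<lambda>v. \<Sum>b\<in>Bz. ?f b v)" unfolding K_def Ex_def K_expand[OF l] ex
    by (intro ext sum.cong refl arg_cong[where f = Re]) (simp only: mult_ac)
  show "smooth_Rn n ?E (\<lambda>v. l (K (\<lambda>j. s * v j) a))"
    unfolding e by (intro smooth_Rn_sum[OF openin_Euclidean] smooth_Rn_exp[OF openin_Euclidean])
  show "partial_deriv i (\<lambda>v. l (K (\<lambda>j. s * v j) a)) v = - s * l (br (w i) (K (\<lambda>j. s * v j) a))" if i: "i < n"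
  proof -
    let ?v = "\<lambda>j. s * v j"
    \<comment> \<open>Derivative and differentiability go through the induction together, since the
      sum rule asks for the latter.\<close>
    have pd: "partial_deriv i (\<lambda>v. \<Sum>b\<in>B. ?f b v) v =
        (\<Sum>b\<in>B. Re (?c b * ?m b i * exp (\<Sum>j<n. of_real (v j) * ?m b j))) \<and>
        partially_differentiable i (\<lambda>v. \<Sum>b\<in>B. ?f b v) v" if "finite B" for B using that
    proof induction
      case empty
      show ?case by (simp add: partial_deriv_const)
    next
      case (insert b B)
      show ?case using insert partial_deriv_rules(1,2)[OF partial_deriv_exp(2)[OF i, of "?c b" "?m b" v]
            insert.IH[THEN conjunct2]] partial_deriv_exp(1)[OF i, of "?c b" "?m b" v] by simp
    qed
    have "Ex ?v (a, 0) = (\<Sum>b\<in>Bz. cscale (crep (a, 0) b * ex ?v (lam b)) b)" by (simp add: Ex_def)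
    hence "cbracket br (w i, 0) (Ex ?v (a, 0)) = (\<Sum>b\<in>Bz. cscale (crep (a, 0) b * ex ?v (lam b) * lam b i) b)"
      unfolding cbr_sum using weight_lam i by (simp add: cbr_sum cbr_scale weight_def)
    moreover have "br (w i) (K ?v a) = fst (cbracket br (w i, 0) (Ex ?v (a, 0)))"
      by (simp add: Ex_real cbracket_def br_simps)
    ultimately have "l (br (w i) (K ?v a)) = l (fst (\<Sum>b\<in>Bz. cscale (crep (a, 0) b * ex ?v (lam b) * lam b i) b))"
      by (simp only:)
    also have "... = (\<Sum>b\<in>Bz. Re (crep (a, 0) b * ex ?v (lam b) * lam b i * Complex (l (fst b)) (l (snd b))))"
      by (rule K_expand[OF l])
    finally have "- s * l (br (w i) (K ?v a)) =
        (\<Sum>b\<in>Bz. - s * Re (crep (a, 0) b * ex ?v (lam b) * lam b i * Complex (l (fst b)) (l (snd b))))"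
      by (simp only: sum_distrib_left)
    also have "... = (\<Sum>b\<in>Bz. Re (?c b * ?m b i * exp (\<Sum>j<n. of_real (v j) * ?m b j)))"
    proof (intro sum.cong refl)
      fix b
      have "- s * Re x = Re (of_real (- s) * x)" for x by simp
      hence "- s * Re (crep (a, 0) b * ex ?v (lam b) * lam b i * Complex (l (fst b)) (l (snd b))) =
          Re (of_real (- s) * (crep (a, 0) b * ex ?v (lam b) * lam b i * Complex (l (fst b)) (l (snd b))))"
        by (simp only:)
      also have "... = Re (?c b * ?m b i * exp (\<Sum>j<n. of_real (v j) * ?m b j))"
        unfolding ex by (rule arg_cong[where f = Re]) (simp only: mult_ac of_real_minus mult_minus_left mult_minus_right)
      finally show "- s * Re (crep (a, 0) b * ex ?v (lam b) * lam b i * Complex (l (fst b)) (l (snd b))) =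
          Re (?c b * ?m b i * exp (\<Sum>j<n. of_real (v j) * ?m b j))" .
    qed
    finally show ?thesis unfolding e using pd[OF finite_Bz] by linarith
  qed
qed

text \<open>Weight vectors are eigenvectors of the exponential, so whatever they span is
  preserved.\<close>

lemma Ex_stable:
  assumes D: "csubspace D" "D = cspan S" and S: "\<And>z. z \<in> S \<Longrightarrow> \<exists>l. weight l z" and u: "u \<in> D"
  shows "Ex v u \<in> D"
proof -
  have "csubspace {u. Ex v u \<in> D}" unfolding cplx.subspace_def
    using cplx.subspace_0[OF D(1)] cplx.subspace_add[OF D(1)] cplx.subspace_scale[OF D(1)]
    by (simp add: Ex_zero Ex_add Ex_scale)
  moreover have "S \<subseteq> {u. Ex v u \<in> D}"
  proof
    fix z assume z: "z \<in> S"
    then obtain l where "weight l z" using S by blast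
    hence "Ex v z = cscale (ex v l) z" by (rule Ex_weight)
    moreover have "z \<in> D" using z D(2) cplx.span_base by blast
    ultimately show "z \<in> {u. Ex v u \<in> D}" using cplx.subspace_scale[OF D(1)] by simp
  qed
  ultimately have "cspan S \<subseteq> {u. Ex v u \<in> D}" by (rule cplx.span_minimal[rotated])
  thus ?thesis using u D(2) by blast
qed

end

section \<open>The Lie algebra data of a normal form\<close>

lemma independent_dual_functionals:
  fixes a :: "'i \<Rightarrow> 'g::real_vector"
  assumes I: "finite I" and l: "\<And>i. i \<in> I \<Longrightarrow> linear (l i :: 'g \<Rightarrow> real)"
    and d: "\<And>i j. i \<in> I \<Longrightarrow> j \<in> I \<Longrightarrow> l i (a j) = (if i = j then 1 else 0)"
  shows "inj_on a I" "independent (a ` I)"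
proof -
  show inj: "inj_on a I" using d by (intro inj_onI) (metis zero_neq_one)
  show "independent (a ` I)"
  proof (rule independent_if_scalars_zero)
    fix f x assume f: "(\<Sum>x\<in>a ` I. f x *\<^sub>R x) = 0" and "x \<in> a ` I"
    then obtain j where j: "j \<in> I" "x = a j" by blast
    have "0 = l j (\<Sum>k\<in>I. f (a k) *\<^sub>R a k)" using f inj linear_0[OF l[OF j(1)]] by (simp add: sum.reindex)
    also have "... = (\<Sum>k\<in>I. f (a k) * l j (a k))"
      by (simp only: linear_sum[OF l[OF j(1)]] linear_scale[OF l[OF j(1)]] real_scaleR_def)
    also have "... = (\<Sum>k\<in>I. if k = j then f (a k) else 0)" by (intro sum.cong refl) (use d j in auto)
    also have "... = f x" using j I by simp
    finally show "f x = 0" by simp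
  qed (use I in simp)
qed

text \<open>One functional is added at a time. If it vanished on the common kernel of the others,
  subtracting components along vectors dual to these would exhibit it as their combination, against
  independence; a vector of the kernel on which it does not vanish then adjusts its value
  alone.\<close>

lemma independent_functionals_onto:
  fixes l :: "'i \<Rightarrow> 'g::real_vector \<Rightarrow> real"
  assumes "finite I" and V: "subspace V" and l: "\<And>i. i \<in> I \<Longrightarrow> linear (l i)"
    and ind: "\<And>c. (\<And>x. x \<in> V \<Longrightarrow> (\<Sum>i\<in>I. c i * l i x) = 0) \<Longrightarrow> (\<And>i. i \<in> I \<Longrightarrow> c i = 0)"
  shows "\<exists>x\<in>V. \<forall>i\<in>I. l i x = c i" using assms(1) l ind
proof (induction I arbitrary: c rule: finite_induct)
  case empty
  show ?case using subspace_0[OF V] by auto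
next
  case (insert j I)
  have l: "linear (l j)" "\<And>i. i \<in> I \<Longrightarrow> linear (l i)" using insert.prems(1) by auto
  have indI: "c i = 0" if "\<And>x. x \<in> V \<Longrightarrow> (\<Sum>i\<in>I. c i * l i x) = 0" "i \<in> I" for c i
  proof -
    have "(if i = j then 0 else c i) = 0"
    proof (rule insert.prems(2)[of "\<lambda>i. if i = j then 0 else c i"])
      fix x assume "x \<in> V"
      have "(\<Sum>i\<in>I. (if i = j then 0 else c i) * l i x) = (\<Sum>i\<in>I. c i * l i x)"
        using insert.hyps(2) by (intro sum.cong) auto
      thus "(\<Sum>i\<in>insert j I. (if i = j then 0 else c i) * l i x) = 0"
        using insert.hyps that(1)[OF \<open>x \<in> V\<close>] by simp
    qed (use that(2) in simp)
    thus ?thesis using that(2) insert.hyps(2) by (auto split: if_splits)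
  qed
  have IH: "\<exists>x\<in>V. \<forall>i\<in>I. l i x = c i" for c
  proof (rule insert.IH)
    show "linear (l i)" if "i \<in> I" for i by (rule l(2)[OF that])
    show "c i = 0" if "\<And>x. x \<in> V \<Longrightarrow> (\<Sum>i\<in>I. c i * l i x) = 0" "i \<in> I" for c i by (rule indI[OF that])
  qed
  have "\<exists>x\<in>V. \<forall>i\<in>I. l i x = (if i = k then 1 else 0)" for k by (rule IH)
  then obtain a where a: "\<And>k. a k \<in> V" "\<And>k i. i \<in> I \<Longrightarrow> l i (a k) = (if i = k then 1 else 0)" by metis
  have "\<exists>y\<in>V. (\<forall>i\<in>I. l i y = 0) \<and> l j y \<noteq> 0"
  proof (rule ccontr)
    assume no: "\<not> (\<exists>y\<in>V. (\<forall>i\<in>I. l i y = 0) \<and> l j y \<noteq> 0)"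
    \<comment> \<open>The excluded relation says that \<open>l j\<close> is the sum of the
      \<open>l i\<close> with coefficients \<open>l j (a i)\<close>; its own coefficient is
      1.\<close>
    have "(if j = j then 1 else - l j (a j)) = (0::real)"
    proof (rule insert.prems(2)[of "\<lambda>i. if i = j then 1 else - l j (a i)" j])
      fix x assume x: "x \<in> V"
      let ?y = "x - (\<Sum>k\<in>I. l k x *\<^sub>R a k)"
      have y: "?y \<in> V" by (intro subspace_diff[OF V] x subspace_sum[OF V] subspace_scale[OF V] a(1))
      have "l i ?y = 0" if i: "i \<in> I" for i
      proof -
        have "l i ?y = l i x - (\<Sum>k\<in>I. l k x * l i (a k))"
          by (simp add: linear_diff[OF l(2)[OF i]] linear_sum[OF l(2)[OF i]] linear_scale[OF l(2)[OF i]])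
        also have "(\<Sum>k\<in>I. l k x * l i (a k)) = (\<Sum>k\<in>I. if k = i then l k x else 0)"
          by (intro sum.cong refl) (simp add: a(2)[OF i])
        finally show ?thesis using i insert.hyps(1) by simp
      qed
      hence "l j ?y = 0" using no y by blast
      hence "l j x - (\<Sum>k\<in>I. l k x * l j (a k)) = 0"
        by (simp add: linear_diff[OF l(1)] linear_sum[OF l(1)] linear_scale[OF l(1)])
      moreover have "(\<Sum>i\<in>I. (if i = j then 1 else - l j (a i)) * l i x) = - (\<Sum>k\<in>I. l k x * l j (a k))"
        unfolding sum_negf[symmetric] using insert.hyps(2) by (intro sum.cong refl) auto
      ultimately show "(\<Sum>i\<in>insert j I. (if i = j then 1 else - l j (a i)) * l i x) = 0"
        using insert.hyps by simp
    qed simp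
    thus False by simp
  qed
  then obtain y where y: "y \<in> V" "\<And>i. i \<in> I \<Longrightarrow> l i y = 0" "l j y \<noteq> 0" by blast
  obtain x where x: "x \<in> V" "\<And>i. i \<in> I \<Longrightarrow> l i x = c i" using IH[of c] by blast
  let ?z = "x + ((c j - l j x) / l j y) *\<^sub>R y"
  have "?z \<in> V" by (intro subspace_add[OF V] subspace_scale[OF V] x y)
  moreover have "l i ?z = c i" if "i \<in> insert j I" for i
  proof (cases "i = j")
    case True
    thus ?thesis using y(3) by (simp add: linear_add[OF l(1)] linear_scale[OF l(1)])
  next
    case False
    hence "i \<in> I" using that by blast
    thus ?thesis using x(2) y(2) by (simp add: linear_add[OF l(2)] linear_scale[OF l(2)])
  qed
  ultimately show ?case by blast
qed

lemma (in finite_basis) independent_finite: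
  assumes "independent (B :: 'g set)"
  shows "finite B" using independent_span_bound[OF basis(1) assms] basis(3) by auto

text \<open>A basis of \<open>V\<close> stays independent when \<open>u\<close> is added.
  Nondegeneracy on \<open>H\<close> turns these vectors into independent functionals on
  \<open>H\<close>, whose values can be prescribed.\<close>

lemma (in finite_basis) separate_from_subspace:
  fixes ip :: "'g \<Rightarrow> 'g \<Rightarrow> real"
  assumes ip: "bilinear ip" and H: "subspace H" and V: "subspace V" "V \<subseteq> H" and u: "u \<in> H" "u \<notin> V"
    and nondeg: "\<And>a. a \<in> H \<Longrightarrow> (\<And>b. b \<in> H \<Longrightarrow> ip b a = 0) \<Longrightarrow> a = 0"
  obtains c where "c \<in> H" "\<And>x. x \<in> V \<Longrightarrow> ip c x = 0" "ip c u = 1"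
proof -
  obtain B where B: "B \<subseteq> V" "independent B" "V \<subseteq> span B" using maximal_independent_subset by blast
  have sV: "span B \<subseteq> V" using span_minimal[OF B(1) V(1)] .
  have uB: "u \<notin> span B" "u \<notin> B" using sV u B(1) by auto
  have ind: "independent (insert u B)" using B(2) uB by (simp add: independent_insert)
  have fin: "finite (insert u B)" by (rule independent_finite[OF ind])
  have sub: "insert u B \<subseteq> H" using u B(1) V(2) by blast
  have "\<exists>c\<in>H. \<forall>b\<in>insert u B. ip c b = (if b = u then 1 else 0)"
  proof (rule independent_functionals_onto[OF fin H])
    show "linear (\<lambda>x. ip x b)" for b using ip by (simp add: bilinear_def)
    fix c i assume c: "\<And>x. x \<in> H \<Longrightarrow> (\<Sum>b\<in>insert u B. c b * ip x b) = 0" and i: "i \<in> insert u B"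
    have "ip x (\<Sum>b\<in>insert u B. c b *\<^sub>R b) = (\<Sum>b\<in>insert u B. c b * ip x b)" for x
    proof -
      have l: "linear (ip x)" using ip by (simp add: bilinear_def)
      show ?thesis by (simp only: linear_sum[OF l] linear_scale[OF l] real_scaleR_def)
    qed
    hence "(\<Sum>b\<in>insert u B. c b *\<^sub>R b) = 0"
      using c by (intro nondeg subspace_sum[OF H] subspace_scale[OF H]) (use sub in auto)
    thus "c i = 0" using ind fin i by (metis independentD order_refl)
  qed
  then obtain c where c: "c \<in> H" "\<And>b. b \<in> insert u B \<Longrightarrow> ip c b = (if b = u then 1 else 0)" by blast
  have "ip c x = 0" if "x \<in> V" for x
  proof -
    have "subspace {x. ip c x = 0}"
      using ip by (simp add: subspace_def bilinear_radd bilinear_rmul bilinear_rzero)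
    moreover have "B \<subseteq> {x. ip c x = 0}" using c(2) uB by auto
    ultimately have "span B \<subseteq> {x. ip c x = 0}" by (rule span_minimal[rotated])
    thus ?thesis using B(3) that by blast
  qed
  thus thesis using that c by simp
qed

lemma root_spaceD: "u \<in> root_space br H \<alpha> \<Longrightarrow> a \<in> H \<Longrightarrow> cbracket br a u = cscale (\<alpha> a) u"
  by (simp add: root_space_def)

text \<open>\<open>Kf\<close> is the definite form that compactness provides. \<open>D_perp\<close>
  is the Lagrangian property of \<open>D\<close>; it is supplied by \<open>nf_structure\<close>,
  where the existence of \<open>J\<close> yields it without counting dimensions.\<close>

locale nf_algebra = lie_form br ip + finite_basis Bs
  for br :: "'g::real_vector \<Rightarrow> 'g \<Rightarrow> 'g" and ip and Bs :: "'g set" +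
  fixes Kf :: "'g \<Rightarrow> 'g \<Rightarrow> real" and p :: nat and h :: "'g set" and D :: "('g \<times> 'g) set" and v :: "nat \<Rightarrow> 'g"
  assumes nondeg: "(\<And>b. ip a b = 0) \<Longrightarrow> a = 0"
    and Kf: "invariant_form br Kf" "a \<noteq> 0 \<Longrightarrow> Kf a a > 0"
    and nfD: "normal_form_D br ip p h D"
    and nfb: "normal_form_basis ip p h D v"
    and D_perp: "(\<And>w. w \<in> D \<Longrightarrow> cform ip u w = 0) \<Longrightarrow> u \<in> D"
begin

abbreviation "rs \<equiv> root_space br (h \<times> h)"

sublocale KF: lie_form br Kf by unfold_locales (rule br_bil br_self jacobi Kf(1))+

lemma h_sub: "subspace h" and h_nil: "\<exists>m. lower_central_series br h m = {0}"
    and h_self: "{a. \<forall>b\<in>h. br a b \<in> h} = h" and D_sub: "csubspace D"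
    and D_br: "x \<in> D \<Longrightarrow> y \<in> D \<Longrightarrow> cbracket br x y \<in> D" and D_iso: "x \<in> D \<Longrightarrow> y \<in> D \<Longrightarrow> cform ip x y = 0"
    and D_norm: "a \<in> h \<Longrightarrow> x \<in> D \<Longrightarrow> cbracket br (a, 0) x \<in> D"
    and dim_A: "dim {a. (a, 0) \<in> D} = p"
proof -
  note n = nfD[unfolded normal_form_D_def]
  note c = n[THEN conjunct2, THEN conjunct2, THEN conjunct1, unfolded cartan_subalgebra_def]
  show "subspace h" by (rule c[THEN conjunct1])
  show "\<exists>m. lower_central_series br h m = {0}" by (rule c[THEN conjunct2, THEN conjunct2, THEN conjunct1])
  show "{a. \<forall>b\<in>h. br a b \<in> h} = h" by (rule c[THEN conjunct2, THEN conjunct2, THEN conjunct2])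
  note s = n[THEN conjunct1, unfolded complex_subalgebra_def]
  show "csubspace D" by (rule s[THEN conjunct1])
  show "cbracket br x y \<in> D" if "x \<in> D" "y \<in> D" using s[THEN conjunct2] that by blast
  note i = n[THEN conjunct2, THEN conjunct1, unfolded maximal_isotropic_def isotropic_def]
  show "cform ip x y = 0" if "x \<in> D" "y \<in> D"
    using i[THEN conjunct2, THEN conjunct2, THEN conjunct1] that by blast
  show "cbracket br (a, 0) x \<in> D" if "a \<in> h" "x \<in> D"
    using n[THEN conjunct2, THEN conjunct2, THEN conjunct2, THEN conjunct1, unfolded normalised_by_def] that
    by blast
  show "dim {a. (a, 0) \<in> D} = p"
    using n[THEN conjunct2, THEN conjunct2, THEN conjunct2, THEN conjunct2, THEN conjunct2, THEN conjunct2] .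
qed

definition P where "P = (SOME P. positive_system br (h \<times> h) P \<and> D = cspan ((D \<inter> h \<times> h) \<union> (\<Union>\<alpha>\<in>P. rs \<alpha>)))"

lemma P: "positive_system br (h \<times> h) P"
    "D = cspan ((D \<inter> h \<times> h) \<union> (\<Union>\<alpha>\<in>P. rs \<alpha>))"
proof -
  have "\<exists>P. positive_system br (h \<times> h) P \<and> D = cspan ((D \<inter> h \<times> h) \<union> (\<Union>\<alpha>\<in>P. rs \<alpha>))"
    using nfD unfolding normal_form_D_def by blast
  from someI_ex[OF this] show "positive_system br (h \<times> h) P"
    "D = cspan ((D \<inter> h \<times> h) \<union> (\<Union>\<alpha>\<in>P. rs \<alpha>))" unfolding P_def by blast+
qed

lemma root_in_D: "\<alpha> \<in> P \<Longrightarrow> e \<in> rs \<alpha> \<Longrightarrow> e \<in> D" by (subst P(2), rule cplx.span_base) blast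

lemma P_root:
  assumes "\<alpha> \<in> P"
  shows "\<exists>a\<in>h \<times> h. \<alpha> a \<noteq> 0" "\<exists>e\<in>rs \<alpha>. e \<noteq> 0"
proof -
  have r: "\<alpha> \<in> lie_roots br (h \<times> h)" using P(1) assms by (auto simp: positive_system_def)
  thus "\<exists>a\<in>h \<times> h. \<alpha> a \<noteq> 0" by (simp add: lie_roots_def)
  have "cbracket br a 0 = 0" for a by (simp add: cbracket_def br_simps zero_prod_def)
  hence "0 \<in> rs \<alpha>" by (simp add: root_space_def)
  moreover have "rs \<alpha> \<noteq> {0}" using r by (simp add: lie_roots_def)
  ultimately show "\<exists>e\<in>rs \<alpha>. e \<noteq> 0" by blast
qed

text \<open>Compactness upgrades nilpotent to abelian. If a term of the lower central series
  commutes with \<open>h\<close>, invariance of \<open>Kf\<close> makes it orthogonal to all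
  brackets with elements of \<open>h\<close>, in particular to itself, so it is zero by
  definiteness.\<close>

lemma h_abelian:
  assumes ab: "a \<in> h" "b \<in> h"
  shows "br a b = 0"
proof -
  let ?L = "lower_central_series br h"
  have step: "?L (Suc k) = {0}" if k: "?L (Suc (Suc k)) = {0}" for k
  proof -
    have z0: "br a z = 0" if "a \<in> h" "z \<in> ?L (Suc k)" for a z
    proof -
      have "br a z \<in> ?L (Suc (Suc k))"
        unfolding lower_central_series.simps(2)[of br h "Suc k"] using that by (intro span_base) blast
      thus ?thesis using k by simp
    qed
    have "z = 0" if z: "z \<in> ?L (Suc k)" for z
    proof (rule ccontr)
      assume "z \<noteq> 0"
      have "subspace {x. Kf x z = 0}" by (simp add: subspace_def KF.ip_simps)
      moreover have "{br a b |a b. a \<in> h \<and> b \<in> ?L k} \<subseteq> {x. Kf x z = 0}"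
        using z0[OF _ z] by (auto simp: KF.ip_br KF.ip_simps)
      ultimately have "span {br a b |a b. a \<in> h \<and> b \<in> ?L k} \<subseteq> {x. Kf x z = 0}" by (rule span_minimal[rotated])
      hence "Kf z z = 0" using z by auto
      thus False using Kf(2)[OF \<open>z \<noteq> 0\<close>] by simp
    qed
    moreover have "0 \<in> ?L (Suc k)" by (simp add: span_zero)
    ultimately show ?thesis by blast
  qed
  obtain m where m: "?L m = {0}" using h_nil by blast
  \<comment> \<open>The collapse runs down to index 1; index 0 is \<open>h\<close> itself, to which
    the argument does not apply.\<close>
  have "?L (Suc 0) = {0} \<or> ?L 0 = {0}" using m
  proof (induction m)
    case (Suc m)
    thus ?case using step by (cases m) auto
  qed simp
  moreover have "br a b \<in> ?L (Suc 0)" using ab by (auto intro!: span_base)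
  moreover have "br a b = 0" if "?L 0 = {0}" using that ab by (simp add: br_simps)
  ultimately show ?thesis by blast
qed

lemma hC_abelian: "x \<in> h \<times> h \<Longrightarrow> y \<in> h \<times> h \<Longrightarrow> cbracket br x y = 0"
  by (auto simp: cbracket_def h_abelian zero_prod_def)

lemma conj_h: "x \<in> h \<times> h \<Longrightarrow> conj_vec x \<in> h \<times> h" using subspace_neg[OF h_sub] by (auto simp: conj_vec_def)

text \<open>A root is nonzero at some \<open>a\<close> of the complexified Cartan subalgebra.
  Invariance moves the bracket with \<open>a\<close> from \<open>e\<close> to \<open>u\<close>,
  where it vanishes as that algebra is abelian. Conjugating both arguments gives the second
  claim.\<close>

lemma hC_root:
  assumes u: "u \<in> h \<times> h" and \<alpha>: "\<alpha> \<in> P" and e: "e \<in> rs \<alpha>"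
  shows "cform ip u e = 0" "cform ip u (conj_vec e) = 0"
proof -
  have "cform ip u e = 0" if u: "u \<in> h \<times> h" for u
  proof -
    obtain a where a: "a \<in> h \<times> h" "\<alpha> a \<noteq> 0" using P_root(1)[OF \<alpha>] by blast
    have "\<alpha> a * cform ip u e = cform ip u (cbracket br a e)" by (simp add: root_spaceD[OF e a(1)] cip_scale)
    also have "... = - cform ip (cbracket br a u) e" by (simp add: cip_br)
    also have "... = 0" using hC_abelian[OF a(1) u] by (simp add: cform_def ip_simps complex_eq_iff)
    finally show ?thesis using a(2) by simp
  qed
  from this[OF u] this[OF conj_h[OF u]] show "cform ip u e = 0" "cform ip u (conj_vec e) = 0"
    using cip_conj[of "conj_vec u" e] by simp_all
qed

text \<open>The root spaces in \<open>D\<close> are orthogonal to \<open>h \<times> h\<close>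
  anyway, so only the Cartan part of \<open>D\<close> has to be tested.\<close>

lemma perp_D:
  assumes u: "u \<in> h \<times> h" and p: "\<And>x. x \<in> D \<inter> h \<times> h \<Longrightarrow> cform ip u x = 0"
  shows "u \<in> D"
proof (rule D_perp)
  fix w assume "w \<in> D"
  hence "w \<in> cspan ((D \<inter> h \<times> h) \<union> (\<Union>\<alpha>\<in>P. rs \<alpha>))" using P(2) by blast
  thus "cform ip u w = 0"
    by (rule cspan_induct_zero) (use p hC_root(1)[OF u] in \<open>auto simp: cip_add cip_scale\<close>)
qed

section \<open>The real part of D and its dual basis\<close>

definition A where "A = {a. (a, 0) \<in> D}"

lemma A_sub: "subspace A"
proof (rule subspaceI)
  note s = csubspace_real[OF D_sub]
  show "0 \<in> A" using subspace_0[OF s] by (simp add: A_def zero_prod_def)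
  show "x + y \<in> A" if "x \<in> A" "y \<in> A" for x y
    using subspace_add[OF s, of "(x, 0)" "(y, 0)"] that by (simp add: A_def)
  show "c *\<^sub>R x \<in> A" if "x \<in> A" for c x using subspace_scale[OF s, of "(x, 0)" c] that by (simp add: A_def)
qed

abbreviation "S \<equiv> span (v ` {..<p})"

lemma v_ind: "inj_on v {..<p}" "independent (v ` {..<p})" and S_h: "S \<subseteq> h"
    and S_iso: "\<And>a b. a \<in> S \<Longrightarrow> b \<in> S \<Longrightarrow> ip a b = 0"
    and S_A: "\<And>a. a \<in> S \<Longrightarrow> (\<And>b. b \<in> A \<Longrightarrow> b \<in> h \<Longrightarrow> ip a b = 0) \<Longrightarrow> a = 0"
    and A_S: "\<And>b. b \<in> A \<Longrightarrow> b \<in> h \<Longrightarrow> (\<And>a. a \<in> S \<Longrightarrow> ip a b = 0) \<Longrightarrow> b = 0"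
proof -
  note n = nfb[unfolded normal_form_basis_def Let_def]
  show "inj_on v {..<p}" "independent (v ` {..<p})" "S \<subseteq> h" using n by simp_all
  note n4 = n[THEN conjunct2, THEN conjunct2, THEN conjunct2]
  show "ip a b = 0" if "a \<in> S" "b \<in> S" for a b using n4[THEN conjunct1] that by blast
  show "a = 0" if "a \<in> S" "\<And>b. b \<in> A \<Longrightarrow> b \<in> h \<Longrightarrow> ip a b = 0" for a
    using n4[THEN conjunct2, THEN conjunct1, THEN bspec, OF that(1)] that(2) unfolding A_def by simp
  show "b = 0" if "b \<in> A" "b \<in> h" "\<And>a. a \<in> S \<Longrightarrow> ip a b = 0" for b
    using n4[THEN conjunct2, THEN conjunct2, THEN bspec, of b] that unfolding A_def by simp
qed

lemma v_S: "i < p \<Longrightarrow> v i \<in> S" by (rule span_base) blast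

lemma v_h: "i < p \<Longrightarrow> v i \<in> h" using v_S S_h by blast

text \<open>No nonzero element of \<open>S\<close> is orthogonal to \<open>A \<inter> h\<close>, so
  the functionals given by the \<open>v j\<close> are independent there and take all values.\<close>

lemma dual_basis_exists: "\<exists>a. \<forall>k<p. a k \<in> A \<inter> h \<and> (\<forall>j<p. ip (a k) (v j) = (if j = k then 1 else 0))"
proof -
  have "\<exists>a\<in>A \<inter> h. \<forall>j\<in>{..<p}. ip a (v j) = (if j = k then 1 else 0)" for k
  proof (rule independent_functionals_onto)
    show "subspace (A \<inter> h)" using A_sub h_sub by (rule subspace_inter)
    show "linear (\<lambda>x. ip x (v j))" for j using ip_bil by (simp add: bilinear_def)
    fix c i assume c: "\<And>x. x \<in> A \<inter> h \<Longrightarrow> (\<Sum>j<p. c j * ip x (v j)) = 0" and i: "i \<in> {..<p}"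
    let ?s = "\<Sum>j<p. c j *\<^sub>R v j"
    have "?s \<in> S" by (intro span_sum span_scale v_S) simp
    moreover have "ip ?s b = 0" if "b \<in> A" "b \<in> h" for b
    proof -
      have l: "linear (ip b)" using ip_bil by (simp add: bilinear_def)
      have "ip b ?s = (\<Sum>j<p. c j * ip b (v j))"
        by (simp only: linear_sum[OF l] linear_scale[OF l] real_scaleR_def)
      thus ?thesis using c that ip_sym[of ?s b] by simp
    qed
    ultimately have "?s = 0" by (rule S_A)
    have "(\<Sum>x\<in>v ` {..<p}. c (the_inv_into {..<p} v x) *\<^sub>R x) =
        (\<Sum>j<p. c (the_inv_into {..<p} v (v j)) *\<^sub>R v j)" by (simp add: sum.reindex[OF v_ind(1)])
    also have "... = ?s" by (intro sum.cong refl) (simp add: the_inv_into_f_f[OF v_ind(1)])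
    finally have "(\<Sum>x\<in>v ` {..<p}. c (the_inv_into {..<p} v x) *\<^sub>R x) = 0" using \<open>?s = 0\<close> by simp
    from independentD[OF v_ind(2) finite_imageI[OF finite_lessThan] order_refl this imageI[OF i]]
    have "c (the_inv_into {..<p} v (v i)) = 0" .
    thus "c i = 0" using the_inv_into_f_f[OF v_ind(1) i] by simp
  qed simp
  hence "\<forall>k. \<exists>a. a \<in> A \<inter> h \<and> (\<forall>j<p. ip a (v j) = (if j = k then 1 else 0))"
    unfolding Bex_def Ball_def lessThan_iff by blast
  from choice[OF this] show ?thesis by blast
qed

definition ah where "ah = (SOME a. \<forall>k<p. a k \<in> A \<inter> h \<and> (\<forall>j<p. ip (a k) (v j) = (if j = k then 1 else 0)))"

lemma ah: "k < p \<Longrightarrow> ah k \<in> A" "k < p \<Longrightarrow> ah k \<in> h"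
    "k < p \<Longrightarrow> j < p \<Longrightarrow> ip (ah k) (v j) = (if j = k then 1 else 0)"
  using someI_ex[OF dual_basis_exists] unfolding ah_def[symmetric] by auto

text \<open>The \<open>p\<close> vectors \<open>ah k\<close> are independent, being dual to
  \<open>v\<close>, and \<open>dim_A\<close> leaves no room for further ones. As they lie in
  \<open>h\<close>, this is how the whole real part of \<open>D\<close> turns out to lie in
  \<open>h\<close>.\<close>

lemma A_span: "A = span (ah ` {..<p})" and ah_ind: "independent (ah ` {..<p})" and ah_inj: "inj_on ah {..<p}"
proof -
  have l: "linear (\<lambda>x. ip x (v j))" for j using ip_bil by (simp add: bilinear_def)
  show inj: "inj_on ah {..<p}" and ind: "independent (ah ` {..<p})"
    by (rule independent_dual_functionals[of "{..<p}" "\<lambda>j x. ip x (v j)"]; simp add: l ah(3))+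
  have sub: "ah ` {..<p} \<subseteq> A" using ah(1) by blast
  show "A = span (ah ` {..<p})"
  proof
    show "span (ah ` {..<p}) \<subseteq> A" by (rule span_minimal[OF sub A_sub])
    obtain B where B: "B \<subseteq> A" "independent B" "A \<subseteq> span B" "card B = dim A" by (rule basis_exists)
    have finB: "finite B" by (rule independent_finite[OF B(2)])
    show "A \<subseteq> span (ah ` {..<p})"
    proof
      fix a assume a: "a \<in> A"
      show "a \<in> span (ah ` {..<p})"
      proof (rule ccontr)
        assume n: "a \<notin> span (ah ` {..<p})"
        hence "a \<notin> ah ` {..<p}" using span_base[of a "ah ` {..<p}"] by blast
        hence "card (insert a (ah ` {..<p})) = Suc p" using inj by (simp add: card_image)
        moreover have i: "independent (insert a (ah ` {..<p}))" using ind n by (simp add: independent_insert)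
        have "insert a (ah ` {..<p}) \<subseteq> span B" using a sub B(3) by blast
        hence "card (insert a (ah ` {..<p})) \<le> card B" using independent_span_bound[OF finB i] by blast
        moreover have "card B = p" using B(4) dim_A by (simp add: A_def)
        ultimately show False by simp
      qed
    qed
  qed
qed

lemma A_h: "A \<subseteq> h" unfolding A_span by (rule span_minimal[OF _ h_sub]) (use ah(2) in blast)

lemma A_perp_S:
  assumes "\<And>i. i < p \<Longrightarrow> ip (ah i) u = 0" "a \<in> A"
  shows "ip a u = 0"
proof -
  have "subspace {x. ip x u = 0}" by (simp add: subspace_def ip_simps)
  moreover have "ah ` {..<p} \<subseteq> {x. ip x u = 0}" using assms(1) by auto
  ultimately have "span (ah ` {..<p}) \<subseteq> {x. ip x u = 0}" by (rule span_minimal[rotated])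
  thus ?thesis using assms(2) A_span by blast
qed

text \<open>A vector of \<open>h\<close> orthogonal to \<open>h\<close> lies in \<open>D\<close> by
  \<open>perp_D\<close> and hence in \<open>A\<close>; it pairs to zero with \<open>S\<close>, which
  \<open>A_S\<close> allows for zero only.\<close>

lemma h_nondeg:
  assumes a: "a \<in> h" and p: "\<And>b. b \<in> h \<Longrightarrow> ip b a = 0"
  shows "a = 0"
proof -
  have "(a, 0) \<in> D"
    by (rule perp_D) (use a p subspace_0[OF h_sub] ip_sym[of a] in \<open>auto simp: cform_def complex_eq_iff ip_simps\<close>)
  hence "a \<in> A" by (simp add: A_def)
  thus ?thesis using A_S[OF _ a] p S_h by blast
qed

section \<open>Weight vectors spanning the complexification\<close>

definition Z where "Z = h \<times> h \<union> (\<Union>\<alpha>\<in>P. rs \<alpha> \<union> conj_vec ` rs \<alpha>)"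

lemma Z_conj: "u \<in> cspan Z \<Longrightarrow> conj_vec u \<in> cspan Z"
proof -
  assume u: "u \<in> cspan Z"
  have "Z \<subseteq> {u. conj_vec u \<in> cspan Z}"
  proof
    fix z assume "z \<in> Z"
    hence "conj_vec z \<in> Z" using conj_h unfolding Z_def by fastforce
    thus "z \<in> {u. conj_vec u \<in> cspan Z}" using cplx.span_base by blast
  qed
  hence "cspan Z \<subseteq> {u. conj_vec u \<in> cspan Z}"
    by (rule cplx.span_minimal[OF _ csubspace_conj[OF cplx.subspace_span]])
  thus ?thesis using u by blast
qed

text \<open>No root space decomposition is invoked. If the span were proper, some nonzero real
  \<open>c\<close> would be orthogonal to its real part, hence to \<open>D\<close>, so
  \<open>c\<close> would lie in \<open>A\<close> and thus in \<open>h\<close>; being orthogonal to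
  \<open>S\<close> as well, it is zero.\<close>

lemma Z_span: "cspan Z = UNIV"
proof -
  define V where "V = {c. (c, 0) \<in> cspan Z}"
  note s = csubspace_real[OF cplx.subspace_span[of Z]]
  have V: "subspace V"
  proof (rule subspaceI)
    show "0 \<in> V" using subspace_0[OF s] by (simp add: V_def zero_prod_def)
    show "x + y \<in> V" if "x \<in> V" "y \<in> V" for x y
      using subspace_add[OF s, of "(x, 0)" "(y, 0)"] that by (simp add: V_def)
    show "c *\<^sub>R x \<in> V" if "x \<in> V" for c x
      using subspace_scale[OF s, of "(x, 0)" c] that by (simp add: V_def)
  qed
  \<comment> \<open>The span is stable under conjugation, so real and imaginary parts of its
    elements stay in it.\<close>
  have parts: "d1 \<in> V" "d2 \<in> V" if d: "(d1, d2) \<in> cspan Z" for d1 d2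
  proof -
    have c: "(d1, - d2) \<in> cspan Z" using Z_conj[OF d] by (simp add: conj_vec_def)
    have "(1/2) *\<^sub>R ((d1, d2) + (d1, - d2)) \<in> cspan Z" by (rule subspace_scale[OF s subspace_add[OF s d c]])
    thus "d1 \<in> V" by (simp add: V_def scaleR_half_double)
    have "cscale (-\<i>/2) ((d1, d2) - (d1, - d2)) \<in> cspan Z"
      by (rule cplx.span_scale[OF cplx.span_diff[OF d c]])
    thus "d2 \<in> V" by (simp add: V_def cscale_def scaleR_half_double)
  qed
  have DZ: "D \<subseteq> cspan Z" by (subst P(2), rule cplx.span_mono) (auto simp: Z_def)
  have hV: "h \<subseteq> V" using cplx.span_base[of _ Z] subspace_0[OF h_sub] by (auto simp: V_def Z_def)
  have "u \<in> V" for u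
  proof (rule ccontr)
    assume u: "u \<notin> V"
    obtain c where c: "\<And>x. x \<in> V \<Longrightarrow> ip c x = 0" "ip c u = 1"
    proof (rule separate_from_subspace[OF ip_bil subspace_UNIV V _ _ u])
      show "a = 0" if "\<And>b. b \<in> UNIV \<Longrightarrow> ip b a = 0" for a using nondeg[of a] that ip_sym[of a] by simp
    qed (use that in auto)
    have "(c, 0) \<in> D"
    proof (rule D_perp)
      fix w assume "w \<in> D"
      hence "fst w \<in> V" "snd w \<in> V" using parts[of "fst w" "snd w"] DZ by auto
      thus "cform ip (c, 0) w = 0" using c(1) by (simp add: cform_def complex_eq_iff ip_simps)
    qed
    hence "c \<in> A" by (simp add: A_def)
    hence "c = 0" using A_S[of c] A_h c(1) hV S_h ip_sym[of c] by (metis subsetD)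
    thus False using c(2) by (simp add: ip_simps)
  qed
  hence "u \<in> cspan Z" for u
  proof -
    have "(fst u, 0) + cscale \<i> (snd u, 0) \<in> cspan Z"
      using \<open>\<And>u. u \<in> V\<close> by (intro cplx.span_add cplx.span_scale) (auto simp: V_def)
    thus ?thesis by (simp add: cscale_def)
  qed
  thus ?thesis by blast
qed

lemma root_conj:
  assumes e: "e \<in> rs \<alpha>" and a: "a \<in> h"
  shows "cbracket br (a, 0) (conj_vec e) = cscale (cnj (\<alpha> (a, 0))) (conj_vec e)"
proof -
  have "(a, 0) \<in> h \<times> h" using a subspace_0[OF h_sub] by simp
  hence "cbracket br (a, 0) e = cscale (\<alpha> (a, 0)) e" by (rule root_spaceD[OF e])
  thus ?thesis using cbr_conj[of "(a, 0)" e] by (simp add: conj_vec_cscale) (simp add: conj_vec_def)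
qed

text \<open>The coroot direction \<open>t\<close>, the bracket of \<open>e\<close> with its
  conjugate, represents \<alpha> on the Cartan subalgebra up to a factor, both for \<open>ip\<close>
  and for \<open>Kf\<close>. If \<alpha> vanished on the Cartan part of \<open>D\<close>, then
  \<open>t\<close> would lie in \<open>D\<close> and so \<alpha> would vanish at \<open>t\<close>,
  making \<open>t\<close> null for the definite form.\<close>

lemma root_nonzero_on_Dh:
  assumes \<alpha>: "\<alpha> \<in> P"
  shows "\<exists>a\<in>D \<inter> h \<times> h. \<alpha> a \<noteq> 0"
proof (rule ccontr)
  assume n: "\<not> (\<exists>a\<in>D \<inter> h \<times> h. \<alpha> a \<noteq> 0)"
  obtain e where e: "e \<in> rs \<alpha>" "e \<noteq> 0" using P_root(2)[OF \<alpha>] by blast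
  define t where "t = cbracket br e (conj_vec e)"
  define \<kappa> where "\<kappa> = Kf (fst e) (fst e) + Kf (snd e) (snd e)"
  have \<kappa>: "\<kappa> > 0"
  proof (cases "fst e = 0")
    case True
    hence "snd e \<noteq> 0" using e(2) by (auto simp: prod_eq_iff)
    thus ?thesis using Kf(2) True by (simp add: \<kappa>_def KF.ip_simps)
  next
    case False
    thus ?thesis using Kf(2)[of "fst e"] Kf(2)[of "snd e"]
      by (cases "snd e = 0") (simp_all add: \<kappa>_def KF.ip_simps)
  qed
  have K\<kappa>: "cform Kf e (conj_vec e) = \<kappa>"
    using KF.ip_sym[of "snd e" "fst e"] by (simp add: cform_def \<kappa>_def complex_eq_iff KF.ip_simps)
  \<comment> \<open>Roots are purely imaginary on the real Cartan subalgebra: \<open>Kf\<close> is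
    invariant and pairs \<open>e\<close> with its conjugate to the positive number \<kappa>.\<close>
  have im: "\<alpha> (a, 0) + cnj (\<alpha> (a, 0)) = 0" if a: "a \<in> h" for a
  proof -
    have "(a, 0) \<in> h \<times> h" using a subspace_0[OF h_sub] by simp
    from root_spaceD[OF e(1) this]
    have "\<alpha> (a, 0) * \<kappa> = - (cnj (\<alpha> (a, 0)) * \<kappa>)"
      using KF.cip_br[of "(a, 0)" e "conj_vec e"] root_conj[OF e(1) a] by (simp add: KF.cip_scale K\<kappa>)
    hence "(\<alpha> (a, 0) + cnj (\<alpha> (a, 0))) * \<kappa> = 0" by (simp add: distrib_right)
    thus ?thesis using \<kappa> by simp
  qed
  have "cbracket br (a, 0) t = 0" if a: "a \<in> h" for a
  proof -
    have "(a, 0) \<in> h \<times> h" using a subspace_0[OF h_sub] by simp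
    from root_spaceD[OF e(1) this] have "cbracket br (a, 0) t = cscale (\<alpha> (a, 0) + cnj (\<alpha> (a, 0))) t"
      using root_conj[OF e(1) a] by (simp add: t_def cbr_jacobi cbr_scale cplx.scale_left_distrib)
    thus ?thesis using im[OF a] by simp
  qed
  \<comment> \<open>\<open>t\<close> has weight zero, so its real and imaginary parts commute with
    \<open>h\<close> and belong to it, as \<open>h\<close> is its own normaliser.\<close>
  hence "br a (fst t) = 0 \<and> br a (snd t) = 0" if "a \<in> h" for a
    using that by (simp add: cbracket_def br_simps zero_prod_def)
  hence "fst t \<in> {a. \<forall>b\<in>h. br a b \<in> h}" "snd t \<in> {a. \<forall>b\<in>h. br a b \<in> h}"
    using br_antisym[of "fst t"] br_antisym[of "snd t"] subspace_0[OF h_sub] by auto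
  hence th: "t \<in> h \<times> h" using h_self by (simp add: mem_Times_iff)
  have tip: "cform ip t a = \<alpha> a * cform ip (conj_vec e) e" if a: "a \<in> h \<times> h" for a
  proof -
    have "cform ip t a = - cform ip (conj_vec e) (cbracket br e a)" by (simp add: t_def cip_br)
    also have "... = cform ip (conj_vec e) (cbracket br a e)" using cbr_antisym[of e a] by (simp add: cip_minus)
    finally show ?thesis by (simp add: root_spaceD[OF e(1) a] cip_scale)
  qed
  have tK: "cform Kf t a = \<alpha> a * \<kappa>" if a: "a \<in> h \<times> h" for a
  proof -
    have "cform Kf t a = - cform Kf (conj_vec e) (cbracket br e a)" by (simp add: t_def KF.cip_br)
    also have "... = cform Kf (conj_vec e) (cbracket br a e)" using cbr_antisym[of e a] by (simp add: KF.cip_minus)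
    finally show ?thesis by (simp add: root_spaceD[OF e(1) a] KF.cip_scale KF.cip_sym[of "conj_vec e"] K\<kappa>)
  qed
  \<comment> \<open>Under the assumption on \<alpha>, \<open>tip\<close> says that \<open>t\<close>
    is orthogonal to the Cartan part of \<open>D\<close>.\<close>
  have "t \<in> D" by (rule perp_D[OF th]) (use tip n in auto)
  hence "\<alpha> t = 0" using th n by blast
  hence tt: "cform Kf t t = 0" using tK[OF th] by simp
  \<comment> \<open>\<open>t\<close> is \<i> times a real vector, so definiteness of the real form
    \<open>Kf\<close> applies to it.\<close>
  have "fst t = 0" using br_antisym[of "fst e" "snd e"] by (simp add: t_def cbracket_def br_simps br_self)
  hence "Kf (snd t) (snd t) = 0" using tt by (simp add: cform_def KF.ip_simps complex_eq_iff)
  hence "snd t = 0" using Kf(2)[of "snd t"] by force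
  hence "t = 0" using \<open>fst t = 0\<close> by (simp add: prod_eq_iff)
  obtain a where a: "a \<in> h \<times> h" "\<alpha> a \<noteq> 0" using P_root(1)[OF \<alpha>] by blast
  have "\<alpha> a * \<kappa> = 0" using tK[OF a(1)] \<open>t = 0\<close> by (simp add: cform_def KF.ip_simps complex_eq_iff)
  thus False using a(2) \<kappa> by simp
qed

text \<open>The Cartan subalgebra is determined by \<open>D\<close>: an element normalising \<open>D\<close> is orthogonal to
  \<open>[D, D]\<close>, which contains all positive root spaces.\<close>

lemma h_normaliser: "h = {a. \<forall>u\<in>D. cbracket br (a, 0) u \<in> D}"
proof
  show "h \<subseteq> {a. \<forall>u\<in>D. cbracket br (a, 0) u \<in> D}" using D_norm by blast
  show "{a. \<forall>u\<in>D. cbracket br (a, 0) u \<in> D} \<subseteq> h"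
  proof
    fix a assume "a \<in> {a. \<forall>u\<in>D. cbracket br (a, 0) u \<in> D}"
    hence a: "cbracket br (a, 0) u \<in> D" if "u \<in> D" for u using that by blast
    \<comment> \<open>The eigenvalue is taken at an element \<open>b\<close> of \<open>D\<close>, so
      that the bracket of \<open>a\<close> with \<open>b\<close> stays in \<open>D\<close> and
      isotropy can be used.\<close>
    have e1: "cform ip (a, 0) e = 0" if \<alpha>: "\<alpha> \<in> P" and e: "e \<in> rs \<alpha>" for \<alpha> e
    proof -
      obtain b where b: "b \<in> D" "b \<in> h \<times> h" "\<alpha> b \<noteq> 0" using root_nonzero_on_Dh[OF \<alpha>] by blast
      have "\<alpha> b * cform ip (a, 0) e = cform ip (a, 0) (cbracket br b e)"
        by (simp add: root_spaceD[OF e b(2)] cip_scale)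
      also have "... = - cform ip (cbracket br b (a, 0)) e" by (simp add: cip_br)
      also have "... = cform ip (cbracket br (a, 0) b) e"
        using cbr_antisym[of b "(a, 0)"] by (simp add: cip_minus)
      also have "... = 0" by (rule D_iso[OF a[OF b(1)] root_in_D[OF \<alpha> e]])
      finally show ?thesis using b(3) by simp
    qed
    have e2: "cform ip (a, 0) (conj_vec e) = 0" if "\<alpha> \<in> P" "e \<in> rs \<alpha>" for \<alpha> e
      using cip_conj[of "(a, 0)" e] e1[OF that] by (simp add: conj_vec_def)
    define N where "N = (\<Union>\<alpha>\<in>P. rs \<alpha> \<union> conj_vec ` rs \<alpha>)"
    have "cspan (h \<times> h) = h \<times> h"
    proof (rule cplx.span_eq_iff[THEN iffD2], unfold cplx.subspace_def, intro conjI ballI allI)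
      show "0 \<in> h \<times> h" using subspace_0[OF h_sub] by (simp add: zero_prod_def)
      show "x + y \<in> h \<times> h" if "x \<in> h \<times> h" "y \<in> h \<times> h" for x y
        using that subspace_add[OF h_sub] by (auto simp: mem_Times_iff)
      show "cscale c x \<in> h \<times> h" if "x \<in> h \<times> h" for c x
        using that subspace_add[OF h_sub] subspace_diff[OF h_sub] subspace_scale[OF h_sub]
        by (auto simp: mem_Times_iff)
    qed
    moreover have "(a, 0) \<in> cspan (h \<times> h \<union> N)" using Z_span by (simp add: Z_def N_def)
    \<comment> \<open>The remainder \<open>e\<close> after splitting off the Cartan part is a
      combination of root vectors and their conjugates; it will be orthogonal to everything and
      hence zero.\<close>
    ultimately obtain a0 e where ae: "(a, 0) = a0 + e" "a0 \<in> h \<times> h" "e \<in> cspan N"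
      unfolding cplx.span_Un by blast
    have eh: "cform ip e z = 0" if z: "z \<in> h \<times> h" for z using ae(3)
    proof (rule cspan_induct_zero)
      show "cform ip x z = 0" if "x \<in> N" for x
      proof -
        have "cform ip z x = 0" using that hC_root[OF z] unfolding N_def by blast
        thus ?thesis using cip_sym[of x z] by simp
      qed
    qed (auto simp: cip_add cip_scale)
    have "cform ip z e = 0" for z
    proof -
      have "z \<in> cspan Z" using Z_span by blast
      thus ?thesis
      proof (rule cspan_induct_zero)
        fix z assume "z \<in> Z"
        then consider "z \<in> h \<times> h" | "z \<in> N" by (auto simp: Z_def N_def)
        thus "cform ip z e = 0"
        proof cases
          case 1
          thus ?thesis using eh cip_sym[of z e] by simp
        next
          case 2
          have "cform ip (a, 0) z = 0" using 2 e1 e2 unfolding N_def by blast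
          moreover have "cform ip a0 z = 0" using 2 hC_root[OF ae(2)] unfolding N_def by blast
          ultimately have "cform ip e z = 0" using cip_add(1)[of a0 e z] ae(1) by simp
          thus ?thesis using cip_sym[of z e] by simp
        qed
      qed (auto simp: cip_add cip_scale)
    qed
    hence "cform ip (b, 0) e = 0" for b by blast
    hence z: "ip b (fst e) = 0" "ip b (snd e) = 0" for b
      by (simp_all add: cform_def ip_simps complex_eq_iff)
    have "fst e = 0" by (rule nondeg) (use z(1) ip_sym[of "fst e"] in simp)
    thus "a \<in> h" using ae(1,2) by (auto simp: prod_eq_iff mem_Times_iff)
  qed
qed

text \<open>Were \<open>u\<close> not the imaginary part of an element of \<open>D\<close> with both
  parts in \<open>h\<close>, some \<open>c\<close> in \<open>h\<close> would be orthogonal to all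
  such imaginary parts but not to \<open>u\<close>. As \<open>D\<close> is complex, real parts occur
  among them too, so \<open>c\<close> would be orthogonal to \<open>D\<close> and lie in
  \<open>A\<close>, to which \<open>u\<close> is orthogonal.\<close>

lemma h_decompose:
  assumes u: "u \<in> h" "\<And>a. a \<in> A \<Longrightarrow> ip a u = 0"
  shows "\<exists>w\<in>h. (- w, u) \<in> D"
proof -
  define V where "V = {x \<in> h. \<exists>w\<in>h. (w, x) \<in> D}"
  note s = csubspace_real[OF D_sub]
  have V: "subspace V"
  proof (rule subspaceI)
    show "0 \<in> V" using subspace_0[OF s] subspace_0[OF h_sub] by (auto simp: V_def zero_prod_def)
    show "x + y \<in> V" if "x \<in> V" "y \<in> V" for x y
    proof -
      obtain a b where "a \<in> h" "b \<in> h" "(a, x) \<in> D" "(b, y) \<in> D" "x \<in> h" "y \<in> h"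
        using \<open>x \<in> V\<close> \<open>y \<in> V\<close> unfolding V_def by blast
      thus ?thesis
        using subspace_add[OF s, of "(a, x)" "(b, y)"] subspace_add[OF h_sub] unfolding V_def by auto
    qed
    show "c *\<^sub>R x \<in> V" if "x \<in> V" for c x
    proof -
      obtain a where "a \<in> h" "(a, x) \<in> D" "x \<in> h" using \<open>x \<in> V\<close> unfolding V_def by blast
      thus ?thesis
        using subspace_scale[OF s, of "(a, x)" c] subspace_scale[OF h_sub] unfolding V_def by auto
    qed
  qed
  have "u \<in> V"
  proof (rule ccontr)
    assume n: "u \<notin> V"
    obtain c where c: "c \<in> h" "\<And>x. x \<in> V \<Longrightarrow> ip c x = 0" "ip c u = 1"
      by (rule separate_from_subspace[OF ip_bil h_sub V _ u(1) n h_nondeg]) (auto simp: V_def)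
    have "(c, 0) \<in> D"
    proof (rule perp_D)
      show "(c, 0) \<in> h \<times> h" using c(1) subspace_0[OF h_sub] by simp
      fix x assume x: "x \<in> D \<inter> h \<times> h"
      obtain a b where ab: "x = (a, b)" by fastforce
      have "b \<in> V" using x ab by (auto simp: V_def)
      moreover have "(b, - a) \<in> D" "- b \<in> h"
        using csubspace_pair(3)[OF D_sub, of a b] x ab subspace_neg[OF h_sub] by auto
      moreover have "(- b, a) \<in> D" using csubspace_pair(1)[OF D_sub, of a b] x ab by auto
      hence "a \<in> V" using x ab \<open>- b \<in> h\<close> by (auto simp: V_def)
      ultimately show "cform ip (c, 0) x = 0" using c(2) by (simp add: ab cform_def ip_simps complex_eq_iff)
    qed
    hence "ip c u = 0" using u(2) by (simp add: A_def)
    thus False using c(3) by simp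
  qed
  then obtain w where "w \<in> h" "(w, u) \<in> D" by (auto simp: V_def)
  thus ?thesis using subspace_neg[OF h_sub] by (intro bexI[of _ "- w"]) auto
qed

text \<open>\<open>h_decompose\<close> leaves each \<open>w i\<close> free up to an element of
  \<open>A\<close>. Isotropy of \<open>D\<close> makes the defect \<open>q\<close> of the required
  symmetry antisymmetric, and such a defect can be absorbed by elements of \<open>A\<close>. The
  symmetry is what makes the B-field of the gauge map real.\<close>

lemma gauge_data:
  assumes v': "\<And>i. i < p \<Longrightarrow> v' i \<in> h" "\<And>i j. i < p \<Longrightarrow> j < p \<Longrightarrow> ip (v' i) (v' j) = 0"
    "\<And>k j. k < p \<Longrightarrow> j < p \<Longrightarrow> ip (ah k) (v' j) = (if j = k then 1 else 0)"
  shows "\<exists>w. \<forall>i<p. w i \<in> h \<and> (- w i, v' i - v i) \<in> D \<and> (\<forall>j<p. ip (w j) (v' i) = ip (w i) (v j))"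
proof -
  define u where "u = (\<lambda>i. v' i - v i)"
  have "\<exists>w\<in>h. (- w, u i) \<in> D" if i: "i < p" for i
  proof (rule h_decompose)
    show "u i \<in> h" unfolding u_def by (rule subspace_diff[OF h_sub v'(1)[OF i] v_h[OF i]])
    show "ip a (u i) = 0" if "a \<in> A" for a
      by (rule A_perp_S[OF _ that]) (simp add: u_def ip_simps v'(3) ah(3) i)
  qed
  then obtain w where w: "\<And>i. i < p \<Longrightarrow> w i \<in> h" "\<And>i. i < p \<Longrightarrow> (- w i, u i) \<in> D" by metis
  define q where "q = (\<lambda>i j. ip (w j) (v' i) - ip (w i) (v j))"
  have q: "q i j = - q j i" if ij: "i < p" "j < p" for i j
  proof -
    have "Im (cform ip (- w i, u i) (- w j, u j)) = 0" using D_iso[OF w(2)[OF ij(1)] w(2)[OF ij(2)]] by simp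
    hence "ip (w i) (u j) + ip (u i) (w j) = 0" by (simp add: cform_def ip_simps)
    thus ?thesis using ip_sym[of "v' i" "w j"] ip_sym[of "v i" "w j"] by (simp add: q_def u_def ip_simps)
  qed
  \<comment> \<open>The correction changes the defect by
    \<open>ip (a j) (v' i) - ip (a i) (v j)\<close>, and each of the two terms removes one half of
    it.\<close>
  define a where "a = (\<lambda>i. \<Sum>k<p. (q i k / 2) *\<^sub>R ah k)"
  have aA: "a i \<in> A" for i unfolding a_def
    by (intro subspace_sum[OF A_sub] subspace_scale[OF A_sub] ah(1)) simp
  have av: "ip (a i) x = q i j / 2" if j: "j < p" and x: "\<And>k. k < p \<Longrightarrow> ip (ah k) x = (if j = k then 1 else 0)" for i j x
  proof -
    have l: "linear (\<lambda>y. ip y x)" using ip_bil by (simp add: bilinear_def)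
    have "ip (a i) x = (\<Sum>k<p. q i k / 2 * ip (ah k) x)"
      unfolding a_def by (simp only: linear_sum[OF l] linear_scale[OF l] real_scaleR_def)
    also have "... = (\<Sum>k<p. if k = j then q i k / 2 else 0)" by (intro sum.cong refl) (auto simp: x)
    finally show ?thesis using j by simp
  qed
  have "w i + a i \<in> h \<and> (- (w i + a i), v' i - v i) \<in> D \<and> (\<forall>j<p. ip (w j + a j) (v' i) = ip (w i + a i) (v j))"
    if i: "i < p" for i
  proof (intro conjI allI impI)
    show "w i + a i \<in> h" using subspace_add[OF h_sub w(1)[OF i]] aA A_h by blast
    have "(- w i, u i) - (a i, 0) \<in> D"
      using subspace_diff[OF csubspace_real[OF D_sub] w(2)[OF i], of "(a i, 0)"] aA[of i] by (simp add: A_def)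
    thus "(- (w i + a i), v' i - v i) \<in> D" by (simp add: u_def)
    fix j assume j: "j < p"
    have 1: "ip (a j) (v' i) = q j i / 2" by (rule av[OF i]) (simp add: v'(3) i)
    have 2: "ip (a i) (v j) = q i j / 2" by (rule av[OF j]) (simp add: ah(3) j)
    show "ip (w j + a j) (v' i) = ip (w i + a i) (v j)"
      using q[OF i j] by (simp add: ip_simps 1 2) (simp add: q_def)
  qed
  thus ?thesis by (intro exI[of _ "\<lambda>i. w i + a i"]) blast
qed

text \<open>The difference of both sides lies in \<open>A\<close> and is orthogonal to
  \<open>S\<close>.\<close>

lemma A_expand:
  assumes a: "a \<in> A"
  shows "a = (\<Sum>k<p. ip a (v k) *\<^sub>R ah k)"
proof -
  let ?b = "a - (\<Sum>k<p. ip a (v k) *\<^sub>R ah k)"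
  have b: "?b \<in> A"
    by (intro subspace_diff[OF A_sub] a subspace_sum[OF A_sub] subspace_scale[OF A_sub] ah(1)) simp
  have bv: "ip (v j) ?b = 0" if j: "j < p" for j
  proof -
    have l: "linear (ip (v j))" using ip_bil by (simp add: bilinear_def)
    have "ip (v j) (\<Sum>k<p. ip a (v k) *\<^sub>R ah k) = (\<Sum>k<p. ip a (v k) * ip (v j) (ah k))"
      by (simp only: linear_sum[OF l] linear_scale[OF l] real_scaleR_def)
    also have "... = (\<Sum>k<p. if k = j then ip a (v k) else 0)"
    proof (intro sum.cong refl)
      fix k assume "k \<in> {..<p}"
      thus "ip a (v k) * ip (v j) (ah k) = (if k = j then ip a (v k) else 0)"
        using ah(3)[of k j] j ip_sym[of "v j" "ah k"] by simp
    qed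
    finally show ?thesis using j ip_sym[of "v j" a] by (simp add: ip_simps)
  qed
  have "?b = 0"
  proof (rule A_S[OF b])
    show "?b \<in> h" using b A_h by blast
    have "S \<subseteq> {x. ip x ?b = 0}"
    proof (rule span_minimal)
      show "v ` {..<p} \<subseteq> {x. ip x ?b = 0}" using bv by blast
      show "subspace {x. ip x ?b = 0}" unfolding subspace_def by (simp only: mem_Collect_eq ip_simps) simp
    qed
    thus "ip x ?b = 0" if "x \<in> S" for x using that by blast
  qed
  thus ?thesis by simp
qed

lemma weights_Z:
  assumes "z \<in> Z"
  shows "\<exists>l. \<forall>a\<in>h. cbracket br (a, 0) z = cscale (l a) z"
proof -
  have h0: "(a, 0) \<in> h \<times> h" if "a \<in> h" for a using that subspace_0[OF h_sub] by simp
  consider "z \<in> h \<times> h" | \<alpha> where "\<alpha> \<in> P" "z \<in> rs \<alpha>"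
    | \<alpha> e where "\<alpha> \<in> P" "e \<in> rs \<alpha>" "z = conj_vec e" using assms by (auto simp: Z_def)
  thus ?thesis
  proof cases
    case 1
    thus ?thesis using hC_abelian[OF h0] by (intro exI[of _ "\<lambda>a. 0"]) simp
  next
    case 2
    thus ?thesis using root_spaceD[OF 2(2) h0] by (intro exI[of _ "\<lambda>a. \<alpha> (a, 0)"]) simp
  next
    case 3
    thus ?thesis using root_conj[OF 3(2)] by (intro exI[of _ "\<lambda>a. cnj (\<alpha> (a, 0))"]) simp
  qed
qed

end

section \<open>Generalized complex structures in normal form\<close>

lemma normal_form_base_open:
  assumes B: "normal_form_base p q k B"
  shows "openin (Euclidean_space (p + 2 * q + 2 * k)) B" "0 \<in> B"
proof -
  let ?n = "p + 2 * q + 2 * k" let ?E = "Euclidean_space ?n"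
  obtain U1 U2 V where U: "openin (Euclidean_space p) U1" "0 \<in> U1" "openin (Euclidean_space (2 * q)) U2" "0 \<in> U2"
    "openin (top_of_set {z::nat \<Rightarrow> complex. \<forall>l\<ge>k. z l = 0}) V" "0 \<in> V"
    and Beq: "B = {v \<in> topspace ?E. (\<lambda>i. if i < p then v i else 0) \<in> U1 \<and>
              (\<lambda>j. if j < 2 * q then v (p + j) else 0) \<in> U2 \<and>
              (\<lambda>l. if l < k then Complex (v (p + 2 * q + 2 * l)) (v (p + 2 * q + 2 * l + 1)) else 0) \<in> V}"
    using B unfolding normal_form_base_def by blast
  have c: "continuous_map ?E euclideanreal (\<lambda>v. v i)" for i
    using continuous_map_coord[of ?n "topspace ?E"] by (simp add: subtopology_topspace)
  have 1: "openin ?E {v \<in> topspace ?E. (\<lambda>i. if i < p then v i else 0) \<in> U1}"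
    by (rule openin_continuous_map_preimage[OF _ U(1)])
      (simp add: continuous_map_componentwise_Euclidean_space c)
  have 2: "openin ?E {v \<in> topspace ?E. (\<lambda>j. if j < 2 * q then v (p + j) else 0) \<in> U2}"
    by (rule openin_continuous_map_preimage[OF _ U(3)])
      (simp add: continuous_map_componentwise_Euclidean_space c)
  let ?z = "\<lambda>v l. if l < k then Complex (v (p + 2 * q + 2 * l)) (v (p + 2 * q + 2 * l + 1)) else 0"
  have "continuous_map ?E (euclidean :: complex topology) (\<lambda>v. ?z v l)" for l
  proof (cases "l < k")
    case True
    have cc: "continuous_map euclideanreal (euclidean :: complex topology) of_real"
      by (simp add: continuous_on_of_real)
    have "continuous_map ?E (euclidean :: complex topology)
        (\<lambda>v. of_real (v (p + 2 * q + 2 * l)) + \<i> * of_real (v (p + 2 * q + 2 * l + 1)))"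
      using continuous_map_compose[OF c cc] by (intro continuous_map_add)
        (auto simp: o_def intro: continuous_map_compose[OF _ continuous_map_iff_continuous2[THEN iffD2, of "(*) \<i>"],
            unfolded o_def] continuous_on_mult_left continuous_on_id)
    thus ?thesis using True by (simp add: Complex_eq)
  next
    case False
    thus ?thesis by simp
  qed
  hence "continuous_map ?E (product_topology (\<lambda>i::nat. euclidean :: complex topology) UNIV) ?z"
    by (simp add: continuous_map_componentwise_UNIV)
  hence "continuous_map ?E (top_of_set {z::nat \<Rightarrow> complex. \<forall>l\<ge>k. z l = 0}) ?z"
    by (auto simp: continuous_map_in_subtopology euclidean_product_topology)
  from openin_continuous_map_preimage[OF this U(5)]
  have 3: "openin ?E {v \<in> topspace ?E. ?z v \<in> V}" .
  have "B = {v \<in> topspace ?E. (\<lambda>i. if i < p then v i else 0) \<in> U1} \<inter>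
      ({v \<in> topspace ?E. (\<lambda>j. if j < 2 * q then v (p + j) else 0) \<in> U2} \<inter> {v \<in> topspace ?E. ?z v \<in> V})"
    by (auto simp: Beq)
  thus "openin ?E B" using openin_Int[OF 1 openin_Int[OF 2 3]] by (simp only:)
  have z: "(\<lambda>i. if i < p then (0 :: nat \<Rightarrow> real) i else 0) = 0"
    "(\<lambda>j. if j < 2 * q then (0 :: nat \<Rightarrow> real) (p + j) else 0) = 0" "?z 0 = 0"
    by (auto simp: fun_eq_iff complex_eq_iff)
  have "0 \<in> topspace ?E" by (simp add: topspace_Euclidean_space)
  thus "0 \<in> B" unfolding Beq mem_Collect_eq z using U(2,4,6) by blast
qed

lemma coord_form_simps:
  "coord_form i (X + Y) = coord_form i X + coord_form i Y"
  "coord_form i (cscale c X) = c * coord_form i X"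
  by (simp_all add: coord_form_def cscale_def complex_eq_iff plus_fun_def fun_diff_def scaleR_fun_def)

lemma coord_form_zero: "coord_form i 0 = 0" using coord_form_simps(2)[of i 0 0] by simp

lemma Re_coord_form: "Re (coord_form i X) = coords (fst X) i" "Im (coord_form i X) = coords (snd X) i"
  by (simp_all add: coord_form_def coords_def)

lemma csubspace_product:
  assumes "subspace T"
  shows "csubspace (T \<times> T)"
  using assms by (auto simp: cplx.subspace_def subspace_def cscale_def zero_prod_def
      intro!: subspace_add subspace_diff subspace_scale)

lemma complex_tangent_eq_sum:
  assumes x: "x \<in> ER n"
    and X: "X \<in> TR n x \<times> TR n x"
  shows "X = (\<Sum>i<n. cscale (coord_form i X) (cvec n x i, 0))"
proof -
  have 1: "fst X \<in> TR n x" "snd X \<in> TR n x" using X by auto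
  show ?thesis using tangent_eq_sum[OF x 1(1)] tangent_eq_sum[OF x 1(2)]
    by (simp add: prod_eq_iff fst_sum snd_sum cscale_def coord_form_def)
qed

text \<open>\<open>W\<close> is the annihilator of the forms dz^l. The equation is dz^l = 0
  multiplied by \<i> and solved for the second component; in this form membership can be tested by
  components.\<close>

lemma normal_form_W_iff:
  assumes x: "x \<in> ER n" and n: "n = p + 2 * q + 2 * k"
  shows "X \<in> normal_form_W (Rn n) p q k x \<longleftrightarrow> X \<in> TR n x \<times> TR n x \<and>
    (\<forall>l<k. coord_form (p + 2 * q + 2 * l + 1) X = \<i> * coord_form (p + 2 * q + 2 * l) X)"
    (is "X \<in> ?W \<longleftrightarrow> X \<in> ?T \<times> ?T \<and> ?P X")
proof
  let ?v = "cvec n x"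
  have T: "subspace ?T" by (rule subspace_tangent_Rn[OF x])
  have cv: "?v i (\<lambda>y. y j) = (if j = i then 1 else 0)" if "i < n" "j < n" for i j
    by (rule coord_vector_coord[OF x that])
  have cf: "coord_form j (?v i, 0) = (if j = i then 1 else 0)" "coord_form j (0, ?v i) = (if j = i then \<i> else 0)"
    if "i < n" "j < n" for i j using cv[OF that] by (simp_all add: coord_form_def complex_eq_iff)
  have anti: "antiholomorphic_vector (Rn n) x a b = cscale (1 / 2) ((?v a, 0) + cscale \<i> (?v b, 0))" for a b
    by (simp add: antiholomorphic_vector_def prod_eq_iff)
  have zero_P: "?P (?v i, 0)" if i: "i < p + 2 * q" for i
  proof (intro allI impI)
    fix l assume l: "l < k"
    have n': "i < n" "p + 2 * q + 2 * l < n" "p + 2 * q + 2 * l + 1 < n" using i l n by simp_all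
    show "coord_form (p + 2 * q + 2 * l + 1) (?v i, 0) = \<i> * coord_form (p + 2 * q + 2 * l) (?v i, 0)"
      using i unfolding cf(1)[OF n'(1,2)] cf(1)[OF n'(1,3)] by simp
  qed
  show "X \<in> ?T \<times> ?T \<and> ?P X" if "X \<in> ?W"
  proof -
    have "?W \<subseteq> {X \<in> ?T \<times> ?T. ?P X}" unfolding normal_form_W_def
    proof (rule cplx.span_minimal)
      show "csubspace {X \<in> ?T \<times> ?T. ?P X}"
      proof (rule cplx.subspaceI)
        note C = csubspace_product[OF T]
        show "0 \<in> {X \<in> ?T \<times> ?T. ?P X}" using cplx.subspace_0[OF C] by (simp add: coord_form_zero)
        show "X + Y \<in> {X \<in> ?T \<times> ?T. ?P X}" if "X \<in> {X \<in> ?T \<times> ?T. ?P X}" "Y \<in> {X \<in> ?T \<times> ?T. ?P X}" for X Y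
          using that cplx.subspace_add[OF C, of X Y] by (simp add: coord_form_simps distrib_left)
        show "cscale c X \<in> {X \<in> ?T \<times> ?T. ?P X}" if "X \<in> {X \<in> ?T \<times> ?T. ?P X}" for c X
          using that cplx.subspace_scale[OF C, of X c] by (simp add: coord_form_simps mult.left_commute)
      qed
      show "{(?v i, 0) |i. i < p} \<union> {(?v (p + j), 0) |j. j < 2 * q} \<union>
          {antiholomorphic_vector (Rn n) x (p + 2 * q + 2 * l) (p + 2 * q + 2 * l + 1) |l. l < k}
          \<subseteq> {X \<in> ?T \<times> ?T. ?P X}"
      proof (intro Un_least subsetI; elim CollectE exE conjE; hypsubst; rule CollectI)
        fix i assume i: "i < p"
        thus "(?v i, 0) \<in> ?T \<times> ?T \<and> ?P (?v i, 0)"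
          using coord_vector_tangent[OF x, of i] subspace_0[OF T] zero_P[of i] n by auto
      next
        fix j assume "j < 2 * q"
        thus "(?v (p + j), 0) \<in> ?T \<times> ?T \<and> ?P (?v (p + j), 0)"
          using coord_vector_tangent[OF x, of "p + j"] subspace_0[OF T] zero_P[of "p + j"] n by auto
      next
        fix l assume l: "l < k"
        let ?a = "p + 2 * q + 2 * l" and ?b = "p + 2 * q + 2 * l + 1"
        have ab: "?a < n" "?b < n" using l n by simp_all
        have "(?v ?a, 0) \<in> ?T \<times> ?T" "(?v ?b, 0) \<in> ?T \<times> ?T"
          using ab by (simp_all add: coord_vector_tangent[OF x] subspace_0[OF T])
        hence 1: "antiholomorphic_vector (Rn n) x ?a ?b \<in> ?T \<times> ?T" unfolding anti
          by (intro cplx.subspace_scale[OF csubspace_product[OF T]] cplx.subspace_add[OF csubspace_product[OF T]])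
        have "?P (antiholomorphic_vector (Rn n) x ?a ?b)"
        proof (intro allI impI)
          fix m assume m: "m < k"
          let ?c = "p + 2 * q + 2 * m" and ?d = "p + 2 * q + 2 * m + 1"
          have cd: "?c < n" "?d < n" using m n by simp_all
          have neq: "?d \<noteq> ?a" "?c \<noteq> ?b" by presburger+
          have "coord_form ?c (?v ?a, 0) = (if m = l then 1 else 0)" "coord_form ?d (?v ?b, 0) = (if m = l then 1 else 0)"
            "coord_form ?c (?v ?b, 0) = 0" "coord_form ?d (?v ?a, 0) = 0"
            using cf(1)[OF ab(1) cd(1)] cf(1)[OF ab(1) cd(2)] cf(1)[OF ab(2) cd(1)] cf(1)[OF ab(2) cd(2)] neq by simp_all
          thus "coord_form ?d (antiholomorphic_vector (Rn n) x ?a ?b) =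
              \<i> * coord_form ?c (antiholomorphic_vector (Rn n) x ?a ?b)"
            unfolding anti coord_form_simps by simp
        qed
        with 1 show "antiholomorphic_vector (Rn n) x ?a ?b \<in> ?T \<times> ?T \<and>
            ?P (antiholomorphic_vector (Rn n) x ?a ?b)" by blast
      qed
    qed
    with that show ?thesis by blast
  qed
  show "X \<in> ?W" if r: "X \<in> ?T \<times> ?T \<and> ?P X"
  proof -
    have W: "csubspace ?W" by (simp add: normal_form_W_def)
    let ?f = "\<lambda>i. cscale (coord_form i X) (?v i, 0)"
    \<comment> \<open>The last \<open>2 * k\<close> coordinates are grouped in pairs, each
      contributing a multiple of one antiholomorphic vector.\<close>
    have split: "(\<Sum>i<m + 2 * r. g i) = (\<Sum>i<m. g i) + (\<Sum>l<r. g (m + 2 * l) + g (m + 2 * l + 1))"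
      for m r and g :: "nat \<Rightarrow> 'v::comm_monoid_add" by (induction r) (simp_all add: algebra_simps)
    have X: "X = (\<Sum>i<p + 2 * q. ?f i) + (\<Sum>l<k. ?f (p + 2 * q + 2 * l) + ?f (p + 2 * q + 2 * l + 1))"
      using complex_tangent_eq_sum[OF x conjunct1[OF r]] split[of ?f "p + 2 * q" k] n by simp
    have 1: "?f i \<in> ?W" if "i < p + 2 * q" for i
    proof (rule cplx.subspace_scale[OF W], cases "i < p")
      case True
      thus "(?v i, 0) \<in> ?W" unfolding normal_form_W_def by (intro cplx.span_base) blast
    next
      case False
      with that have "(?v i, 0) \<in> {(?v (p + j), 0) |j. j < 2 * q}" by (auto intro!: exI[of _ "i - p"])
      thus "(?v i, 0) \<in> ?W" unfolding normal_form_W_def by (intro cplx.span_base) blast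
    qed
    have 2: "?f (p + 2 * q + 2 * l) + ?f (p + 2 * q + 2 * l + 1) \<in> ?W" if l: "l < k" for l
    proof -
      let ?a = "p + 2 * q + 2 * l" and ?b = "p + 2 * q + 2 * l + 1"
      have "?f ?a + ?f ?b = cscale (2 * coord_form ?a X) (antiholomorphic_vector (Rn n) x ?a ?b)"
        using r l by (simp add: anti cplx.scale_right_distrib mult.commute)
      also have "... \<in> ?W"
        unfolding normal_form_W_def using l by (intro cplx.span_scale cplx.span_base) blast
      finally show ?thesis .
    qed
    show ?thesis by (subst X) (intro cplx.subspace_add[OF W] cplx.subspace_sum[OF W] 1 2; simp)
  qed
qed

text \<open>With s = \<sigma>(X) + r the argument \<sigma>(X) + 2r of the defining condition becomes
  2s - \<sigma>(X), so the parameter r can be eliminated in favour of the algebra part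
  itself.\<close>

lemma mem_L_space:
  "(e1, e2) \<in> L_space ip T W D \<sigma> \<epsilon> \<longleftrightarrow> (let X = (fst e1, fst e2) in
      X \<in> W \<and> cov e1 \<in> dual_space T \<and> cov e2 \<in> dual_space T \<and> (alg e1, alg e2) - \<sigma> X \<in> D \<and>
      (\<forall>Y\<in>W. cform (\<lambda>\<xi> Y. \<xi> Y) (cov e1, cov e2) Y =
         2 * \<epsilon> X Y - cform ip (\<sigma> Y) (cscale 2 (alg e1, alg e2) - \<sigma> X)))"
  (is "?l \<longleftrightarrow> ?r")
proof
  assume ?l
  then obtain X \<xi> r where "e1 = (fst X, fst \<xi>, fst (\<sigma> X + r))" "e2 = (snd X, snd \<xi>, snd (\<sigma> X + r))"
      "X \<in> W" "\<xi> \<in> dual_space T \<times> dual_space T" "r \<in> D"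
      "\<forall>Y\<in>W. cform (\<lambda>\<xi>' Y'. \<xi>' Y') \<xi> Y = 2 * \<epsilon> X Y - cform ip (\<sigma> Y) (\<sigma> X + cscale 2 r)"
    unfolding L_space_def by blast
  moreover have "cscale 2 (\<sigma> X + r) - \<sigma> X = \<sigma> X + cscale 2 r" by (simp add: prod_eq_iff scaleR_2)
  moreover have "(fst (\<sigma> X + r), snd (\<sigma> X + r)) = \<sigma> X + r" by (rule prod.collapse)
  ultimately show ?r unfolding Let_def
    by (simp only: fst_conv snd_conv mem_Times_iff prod.collapse add_diff_cancel_left' simp_thms ball_simps)
next
  assume r: ?r
  define X where "X = (fst e1, fst e2)"
  define \<xi> where "\<xi> = (cov e1, cov e2)"
  define s where "s = (alg e1, alg e2)"
  have "\<sigma> X + cscale 2 (s - \<sigma> X) = cscale 2 s - \<sigma> X" by (simp add: prod_eq_iff scaleR_2 algebra_simps)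
  hence "(fst X, fst \<xi>, fst (\<sigma> X + (s - \<sigma> X))) = e1 \<and> (snd X, snd \<xi>, snd (\<sigma> X + (s - \<sigma> X))) = e2 \<and>
      X \<in> W \<and> \<xi> \<in> dual_space T \<times> dual_space T \<and> s - \<sigma> X \<in> D \<and>
       (\<forall>Y\<in>W. cform (\<lambda>\<xi>' Y'. \<xi>' Y') \<xi> Y = 2 * \<epsilon> X Y - cform ip (\<sigma> Y) (\<sigma> X + cscale 2 (s - \<sigma> X)))"
    using r by (simp add: Let_def X_def \<xi>_def s_def)
  thus ?l unfolding L_space_def mem_Collect_eq by metis
qed

text \<open>If \<open>m\<close> were smaller than \<open>n\<close>, the inverse of \<open>h\<close>
  would be a continuous injection of an open set of the larger space into that space, so
  \<open>S\<close> would be open there by invariance of domain; but its points all vanish at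
  coordinate \<open>m\<close>.\<close>

lemma open_bijection_dimension_le:
  assumes S: "opn m S" "S \<noteq> {}" and S': "opn n (h ` S)"
    and inj: "inj_on h S"
    and o: "\<And>V. V \<subseteq> S \<Longrightarrow> opn m V \<Longrightarrow> opn n (h ` V)"
  shows "n \<le> m"
proof (rule ccontr)
  assume "\<not> n \<le> m"
  hence mn: "m < n" by simp
  let ?g = "inv_into S h"
  have SE: "S \<subseteq> ER m" using S(1) openin_subset by blast
  have sub: "ER m \<subseteq> ER n" using mn by (auto simp: topspace_Euclidean_space)
  have "continuous_map (subtopology (Euclidean_space n) (h ` S)) (Euclidean_space m) ?g"
    unfolding continuous_map_def
  proof (intro conjI allI impI)
    show "?g \<in> topspace (subtopology (Euclidean_space n) (h ` S)) \<rightarrow> ER m" using SE inj by auto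
    fix V assume V: "opn m V"
    have "{x \<in> topspace (subtopology (Euclidean_space n) (h ` S)). ?g x \<in> V} = h ` (S \<inter> V)"
      using openin_subset[OF S'] inj by (auto simp: inv_into_f_f)
    moreover have "openin (subtopology (Euclidean_space n) (h ` S)) (h ` (S \<inter> V))"
      using o[of "S \<inter> V"] openin_Int[OF S(1) V] openin_open_subtopology[OF S'] by auto
    ultimately show "openin (subtopology (Euclidean_space n) (h ` S))
        {x \<in> topspace (subtopology (Euclidean_space n) (h ` S)). ?g x \<in> V}" by simp
  qed
  hence "continuous_map (subtopology (Euclidean_space n) (h ` S)) (Euclidean_space n) ?g"
    using mn by (simp add: continuous_map_componentwise_Euclidean_space continuous_map_in_subtopology
        Euclidean_space_def continuous_map_componentwise_UNIV Pi_iff)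
  from invariance_of_domain_Euclidean_space[OF S' this inj_on_inv_into[OF order_refl]]
  have "opn n (?g ` h ` S)" .
  moreover have "?g ` h ` S = S" using inj by (auto simp: inv_into_f_f image_image)
  ultimately have So: "opn n S" by simp
  obtain x where x: "x \<in> S" using S(2) by blast
  \<comment> \<open>The zero function serves merely to extract a box inside
    \<open>S\<close>.\<close>
  obtain d where d: "d > 0"
    "\<And>y. y \<in> ER n \<Longrightarrow> (\<And>i. i < n \<Longrightarrow> \<bar>y i - x i\<bar> < d) \<Longrightarrow> y \<in> S \<and> \<bar>(0::real) - 0\<bar> < 1"
    by (rule continuous_map_Euclidean_epsilon[OF So x, of "\<lambda>_. 0" 1]) auto
  have "x(m := x m + d / 2) \<in> S"
    using d(2)[of "x(m := x m + d / 2)"] d(1) mn x sub SE by (auto simp: topspace_Euclidean_space)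
  from subsetD[OF SE this] subsetD[OF SE x] have "(x(m := x m + d / 2)) m = 0" "x m = 0"
    unfolding topspace_Euclidean_space by blast+
  thus False using d(1) by simp
qed

text \<open>Only open sets are compared: a chart combined with \<open>f\<close> carries them in both
  directions, so the dimension bound applies twice.\<close>

lemma local_iso_dimension:
  assumes i: "local_iso M U E (Rn n) U' E' f g \<Phi>" and M: "smooth_manifold M" and x: "x \<in> U"
  shows "mdim M = n"
proof -
  note d = local_isoD[OF i]
  have P: "proper_charts M" by (rule smooth_manifold_proper_charts[OF M])
  note Mu = M[unfolded smooth_manifold_def]
  have "x \<in> \<Union> (fst ` charts M)"
    using Mu[THEN conjunct2, THEN conjunct2, THEN conjunct1] x openin_subset[OF d(1)] by (simp add: subset_iff)
  then obtain V \<phi> where c: "(V, \<phi>) \<in> charts M" "x \<in> V" by auto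
  note pc = proper_chartsD[OF P c(1)]
  let ?W = "U \<inter> V"
  let ?h = "\<lambda>w. f (inv_into V \<phi> w)"
  have W: "openM M ?W" by (rule openin_Int[OF d(1) pc(1)])
  have inv: "inv_into V \<phi> ` \<phi> ` Y = Y" if "Y \<subseteq> V" for Y
  proof -
    have "(\<lambda>w. inv_into V \<phi> (\<phi> w)) ` Y = (\<lambda>w. w) ` Y"
      using inv_into_f_f[OF pc(2)] that by (intro image_cong refl) blast
    thus ?thesis by (simp add: image_image)
  qed
  have hW: "?h ` \<phi> ` Y = f ` Y" if "Y \<subseteq> V" for Y
  proof -
    have "?h ` \<phi> ` Y = f ` inv_into V \<phi> ` \<phi> ` Y" by (simp only: image_image)
    thus ?thesis by (simp only: inv[OF that])
  qed
  have ofW: "opn n (f ` ?W)" using d(5)[of ?W] W by simp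
  have opW: "openin (Euclidean_space (mdim M)) (\<phi> ` ?W)" using pc(3)[OF d(1)] .
  have injf: "inj_on f U" by (rule inj_on_inverseI[of U g]) (rule d(4))
  have fv: "inv_into V \<phi> w \<in> ?W" "\<phi> (inv_into V \<phi> w) = w" if "w \<in> \<phi> ` ?W" for w
  proof -
    obtain y where y: "y \<in> ?W" "w = \<phi> y" using \<open>w \<in> \<phi> ` ?W\<close> by blast
    hence "inv_into V \<phi> w = y" using inv_into_f_f[OF pc(2), of y] by simp
    thus "inv_into V \<phi> w \<in> ?W" "\<phi> (inv_into V \<phi> w) = w" using y by simp_all
  qed
  have phi_open: "openM M Y \<longleftrightarrow> openin (Euclidean_space (mdim M)) (\<phi> ` Y)" if "Y \<subseteq> ?W" for Y
  proof
    assume "openM M Y"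
    moreover have "Y \<inter> V = Y" using that by blast
    ultimately show "openin (Euclidean_space (mdim M)) (\<phi> ` Y)" using pc(3)[of Y] by simp
  next
    assume o: "openin (Euclidean_space (mdim M)) (\<phi> ` Y)"
    have "homeomorphic_map (subtopology (mtop M) V) (subtopology (Euclidean_space (mdim M)) (\<phi> ` V)) \<phi>"
      using bspec[OF Mu[THEN conjunct2, THEN conjunct2, THEN conjunct2, THEN conjunct1] c(1)] by simp
    hence h: "openin (subtopology (mtop M) V) Y \<longleftrightarrow> openin (subtopology (Euclidean_space (mdim M)) (\<phi> ` V)) (\<phi> ` Y)"
      using that openin_subset[OF pc(1)] by (intro homeomorphic_map_openness[symmetric]) auto
    have oV: "openin (Euclidean_space (mdim M)) (\<phi> ` V)" using pc(3)[OF pc(1)] by simp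
    have Y: "\<phi> ` Y \<subseteq> \<phi> ` V" using that by (intro image_mono) blast
    have "openin (subtopology (Euclidean_space (mdim M)) (\<phi> ` V)) (\<phi> ` Y)"
      by (rule openin_open_subtopology[OF oV, THEN iffD2, OF conjI[OF o Y]])
    thus "openM M Y"
      by (rule openin_open_subtopology[OF pc(1), THEN iffD1, THEN conjunct1, OF h[THEN iffD2]])
  qed
  have "n \<le> mdim M"
  proof (rule open_bijection_dimension_le[OF opW])
    show "\<phi> ` ?W \<noteq> {}" using x c(2) by blast
    show "opn n (?h ` \<phi> ` ?W)" using ofW hW[of ?W] by simp
    show "inj_on ?h (\<phi> ` ?W)"
    proof (rule inj_onI)
      fix a b assume ab: "a \<in> \<phi> ` ?W" "b \<in> \<phi> ` ?W" "?h a = ?h b"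
      have "inv_into V \<phi> a = inv_into V \<phi> b"
        by (rule inj_onD[OF injf ab(3) IntD1[OF fv(1)[OF ab(1)]] IntD1[OF fv(1)[OF ab(2)]]])
      hence "\<phi> (inv_into V \<phi> a) = \<phi> (inv_into V \<phi> b)" by (rule arg_cong)
      thus "a = b" unfolding fv(2)[OF ab(1)] fv(2)[OF ab(2)] .
    qed
    fix Y assume Y: "Y \<subseteq> \<phi> ` ?W" "openin (Euclidean_space (mdim M)) Y"
    let ?Z = "inv_into V \<phi> ` Y"
    have "(\<lambda>w. \<phi> (inv_into V \<phi> w)) ` Y = (\<lambda>w. w) ` Y" using fv(2) Y(1) by (intro image_cong refl) blast
    hence Z: "?Z \<subseteq> ?W" "\<phi> ` ?Z = Y" using fv(1) Y(1) by (auto simp: image_image)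
    hence "openM M ?Z" using phi_open Y(2) by simp
    hence "opn n (f ` ?Z)" using d(5)[of ?Z] Z(1) by simp
    thus "opn n (?h ` Y)" by (simp add: image_image)
  qed
  moreover have "mdim M \<le> n"
  proof (rule open_bijection_dimension_le[OF ofW, of _ "\<lambda>y. \<phi> (g y)"])
    have gf: "g (f w) = w" if "w \<in> ?W" for w using d(4) that by simp
    have im: "(\<lambda>y. \<phi> (g y)) ` f ` Y = \<phi> ` Y" if "Y \<subseteq> ?W" for Y
      unfolding image_image using gf that by (intro image_cong refl) (simp add: subset_iff)
    show "f ` ?W \<noteq> {}" using x c(2) by blast
    show "openin (Euclidean_space (mdim M)) ((\<lambda>y. \<phi> (g y)) ` f ` ?W)" using opW im[of ?W] by simp
    show "inj_on (\<lambda>y. \<phi> (g y)) (f ` ?W)"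
    proof (rule inj_onI)
      fix a b assume "a \<in> f ` ?W" "b \<in> f ` ?W" and e: "\<phi> (g a) = \<phi> (g b)"
      then obtain y z where yz: "y \<in> ?W" "a = f y" "z \<in> ?W" "b = f z" by blast
      have "\<phi> y = \<phi> z" using e unfolding yz(2,4) gf[OF yz(1)] gf[OF yz(3)] .
      from inj_onD[OF pc(2) this IntD2[OF yz(1)] IntD2[OF yz(3)]] show "a = b" using yz(2,4) by (simp only:)
    qed
    fix Y assume Y: "Y \<subseteq> f ` ?W" "opn n Y"
    then obtain Z where Z: "Z \<subseteq> ?W" "Y = f ` Z" by (auto simp: subset_image_iff)
    hence "openM M Z" using d(5)[of Z] Y(2) by auto
    thus "openin (Euclidean_space (mdim M)) ((\<lambda>y. \<phi> (g y)) ` Y)"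
      using phi_open[OF Z(1)] im[OF Z(1)] Z(2) by simp
  qed
  ultimately show ?thesis by simp
qed

lemma complex_covector_exists:
  assumes x: "x \<in> ER n"
    and \<psi>: "\<And>X Y. \<psi> (X + Y) = \<psi> X + \<psi> Y" "\<And>c X. \<psi> (cscale c X) = c * (\<psi> X :: complex)"
  obtains \<xi>1 \<xi>2 where "\<xi>1 \<in> dual_space (TR n x)"
    "\<xi>2 \<in> dual_space (TR n x)"
    "\<And>Y. Y \<in> TR n x \<times> TR n x \<Longrightarrow> cform (\<lambda>\<xi> Y. \<xi> Y) (\<xi>1, \<xi>2) Y = \<psi> Y"
proof -
  let ?c = "\<lambda>j. \<psi> (cvec n x j, 0)"
  have zero: "\<psi> 0 = 0" using \<psi>(2)[of 0 0] by simp
  have sum: "\<psi> (\<Sum>j\<in>I. f j) = (\<Sum>j\<in>I. \<psi> (f j))" for I :: "nat set" and f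
    by (induction I rule: infinite_finite_induct) (simp_all add: \<psi>(1) zero)
  have 1: "cform (\<lambda>\<xi> Y. \<xi> Y) (covec n x (\<lambda>j. Re (?c j)), covec n x (\<lambda>j. Im (?c j))) Y = \<psi> Y"
    if Y: "Y \<in> TR n x \<times> TR n x" for Y
  proof -
    have T: "fst Y \<in> TR n x" "snd Y \<in> TR n x" using Y by auto
    have "\<psi> Y = \<psi> (\<Sum>i<n. cscale (coord_form i Y) (cvec n x i, 0))"
      by (rule arg_cong[of _ _ \<psi>, OF complex_tangent_eq_sum[OF x Y]])
    also have "... = (\<Sum>i<n. coord_form i Y * ?c i)" by (simp only: sum \<psi>(2))
    finally show ?thesis
      using T by (simp add: complex_eq_iff cform_def covec_def coord_form_def sum_subtractf sum.distrib)
  qed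
  show thesis by (rule that[OF covec_dual[OF x] covec_dual[OF x] 1])
qed

lemma normal_form_sigma_simps:
  "normal_form_sigma p v (X + Y) = normal_form_sigma p v X + normal_form_sigma p v Y"
  "normal_form_sigma p v (cscale c X) = cscale c (normal_form_sigma p v X)"
  by (simp_all add: normal_form_sigma_def coord_form_simps cplx.scale_left_distrib sum.distrib
      cplx.scale_sum_right algebra_simps del: cplx.scale_scale)
    (simp_all add: mult.assoc mult.left_commute)

lemma normal_form_sigma_zero: "normal_form_sigma p v 0 = 0"
  using normal_form_sigma_simps(2)[of p v 0 0] by simp

lemma normal_form_eps_simps:
  "normal_form_eps p q X (Y + Z) = normal_form_eps p q X Y + normal_form_eps p q X Z"
  "normal_form_eps p q X (cscale c Y) = c * normal_form_eps p q X Y"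
  by (simp_all add: normal_form_eps_def coord_form_simps sum_distrib_left sum.distrib[symmetric] algebra_simps)

text \<open>The base set \<open>B\<close> is kept apart from the algebroid, which is taken over all
  of coordinate space; \<open>J\<close> is recorded by its properties at the points of
  \<open>B\<close>, and \<open>hol\<close> identifies its eigenspaces.\<close>

locale nf_structure = lie_form br ip
  for br :: "'g::real_vector \<Rightarrow> 'g \<Rightarrow> 'g" and ip +
  fixes p q k n :: nat and D :: "('g \<times> 'g) set" and v :: "nat \<Rightarrow> 'g" and B :: "(nat \<Rightarrow> real) set"
    and J :: "(nat \<Rightarrow> real) \<Rightarrow> (nat \<Rightarrow> real) tvec \<times> (nat \<Rightarrow> real) covec \<times> 'g \<Rightarrow>
      (nat \<Rightarrow> real) tvec \<times> (nat \<Rightarrow> real) covec \<times> 'g"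
  assumes n: "n = p + 2 * q + 2 * k" and B: "opn n B" "0 \<in> B"
    and nondeg: "(\<And>s. ip r s = 0) \<Longrightarrow> r = 0"
    and D_iso: "u \<in> D \<Longrightarrow> w \<in> D \<Longrightarrow> cform ip u w = 0"
    and D_sub: "csubspace D"
    and J: "x \<in> B \<Longrightarrow> linear_over (fibre (untw n br ip) x) (J x)"
      "x \<in> B \<Longrightarrow> a \<in> fibre (untw n br ip) x \<Longrightarrow> J x a \<in> fibre (untw n br ip) x"
      "x \<in> B \<Longrightarrow> a \<in> fibre (untw n br ip) x \<Longrightarrow> J x (J x a) = - a"
      "x \<in> B \<Longrightarrow> a \<in> fibre (untw n br ip) x \<Longrightarrow> b \<in> fibre (untw n br ip) x \<Longrightarrow>
        pairing (untw n br ip) x (J x a) b = - pairing (untw n br ip) x a (J x b)"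
    and hol: "x \<in> B \<Longrightarrow> holomorphic_bundle (untw n br ip) J x =
      L_space ip (TR n x) (normal_form_W (Rn n) p q k x) D (normal_form_sigma p v) (normal_form_eps p q)"
begin

abbreviation "T x \<equiv> TR n x"
abbreviation "F x \<equiv> fibre (untw n br ip) x"
abbreviation "W x \<equiv> normal_form_W (Rn n) p q k x"
abbreviation "\<sigma> \<equiv> normal_form_sigma p v"
abbreviation "\<epsilon> \<equiv> normal_form_eps p q"
abbreviation "L x \<equiv> L_space ip (T x) (W x) D \<sigma> \<epsilon>"
abbreviation "pr x \<equiv> pairing (untw n br ip) x"

section \<open>The (1,0)-bundle at a point and its Lagrangian property\<close>

lemma B_E: "x \<in> B \<Longrightarrow> x \<in> ER n" using openin_subset[OF B(1)] by blast

lemma L_iff: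
  assumes x: "x \<in> B"
  shows "(a, b) \<in> L x \<longleftrightarrow> a \<in> F x \<and> b \<in> F x \<and> J x a = - b \<and> J x b = a"
proof -
  have "cscale \<i> (a, b) = (- b, a)" by (simp add: cscale_def)
  thus ?thesis unfolding hol[OF x, symmetric] holomorphic_bundle_def by auto
qed

lemma F_sub: "x \<in> B \<Longrightarrow> subspace (F x)" using subspace_tangent_Rn[OF B_E]
  by (auto simp: untw_simps subspace_def dual_space_def linear_over_def fun_add_apply fun_scaleR_apply
      zero_prod_def algebra_simps)

lemma graph_in_L:
  assumes x: "x \<in> B" and a: "a \<in> F x"
  shows "(a, - J x a) \<in> L x"
proof -
  have "J x (- J x a) = - J x (J x a)" using J(1)[OF x] J(2)[OF x a] unfolding linear_over_def
    by (metis scaleR_minus1_left)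
  moreover have "- J x a \<in> F x" by (rule subspace_neg[OF F_sub[OF x] J(2)[OF x a]])
  ultimately show ?thesis using L_iff[OF x] a J(3)[OF x a] by simp
qed

lemma F_zero: "x \<in> B \<Longrightarrow> 0 \<in> T x" "x \<in> B \<Longrightarrow> 0 \<in> dual_space (T x)"
  using subspace_0[OF subspace_tangent_Rn[OF B_E]] by (simp_all add: dual_space_def linear_over_def)

lemma dual_zero:
  assumes x: "x \<in> B" and \<eta>: "\<eta> \<in> dual_space (T x)"
  shows "\<eta> 0 = 0"
proof -
  have "\<forall>c. \<forall>a\<in>T x. \<eta> (c *\<^sub>R a) = c *\<^sub>R \<eta> a" using \<eta> by (simp add: dual_space_def linear_over_def)
  from this[THEN spec, of 0] F_zero(1)[OF x] show ?thesis by auto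
qed

lemma pairing_nondeg:
  assumes x: "x \<in> B" and a: "a \<in> F x" and z: "\<And>b. b \<in> F x \<Longrightarrow> pr x a b = 0"
  shows "a = 0"
proof -
  obtain X \<xi> r where e: "a = (X, \<xi>, r)" by (cases a)
  have m: "X \<in> T x" "\<xi> \<in> dual_space (T x)" using a by (simp_all add: e untw_simps)
  note l0 = dual_zero[OF x]
  have "r = 0"
  proof (rule nondeg)
    fix s show "ip r s = 0" using z[of "(0, 0, s)"] l0[OF m(2)] F_zero[OF x] by (simp add: e untw_simps)
  qed
  moreover have "\<xi> Y = 0" for Y
  proof (cases "Y \<in> T x")
    case True
    thus ?thesis using z[of "(Y, 0, 0)"] F_zero[OF x] \<open>r = 0\<close> by (simp add: e untw_simps ip_simps)
  next
    case False
    thus ?thesis by (rule dual_space_zero[OF m(2)])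
  qed
  moreover have "X = 0"
  proof (rule tangent_eqI[OF B_E[OF x] m(1) F_zero(1)[OF x]])
    fix i assume i: "i < n"
    let ?c = "\<lambda>j. if j = i then 1 else 0 :: real"
    have "covec n x ?c X = (\<Sum>j<n. X (\<lambda>y. y j) * ?c j)" using m(1) by (simp add: covec_def)
    also have "... = X (\<lambda>y. y i)" using i by (simp add: if_distrib cong: if_cong)
    finally show "X (\<lambda>y. y i) = (0 :: (nat \<Rightarrow> real) tvec) (\<lambda>y. y i)"
      using z[of "(0, covec n x ?c, 0)"] F_zero[OF x] \<open>r = 0\<close> l0[OF m(2)] covec_dual[OF B_E[OF x], of ?c]
      by (simp add: e untw_simps ip_simps)
  qed
  ultimately show ?thesis by (simp add: e fun_eq_iff zero_prod_def)
qed

lemma pr_simps: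
  assumes "x \<in> B" "a \<in> F x" "b \<in> F x" "c \<in> F x"
  shows "pr x (a + b) c = pr x a c + pr x b c" "pr x (- a) c = - pr x a c"
    "pr x c (- a) = - pr x c a" "pr x a c = pr x c a"
proof -
  have m: "\<eta> (X + Y) = \<eta> X + \<eta> Y" "\<eta> (- X) = - \<eta> X" if "\<eta> \<in> dual_space (T x)" "X \<in> T x" "Y \<in> T x" for \<eta> X Y
  proof -
    have 1: "\<forall>c. \<forall>a\<in>T x. \<eta> (c *\<^sub>R a) = c *\<^sub>R \<eta> a" using that(1) by (simp add: dual_space_def linear_over_def)
    show "\<eta> (X + Y) = \<eta> X + \<eta> Y" using that by (simp add: dual_space_def linear_over_def)
    show "\<eta> (- X) = - \<eta> X" using 1[THEN spec, of "-1"] that(2) by simp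
  qed
  obtain X \<xi> r where a: "a = (X, \<xi>, r)" by (cases a)
  obtain Y \<eta> s where b: "b = (Y, \<eta>, s)" by (cases b)
  obtain Z \<theta> t where c: "c = (Z, \<theta>, t)" by (cases c)
  have f: "X \<in> T x" "\<xi> \<in> dual_space (T x)" "Y \<in> T x" "\<eta> \<in> dual_space (T x)" "Z \<in> T x" "\<theta> \<in> dual_space (T x)"
    using assms by (simp_all add: a b c untw_simps)
  show "pr x (a + b) c = pr x a c + pr x b c"
    using m(1)[OF f(6) f(1) f(3)] by (simp add: a b c untw_simps ip_simps fun_add_apply field_simps)
  show "pr x (- a) c = - pr x a c" "pr x c (- a) = - pr x c a"
    using m(2)[OF f(6) f(1) f(3)] by (simp_all add: a c untw_simps ip_simps fun_Compl_def field_simps)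
  show "pr x a c = pr x c a" by (simp add: a c untw_simps ip_sym)
qed

text \<open>The assumption is the real part of orthogonality to \<open>L x\<close>, which suffices
  because \<open>L x\<close> is complex. Testing against \<open>(c, - J x c)\<close> and using
  skewness of \<open>J\<close> makes \<open>a - J x b\<close> orthogonal to everything.\<close>

lemma L_perp:
  assumes x: "x \<in> B" and ab: "a \<in> F x" "b \<in> F x"
    and z: "\<And>c d. (c, d) \<in> L x \<Longrightarrow> pr x a c = pr x b d"
  shows "(a, b) \<in> L x"
proof -
  have "a + - J x b = 0"
  proof (rule pairing_nondeg[OF x])
    have Jb: "J x b \<in> F x" "- J x b \<in> F x" using J(2)[OF x ab(2)] subspace_neg[OF F_sub[OF x]] by blast+
    show "a + - J x b \<in> F x" by (rule subspace_add[OF F_sub[OF x] ab(1) Jb(2)])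
    fix c assume c: "c \<in> F x"
    have "pr x a c = pr x b (- J x c)" by (rule z[OF graph_in_L[OF x c]])
    also have "... = - pr x b (J x c)" by (rule pr_simps(3)[OF x J(2)[OF x c] J(2)[OF x c] ab(2)])
    also have "... = pr x (J x b) c" using J(4)[OF x ab(2) c] by simp
    finally show "pr x (a + - J x b) c = 0"
      using pr_simps(1)[OF x ab(1) Jb(2) c] pr_simps(2)[OF x Jb(1) Jb(1) c] by simp
  qed
  hence "J x b = a" by simp
  thus ?thesis using L_iff[OF x] ab J(3)[OF x ab(2)] by auto
qed

lemma W_T: "x \<in> B \<Longrightarrow> X \<in> W x \<Longrightarrow> X \<in> T x \<times> T x" using normal_form_W_iff[OF B_E n] by blast

text \<open>Orthogonality to the elements of \<open>L x\<close> over \<open>W x\<close> dictates the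
  covector; with it the vertical element is orthogonal to all of \<open>L x\<close> and therefore
  belongs to it.\<close>

lemma vertical_in_L:
  assumes x: "x \<in> B" and u: "\<And>w. w \<in> D \<Longrightarrow> cform ip u w = 0"
  obtains \<xi>1 \<xi>2 where "((0, \<xi>1, fst u), (0, \<xi>2, snd u)) \<in> L x"
proof -
  define \<psi> where "\<psi> = (\<lambda>Y. - 2 * cform ip u (\<sigma> Y))"
  have "\<psi> (X + Y) = \<psi> X + \<psi> Y" "\<psi> (cscale c X) = c * \<psi> X" for X Y c
    by (simp_all add: \<psi>_def normal_form_sigma_simps cip_add cip_scale distrib_left)
  then obtain \<xi>1 \<xi>2 where \<xi>: "\<xi>1 \<in> dual_space (T x)" "\<xi>2 \<in> dual_space (T x)"
    "\<And>Y. Y \<in> T x \<times> T x \<Longrightarrow> cform (\<lambda>\<xi> Y. \<xi> Y) (\<xi>1, \<xi>2) Y = \<psi> Y"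
    using complex_covector_exists[OF B_E[OF x], of \<psi>] by blast
  have "((0, \<xi>1, fst u), (0, \<xi>2, snd u)) \<in> L x"
  proof (rule L_perp[OF x])
    show "(0, \<xi>1, fst u) \<in> F x" "(0, \<xi>2, snd u) \<in> F x"
      using \<xi>(1,2) F_zero(1)[OF x] by (simp_all add: untw_simps)
    fix c d assume cd: "(c, d) \<in> L x"
    define X where "X = (fst c, fst d)"
    define s where "s = (alg c, alg d)"
    have 1: "X \<in> W x" "s - \<sigma> X \<in> D" using cd unfolding mem_L_space Let_def X_def s_def by blast+
    have F: "c \<in> F x" "d \<in> F x" using cd L_iff[OF x] by blast+
    have "cform ip u s = cform ip u (\<sigma> X + (s - \<sigma> X))" by simp
    also have "... = cform ip u (\<sigma> X)" using u[OF 1(2)] by (simp only: cip_add add_0_right)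
    finally have us: "cform ip u s = cform ip u (\<sigma> X)" .
    have "cform (\<lambda>\<xi> Y. \<xi> Y) (\<xi>1, \<xi>2) X = - 2 * cform ip u (\<sigma> X)"
      using \<xi>(3)[OF W_T[OF x 1(1)]] by (simp add: \<psi>_def)
    hence "cform (\<lambda>\<xi> Y. \<xi> Y) (\<xi>1, \<xi>2) X + 2 * cform ip u s = 0" using us by simp
    hence "Re (cform (\<lambda>\<xi> Y. \<xi> Y) (\<xi>1, \<xi>2) X) + 2 * Re (cform ip u s) = 0" by (simp add: complex_eq_iff)
    hence r: "\<xi>1 (fst c) - \<xi>2 (fst d) + 2 * (ip (fst u) (alg c) - ip (snd u) (alg d)) = 0"
      by (simp add: cform_def X_def s_def)
    have "cov c 0 = 0" "cov d 0 = 0" using F by (auto simp: untw_simps intro!: dual_zero[OF x])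
    thus "pr x (0, \<xi>1, fst u) c = pr x (0, \<xi>2, snd u) d"
      using r by (cases c, cases d) (simp add: untw_simps field_simps)
  qed
  thus thesis by (rule that)
qed

lemma vertical_L:
  assumes "((0, \<xi>1, u1), (0, \<xi>2, u2)) \<in> L x"
  shows "(u1, u2) \<in> D"
  using assms normal_form_sigma_zero[of p v] unfolding mem_L_space Let_def fst_conv snd_conv zero_prod_def[symmetric]
  by simp

text \<open>The Lagrangian property of \<open>L\<close> descends to its vertical part, whose algebra
  components form \<open>D\<close>.\<close>

lemma D_perp:
  assumes "\<And>w. w \<in> D \<Longrightarrow> cform ip u w = 0"
  shows "u \<in> D"
proof -
  obtain \<xi>1 \<xi>2 where "((0, \<xi>1, fst u), (0, \<xi>2, snd u)) \<in> L 0" by (rule vertical_in_L[OF B(2) assms])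
  hence "(fst u, snd u) \<in> D" by (rule vertical_L)
  thus ?thesis by (simp only: prod.collapse)
qed

text \<open>The element over \<open>X\<close> with r = 0. The condition on its covector is given by
  formulas that make sense on the whole complexified tangent space, so they define a suitable
  covector.\<close>

lemma W_lift:
  assumes x: "x \<in> B" and X: "X \<in> W x"
  obtains \<xi>1 \<xi>2 where "((fst X, \<xi>1, fst (\<sigma> X)), (snd X, \<xi>2, snd (\<sigma> X))) \<in> L x"
proof -
  define \<psi> where "\<psi> = (\<lambda>Y. 2 * \<epsilon> X Y - cform ip (\<sigma> Y) (\<sigma> X))"
  have "\<psi> (Z + Y) = \<psi> Z + \<psi> Y" "\<psi> (cscale c Y) = c * \<psi> Y" for Z Y c
    by (simp_all add: \<psi>_def normal_form_sigma_simps cip_add cip_scale normal_form_eps_simps algebra_simps)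
  then obtain \<xi>1 \<xi>2 where \<xi>: "\<xi>1 \<in> dual_space (T x)" "\<xi>2 \<in> dual_space (T x)"
    "\<And>Y. Y \<in> T x \<times> T x \<Longrightarrow> cform (\<lambda>\<xi> Y. \<xi> Y) (\<xi>1, \<xi>2) Y = \<psi> Y"
    using complex_covector_exists[OF B_E[OF x], of \<psi>] by blast
  have "cscale 2 (\<sigma> X) - \<sigma> X = \<sigma> X" by (simp add: prod_eq_iff scaleR_2)
  hence "((fst X, \<xi>1, fst (\<sigma> X)), (snd X, \<xi>2, snd (\<sigma> X))) \<in> L x" unfolding mem_L_space Let_def
    using X \<xi>(1,2) \<xi>(3)[OF W_T[OF x]] cplx.subspace_0[OF D_sub] by (simp add: \<psi>_def)
  thus thesis by (rule that)
qed

end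

lemma gcs_equivalence_untwisted_submanifold:
  assumes N: "proper_charts N" and B: "openM N B"
    and e: "gcs_equivalence M E J (open_submanifold N B) (untwisted (open_submanifold N B) br ip) J0 f \<Phi>"
  shows "gcs_equivalence M E J (open_submanifold N B) (untwisted N br ip) J0 f \<Phi>"
proof -
  note u = untwisted_submanifold[OF N B]
  note e' = e[unfolded gcs_equivalence_def]
  note c = e'[THEN conjunct2, THEN conjunct1, unfolded courant_iso_def courant_pullback_def Let_def courant.simps]
  have "f ` topspace (mtop M) = B"
    using homeomorphic_imp_surjective_map[OF e'[THEN conjunct1, unfolded diffeomorphism_def, THEN conjunct1]]
    unfolding topspace_submanifold[OF B] .
  hence fB: "f x \<in> B" if "x \<in> topspace (mtop M)" for x using that by blast
  have fV: "f ` V \<subseteq> B" if "openM M V" for V using openin_subset[OF that] fB by blast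
  have "courant_iso M E (courant_pullback M f (untwisted N br ip)) \<Phi>"
    unfolding courant_iso_def courant_pullback_def Let_def courant.simps
  proof (intro conjI ballI allI impI; (elim conjE)?)
    fix x assume x: "x \<in> topspace (mtop M)"
    note cx = bspec[OF c[THEN conjunct1] x]
    show "linear_over (fibre E x) (\<Phi> x)" by (rule cx[THEN conjunct1])
    show "bij_betw (\<Phi> x) (fibre E x) (fibre (untwisted N br ip) (f x))"
      using cx[THEN conjunct2, THEN conjunct1] unfolding u(1)[OF fB[OF x]] .
    fix a assume a: "a \<in> fibre E x"
    show "(\<lambda>h. anchor (untwisted N br ip) (f x) (\<Phi> x a) (\<lambda>y. h (inv_into (topspace (mtop M)) f y))) = anchor E x a"
      using bspec[OF cx[THEN conjunct2, THEN conjunct2, THEN conjunct1] a] unfolding u(3) .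
    fix b assume b: "b \<in> fibre E x"
    show "pairing (untwisted N br ip) (f x) (\<Phi> x a) (\<Phi> x b) = pairing E x a b"
      using bspec[OF bspec[OF cx[THEN conjunct2, THEN conjunct2, THEN conjunct2] a] b] unfolding u(4) .
  next
    fix V w assume V: "openM M V" "\<forall>x\<in>V. w x \<in> fibre E x"
    show "(w \<in> sections E V) = ((\<lambda>x. \<Phi> x (w x)) \<in> {u. (\<lambda>y. u (inv_into (topspace (mtop M)) f y)) \<in> sections (untwisted N br ip) (f ` V)})"
      using c[THEN conjunct2, THEN conjunct1, rule_format, of V w] V unfolding u(2)[OF fV[OF V(1)]] by blast
  next
    fix V w z x assume V: "openM M V" "w \<in> sections E V" "z \<in> sections E V" "x \<in> V"
    have x: "x \<in> topspace (mtop M)" using openin_subset[OF V(1)] V(4) by blast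
    show "\<Phi> x (dorfman E w z x) = dorfman (untwisted N br ip)
        (\<lambda>y. \<Phi> (inv_into (topspace (mtop M)) f y) (w (inv_into (topspace (mtop M)) f y)))
        (\<lambda>y. \<Phi> (inv_into (topspace (mtop M)) f y) (z (inv_into (topspace (mtop M)) f y))) (f x)"
      using c[THEN conjunct2, THEN conjunct2, rule_format, OF V] unfolding u(5)[OF fB[OF x]] .
  qed
  thus ?thesis unfolding gcs_equivalence_def using e' by blast
qed

lemma normal_form_nf_structure:
  assumes lf: "lie_form br ip" and nondeg: "\<And>r. (\<And>s. ip r s = 0) \<Longrightarrow> r = 0"
    and nf: "normal_form br ip p q k D B J"
  obtains h v where "nf_structure br ip p q k (p + 2 * q + 2 * k) D v B J"
    "normal_form_D br ip p h D" "normal_form_basis ip p h D v"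
proof -
  let ?n = "p + 2 * q + 2 * k" let ?R = "Rn (p + 2 * q + 2 * k)"
  note nf' = nf[unfolded normal_form_def Let_def]
  note o = normal_form_base_open[OF nf'[THEN conjunct1]]
  have o': "openin (mtop ?R) B" using o(1) by simp
  note P = proper_charts_Rn[of ?n]
  note u = untwisted_submanifold[OF P o']
  obtain h v where hv: "normal_form_D br ip p h D" "normal_form_basis ip p h D v"
    "\<forall>x\<in>B. holomorphic_bundle (untwisted (open_submanifold ?R B) br ip) J x =
       L_space ip (tangent_space (open_submanifold ?R B) x) (normal_form_W (open_submanifold ?R B) p q k x) D
               (normal_form_sigma p v) (normal_form_eps p q)"
    using nf'[THEN conjunct2, THEN conjunct2] by blast
  note G = nf'[THEN conjunct2, THEN conjunct1, unfolded generalized_complex_structure_def, THEN conjunct1,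
      unfolded topspace_submanifold[OF o']]
  have W: "normal_form_W (open_submanifold ?R B) p q k x = normal_form_W ?R p q k x" if x: "x \<in> B" for x
    by (simp add: normal_form_W_def coord_vector_def antiholomorphic_vector_def smooth_near_submanifold[OF P o' x])
  have "nf_structure br ip p q k ?n D v B J"
  proof (intro nf_structure.intro lf nf_structure_axioms.intro refl o)
    show "r = 0" if "\<And>s. ip r s = 0" for r using nondeg that by blast
    show "cform ip a b = 0" if "a \<in> D" "b \<in> D" for a b
      using hv(1) that by (simp add: normal_form_D_def maximal_isotropic_def isotropic_def)
    show "csubspace D" using hv(1) by (simp add: normal_form_D_def complex_subalgebra_def)
    fix x assume x: "x \<in> B"
    note Gx = bspec[OF G x, unfolded u(1)[OF x] u(4)]
    show "linear_over (fibre (untw ?n br ip) x) (J x)" by (rule Gx[THEN conjunct1])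
    show "holomorphic_bundle (untw ?n br ip) J x = L_space ip (tangent_space ?R x) (normal_form_W ?R p q k x) D
        (normal_form_sigma p v) (normal_form_eps p q)"
      using bspec[OF hv(3) x] unfolding holomorphic_bundle_def u(1)[OF x] tangent_space_submanifold[OF P o' x] W[OF x] .
    fix a assume a: "a \<in> fibre (untw ?n br ip) x"
    show "J x a \<in> fibre (untw ?n br ip) x" using Gx[THEN conjunct2, THEN conjunct1] a by blast
    show "J x (J x a) = - a" using bspec[OF Gx[THEN conjunct2, THEN conjunct2, THEN conjunct1] a] .
    fix b assume b: "b \<in> fibre (untw ?n br ip) x"
    show "pairing (untw ?n br ip) x (J x a) b = - pairing (untw ?n br ip) x a (J x b)"
      using bspec[OF bspec[OF Gx[THEN conjunct2, THEN conjunct2, THEN conjunct2] a] b] .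
  qed
  thus thesis using hv(1,2) by (rule that)
qed

lemma has_normal_form_near_pointed_iso:
  assumes M: "smooth_manifold M" and E: "courant_algebroid M E"
    and J: "\<And>x a. x \<in> topspace (mtop M) \<Longrightarrow> a \<in> fibre E x \<Longrightarrow> J x a \<in> fibre E x"
    and nf: "has_normal_form_near M E J x br ip p q k D"
  obtains B J0 where "normal_form br ip p q k D B J0"
    "pointed_iso M E J x (Rn (p + 2 * q + 2 * k)) (untw (p + 2 * q + 2 * k) br ip) J0 0"
proof -
  let ?R = "Rn (p + 2 * q + 2 * k)"
  obtain U B J0 f \<Phi> where 1: "openM M U" "x \<in> U" "f x = 0" "normal_form br ip p q k D B J0"
    "gcs_equivalence (open_submanifold M U) E J (open_submanifold ?R B) (untwisted (open_submanifold ?R B) br ip) J0 f \<Phi>"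
    using nf unfolding has_normal_form_near_def Let_def by blast
  note o = normal_form_base_open[OF 1(4)[unfolded normal_form_def Let_def, THEN conjunct1]]
  have o': "openin (mtop ?R) B" using o(1) by simp
  note P = proper_charts_Rn[of "p + 2 * q + 2 * k"]
  have PM: "proper_charts M" by (rule smooth_manifold_proper_charts[OF M])
  have xM: "x \<in> topspace (mtop M)" using 1(1,2) openin_subset by blast
  obtain T where T: "openM M T" "x \<in> T" "tame_on M E T" "dorfman_closed M E T"
    by (rule courant_algebroid_tame[OF PM E xM])
  have "pointed_iso M E J x ?R (untwisted ?R br ip) J0 (f x)"
  proof (rule gcs_equivalence_pointed_iso[OF gcs_equivalence_untwisted_submanifold[OF P o' 1(5)] PM P 1(1) o' 1(2) _ T(1-3) _ _ tame_untw])
    show "J x a \<in> fibre E x" if "x \<in> U" "a \<in> fibre E x" for x a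
      using J[of x a] that openin_subset[OF 1(1)] by blast
    show "openin (mtop ?R) (topspace (Euclidean_space (p + 2 * q + 2 * k)))" by simp
    show "f x \<in> topspace (Euclidean_space (p + 2 * q + 2 * k))" by (simp add: 1(3) topspace_Euclidean_space)
  qed
  thus thesis using that[OF 1(4)] 1(3) by simp
qed

section \<open>Invariants\<close>

lemma vec_deriv_zero: "vec_deriv 0 r = 0" by (rule vec_deriv_eqI) (simp add: linear_0)

lemma const_section_untw:
  fixes br :: "'g::real_vector \<Rightarrow> 'g \<Rightarrow> 'g"
  assumes U: "opn n U"
  shows "(\<lambda>x. (0, 0, a)) \<in> sections (untw n br ip) U"
proof (rule untw_sectionsI[OF U])
  show "fst (0, 0, a) \<in> TR n x" if "x \<in> U" for x
    using subspace_0[OF subspace_tangent_Rn[of x n]] openin_subset[OF U] that by auto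
  show "smooth_Rn n U (\<lambda>x. coords (fst (0, 0, a)) i)" for i
    using smooth_Rn_const[OF U, of 0] by (simp add: coords_def)
  show "cov (0, 0, a) \<in> dual_space (TR n x)" for x by (simp add: dual_space_def linear_over_def)
  show "smooth_Rn n U (\<lambda>x. cov (0, 0, a) (cvec n x i))" for i using smooth_Rn_const[OF U, of 0] by simp
  show "smooth_Rn n U (\<lambda>x. l (alg (0, 0, a)))" for l by (simp add: smooth_Rn_const[OF U])
qed

locale nf_iso = finite_basis Bs + A: nf_structure br ip p q k n D v B J + A': nf_structure br ip p' q' k' n' D' v' B' J'
  for Bs :: "'g::real_vector set" and br :: "'g \<Rightarrow> 'g \<Rightarrow> 'g" and ip p q k n D v B J p' q' k' n' D' v' B' J' +
  fixes U U' :: "(nat \<Rightarrow> real) set" and f g \<Phi>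
  assumes iso: "local_iso (Rn n) U (untw n br ip) (Rn n') U' (untw n' br ip) f g \<Phi>"
    and U: "0 \<in> U" and f0: "f 0 = 0"
    and tw: "intertwines U (untw n br ip) J J' f \<Phi>"
begin

lemmas d = local_isoD[OF iso]

lemma g0: "g 0 = 0" using d(4)[OF U] f0 by simp

abbreviation "\<Phi>0 \<equiv> \<Phi> 0"

lemma U_Euclidean: "opn n U" "opn n' U'" "0 \<in> U'"
proof -
  show "opn n U" "opn n' U'" using d(1,2) by simp_all
  show "0 \<in> U'" using imageI[OF U, of f] unfolding f0 d(3) .
qed

lemma \<Phi>_fibre: "a \<in> A.F 0 \<Longrightarrow> \<Phi>0 a \<in> A'.F 0" using d(8)[OF U] f0 bij_betwE by fastforce

lemma \<Phi>_onto:
  assumes "b \<in> A'.F 0"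
  obtains a where "a \<in> A.F 0" "\<Phi>0 a = b"
proof -
  have "\<Phi>0 ` A.F 0 = A'.F 0" using d(8)[OF U] unfolding f0 bij_betw_def by (rule conjunct2)
  hence "b \<in> \<Phi>0 ` A.F 0" using assms by (simp only:)
  then obtain a where "b = \<Phi>0 a" "a \<in> A.F 0" by (rule imageE)
  thus thesis by (intro that[of a]) (simp_all only:)
qed

lemma \<Phi>_inj: "a \<in> A.F 0 \<Longrightarrow> b \<in> A.F 0 \<Longrightarrow> \<Phi>0 a = \<Phi>0 b \<Longrightarrow> a = b"
  by (rule inj_onD[OF bij_betw_imp_inj_on[OF d(8)[OF U]]])

lemma \<Phi>_linear:
  "a \<in> A.F 0 \<Longrightarrow> b \<in> A.F 0 \<Longrightarrow> \<Phi>0 (a + b) = \<Phi>0 a + \<Phi>0 b"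
  "a \<in> A.F 0 \<Longrightarrow> \<Phi>0 (c *\<^sub>R a) = c *\<^sub>R \<Phi>0 a"
  using bspec[OF bspec[OF d(7)[OF U, unfolded linear_over_def, THEN conjunct1]]]
    bspec[OF spec[OF d(7)[OF U, unfolded linear_over_def, THEN conjunct2]]] by simp_all

lemma \<Phi>_neg: "a \<in> A.F 0 \<Longrightarrow> \<Phi>0 (- a) = - \<Phi>0 a" using \<Phi>_linear(2)[of a "-1"] by simp

lemma \<Phi>_anchor:
  assumes a: "a \<in> A.F 0"
  shows "fst (\<Phi>0 a) (\<lambda>y. h (g y)) = fst a h" "fst (\<Phi>0 a) r = fst a (\<lambda>x. r (f x))"
proof -
  show 1: "fst (\<Phi>0 a) (\<lambda>y. h (g y)) = fst a h" for h using d(9)[OF U a, of h] by (simp add: untw_simps)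
  have T: "fst (\<Phi>0 a) \<in> A'.T 0" using \<Phi>_fibre[OF a] by (auto simp: untw_simps)
  have "r (f (g y)) = r y" if "y \<in> U'" for y using that d(3,4) by auto
  hence "fst (\<Phi>0 a) (\<lambda>y. r (f (g y))) = fst (\<Phi>0 a) r"
    by (intro tangent_local[OF proper_charts_Rn T d(2) U_Euclidean(3)])
  thus "fst (\<Phi>0 a) r = fst a (\<lambda>x. r (f x))" using 1[of "\<lambda>x. r (f x)"] by simp
qed

lemma \<Phi>_anchor_zero:
  assumes a: "a \<in> A.F 0"
  shows "fst (\<Phi>0 a) = 0 \<longleftrightarrow> fst a = 0"
proof
  assume "fst (\<Phi>0 a) = 0"
  thus "fst a = 0" using \<Phi>_anchor(1)[OF a] by (simp add: fun_eq_iff)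
next
  assume "fst a = 0"
  thus "fst (\<Phi>0 a) = 0" using \<Phi>_anchor(2)[OF a] by (simp add: fun_eq_iff)
qed

lemma \<Phi>_pairing: "a \<in> A.F 0 \<Longrightarrow> b \<in> A.F 0 \<Longrightarrow> A'.pr 0 (\<Phi>0 a) (\<Phi>0 b) = A.pr 0 a b" using d(10)[OF U] f0 by simp

lemma \<Phi>_L:
  assumes ab: "a \<in> A.F 0" "b \<in> A.F 0"
  shows "(\<Phi>0 a, \<Phi>0 b) \<in> A'.L 0 \<longleftrightarrow> (a, b) \<in> A.L 0"
proof -
  have J: "\<Phi>0 (J 0 c) = J' 0 (\<Phi>0 c)" if "c \<in> A.F 0" for c
    using bspec[OF bspec[OF tw[unfolded intertwines_def] U] that, THEN conjunct2] unfolding f0 .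
  have nb: "- b \<in> A.F 0" by (rule subspace_neg[OF A.F_sub[OF A.B(2)] ab(2)])
  have "J 0 a = - b \<longleftrightarrow> \<Phi>0 (J 0 a) = \<Phi>0 (- b)" using \<Phi>_inj[OF A.J(2)[OF A.B(2) ab(1)] nb] by auto
  moreover have "J 0 b = a \<longleftrightarrow> \<Phi>0 (J 0 b) = \<Phi>0 a" using \<Phi>_inj[OF A.J(2)[OF A.B(2) ab(2)] ab(1)] by auto
  ultimately show ?thesis
    unfolding A.L_iff[OF A.B(2)] A'.L_iff[OF A'.B(2)] J[OF ab(1)] J[OF ab(2)] \<Phi>_neg[OF ab(2)]
    using ab \<Phi>_fibre by simp
qed

text \<open>The kernel of the anchor consists of covectors and algebra parts, and the covectors are
  its radical; reading off the last component is passing to the quotient.\<close>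

definition \<phi> :: "'g \<Rightarrow> 'g"
  where "\<phi> a = alg (\<Phi>0 (0, 0, a))"

lemma vertical_F: "(0, 0, a) \<in> A.F 0" "(0, 0, a) \<in> A'.F 0"
  using A.F_zero[OF A.B(2)] A'.F_zero[OF A'.B(2)] by (simp_all add: untw_simps)

text \<open>\<Phi> preserves the pairing and the kernel of the anchor, to which covectors are
  orthogonal; so the image of a covector pairs to zero with every purely algebraic vector.\<close>

lemma covector_component:
  assumes "(0, \<xi>, 0) \<in> A.F 0"
  shows "alg (\<Phi>0 (0, \<xi>, 0)) = 0"
proof (rule A.nondeg)
  fix s
  obtain c where c: "c \<in> A.F 0" "\<Phi>0 c = (0, 0, s)" by (rule \<Phi>_onto[OF vertical_F(2)])
  have c0: "fst c = 0" using \<Phi>_anchor_zero[OF c(1)] c(2) by simp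
  have \<xi>0: "\<xi> 0 = 0" using assms A.dual_zero[OF A.B(2)] by (simp add: untw_simps)
  have f0: "fst (\<Phi>0 (0, \<xi>, 0)) = 0" using \<Phi>_anchor_zero[OF assms] by simp
  have m: "\<Phi>0 (0, \<xi>, 0) \<in> A'.F 0" by (rule \<Phi>_fibre[OF assms])
  have "A'.pr 0 (\<Phi>0 (0, \<xi>, 0)) (0, 0, s) = A.pr 0 (0, \<xi>, 0) c" using \<Phi>_pairing[OF assms c(1)] c(2) by simp
  also have "... = 0"
    using c0 \<xi>0 c(1) A.dual_zero[OF A.B(2), of "cov c"] by (cases c) (simp add: untw_simps A.ip_simps)
  finally have 1: "A'.pr 0 (\<Phi>0 (0, \<xi>, 0)) (0, 0, s) = 0" .
  have "cov (\<Phi>0 (0, \<xi>, 0)) 0 = 0" using m A'.dual_zero[OF A'.B(2)] by (auto simp: untw_simps)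
  thus "ip (alg (\<Phi>0 (0, \<xi>, 0))) s = 0" using 1 f0 by (cases "\<Phi>0 (0, \<xi>, 0)") (simp add: untw_simps)
qed

lemma third_component:
  assumes "(0, \<xi>, a) \<in> A.F 0"
  shows "alg (\<Phi>0 (0, \<xi>, a)) = \<phi> a"
proof -
  have 1: "(0, \<xi>, 0) \<in> A.F 0" using assms by (simp add: untw_simps)
  have e: "((0 :: (nat \<Rightarrow> real) tvec), \<xi>, (0 :: 'g)) + (0, 0, a) = (0, \<xi>, a)" by simp
  have "\<Phi>0 (0, \<xi>, a) = \<Phi>0 (0, \<xi>, 0) + \<Phi>0 (0, 0, a)"
    by (rule \<Phi>_linear(1)[OF 1 vertical_F(1), of a, unfolded e])
  thus ?thesis using covector_component[OF 1] by (simp only: \<phi>_def snd_add add_0_left)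
qed

lemma \<phi>_linear: "linear \<phi>"
proof (rule linearI)
  have e: "((0 :: (nat \<Rightarrow> real) tvec), (0 :: (nat \<Rightarrow> real) covec), a) + (0, 0, b) = (0, 0, a + b)"
    "c *\<^sub>R ((0 :: (nat \<Rightarrow> real) tvec), (0 :: (nat \<Rightarrow> real) covec), a) = (0, 0, c *\<^sub>R a)" for a b :: 'g and c
    by simp_all
  show "\<phi> (a + b) = \<phi> a + \<phi> b" for a b
    using \<Phi>_linear(1)[OF vertical_F(1)[of a] vertical_F(1)[of b]] unfolding e \<phi>_def by (simp only: snd_add)
  show "\<phi> (c *\<^sub>R a) = c *\<^sub>R \<phi> a" for c a
    using \<Phi>_linear(2)[OF vertical_F(1)[of a], of c] unfolding e \<phi>_def by (simp only: snd_scaleR)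
qed

lemma \<phi>_ip: "ip (\<phi> a) (\<phi> b) = ip a b"
proof -
  have f: "fst (\<Phi>0 (0, 0, c)) = 0" for c using \<Phi>_anchor_zero[OF vertical_F(1)] by simp
  have z: "cov (\<Phi>0 (0, 0, c)) 0 = 0" for c
    using \<Phi>_fibre[OF vertical_F(1)[of c]] A'.dual_zero[OF A'.B(2)] by (auto simp: untw_simps)
  have "A'.pr 0 (\<Phi>0 (0, 0, a)) (\<Phi>0 (0, 0, b)) = ip (\<phi> a) (\<phi> b)"
    using f[of a] f[of b] z[of a] z[of b] unfolding \<phi>_def
    by (cases "\<Phi>0 (0, 0, a)", cases "\<Phi>0 (0, 0, b)") (simp add: untw_simps)
  thus ?thesis using \<Phi>_pairing[OF vertical_F(1)[of a] vertical_F(1)[of b]] by (simp add: untw_simps)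
qed

lemma \<phi>_bij: "bij \<phi>"
proof (rule bijI)
  have "a = 0" if "\<phi> a = 0" for a
  proof (rule A.nondeg)
    show "ip a s = 0" for s using \<phi>_ip[of a s] that by (simp add: A.ip_simps)
  qed
  thus "inj \<phi>" using linear_injective_0[OF \<phi>_linear] by blast
  show "surj \<phi>"
  proof (rule surjI)
    fix s
    obtain c where c: "c \<in> A.F 0" "\<Phi>0 c = (0, 0, s)" by (rule \<Phi>_onto[OF vertical_F(2)])
    have "fst c = 0" using \<Phi>_anchor_zero[OF c(1)] c(2) by simp
    hence "c = (0, cov c, alg c)" by (cases c) simp
    hence "alg (\<Phi>0 c) = \<phi> (alg c)" using third_component c(1) by metis
    thus "\<phi> ((\<lambda>s. SOME a. \<phi> a = s) s) = s" using c(2) by (simp, metis (mono_tags) someI)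
  qed
qed

text \<open>The algebra part of a Dorfman bracket differs from the pointwise Lie bracket by
  derivatives along the two anchors. At 0 these vanish, for constant sections as well as for their
  images under \<Phi>.\<close>

lemma \<phi>_bracket: "\<phi> (br a b) = br (\<phi> a) (\<phi> b)"
proof -
  let ?s = "\<lambda>c. (\<lambda>x. (0, 0, c)) :: (nat \<Rightarrow> real) \<Rightarrow> (nat \<Rightarrow> real) tvec \<times> (nat \<Rightarrow> real) covec \<times> 'g"
  note s = const_section_untw[OF U_Euclidean(1), of _ br ip]
  note dt = dorfman_untw[OF s[of a] s[of b] U]
  have T: "fst (dorfman (untw n br ip) (?s a) (?s b) 0) = 0"
  proof (rule tangent_eqI[OF A.B_E[OF A.B(2)] field_bracket_untw(1)[OF s s U] A.F_zero(1)[OF A.B(2)]])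
    fix i
    show "fst (dorfman (untw n br ip) (?s a) (?s b) 0) (\<lambda>y. y i) = (0 :: (nat \<Rightarrow> real) tvec) (\<lambda>y. y i)"
      using field_bracket_untw(2)[OF s[of a] s[of b] U, of i] by (simp add: coords_def)
  qed
  have r: "alg (dorfman (untw n br ip) (?s a) (?s b) 0) = br a b" using dt(3) by (simp add: vec_deriv_zero)
  have e: "dorfman (untw n br ip) (?s a) (?s b) 0 = (0, cov (dorfman (untw n br ip) (?s a) (?s b) 0), br a b)"
    using T r by (simp add: prod_eq_iff)
  have "cov (dorfman (untw n br ip) (?s a) (?s b) 0) \<in> dual_space (A.T 0)"
    by (rule dorfman_untw_dual[OF A.ip_bil s s U])
  hence m: "(0, cov (dorfman (untw n br ip) (?s a) (?s b) 0), br a b) \<in> A.F 0"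
    using A.F_zero(1)[OF A.B(2)] by (simp add: untw_simps)
  have 1: "alg (\<Phi>0 (dorfman (untw n br ip) (?s a) (?s b) 0)) = \<phi> (br a b)"
    by (subst e) (rule third_component[OF m])
  have s': "(\<lambda>y. \<Phi> (g y) (?s c (g y))) \<in> sections (untw n' br ip) U'" for c
  proof -
    have "?s c x \<in> fibre (untw n br ip) x" if "x \<in> U" for x
      by (rule tame_onD(1)[OF tame_untw openin_subset[OF U_Euclidean(1)] d(1) s that])
    hence "(\<lambda>y. \<Phi> (g y) (?s c (g y))) \<in> sections (untw n' br ip) (f ` U)"
      by (rule d(11)[OF order_refl d(1), of "?s c", THEN iffD1, OF _ s])
    thus ?thesis unfolding d(3) .
  qed
  have z: "fst (\<Phi> (g 0) (?s c (g 0))) = 0" for c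
    using \<Phi>_anchor_zero[OF vertical_F(1), of c] by (simp add: g0)
  have "\<Phi>0 (dorfman (untw n br ip) (?s a) (?s b) 0) =
      dorfman (untw n' br ip) (\<lambda>y. \<Phi> (g y) (?s a (g y))) (\<lambda>y. \<Phi> (g y) (?s b (g y))) 0"
    using d(12)[OF order_refl d(1) s[of a] s[of b] U] by (simp only: f0)
  hence "alg (\<Phi>0 (dorfman (untw n br ip) (?s a) (?s b) 0)) = br (\<phi> a) (\<phi> b)"
    using dorfman_untw(3)[OF s'[of a] s'[of b] U_Euclidean(3)] z[of a] z[of b]
    by (simp add: vec_deriv_zero \<phi>_def g0)
  thus ?thesis using 1 by simp
qed

lemma \<phi>_aut: "\<phi> \<in> lie_aut br ip" by (simp add: lie_aut_def \<phi>_linear \<phi>_bij \<phi>_bracket \<phi>_ip)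

text \<open>\<open>D\<close> is formed by the algebra parts of the vertical elements of
  \<open>L\<close>, and \<Phi> matches the vertical elements of the two bundles in both
  directions.\<close>

lemma \<phi>_D: "map_prod \<phi> \<phi> ` D = D'"
proof
  show "map_prod \<phi> \<phi> ` D \<subseteq> D'"
  proof (rule image_subsetI)
    fix u assume u: "u \<in> D"
    obtain \<xi>1 \<xi>2 where L: "((0, \<xi>1, fst u), (0, \<xi>2, snd u)) \<in> A.L 0"
      by (rule A.vertical_in_L[OF A.B(2) A.D_iso[OF u]])
    hence m: "(0, \<xi>1, fst u) \<in> A.F 0" "(0, \<xi>2, snd u) \<in> A.F 0" using A.L_iff[OF A.B(2)] by blast+
    have e: "\<Phi>0 (0, \<xi>, r) = (0, cov (\<Phi>0 (0, \<xi>, r)), \<phi> r)" if "(0, \<xi>, r) \<in> A.F 0" for \<xi> r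
      using third_component[OF that] \<Phi>_anchor_zero[OF that] by (simp add: prod_eq_iff)
    have "(\<Phi>0 (0, \<xi>1, fst u), \<Phi>0 (0, \<xi>2, snd u)) \<in> A'.L 0" using \<Phi>_L[OF m] L by simp
    hence "(\<phi> (fst u), \<phi> (snd u)) \<in> D'"
      by (subst (asm) e[OF m(1)], subst (asm) e[OF m(2)]) (rule A'.vertical_L)
    thus "map_prod \<phi> \<phi> u \<in> D'" by (simp add: map_prod_def case_prod_beta)
  qed
  show "D' \<subseteq> map_prod \<phi> \<phi> ` D"
  proof
    fix u assume u: "u \<in> D'"
    obtain \<xi>1 \<xi>2 where L: "((0, \<xi>1, fst u), (0, \<xi>2, snd u)) \<in> A'.L 0"
      by (rule A'.vertical_in_L[OF A'.B(2) A'.D_iso[OF u]])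
    hence m: "(0, \<xi>1, fst u) \<in> A'.F 0" "(0, \<xi>2, snd u) \<in> A'.F 0" using A'.L_iff[OF A'.B(2)] by blast+
    obtain a where a: "a \<in> A.F 0" "\<Phi>0 a = (0, \<xi>1, fst u)" by (rule \<Phi>_onto[OF m(1)])
    obtain b where b: "b \<in> A.F 0" "\<Phi>0 b = (0, \<xi>2, snd u)" by (rule \<Phi>_onto[OF m(2)])
    have "(a, b) \<in> A.L 0" using \<Phi>_L[OF a(1) b(1)] L a(2) b(2) by simp
    have e: "a = (0, cov a, alg a)" "b = (0, cov b, alg b)"
      using \<Phi>_anchor_zero[OF a(1)] \<Phi>_anchor_zero[OF b(1)] a(2) b(2) by (simp_all add: prod_eq_iff)
    have "(alg a, alg b) \<in> D" by (rule A.vertical_L[of "cov a" _ "cov b"]) (use \<open>(a, b) \<in> A.L 0\<close> e in simp)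
    moreover have "\<phi> (alg a) = fst u" "\<phi> (alg b) = snd u"
      using third_component[of "cov a" "alg a"] third_component[of "cov b" "alg b"]
        a b unfolding e(1)[symmetric] e(2)[symmetric] by simp_all
    ultimately show "u \<in> map_prod \<phi> \<phi> ` D"
      by (intro image_eqI[of _ _ "(alg a, alg b)"]) (simp_all add: prod_eq_iff)
  qed
qed

text \<open>On a real vector the equation of \<open>normal_form_W_iff\<close> equates a real with an
  imaginary number, so both components vanish.\<close>

lemma real_W:
  assumes X: "(X, 0) \<in> A'.W 0"
  shows "X \<in> span (cvec n' 0 ` {..<p' + 2 * q'})"
proof -
  note w = normal_form_W_iff[OF A'.B_E[OF A'.B(2)] A'.n, THEN iffD1, OF X]
  have T: "X \<in> A'.T 0" using w by blast
  have z: "X (\<lambda>y. y i) = 0" if i: "i < n'" "\<not> i < p' + 2 * q'" for i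
  proof -
    define l where "l = (i - (p' + 2 * q')) div 2"
    have l: "l < k'" using i A'.n by (simp add: l_def)
    have "i = p' + 2 * q' + 2 * l \<or> i = p' + 2 * q' + 2 * l + 1" using i by (simp add: l_def) presburger
    moreover have "X (\<lambda>y. y (p' + 2 * q' + 2 * l)) = 0" "X (\<lambda>y. y (p' + 2 * q' + 2 * l + 1)) = 0"
      using w[THEN conjunct2, rule_format, OF l] by (simp_all add: coord_form_def complex_eq_iff)
    ultimately show ?thesis by auto
  qed
  have "X = (\<Sum>i<n'. X (\<lambda>y. y i) *\<^sub>R cvec n' 0 i)" by (rule tangent_eq_sum[OF A'.B_E[OF A'.B(2)] T])
  also have "... \<in> span (cvec n' 0 ` {..<p' + 2 * q'})"
  proof (rule span_sum)
    fix i assume i: "i \<in> {..<n'}"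
    show "X (\<lambda>y. y i) *\<^sub>R cvec n' 0 i \<in> span (cvec n' 0 ` {..<p' + 2 * q'})"
    proof (cases "i < p' + 2 * q'")
      case True
      thus ?thesis by (intro span_scale span_base) blast
    next
      case False
      thus ?thesis using z[of i] i by (simp add: span_zero)
    qed
  qed
  finally show ?thesis .
qed

text \<open>The real vectors of \<open>W\<close> are attached to the structure independently of
  coordinates, and \<open>p + 2 * q\<close> of them are independent. The opposite inequality will
  come from the inverse germ.\<close>

lemma rank_le: "p + 2 * q \<le> p' + 2 * q'"
proof -
  let ?m = "p + 2 * q" and ?v = "cvec n 0"
  let ?t = "\<lambda>j. fst (\<Phi>0 (?v j, 0, 0))"
  have jn: "j < n" if "j < ?m" for j using that A.n by simp
  have m: "(?v j, 0, 0) \<in> A.F 0" if "j < ?m" for j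
    using coord_vector_tangent[OF A.B_E[OF A.B(2)] jn[OF that]] A.F_zero[OF A.B(2)] by (simp add: untw_simps)
  \<comment> \<open>Evaluation at the components of \<open>g\<close> is dual to the images of the
    coordinate vectors, because \<Phi> carries anchors along \<open>f\<close>.\<close>
  have l: "linear (\<lambda>X :: (nat \<Rightarrow> real) tvec. X (\<lambda>y. g y i))" for i
    by (rule linearI) (simp_all add: fun_add_apply fun_scaleR_apply)
  have dual: "?t j (\<lambda>y. g y i) = (if i = j then 1 else 0)" if "i \<in> {..<?m}" "j \<in> {..<?m}" for i j
    using \<Phi>_anchor(1)[OF m[of j], of "\<lambda>y. y i"] that
      coord_vector_coord[OF A.B_E[OF A.B(2)] jn jn, of j i] by simp
  note ind = independent_dual_functionals[of "{..<?m}" "\<lambda>i X. X (\<lambda>y. g y i)" ?t, OF finite_lessThan l dual]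
  have "?t ` {..<?m} \<subseteq> span (cvec n' 0 ` {..<p' + 2 * q'})"
  proof (rule image_subsetI)
    fix j assume j: "j \<in> {..<?m}"
    have W: "(?v j, 0) \<in> A.W 0"
    proof -
      have "(?v j, 0) \<in> {(?v i, 0) |i. i < p} \<union> {(?v (p + i), 0) |i. i < 2 * q}"
      proof (cases "j < p")
        case False
        thus ?thesis using j by (auto intro!: exI[of _ "j - p"])
      qed auto
      thus ?thesis unfolding normal_form_W_def by (intro cplx.span_base) blast
    qed
    \<comment> \<open>A lift of a real vector to \<open>L\<close> has an imaginary part without
      anchor, and \<Phi> preserves this; so the image vector is again real.\<close>
    obtain \<xi>1 \<xi>2 where L: "((?v j, \<xi>1, fst (A.\<sigma> (?v j, 0))), (0, \<xi>2, snd (A.\<sigma> (?v j, 0)))) \<in> A.L 0"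
      by (rule A.W_lift[OF A.B(2) W, unfolded fst_conv snd_conv])
    obtain a b where ab: "(a, b) \<in> A.L 0" "fst a = ?v j" "fst b = 0" by (rule that[OF L]) simp_all
    hence F: "a \<in> A.F 0" "b \<in> A.F 0" using A.L_iff[OF A.B(2)] by blast+
    have "(\<Phi>0 a, \<Phi>0 b) \<in> A'.L 0" using \<Phi>_L[OF F] ab(1) by simp
    hence "(fst (\<Phi>0 a), fst (\<Phi>0 b)) \<in> A'.W 0" unfolding mem_L_space Let_def by blast
    moreover have "fst (\<Phi>0 b) = 0" using \<Phi>_anchor_zero[OF F(2)] ab(3) by simp
    moreover have "fst (\<Phi>0 a) = ?t j"
      using \<Phi>_anchor(2)[OF F(1)] \<Phi>_anchor(2)[OF m[of j]] ab(2) j by (simp add: fun_eq_iff)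
    ultimately show "?t j \<in> span (cvec n' 0 ` {..<p' + 2 * q'})" using real_W by simp
  qed
  from independent_span_bound[OF _ ind(2) this]
  have "card (?t ` {..<?m}) \<le> card (cvec n' 0 ` {..<p' + 2 * q'})" by simp
  also have "... \<le> card {..<p' + 2 * q'}" by (rule card_image_le) simp
  finally show ?thesis using card_image[OF ind(1)] by simp
qed

end

section \<open>Equivalence of normal forms\<close>

locale nf_match =
  N: nf_structure br ip p q k n D v B J + N': nf_structure br ip p q k n D' v' B' J' +
  A: nf_algebra br ip Bs Kf p h D v + A': nf_algebra br ip Bs Kf p h' D' v'
  for br :: "'g::real_vector \<Rightarrow> 'g \<Rightarrow> 'g" and ip p q k n D v B J D' v' B' J' Bs Kf h h' +
  fixes \<phi> \<psi> :: "'g \<Rightarrow> 'g"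
  assumes \<phi>: "linear \<phi>" "\<And>a b. \<phi> (br a b) = br (\<phi> a) (\<phi> b)" "\<And>a b. ip (\<phi> a) (\<phi> b) = ip a b"
    and \<psi>: "linear \<psi>" "\<And>a b. \<psi> (br a b) = br (\<psi> a) (\<psi> b)" "\<And>a b. ip (\<psi> a) (\<psi> b) = ip a b"
    and \<phi>\<psi>: "\<And>a. \<phi> (\<psi> a) = a" "\<And>a. \<psi> (\<phi> a) = a"
    and D': "D' = map_prod \<phi> \<phi> ` D"
begin

abbreviation "\<phi>C \<equiv> map_prod \<phi> \<phi>"

lemma \<phi>_mem: "\<phi>C u \<in> D' \<longleftrightarrow> u \<in> D"
proof
  assume "\<phi>C u \<in> D'"
  then obtain u' where "\<phi>C u = \<phi>C u'" "u' \<in> D" unfolding D' by (rule imageE)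
  moreover have "u = map_prod \<psi> \<psi> (\<phi>C u)" for u by (simp add: prod.map_comp o_def \<phi>\<psi>)
  ultimately show "u \<in> D" by metis
qed (simp add: D')

lemma \<phi>_cbracket: "\<phi>C (cbracket br x y) = cbracket br (\<phi>C x) (\<phi>C y)"
  by (simp add: cbracket_def map_prod_def case_prod_beta \<phi>(2) linear_diff[OF \<phi>(1)] linear_add[OF \<phi>(1)])

text \<open>\<open>h_normaliser\<close> recovers \<open>h\<close> from \<open>D\<close> and
  \<open>h'\<close> from \<open>D'\<close> by the same formula, and \<phi> matches \<open>D\<close>
  with \<open>D'\<close>.\<close>

lemma \<phi>_h: "\<phi> a \<in> h' \<longleftrightarrow> a \<in> h"
proof -
  have e: "(\<phi> a, 0) = \<phi>C (a, 0)" by (simp add: linear_0[OF \<phi>(1)])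
  have "\<phi> a \<in> h' \<longleftrightarrow> (\<forall>u\<in>D'. cbracket br (\<phi> a, 0) u \<in> D')" by (subst A'.h_normaliser) simp
  also have "... \<longleftrightarrow> (\<forall>u\<in>D. \<phi>C (cbracket br (a, 0) u) \<in> D')" unfolding e \<phi>_cbracket D' by simp
  also have "... \<longleftrightarrow> a \<in> h" unfolding \<phi>_mem by (subst A.h_normaliser) simp
  finally show ?thesis .
qed

lemma \<psi>_h: "a \<in> h' \<Longrightarrow> \<psi> a \<in> h" using \<phi>_h[of "\<psi> a"] by (simp add: \<phi>\<psi>)

lemma \<phi>_A: "\<phi> a \<in> A'.A \<longleftrightarrow> a \<in> A.A" using \<phi>_mem[of "(a, 0)"] by (simp add: A.A_def A'.A_def linear_0[OF \<phi>(1)])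

lemma \<psi>_A: "a \<in> A'.A \<Longrightarrow> \<psi> a \<in> A.A" using \<phi>_A[of "\<psi> a"] by (simp add: \<phi>\<psi>)

lemma \<phi>\<psi>_ip: "ip (\<psi> a) b = ip a (\<phi> b)" "ip a (\<psi> b) = ip (\<phi> a) b"
  using \<phi>(3)[of "\<psi> a" b] \<phi>(3)[of a "\<psi> b"] by (simp_all add: \<phi>\<psi>)

lemma ip_sum: "ip (\<Sum>i\<in>I. c i *\<^sub>R f i) b = (\<Sum>i\<in>I. c i * ip (f i) b)"
  "ip b (\<Sum>i\<in>I. c i *\<^sub>R f i) = (\<Sum>i\<in>I. c i * ip b (f i))" for c :: "'i \<Rightarrow> real"
  by (induction I rule: infinite_finite_induct) (simp_all add: N.ip_simps)

section \<open>The two dual bases compared; change of the coordinates x^i\<close>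

definition M where "M i j = ip (\<psi> (A'.ah i)) (v j)"
definition M' where "M' i j = ip (\<phi> (A.ah i)) (v' j)"

text \<open>\<open>M\<close> expresses the basis \<open>A'.ah\<close>, moved by \<psi>, through
  \<open>A.ah\<close>, and \<open>M'\<close> does the converse; both products are evaluated by
  \<open>A_expand\<close>.\<close>

lemma M_inverse:
  assumes "j < p" "i < p"
  shows "(\<Sum>l<p. M j l * M' l i) = (if j = i then 1 else 0)"
    "(\<Sum>l<p. M' j l * M l i) = (if j = i then 1 else 0)"
proof -
  have "(\<Sum>l<p. M j l * M' l i) = (\<Sum>l<p. ip (\<psi> (A'.ah j)) (v l) * ip (A.ah l) (\<psi> (v' i)))"
    by (simp add: M_def M'_def \<phi>\<psi>_ip)
  also have "... = ip (\<psi> (A'.ah j)) (\<psi> (v' i))" unfolding ip_sum(1)[symmetric]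
    by (rule arg_cong[of _ _ "\<lambda>a. ip a (\<psi> (v' i))", OF A.A_expand[OF \<psi>_A[OF A'.ah(1)[OF assms(1)]], symmetric]])
  also have "... = (if j = i then 1 else 0)" using A'.ah(3)[OF assms] by (simp add: \<psi>(3))
  finally show "(\<Sum>l<p. M j l * M' l i) = (if j = i then 1 else 0)" .
  have \<phi>A: "\<phi> (A.ah j) \<in> A'.A" using A.ah(1)[OF assms(1)] \<phi>_A by blast
  have "(\<Sum>l<p. M' j l * M l i) = (\<Sum>l<p. ip (\<phi> (A.ah j)) (v' l) * ip (A'.ah l) (\<phi> (v i)))"
    by (simp add: M_def M'_def \<phi>\<psi>_ip)
  also have "... = ip (\<phi> (A.ah j)) (\<phi> (v i))" unfolding ip_sum(1)[symmetric]
    by (rule arg_cong[of _ _ "\<lambda>a. ip a (\<phi> (v i))", OF A'.A_expand[OF \<phi>A, symmetric]])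
  also have "... = (if j = i then 1 else 0)" using A.ah(3)[OF assms] by (simp add: \<phi>(3))
  finally show "(\<Sum>l<p. M' j l * M l i) = (if j = i then 1 else 0)" .
qed

text \<open>The family \<open>v'\<close> carried back by \<psi> and recombined so as to be dual to
  \<open>A.ah\<close>, the basis to which \<open>v\<close> is dual as well. The recombination is
  matched by the coordinate change \<open>Fm\<close>.\<close>

definition v1 where "v1 j = \<psi> (\<Sum>i<p. M i j *\<^sub>R v' i)"

lemma \<phi>_v1: "\<phi> (v1 j) = (\<Sum>i<p. M i j *\<^sub>R v' i)" by (simp add: v1_def \<phi>\<psi>)

lemma v1_h: "v1 j \<in> h"
  unfolding v1_def by (intro \<psi>_h subspace_sum[OF A'.h_sub] subspace_scale[OF A'.h_sub] A'.v_h) simp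

lemma v1_iso: "ip (v1 i) (v1 j) = 0"
proof -
  have "ip (v1 i) (v1 j) = (\<Sum>l<p. M l j * (\<Sum>m<p. M m i * ip (v' m) (v' l)))"
    unfolding v1_def \<psi>(3) ip_sum by (rule refl)
  also have "... = 0" using A'.S_iso[OF A'.v_S A'.v_S] by simp
  finally show ?thesis .
qed

lemma v1_dual: "i < p \<Longrightarrow> j < p \<Longrightarrow> ip (A.ah i) (v1 j) = (if j = i then 1 else 0)"
  using M_inverse(2)[of i j] unfolding v1_def \<phi>\<psi>_ip ip_sum by (simp add: M'_def mult.commute eq_commute[of i])

lemma v_iso: "i < p \<Longrightarrow> j < p \<Longrightarrow> ip (v i) (v j) = 0" by (rule A.S_iso[OF A.v_S A.v_S])

text \<open>Only the coordinates x^i are changed; the identity block leaves the conditions defining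
  \<open>W\<close> and the form \<epsilon> untouched.\<close>

definition Fm where "Fm i j = (if i < p \<and> j < p then M i j else if i = j then 1 else 0)"
definition Gm where "Gm i j = (if i < p \<and> j < p then M' i j else if i = j then 1 else (0::real))"

lemma block_inverse:
  fixes X Y :: "nat \<Rightarrow> nat \<Rightarrow> real"
  assumes XY: "\<And>i j. i < p \<Longrightarrow> j < p \<Longrightarrow> (\<Sum>l<p. X i l * Y l j) = (if i = j then 1 else 0)"
    and ij: "i < n" "j < n"
  shows "(\<Sum>l<n. (if i < p \<and> l < p then X i l else if i = l then 1 else 0) *
    (if l < p \<and> j < p then Y l j else if l = j then 1 else 0)) = (if i = j then 1 else 0)" (is "(\<Sum>l<n. ?f l) = _")
proof (cases "i < p")
  case True
  have pn: "p \<le> n" using N.n by simp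
  have "(\<Sum>l<n. ?f l) = (\<Sum>l<p. ?f l)" by (rule sum.mono_neutral_right) (use pn True in auto)
  also have "... = (\<Sum>l<p. X i l * (if j < p then Y l j else 0))" by (intro sum.cong refl) (use True in auto)
  also have "... = (if i = j then 1 else 0)" using XY[OF True, of j] True by (cases "j < p") auto
  finally show ?thesis .
next
  case False
  have "(\<Sum>l<n. ?f l) = (\<Sum>l<n. if l = i then (if l < p \<and> j < p then Y l j else if l = j then 1 else 0) else 0)"
    by (intro sum.cong refl) (use False in auto)
  also have "... = (if i = j then 1 else 0)" using ij False by simp
  finally show ?thesis .
qed

lemma FG:
  assumes "j < n" "l < n"
  shows "(\<Sum>i<n. Fm j i * Gm i l) = (if j = l then 1 else 0)"
    "(\<Sum>i<n. Gm j i * Fm i l) = (if j = l then 1 else 0)"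
proof -
  show "(\<Sum>i<n. Fm j i * Gm i l) = (if j = l then 1 else 0)"
    unfolding Fm_def Gm_def by (rule block_inverse[OF M_inverse(1) assms])
  show "(\<Sum>i<n. Gm j i * Fm i l) = (if j = l then 1 else 0)"
    unfolding Fm_def Gm_def by (rule block_inverse[OF M_inverse(2) assms])
qed

sublocale LC: linear_change_pair Bs n br ip Fm Gm \<phi> \<psi>
  by (intro linear_change_pair.intro linear_change.intro linear_change_axioms.intro A.finite_basis_axioms)
    (rule FG \<phi> \<psi> \<phi>\<psi> N.ip_bil | assumption)+

end

text \<open>\<open>w\<close> is continued by 0 beyond \<open>p\<close> because the gauge map sums
  over all \<open>n\<close> coordinates.\<close>

locale nf_gauge = nf_match +
  fixes w :: "nat \<Rightarrow> 'a"
  assumes w: "\<And>i. w i \<in> h" "\<And>i. i < p \<Longrightarrow> (- w i, v1 i - v i) \<in> D"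
    "\<And>i j. i < p \<Longrightarrow> j < p \<Longrightarrow> ip (w j) (v1 i) = ip (w i) (v j)" "\<And>i. \<not> i < p \<Longrightarrow> w i = 0"
begin

lemma w_comm: "br (w i) (w j) = 0" by (rule A.h_abelian[OF w(1) w(1)])

sublocale WF: weight_flow br ip Bs n w A.Z
proof (intro weight_flow.intro weight_flow_axioms.intro N.lie_form_axioms A.finite_basis_axioms A.Z_span w_comm)
  fix z assume "z \<in> A.Z"
  then obtain l where "\<forall>a\<in>h. cbracket br (a, 0) z = cscale (l a) z" using A.weights_Z by blast
  thus "\<exists>l. \<forall>j<n. cbracket br (w j, 0) z = cscale (l j) z"
    using w(1) by (intro exI[of _ "\<lambda>j. l (w j)"]) simp
qed

text \<open>The real part of \<open>Bt_identity\<close>, solved for the B-field.\<close>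

definition \<beta> where "\<beta> j i = (if j < p \<and> i < p then ip (v1 i) (v j) - ip (v i) (v1 j) else 0)"

lemma K_h: "a \<in> h \<Longrightarrow> WF.K x a = a" by (rule WF.K_fixed) (rule A.h_abelian[OF w(1)])

text \<open>Negating the argument of \<open>WF.K\<close> gives its inverse and, in the flow
  equation, turns \<open>w i\<close> into \<open>- w i\<close>.\<close>

sublocale GP: gauge_pair Bs n br ip w \<beta> WF.K "\<lambda>x. WF.K (\<lambda>j. - x j)"
proof (intro gauge_pair.intro gauge.intro gauge_axioms.intro gauge_pair_axioms.intro A.finite_basis_axioms
    N.br_bil N.ip_bil WF.K_linear WF.K_bracket WF.K_ip)

  show "br (w i) (w j) = 0" "br (- w i) (- w j) = 0" for i j by (simp_all add: N.br_simps w_comm)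
  show \<beta>: "\<beta> i j = - \<beta> j i" "- \<beta> i j = - (- \<beta> j i)" for i j by (simp_all add: \<beta>_def N.ip_sym)
  show "WF.K x (w i) = w i" for x i by (rule K_h[OF w(1)])
  show "WF.K (\<lambda>j. - x j) (- w i) = - w i" for x i by (rule K_h) (rule subspace_neg[OF A.h_sub w(1)])
  show "smooth_Rn n (ER n) (\<lambda>x. l (WF.K x a))" if "linear l" for l :: "_ \<Rightarrow> real" and a
    using WF.K_smooth(1)[OF that, of 1 a] by simp
  show "smooth_Rn n (ER n) (\<lambda>x. l (WF.K (\<lambda>j. - x j) a))" if "linear l" for l :: "_ \<Rightarrow> real" and a
    using WF.K_smooth(1)[OF that, of "-1" a] by simp
  show "partial_deriv i (\<lambda>x. l (WF.K x a)) x = - l (br (w i) (WF.K x a))"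
    if "linear l" "i < n" for l :: "_ \<Rightarrow> real" and i a x using WF.K_smooth(2)[OF that, of 1 a x] by simp
  show "partial_deriv i (\<lambda>x. l (WF.K (\<lambda>j. - x j) a)) x = - l (br (- w i) (WF.K (\<lambda>j. - x j) a))"
    if "linear l" "i < n" for l :: "_ \<Rightarrow> real" and i a x
    using WF.K_smooth(2)[OF that, of "-1" a x] by (simp add: N.br_simps linear_neg[OF that(1)])
  show "WF.K (\<lambda>j. - x j) (WF.K x a) = a" for x a by (rule WF.K_neg)
  show "WF.K x (WF.K (\<lambda>j. - x j) a) = a" for x a using WF.K_neg[of "\<lambda>j. - x j" a] by simp
qed (rule N.br_antisym N.ip_sym N.ip_br)+

end

section \<open>The gauge map on the (1,0)-bundle\<close>

context nf_gauge
begin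

text \<open>The common shape of \<sigma>, \<sigma>1 and the shift: one-forms in the dx^i with
  constant coefficients. Bilinear identities between them can thus be checked on pairs of
  indices.\<close>

definition sig :: "(nat \<Rightarrow> 'a \<times> 'a) \<Rightarrow> (nat \<Rightarrow> real) tvec \<times> (nat \<Rightarrow> real) tvec \<Rightarrow> 'a \<times> 'a"
  where "sig a X = (\<Sum>i<p. cscale (coord_form i X) (a i))"

abbreviation "WC X \<equiv> (GP.W (coords (fst X)), GP.W (coords (snd X)))"
abbreviation "\<sigma>1 \<equiv> normal_form_sigma p v1"
abbreviation "L1 x \<equiv> L_space ip (N.T x) (N.W x) D \<sigma>1 N.\<epsilon>"

lemma sig_sigma: "normal_form_sigma p u X = sig (\<lambda>i. (0, u i)) X" unfolding normal_form_sigma_def sig_def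
  by (intro sum.cong refl arg_cong2[of _ _ _ _ cscale]) (simp add: cscale_def)

lemma sig_diff: "sig a X - sig b X = sig (\<lambda>i. a i - b i) X"
  by (simp only: sig_def cplx.scale_right_diff_distrib sum_subtractf)

lemma WC_sig: "WC X = sig (\<lambda>i. (w i, 0)) X"
proof -
  have "GP.W a = (\<Sum>i<p. a i *\<^sub>R w i)" for a
    unfolding GP.W_def by (rule sum.mono_neutral_right) (use N.n w(4) in auto)
  thus ?thesis by (simp add: sig_def prod_eq_iff fst_sum snd_sum cscale_def coord_form_def coords_def)
qed

lemma cform_sig:
  "cform ip (sig a X) (sig b Y) = (\<Sum>i<p. \<Sum>j<p. coord_form i X * coord_form j Y * cform ip (a i) (b j))"
proof -
  have "cform ip (sig a X) (sig b Y) = (\<Sum>j<p. \<Sum>i<p. coord_form i X * coord_form j Y * cform ip (a i) (b j))"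
    unfolding sig_def WF.cip_sum N.cip_scale by (simp add: sum_distrib_left mult.assoc mult.left_commute)
  also have "... = (\<Sum>i<p. \<Sum>j<p. coord_form i X * coord_form j Y * cform ip (a i) (b j))" by (rule sum.swap)
  finally show ?thesis .
qed

lemma cip_diff: "cform ip (a - b) c = cform ip a c - cform ip b c"
  by (simp only: diff_conv_add_uminus N.cip_add N.cip_minus)

lemma Bt_eq: "GP.Bt a c = (\<Sum>i<p. \<Sum>j<p. a i * c j * \<beta> i j)"
proof -
  have "GP.Bt a c = (\<Sum>i<p. (\<Sum>j<n. \<beta> j i * a j) * c i)"
    unfolding GP.Bt_def by (rule sum.mono_neutral_right) (use N.n in \<open>auto simp: \<beta>_def\<close>)
  also have "... = (\<Sum>i<p. (\<Sum>j<p. \<beta> j i * a j) * c i)"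
    by (intro sum.cong refl arg_cong2[of _ _ _ _ "(*)"] sum.mono_neutral_right) (use N.n in \<open>auto simp: \<beta>_def\<close>)
  also have "... = (\<Sum>i<p. \<Sum>j<p. a j * c i * \<beta> j i)"
    by (simp add: sum_distrib_right sum_distrib_left mult_ac)
  also have "... = (\<Sum>i<p. \<Sum>j<p. a i * c j * \<beta> i j)" by (rule sum.swap)
  finally show ?thesis .
qed

lemma cform_Bt:
  "cform (\<lambda>X Y. GP.Bt (coords X) (coords Y)) X Y =
    (\<Sum>i<p. \<Sum>j<p. coord_form i X * coord_form j Y * of_real (\<beta> i j))" unfolding cform_def Bt_eq
  by (simp add: complex_eq_iff Re_coord_form sum_subtractf[symmetric] sum.distrib[symmetric] algebra_simps)

lemma \<delta>_sig: "\<sigma>1 X - N.\<sigma> X - WC X = sig (\<lambda>i. (- w i, v1 i - v i)) X"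
  unfolding sig_sigma WC_sig sig_diff by simp

text \<open>The coefficients \<open>(- w i, v1 i - v i)\<close> lie in \<open>D\<close> by the
  choice of \<open>w\<close>.\<close>

lemma \<delta>_D: "\<sigma>1 X - N.\<sigma> X - WC X \<in> D" unfolding \<delta>_sig unfolding sig_def
  by (intro cplx.subspace_sum[OF A.D_sub] cplx.subspace_scale[OF A.D_sub] w(2)) simp

text \<open>Comparing the covector produced by the gauge map with the one that the target bundle
  demands leaves this condition. On coefficients, isotropy of \<open>D\<close> expresses
  \<open>ip (w i) (w j)\<close> through \<open>v\<close> and \<open>v1\<close>, which gives the real
  part; the symmetry imposed on \<open>w\<close> cancels the imaginary part.\<close>

lemma Bt_identity:
  "cform (\<lambda>X Y. GP.Bt (coords X) (coords Y)) X Y =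
    cform ip (WC X) (WC Y) - 2 * cform ip (WC X) (\<sigma>1 Y) - 2 * cform ip (N.\<sigma> X) (\<sigma>1 Y - N.\<sigma> Y - WC Y)"
proof -
  have "complex_of_real (\<beta> i j) = cform ip (w i, 0) (w j, 0) - 2 * cform ip (w i, 0) (0, v1 j) -
      2 * cform ip (0, v i) (- w j, v1 j - v j)" if ij: "i < p" "j < p" for i j
  proof -
    have "cform ip (- w i, v1 i - v i) (- w j, v1 j - v j) = 0"
      by (rule A.D_iso[OF w(2)[OF ij(1)] w(2)[OF ij(2)]])
    hence "ip (w i) (w j) = - ip (v1 i) (v j) - ip (v i) (v1 j)"
      using v_iso[OF ij] v1_iso[of i j] by (simp add: cform_def complex_eq_iff N.ip_simps)
    moreover have "ip (w i) (v1 j) = ip (v i) (w j)" using w(3)[OF ij(2,1)] N.ip_sym by simp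
    ultimately show ?thesis using v_iso[OF ij] ij N.ip_sym[of "v1 j" "v i"] N.ip_sym[of "v j" "v1 i"]
      by (simp add: cform_def complex_eq_iff N.ip_simps \<beta>_def)
  qed
  hence "cform (\<lambda>X Y. GP.Bt (coords X) (coords Y)) X Y =
    (\<Sum>i<p. \<Sum>j<p. coord_form i X * coord_form j Y * (cform ip (w i, 0) (w j, 0) - 2 * cform ip (w i, 0) (0, v1 j) -
      2 * cform ip (0, v i) (- w j, v1 j - v j)))" unfolding cform_Bt by (intro sum.cong refl) simp
  also have "... = cform ip (WC X) (WC Y) - 2 * cform ip (WC X) (\<sigma>1 Y) - 2 * cform ip (N.\<sigma> X) (\<sigma>1 Y - N.\<sigma> Y - WC Y)"
    unfolding \<delta>_sig unfolding WC_sig sig_sigma cform_sig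
    by (simp add: sum_subtractf[symmetric] sum_distrib_left algebra_simps)
  finally show ?thesis .
qed

lemma sigma_iso: "cform ip (N.\<sigma> X) (N.\<sigma> Y) = 0" "cform ip (\<sigma>1 X) (\<sigma>1 Y) = 0"
proof -
  have "cform ip (0, v i) (0, v j) = 0" if "i < p" "j < p" for i j
    using v_iso[OF that] by (simp add: cform_def N.ip_simps complex_eq_iff)
  thus "cform ip (N.\<sigma> X) (N.\<sigma> Y) = 0" unfolding sig_sigma cform_sig by simp
  have "cform ip (0, v1 i) (0, v1 j) = 0" for i j
    using v1_iso by (simp add: cform_def N.ip_simps complex_eq_iff)
  thus "cform ip (\<sigma>1 X) (\<sigma>1 Y) = 0" unfolding sig_sigma cform_sig by simp
qed

lemma Ex_h: "u \<in> h \<times> h \<Longrightarrow> WF.Ex x u = u" by (cases u) (simp add: WF.Ex_K K_h)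

lemma \<sigma>1_h: "\<sigma>1 X \<in> h \<times> h" unfolding sig_sigma sig_def
  by (intro cplx.subspace_sum[OF csubspace_product[OF A.h_sub]] cplx.subspace_scale[OF csubspace_product[OF A.h_sub]])
    (simp add: v1_h subspace_0[OF A.h_sub])

text \<open>\<open>D\<close> is spanned by weight vectors of \<open>h\<close>, and the flow acts on
  these by scalars.\<close>

lemma Ex_D:
  assumes u: "u \<in> D"
  shows "WF.Ex x u \<in> D"
proof (rule WF.Ex_stable[OF A.D_sub A.P(2) _ u])
  fix z assume "z \<in> (D \<inter> h \<times> h) \<union> (\<Union>\<alpha>\<in>A.P. root_space br (h \<times> h) \<alpha>)"
  hence "z \<in> A.Z" unfolding A.Z_def by blast
  then obtain l where l: "\<forall>a\<in>h. cbracket br (a, 0) z = cscale (l a) z" using A.weights_Z by blast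
  show "\<exists>l. WF.weight l z" unfolding WF.weight_def using l w(1) by (intro exI[of _ "\<lambda>j. l (w j)"]) simp
qed

text \<open>Algebra part: the flow fixes the complexified Cartan subalgebra and preserves
  \<open>D\<close>, and \<open>\<sigma>1 X\<close> equals \<open>N.\<sigma> X\<close> plus the shift
  up to an element of \<open>D\<close>. Covector part: the discrepancy is bilinear in
  \<open>X\<close> and \<open>Y\<close> and is removed by \<open>Bt_identity\<close>.\<close>

lemma gmap_L:
  assumes x: "x \<in> B" and ab: "(a, b) \<in> N.L x"
  shows "(GP.gmap x a, GP.gmap x b) \<in> L1 x"
proof -
  define X where "X = (fst a, fst b)"
  define s where "s = (alg a, alg b)"
  define \<xi> where "\<xi> = (cov a, cov b)"
  let ?s = "WF.Ex x (s + WC X)"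
  have L: "X \<in> N.W x" "s - N.\<sigma> X \<in> D"
    and Lev: "\<And>Y. Y \<in> N.W x \<Longrightarrow> cform (\<lambda>\<xi> Y. \<xi> Y) \<xi> Y = 2 * N.\<epsilon> X Y - cform ip (N.\<sigma> Y) (cscale 2 s - N.\<sigma> X)"
    using ab unfolding mem_L_space Let_def X_def s_def \<xi>_def by blast+
  have F: "a \<in> N.F x" "b \<in> N.F x" using ab N.L_iff[OF x] by blast+
  have gF: "GP.gmap x a \<in> N.F x" "GP.gmap x b \<in> N.F x" using GP.gmap_fibre[OF N.B_E[OF x]] F by blast+
  have gX: "fst (GP.gmap x a) = fst X" "fst (GP.gmap x b) = snd X" by (simp_all add: GP.gmap_def X_def)
  have gs: "(alg (GP.gmap x a), alg (GP.gmap x b)) = ?s" by (simp add: GP.gmap_def X_def s_def WF.Ex_K)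
  have ExD: "?s - \<sigma>1 X \<in> D"
  proof -
    \<comment> \<open>\<open>\<sigma>1 X\<close> is fixed by the flow, so the flow can be pulled out
      of the whole difference.\<close>
    have "?s - \<sigma>1 X = WF.Ex x (s + WC X) + WF.Ex x (cscale (- 1) (\<sigma>1 X))"
      unfolding WF.Ex_scale Ex_h[OF \<sigma>1_h] by (simp add: prod_eq_iff)
    also have "... = WF.Ex x ((s - N.\<sigma> X) - (\<sigma>1 X - N.\<sigma> X - WC X))"
      unfolding WF.Ex_add[symmetric] by (rule arg_cong) (simp add: prod_eq_iff)
    also have "... \<in> D" by (rule Ex_D[OF cplx.subspace_diff[OF A.D_sub L(2) \<delta>_D]])
    finally show ?thesis .
  qed
  have ev: "cform (\<lambda>\<xi> Y. \<xi> Y) (cov (GP.gmap x a), cov (GP.gmap x b)) Y =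
      2 * N.\<epsilon> X Y - cform ip (\<sigma>1 Y) (cscale 2 ?s - \<sigma>1 X)" if Y: "Y \<in> N.W x" for Y
  proof -
    have T: "fst Y \<in> N.T x" "snd Y \<in> N.T x" using N.W_T[OF x Y] by auto
    have "cform (\<lambda>\<xi> Y. \<xi> Y) (cov (GP.gmap x a), cov (GP.gmap x b)) Y =
        cform (\<lambda>\<xi> Y. \<xi> Y) \<xi> Y + (cform (\<lambda>X Y. GP.Bt (coords X) (coords Y)) X Y - cform ip (WC X) (WC Y) - 2 * cform ip (WC Y) s)"
      using T by (simp add: GP.gmap_def cform_def complex_eq_iff GP.covec_delta X_def s_def \<xi>_def)
    also have "cform (\<lambda>\<xi> Y. \<xi> Y) \<xi> Y = 2 * N.\<epsilon> X Y - (2 * cform ip (N.\<sigma> Y) s - cform ip (N.\<sigma> Y) (N.\<sigma> X))"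
      unfolding Lev[OF Y] by (simp only: diff_conv_add_uminus N.cip_add N.cip_scale N.cip_minus)
    also have "cform ip (N.\<sigma> Y) (N.\<sigma> X) = 0" by (rule sigma_iso(1))
    also have "cform (\<lambda>X Y. GP.Bt (coords X) (coords Y)) X Y =
      cform ip (WC X) (WC Y) - 2 * cform ip (WC X) (\<sigma>1 Y) - 2 * cform ip (N.\<sigma> X) (\<sigma>1 Y - N.\<sigma> Y - WC Y)"
      by (rule Bt_identity)
    \<comment> \<open>\<open>s\<close> may replace \<open>N.\<sigma> X\<close>, since they differ by
      an element of \<open>D\<close>, and the other argument lies in the isotropic space
      \<open>D\<close> too.\<close>
    also have "cform ip (N.\<sigma> X) (\<sigma>1 Y - N.\<sigma> Y - WC Y) = cform ip s (\<sigma>1 Y - N.\<sigma> Y - WC Y)"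
    proof -
      have "cform ip (s - N.\<sigma> X) (\<sigma>1 Y - N.\<sigma> Y - WC Y) = 0" by (rule A.D_iso[OF L(2) \<delta>_D])
      thus ?thesis unfolding cip_diff by simp
    qed
    also have "cform ip s (\<sigma>1 Y - N.\<sigma> Y - WC Y) = cform ip s (\<sigma>1 Y) - cform ip (N.\<sigma> Y) s - cform ip (WC Y) s"
      by (simp only: diff_conv_add_uminus N.cip_add N.cip_minus N.cip_sym[of s])
    finally have 1: "cform (\<lambda>\<xi> Y. \<xi> Y) (cov (GP.gmap x a), cov (GP.gmap x b)) Y =
        2 * N.\<epsilon> X Y - 2 * (cform ip (\<sigma>1 Y) s + cform ip (\<sigma>1 Y) (WC X))"
      by (simp add: N.cip_sym[of _ "\<sigma>1 Y"] algebra_simps)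
    have "cform ip (\<sigma>1 Y) ?s = cform ip (WF.Ex x (\<sigma>1 Y)) ?s" by (simp only: Ex_h[OF \<sigma>1_h])
    also have "... = cform ip (\<sigma>1 Y) s + cform ip (\<sigma>1 Y) (WC X)" by (simp only: WF.Ex_ip N.cip_add)
    finally have 2: "cform ip (\<sigma>1 Y) ?s = cform ip (\<sigma>1 Y) s + cform ip (\<sigma>1 Y) (WC X)" .
    have "cform ip (\<sigma>1 Y) (cscale 2 ?s - \<sigma>1 X) = 2 * cform ip (\<sigma>1 Y) ?s - cform ip (\<sigma>1 Y) (\<sigma>1 X)"
      by (simp only: diff_conv_add_uminus N.cip_add N.cip_scale N.cip_minus)
    thus ?thesis unfolding 1 2 sigma_iso(2) by simp
  qed
  show ?thesis unfolding mem_L_space Let_def gX gs prod.collapse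
    using L(1) ExD ev gF by (auto simp: untw_simps)
qed

section \<open>The coordinate change on the (1,0)-bundle\<close>

lemma coord_form_push:
  assumes "i < n"
  shows "coord_form i (LC.push x (fst X), LC.push x (snd X)) = (\<Sum>j<n. of_real (Fm i j) * coord_form j X)"
  using LC.coords_push[OF assms, of x "fst X"] LC.coords_push[OF assms, of x "snd X"] assms
  by (simp add: complex_eq_iff Re_coord_form lin_map_def)

lemma coord_form_push_high:
  assumes "i < n" "p \<le> i"
  shows "coord_form i (LC.push x (fst X), LC.push x (snd X)) = coord_form i X"
proof -
  have "(\<Sum>j<n. of_real (Fm i j) * coord_form j X) = (\<Sum>j<n. if j = i then coord_form j X else 0)"
    by (intro sum.cong refl) (use assms in \<open>auto simp: Fm_def\<close>)
  thus ?thesis using assms coord_form_push by simp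
qed

lemma coord_form_push_low:
  assumes "i < p"
  shows "coord_form i (LC.push x (fst X), LC.push x (snd X)) = (\<Sum>j<p. of_real (M i j) * coord_form j X)"
proof -
  have "(\<Sum>j<n. of_real (Fm i j) * coord_form j X) = (\<Sum>j<p. of_real (Fm i j) * coord_form j X)"
    by (rule sum.mono_neutral_right) (use assms N.n in \<open>auto simp: Fm_def\<close>)
  thus ?thesis using assms N.n coord_form_push[of i] by (simp add: Fm_def)
qed

text \<open>The equations of \<open>W\<close> involve only coordinates on which the substitution is
  the identity.\<close>

lemma push_W:
  assumes x: "x \<in> B" "lin_map n Fm x \<in> B'" and X: "X \<in> N.T x \<times> N.T x"
  shows "(LC.push x (fst X), LC.push x (snd X)) \<in> N'.W (lin_map n Fm x) \<longleftrightarrow> X \<in> N.W x"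
proof -
  have "coord_form (p + 2 * q + 2 * l + 1) (LC.push x (fst X), LC.push x (snd X)) = coord_form (p + 2 * q + 2 * l + 1) X"
    "coord_form (p + 2 * q + 2 * l) (LC.push x (fst X), LC.push x (snd X)) = coord_form (p + 2 * q + 2 * l) X"
    if "l < k" for l
  proof -
    have "p + 2 * q + 2 * l + 1 < n" "p + 2 * q + 2 * l < n" using that N.n by simp_all
    thus "coord_form (p + 2 * q + 2 * l + 1) (LC.push x (fst X), LC.push x (snd X)) = coord_form (p + 2 * q + 2 * l + 1) X"
      "coord_form (p + 2 * q + 2 * l) (LC.push x (fst X), LC.push x (snd X)) = coord_form (p + 2 * q + 2 * l) X"
      by (auto intro!: coord_form_push_high)
  qed
  thus ?thesis unfolding normal_form_W_iff[OF N.B_E[OF x(1)] N.n] normal_form_W_iff[OF N'.B_E[OF x(2)] N.n]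
    using X LC.push_tangent by simp
qed

text \<open>The matrix \<open>M\<close> enters on the left through the new coordinates and on the
  right through the definition of \<open>v1\<close>.\<close>

lemma sigma_push: "N'.\<sigma> (LC.push x (fst X), LC.push x (snd X)) = \<phi>C (\<sigma>1 X)"
proof -
  have m: "\<phi>C (cscale c (0, u)) = cscale c (0, \<phi> u)" for c u
    by (simp add: cscale_def linear_scale[OF \<phi>(1)] linear_0[OF \<phi>(1)] linear_neg[OF \<phi>(1)])
  have ms: "\<phi>C (\<Sum>j<p. f j) = (\<Sum>j<p. \<phi>C (f j))" for f :: "nat \<Rightarrow> 'a \<times> 'a"
    by (simp add: prod_eq_iff fst_sum snd_sum linear_sum[OF \<phi>(1)])
  have r: "cscale c (0, \<Sum>i<p. M i j *\<^sub>R v' i) = (\<Sum>i<p. cscale (of_real (M i j) * c) (0, v' i))" for c j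
    by (simp add: prod_eq_iff fst_sum snd_sum cscale_def scaleR_sum_right mult.commute sum_negf[symmetric])
  have "N'.\<sigma> (LC.push x (fst X), LC.push x (snd X)) =
      (\<Sum>i<p. \<Sum>j<p. cscale (of_real (M i j) * coord_form j X) (0, v' i))" unfolding sig_sigma sig_def
    by (intro sum.cong refl) (simp add: coord_form_push_low cplx.scale_sum_left)
  also have "... = (\<Sum>j<p. \<Sum>i<p. cscale (of_real (M i j) * coord_form j X) (0, v' i))" by (rule sum.swap)
  also have "... = (\<Sum>j<p. \<phi>C (cscale (coord_form j X) (0, v1 j)))" unfolding m \<phi>_v1 r by (rule refl)
  also have "... = \<phi>C (\<sigma>1 X)" unfolding sig_sigma sig_def ms by (rule refl)
  finally show ?thesis .
qed

lemma cform_\<phi>: "cform ip (\<phi>C u) (\<phi>C u') = cform ip u u'"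
  by (simp add: cform_def map_prod_def case_prod_beta \<phi>(3))

lemma map_\<phi>: "\<phi>C u - \<phi>C u' = \<phi>C (u - u')"
  "cscale c (\<phi>C u) = \<phi>C (cscale c u)"
  by (simp_all add: prod_eq_iff cscale_def linear_diff[OF \<phi>(1)] linear_add[OF \<phi>(1)] linear_scale[OF \<phi>(1)])

lemma lmap_L:
  assumes x: "x \<in> B" "lin_map n Fm x \<in> B'" and F: "a \<in> N.F x" "b \<in> N.F x" and ab: "(a, b) \<in> L1 x"
  shows "(LC.lmap x a, LC.lmap x b) \<in> N'.L (lin_map n Fm x)"
proof -
  define X where "X = (fst a, fst b)"
  define s where "s = (alg a, alg b)"
  define \<xi> where "\<xi> = (cov a, cov b)"
  let ?y = "lin_map n Fm x"
  let ?p = "\<lambda>X. (LC.push x (fst X), LC.push x (snd X))"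
  note xE = N.B_E[OF x(1)]
  have L: "X \<in> N.W x" "s - \<sigma>1 X \<in> D"
    and Lev: "\<And>Y. Y \<in> N.W x \<Longrightarrow> cform (\<lambda>\<xi> Y. \<xi> Y) \<xi> Y = 2 * N.\<epsilon> X Y - cform ip (\<sigma>1 Y) (cscale 2 s - \<sigma>1 X)"
    using ab unfolding mem_L_space Let_def X_def s_def \<xi>_def by blast+
  have d: "fst \<xi> \<in> dual_space (N.T x)" "snd \<xi> \<in> dual_space (N.T x)" using F by (auto simp: untw_simps \<xi>_def)
  have lX: "(fst (LC.lmap x a), fst (LC.lmap x b)) = ?p X" by (simp add: LC.lmap_def X_def)
  have ls: "(alg (LC.lmap x a), alg (LC.lmap x b)) = \<phi>C s" by (simp add: LC.lmap_def s_def)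
  have ev: "cform (\<lambda>\<xi> Y. \<xi> Y) (cov (LC.lmap x a), cov (LC.lmap x b)) Y' =
      2 * N.\<epsilon> (?p X) Y' - cform ip (N'.\<sigma> Y') (cscale 2 (\<phi>C s) - N'.\<sigma> (?p X))" if Y': "Y' \<in> N'.W ?y" for Y'
  proof -
    \<comment> \<open>The preimage of \<open>Y'\<close> under the differential; the new covectors
      are known on pushed vectors.\<close>
    define Y where "Y = (tvec n x (lin_map n Gm (coords (fst Y'))), tvec n x (lin_map n Gm (coords (snd Y'))))"
    have YT: "fst Y \<in> N.T x" "snd Y \<in> N.T x" by (simp_all add: Y_def tvec_in_tangent[OF xE])
    have T': "fst Y' \<in> N'.T ?y" "snd Y' \<in> N'.T ?y" using N'.W_T[OF x(2) Y'] by auto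
    have push: "LC.push x (tvec n x (lin_map n Gm (coords Z))) = Z" if Z: "Z \<in> N'.T ?y" for Z
    proof (rule tangent_eqI[OF lin_map_Euclidean LC.push_tangent Z])
      fix i assume i: "i < n"
      have "coords (LC.push x (tvec n x (lin_map n Gm (coords Z)))) i = lin_map n Fm (lin_map n Gm (coords Z)) i"
        unfolding LC.coords_push[OF i] by (rule fun_cong[OF lin_map_cong]) (rule coords_tvec[OF xE])
      thus "LC.push x (tvec n x (lin_map n Gm (coords Z))) (\<lambda>y. y i) = Z (\<lambda>y. y i)"
        using LC.lin_map_FG[OF i] by (simp add: coords_def)
    qed
    have pY: "?p Y = Y'" by (simp add: Y_def push T')
    have YW: "Y \<in> N.W x" using push_W[OF x, of Y] YT Y' by (simp add: pY mem_Times_iff)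
    have c: "cov (LC.lmap x e) (LC.push x Z) = cov e Z" if "cov e \<in> dual_space (N.T x)" "Z \<in> N.T x" for e Z
      unfolding LC.lmap_covec covector_eq_sum[OF xE that(2,1)] coords_def by (rule refl)
    have "cform (\<lambda>\<xi> Y. \<xi> Y) (cov (LC.lmap x a), cov (LC.lmap x b)) (?p Y) = cform (\<lambda>\<xi> Y. \<xi> Y) \<xi> Y"
      using c[of a "fst Y"] c[of a "snd Y"] c[of b "fst Y"] c[of b "snd Y"] d YT by (simp add: cform_def \<xi>_def)
    also have "... = 2 * N.\<epsilon> X Y - cform ip (\<sigma>1 Y) (cscale 2 s - \<sigma>1 X)" by (rule Lev[OF YW])
    also have "N.\<epsilon> X Y = N.\<epsilon> (?p X) (?p Y)"
    proof -
      have "coord_form (p + j) (?p Z) = coord_form (p + j) Z" "coord_form (p + q + j) (?p Z) = coord_form (p + q + j) Z"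
        if "j < q" for j Z
      proof -
        have "p + j < n" "p + q + j < n" using that N.n by simp_all
        thus "coord_form (p + j) (?p Z) = coord_form (p + j) Z" "coord_form (p + q + j) (?p Z) = coord_form (p + q + j) Z"
          by (auto intro!: coord_form_push_high)
      qed
      thus ?thesis by (simp add: normal_form_eps_def)
    qed
    also have "cform ip (\<sigma>1 Y) (cscale 2 s - \<sigma>1 X) = cform ip (N'.\<sigma> (?p Y)) (cscale 2 (\<phi>C s) - N'.\<sigma> (?p X))"
      unfolding sigma_push map_\<phi> cform_\<phi> by (rule refl)
    finally show ?thesis unfolding pY .
  qed
  have "?p X \<in> N'.W ?y" using push_W[OF x N.W_T[OF x(1) L(1)]] L(1) by simp
  moreover have "\<phi>C s - N'.\<sigma> (?p X) \<in> D'" unfolding sigma_push map_\<phi> \<phi>_mem by (rule L(2))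
  moreover have "cov (LC.lmap x a) \<in> dual_space (N'.T ?y)" "cov (LC.lmap x b) \<in> dual_space (N'.T ?y)"
    by (simp_all add: LC.lmap_def covec_dual[OF lin_map_Euclidean])
  ultimately show ?thesis unfolding mem_L_space Let_def lX ls using ev by blast
qed

lemma pointed_iso_gauge:
  "pointed_iso (Rn n) (untw n br ip) J 0 (Rn n) (untw n br ip) J' 0"
proof -
  let ?R = "Rn n" let ?E = "untw n br ip" let ?F = "lin_map n Fm"
  \<comment> \<open>Smaller than \<open>B\<close>, so that the substitution lands in
    \<open>B'\<close>.\<close>
  define U where "U = {x \<in> B. ?F x \<in> B'}"
  have BE: "B \<subseteq> ER n" by (rule openin_subset[OF N.B(1)])
  have "U = B \<inter> {x \<in> ER n. ?F x \<in> B'}" using BE by (auto simp: U_def)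
  moreover have "opn n {x \<in> ER n. ?F x \<in> B'}"
    by (rule openin_continuous_map_preimage[OF continuous_map_lin_map N'.B(1)])
  ultimately have U: "opn n U" using openin_Int[OF N.B(1)] by simp
  have F0: "?F 0 = 0" by (simp add: lin_map_def fun_eq_iff)
  have U0: "0 \<in> U" using N.B(2) N'.B(2) by (simp add: U_def F0)
  note i1 = GP.local_iso_gauge[OF U] and i2 = LC.local_iso_linear[OF U]
  have t: "tame_on ?R ?E V" if "opn n V" for V by (rule tame_on_subset[OF tame_untw openin_subset[OF that]])
  have U': "opn n (?F ` U)" using local_isoD(2)[OF i2] by simp
  note i = local_iso_compose[OF i1 i2 t[OF U] t[OF U']]
  have "intertwines U ?E J J' ?F (\<lambda>x a. LC.lmap x (GP.gmap x a))" unfolding intertwines_def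
  proof (intro ballI conjI)
    fix x a assume x: "x \<in> U" and a: "a \<in> fibre ?E x"
    have xB: "x \<in> B" "?F x \<in> B'" using x by (simp_all add: U_def)
    show Ja: "J x a \<in> fibre ?E x" by (rule N.J(2)[OF xB(1) a])
    have nJa: "- J x a \<in> fibre ?E x" by (rule subspace_neg[OF N.F_sub[OF xB(1)] Ja])
    let ?\<Phi> = "\<lambda>a. LC.lmap x (GP.gmap x a)"
    have l: "linear_over (fibre ?E x) ?\<Phi>" by (rule local_isoD(7)[OF i x])
    have neg: "?\<Phi> (- J x a) = - ?\<Phi> (J x a)"
      using bspec[OF spec[OF l[unfolded linear_over_def, THEN conjunct2], of "-1"] Ja] by simp
    \<comment> \<open>The vector a - \<i> J a represents \<open>a\<close> in the bundle; its image
      therefore shows how \<open>J'\<close> acts on the image of \<open>a\<close>.\<close>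
    have "(?\<Phi> a, ?\<Phi> (- J x a)) \<in> N'.L (?F x)"
      by (rule lmap_L[OF xB GP.gmap_fibre[OF N.B_E[OF xB(1)] a] GP.gmap_fibre[OF N.B_E[OF xB(1)] nJa]
          gmap_L[OF xB(1) N.graph_in_L[OF xB(1) a]]])
    hence "J' (?F x) (?\<Phi> a) = - ?\<Phi> (- J x a)" using N'.L_iff[OF xB(2)] by blast
    thus "?\<Phi> (J x a) = J' (?F x) (?\<Phi> a)" unfolding neg by simp
  qed
  thus ?thesis unfolding pointed_iso_def using i U0 F0 t[OF U] t[OF U'] by blast
qed

end

lemma (in nf_match) pointed_iso_match:
  "pointed_iso (Rn n) (untw n br ip) J 0 (Rn n) (untw n br ip) J' 0"
proof -
  obtain w where w: "\<And>i. i < p \<Longrightarrow> w i \<in> h \<and> (- w i, v1 i - v i) \<in> D \<and> (\<forall>j<p. ip (w j) (v1 i) = ip (w i) (v j))"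
    using A.gauge_data[of v1, OF v1_h v1_iso v1_dual] by blast
  interpret nf_gauge br ip p q k n D v B J D' v' B' J' Bs Kf h h' \<phi> \<psi> "\<lambda>i. if i < p then w i else 0"
    by unfold_locales (use w subspace_0[OF A.h_sub] in auto)
  show ?thesis by (rule pointed_iso_gauge)
qed

section \<open>Classification\<close>

text \<open>If \<open>D\<close> contains an element and its conjugate, it contains the real and the
  imaginary part, since it is a complex subspace. The intersection is thus the complexification of
  \<open>A\<close>.\<close>

lemma (in nf_algebra) real_part_D: "D \<inter> conj_vec ` D = A \<times> A"
proof
  show "D \<inter> conj_vec ` D \<subseteq> A \<times> A"
  proof
    fix u assume "u \<in> D \<inter> conj_vec ` D"
    then obtain u' where u: "u \<in> D" "u' \<in> D" "u = conj_vec u'" by blast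
    hence c: "conj_vec u \<in> D" by simp
    have "cscale (1 / 2) (u + conj_vec u) \<in> D" "cscale (- \<i> / 2) (u - conj_vec u) \<in> D"
      by (intro cplx.subspace_scale[OF D_sub] cplx.subspace_add[OF D_sub] cplx.subspace_diff[OF D_sub] u(1) c)+
    moreover have "cscale (1 / 2) (u + conj_vec u) = (fst u, 0)" "cscale (- \<i> / 2) (u - conj_vec u) = (snd u, 0)"
      by (simp_all add: cscale_def conj_vec_def scaleR_2[symmetric])
    ultimately show "u \<in> A \<times> A" by (simp add: A_def mem_Times_iff)
  qed
  show "A \<times> A \<subseteq> D \<inter> conj_vec ` D"
  proof
    fix u assume "u \<in> A \<times> A"
    then obtain a b where u: "u = (a, b)" and ab: "(a, 0) \<in> D" "(b, 0) \<in> D" by (auto simp: A_def)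
    have "(a, 0) + cscale \<i> (b, 0) \<in> D" "(a, 0) + cscale (- \<i>) (b, 0) \<in> D"
      by (intro cplx.subspace_scale[OF D_sub] cplx.subspace_add[OF D_sub] ab)+
    hence "u \<in> D" "conj_vec u \<in> D" by (simp_all add: u cscale_def conj_vec_def)
    moreover have "u = conj_vec (conj_vec u)" by simp
    ultimately show "u \<in> D \<inter> conj_vec ` D" by blast
  qed
qed

text \<open>A real basis of \<open>A\<close> is a complex basis of its complexification;
  independence is tested against the dual family \<open>v\<close>.\<close>

lemma (in nf_algebra) cdim_real_part: "cdim (D \<inter> conj_vec ` D) = p"
proof -
  let ?b = "\<lambda>k. (ah k, 0 :: 'g)"
  have inj: "inj_on ?b {..<p}" using ah_inj by (auto simp: inj_on_def)
  have csum: "cform ip (\<Sum>k\<in>I. f k) u = (\<Sum>k\<in>I. cform ip (f k) u)" for I :: "nat set" and f u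
    by (induction I rule: infinite_finite_induct) (simp_all add: cip_add, simp_all add: cform_def ip_simps complex_eq_iff)
  have "cdim (A \<times> A) = p"
  proof (rule cplx.dim_unique)
    show "?b ` {..<p} \<subseteq> A \<times> A" using ah(1) subspace_0[OF A_sub] by blast
    show "A \<times> A \<subseteq> cspan (?b ` {..<p})"
    proof
      fix u assume u: "u \<in> A \<times> A"
      have "u = (\<Sum>k<p. cscale (Complex (ip (fst u) (v k)) (ip (snd u) (v k))) (?b k))"
        using A_expand[of "fst u"] A_expand[of "snd u"] u
        by (simp add: prod_eq_iff fst_sum snd_sum cscale_def mem_Times_iff)
      also have "... \<in> cspan (?b ` {..<p})" by (intro cplx.span_sum cplx.span_scale cplx.span_base) blast
      finally show "u \<in> cspan (?b ` {..<p})" .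
    qed
    show "cplx.independent (?b ` {..<p})"
    proof (rule cplx.independent_if_scalars_zero)
      fix f u assume f: "(\<Sum>u\<in>?b ` {..<p}. cscale (f u) u) = 0" and "u \<in> ?b ` {..<p}"
      then obtain j where j: "j < p" "u = ?b j" by blast
      have "(0::complex) = cform ip (\<Sum>k<p. cscale (f (?b k)) (?b k)) (v j, 0)"
        using f by (simp add: sum.reindex[OF inj] o_def cform_def ip_simps complex_eq_iff)
      also have "... = (\<Sum>k<p. f (?b k) * of_real (ip (ah k) (v j)))"
        unfolding csum cip_scale by (intro sum.cong refl arg_cong2[of _ _ _ _ "(*)"]) (simp add: cform_def ip_simps complex_eq_iff)
      also have "... = (\<Sum>k<p. if k = j then f (?b k) else 0)" by (intro sum.cong refl) (use ah(3) j in auto)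
      also have "... = f u" using j by simp
      finally show "f u = 0" by simp
    qed simp
    show "card (?b ` {..<p}) = p" using card_image[OF inj] by simp
  qed
  thus ?thesis by (simp add: real_part_D)
qed

lemma dim_image_injective:
  fixes \<phi> :: "'g::real_vector \<Rightarrow> 'h::real_vector"
  assumes l: "linear \<phi>" and i: "inj \<phi>"
  shows "dim (\<phi> ` S) = dim S"
proof -
  obtain B where B: "B \<subseteq> S" "independent B" "S \<subseteq> span B" "card B = dim S" by (rule basis_exists)
  show ?thesis
  proof (rule real_vector.dim_unique)
    show "\<phi> ` B \<subseteq> \<phi> ` S" using B(1) by blast
    show "\<phi> ` S \<subseteq> span (\<phi> ` B)" unfolding linear_span_image[OF l] using B(3) by blast
    show "independent (\<phi> ` B)" by (rule linear_independent_injective_image[OF l B(2) inj_on_subset[OF i subset_UNIV]])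
    show "card (\<phi> ` B) = dim S" using card_image[OF inj_on_subset[OF i subset_UNIV], of B] B(4) by simp
  qed
qed

text \<open>\<open>p\<close> is the dimension of the real part of \<open>D\<close>, which a real
  automorphism transports.\<close>

lemma normal_form_D_aut:
  assumes \<phi>: "\<phi> \<in> lie_aut br ip" and D: "normal_form_D br ip p h D"
    and D': "normal_form_D br ip p' h' (map_prod \<phi> \<phi> ` D)"
  shows "p' = p"
proof -
  have l: "linear \<phi>" and b: "inj \<phi>" using \<phi> by (auto simp: lie_aut_def bij_def)
  have "{a. (a, 0) \<in> map_prod \<phi> \<phi> ` D} = \<phi> ` {a. (a, 0) \<in> D}"
  proof (intro equalityI subsetI; elim CollectE imageE)
    fix a u assume u: "u \<in> D" "(a, 0) = map_prod \<phi> \<phi> u"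
    hence "\<phi> (snd u) = \<phi> 0" by (cases u) (simp add: linear_0[OF l])
    hence "u = (fst u, 0)" using injD[OF b] by (simp add: prod_eq_iff)
    moreover have "a = \<phi> (fst u)" using u(2) by (cases u) simp
    ultimately show "a \<in> \<phi> ` {a. (a, 0) \<in> D}" using u(1) by auto
  next
    fix a c assume "a = \<phi> c" "(c, 0) \<in> D"
    thus "a \<in> {a. (a, 0) \<in> map_prod \<phi> \<phi> ` D}"
      by (auto intro!: image_eqI[of _ _ "(c, 0)"] simp: linear_0[OF l])
  qed
  thus ?thesis using D D' dim_image_injective[OF l b] unfolding normal_form_D_def by metis
qed

lemma pointed_iso_normal_forms:
  fixes br :: "'g::real_vector \<Rightarrow> 'g \<Rightarrow> 'g"
  assumes i: "pointed_iso (Rn n) (untw n br ip) J 0 (Rn n') (untw n' br ip) J' 0"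
    and Bs: "finite_basis (Bs :: 'g set)"
    and A: "nf_structure br ip p q k n D v B J" and A': "nf_structure br ip p' q' k' n' D' v' B' J'"
  shows "\<exists>\<phi>\<in>lie_aut br ip. D' = map_prod \<phi> \<phi> ` D" "p + 2 * q \<le> p' + 2 * q'"
proof -
  obtain U U' f g \<Phi> where 1: "local_iso (Rn n) U (untw n br ip) (Rn n') U' (untw n' br ip) f g \<Phi>"
    "0 \<in> U" "f 0 = 0" "intertwines U (untw n br ip) J J' f \<Phi>"
    using i unfolding pointed_iso_def by (elim exE conjE)
  interpret nf_iso Bs br ip p q k n D v B J p' q' k' n' D' v' B' J' U U' f g \<Phi>
    by (intro nf_iso.intro Bs A A' nf_iso_axioms.intro 1)
  show "\<exists>\<phi>\<in>lie_aut br ip. D' = map_prod \<phi> \<phi> ` D" by (intro bexI[of _ \<phi>] \<phi>_D[symmetric] \<phi>_aut)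
  show "p + 2 * q \<le> p' + 2 * q'" by (rule rank_le)
qed

lemma pointed_iso_dimension:
  assumes "pointed_iso M E J x (Rn n) E' J' y" "smooth_manifold M"
  shows "mdim M = n"
proof -
  obtain U U' f g \<Phi> where "local_iso M U E (Rn n) U' E' f g \<Phi>" "x \<in> U"
    using assms(1) unfolding pointed_iso_def by (elim exE conjE)
  thus ?thesis by (rule local_iso_dimension[OF _ assms(2)])
qed

text \<open>The formula for \<open>p\<close> is stated over the integers, where subtraction is not
  cut off at 0.\<close>

theorem corollary3:
  fixes br :: "'g::real_vector \<Rightarrow> 'g \<Rightarrow> 'g" and ip :: "'g \<Rightarrow> 'g \<Rightarrow> real"
    and M :: "'a manifold" and E :: "('a, 'e::real_vector) courant" and J :: "'a \<Rightarrow> 'e \<Rightarrow> 'e"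
    and M' :: "'b manifold" and E' :: "('b, 'f::real_vector) courant" and J' :: "'b \<Rightarrow> 'f \<Rightarrow> 'f"
    and x :: 'a and x' :: 'b
    and p q k p' q' k' :: nat and \<D> \<D>' :: "('g \<times> 'g) set"
  assumes g: "quadratic_lie_algebra br ip" "compact_lie_algebra br" "semisimple_lie_algebra br"
      "neutral_signature ip"
    and E: "smooth_manifold M" "transitive_courant_algebroid M E" "fibre_type M E br ip"
    and J: "regular_gcs M E J br ip"
    and x: "x \<in> topspace (mtop M)" "regular_point M E J x"
    and nf: "has_normal_form_near M E J x br ip p q k \<D>"
    and E': "smooth_manifold M'" "transitive_courant_algebroid M' E'" "fibre_type M' E' br ip"
    and J': "regular_gcs M' E' J' br ip"
    and x': "x' \<in> topspace (mtop M')" "regular_point M' E' J' x'"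
    and nf': "has_normal_form_near M' E' J' x' br ip p' q' k' \<D>'"
  shows "(locally_equivalent M E J x M' E' J' x' \<longleftrightarrow>
            q = q' \<and> k = k' \<and> \<D>' \<in> aut_orbit br ip \<D>) \<and>
         int p = int (mdim M) - 2 * (int q + int k) \<and>
         p = cdim (\<D> \<inter> conj_vec ` \<D>) \<and>
         int p' = int (mdim M') - 2 * (int q' + int k') \<and>
         p' = cdim (\<D>' \<inter> conj_vec ` \<D>')"
proof -
  note q1 = g(1)[unfolded quadratic_lie_algebra_def lie_algebra_def]
  have lf: "lie_form br ip" using q1 by (intro lie_form.intro) blast+
  have nondeg: "r = 0" if "\<And>s. ip r s = 0" for r using q1 that by blast
  obtain S :: "'g set" where S: "finite S" "span S = UNIV" using q1 by blast
  obtain Bs :: "'g set" where "finite Bs" "independent Bs" "span Bs = UNIV" by (rule finite_basis_exists[OF S])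
  hence Bs: "finite_basis Bs" by (rule finite_basis.intro)
  obtain Kf where Kf: "invariant_form br Kf" "\<And>a. a \<noteq> 0 \<Longrightarrow> Kf a a > 0"
    using g(2) unfolding compact_lie_algebra_def by blast
  have C: "courant_algebroid M E" "courant_algebroid M' E'"
    using E(2) E'(2) by (simp_all add: transitive_courant_algebroid_def)
  have P: "proper_charts M" "proper_charts M'"
    using E(1) E'(1) by (simp_all add: smooth_manifold_proper_charts)
  have JF: "J y a \<in> fibre E y" if "y \<in> topspace (mtop M)" "a \<in> fibre E y" for y a
    using bspec[OF J[unfolded regular_gcs_def generalized_complex_structure_def, THEN conjunct1, THEN conjunct1] that(1),
        THEN conjunct2, THEN conjunct1] that(2) by blast
  have JF': "J' y a \<in> fibre E' y" if "y \<in> topspace (mtop M')" "a \<in> fibre E' y" for y a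
    using bspec[OF J'[unfolded regular_gcs_def generalized_complex_structure_def, THEN conjunct1, THEN conjunct1] that(1),
        THEN conjunct2, THEN conjunct1] that(2) by blast
  define n n' where "n = p + 2 * q + 2 * k" and "n' = p' + 2 * q' + 2 * k'"
  obtain B J0 where n1: "normal_form br ip p q k \<D> B J0"
    "pointed_iso M E J x (Rn n) (untw n br ip) J0 0"
    unfolding n_def by (rule has_normal_form_near_pointed_iso[OF E(1) C(1) JF nf])
  obtain B' J0' where m1: "normal_form br ip p' q' k' \<D>' B' J0'"
    "pointed_iso M' E' J' x' (Rn n') (untw n' br ip) J0' 0"
    unfolding n'_def by (rule has_normal_form_near_pointed_iso[OF E'(1) C(2) JF' nf'])
  obtain h v where n2: "nf_structure br ip p q k n \<D> v B J0" "normal_form_D br ip p h \<D>" "normal_form_basis ip p h \<D> v"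
    unfolding n_def by (rule normal_form_nf_structure[OF lf nondeg n1(1)])
  obtain h' v' where m2: "nf_structure br ip p' q' k' n' \<D>' v' B' J0'" "normal_form_D br ip p' h' \<D>'"
    "normal_form_basis ip p' h' \<D>' v'"
    unfolding n'_def by (rule normal_form_nf_structure[OF lf nondeg m1(1)])
  have A: "nf_algebra br ip Bs Kf p h \<D> v"
    by (intro nf_algebra.intro nf_algebra_axioms.intro lf Bs Kf n2(2,3) nondeg nf_structure.D_perp[OF n2(1)])
  have A': "nf_algebra br ip Bs Kf p' h' \<D>' v'"
    by (intro nf_algebra.intro nf_algebra_axioms.intro lf Bs Kf m2(2,3) nondeg nf_structure.D_perp[OF m2(1)])
  have dim: "mdim M = n" "mdim M' = n'"
    by (rule pointed_iso_dimension[OF n1(2) E(1)], rule pointed_iso_dimension[OF m1(2) E'(1)])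
  have iff: "locally_equivalent M E J x M' E' J' x' \<longleftrightarrow> q = q' \<and> k = k' \<and> \<D>' \<in> aut_orbit br ip \<D>"
  proof
    assume "locally_equivalent M E J x M' E' J' x'"
    hence i: "pointed_iso M E J x M' E' J' x'" by (rule locally_equivalent_pointed_iso[OF _ P C JF])
    note s = pointed_iso_sym[OF i P(1) C(1)] pointed_iso_sym[OF n1(2) P(1) C(1)] pointed_iso_sym[OF m1(2) P(2) C(2)]
    \<comment> \<open>Composing with the germs to the normal forms compares these directly; the
      composite in the other direction yields the opposite rank inequality.\<close>
    note N = pointed_iso_normal_forms[OF pointed_iso_trans[OF s(2) pointed_iso_trans[OF i m1(2)]] Bs n2(1) m2(1)]
    note N' = pointed_iso_normal_forms[OF pointed_iso_trans[OF s(3) pointed_iso_trans[OF s(1) n1(2)]] Bs m2(1) n2(1)]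
    obtain \<phi> where \<phi>: "\<phi> \<in> lie_aut br ip" "\<D>' = map_prod \<phi> \<phi> ` \<D>" using N(1) by blast
    have p: "p' = p" using normal_form_D_aut[OF \<phi>(1) n2(2)] m2(2) unfolding \<phi>(2) by blast
    \<comment> \<open>The numbers \<open>p + 2 * q\<close> and \<open>n\<close> agree for both
      structures, and so does \<open>p\<close>; hence \<open>q\<close> and then \<open>k\<close>
      agree.\<close>
    have "n = n'" using pointed_iso_dimension[OF pointed_iso_trans[OF i m1(2)] E(1)] dim(1) by simp
    hence "q = q' \<and> k = k'" using N(2) N'(2) p by (simp add: n_def n'_def)
    thus "q = q' \<and> k = k' \<and> \<D>' \<in> aut_orbit br ip \<D>" using \<phi> by (auto simp: aut_orbit_def)
  next
    assume r: "q = q' \<and> k = k' \<and> \<D>' \<in> aut_orbit br ip \<D>"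
    then obtain \<phi> where \<phi>: "\<phi> \<in> lie_aut br ip" "\<D>' = map_prod \<phi> \<phi> ` \<D>" by (auto simp: aut_orbit_def)
    \<comment> \<open>Equality of \<open>p\<close> is not part of the assumption; it comes from the
      orbit and puts both normal forms on the same coordinate space.\<close>
    have p: "p' = p" using normal_form_D_aut[OF \<phi>(1) n2(2)] m2(2) unfolding \<phi>(2) by blast
    have eq: "q' = q" "k' = k" "n' = n" using r p by (simp_all add: n_def n'_def)
    have \<phi>': "linear \<phi>" "\<And>a b. \<phi> (br a b) = br (\<phi> a) (\<phi> b)" "\<And>a b. ip (\<phi> a) (\<phi> b) = ip a b" "bij \<phi>"
      using \<phi>(1) by (simp_all add: lie_aut_def)
    let ?\<psi> = "inv_into UNIV \<phi>"
    have inv: "\<phi> (?\<psi> a) = a" "?\<psi> (\<phi> a) = a" for a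
      using \<phi>'(4) by (simp_all add: bij_is_surj surj_f_inv_f bij_is_inj inv_f_f)
    have \<psi>: "linear ?\<psi>" "?\<psi> (br a b) = br (?\<psi> a) (?\<psi> b)" "ip (?\<psi> a) (?\<psi> b) = ip a b" for a b
    proof -
      have e: "?\<psi> c = d" if "c = \<phi> d" for c d using that inv(2) by simp
      show "linear ?\<psi>"
        by (rule linearI; rule e) (simp_all add: linear_add[OF \<phi>'(1)] linear_scale[OF \<phi>'(1)] inv)
      show "?\<psi> (br a b) = br (?\<psi> a) (?\<psi> b)" by (rule e) (simp add: \<phi>'(2) inv)
      show "ip (?\<psi> a) (?\<psi> b) = ip a b" using \<phi>'(3)[of "?\<psi> a" "?\<psi> b"] by (simp add: inv)
    qed
    interpret nf_match br ip p q k n \<D> v B J0 \<D>' v' B' J0' Bs Kf h h' \<phi> ?\<psi>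
      by (intro nf_match.intro nf_match_axioms.intro n2(1) m2(1)[unfolded p eq] A A'[unfolded p] \<phi>'(1-3) \<psi> inv \<phi>(2))
    have "pointed_iso M E J x M' E' J' x'"
      by (rule pointed_iso_trans[OF n1(2) pointed_iso_trans[OF pointed_iso_match
              pointed_iso_sym[OF m1(2) P(2) C(2), unfolded eq(3)]]])
    thus "locally_equivalent M E J x M' E' J' x'" by (rule pointed_iso_locally_equivalent[OF _ P])
  qed
  show ?thesis using iff dim nf_algebra.cdim_real_part[OF A] nf_algebra.cdim_real_part[OF A']
    by (simp add: n_def n'_def)
qed

end
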